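(* Let $\alpha>1$, $\tau>0$, $\delta>0$ and $a\in\{0,1\}$. Then the following assertions hold. (i) There exists $\nu_0>0$ such that for every $0<\nu\le \nu_0$, any solution $\omega$ of the linear equation $$\partial_t\omega = \nu\Delta \omega - a\sin y\, \partial_x (1+\Delta^{-1})\omega -e^{-\nu t}\sin y\, \partial_x (1+\Delta^{-1})\omega \quad\text{in } \mathbb{T}_\alpha$$ with initial value $\omega(0)\in L_2(\mathbb{T}_\alpha)$ satisfying $P_{\neq 0}\omega(0)=\omega(0)$ satisfies $$\Big\|\omega\Big(\frac{\tau}{\nu}\Big)\Big\|_{L_2}\le \delta\,\|\omega(0)\|_{L_2}.$$ (ii) There exist $\nu_0>0$ and $d_0>0$ such that for all $0<\nu\le\nu_0$ and $0<d\le d_0$ the following holds. Let $\omega$ be any solution of the nonlinear equation $$\partial_t\omega +J(\Delta^{-1}\omega,\omega)-\nu\Delta\omega=-\nu a\cos y\quad\text{in } \mathbb{T}_\alpha,$$ written in the perturbed form $$\omega=-a\cos y-e^{-\nu t}\cos y+\omega'.$$ If $\omega'(0)\in L_2(\mathbb{T}_\alpha)$ and $\|\omega'(0)\|_{L_2}\le \nu d$, then $$\Big\|P_{\neq0}\,\omega'\Big(\frac{\tau}{\nu}\Big)\Big\|_{L_2}\le\delta\,\|P_{\neq0}\,\omega'(0)\|_{L_2}.$$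
   Context: $\mathbb{T}_\alpha=[0,2\pi/\alpha)\times[0,2\pi)$ is the flat torus with coordinates $(x,y)$; all functions are $2\pi/\alpha$-periodic in $x$ and $2\pi$-periodic in $y$. $\nu>0$ is the viscosity. $L_2(\mathbb{T}_\alpha)$ denotes the space of mean-zero functions $\omega$ on $\mathbb{T}_\alpha$ with $\|\omega\|_{L_2}^2=\int_{\mathbb{T}_\alpha}|\omega|^2\,dx\,dy<\infty$, and $\Delta^{-1}$ is the inverse of the Laplacian on mean-zero functions. The Jacobian is $J(\phi,\varphi)=\partial_x\phi\,\partial_y\varphi-\partial_y\phi\,\partial_x\varphi$. The projections are $$P_0\omega=\frac{\alpha}{2\pi}\int_0^{2\pi/\alpha}\omega\,dx,\qquad P_{\neq0}\omega=\omega-P_0\omega .$$ The nonlinear equation is the vorticity form of the two-dimensional Navier-Stokes equations on $\mathbb{T}_\alpha$ driven by the force $\nu(a\sin y,0)$, and the linear equation is its linearization around the exact solution $-a\cos y-e^{-\nu t}\cos y$. Solutions are considered for times $t\ge 0$. *)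

theory Defs
  imports "HOL-Analysis.Analysis"
begin

text \<open>
  Functions on the torus are represented by doubly periodic functions on the plane, and integrated
  over one fundamental cell. Elements of \<open>L\<^sub>2\<close> are represented by Borel functions; all notions
  below depend only on the class up to almost everywhere equality.
\<close>

definition torus :: "real \<Rightarrow> (real \<times> real) measure" where
  "torus \<alpha> = restrict_space lborel ({0..<2 * pi / \<alpha>} \<times> {0..<2 * pi})"

definition torus_periodic :: "real \<Rightarrow> (real \<times> real \<Rightarrow> real) \<Rightarrow> bool" where
  "torus_periodic \<alpha> f \<longleftrightarrow>
     (\<forall>x y. f (x + 2 * pi / \<alpha>, y) = f (x, y) \<and> f (x, y + 2 * pi) = f (x, y))"

definition L2_torus :: "real \<Rightarrow> (real \<times> real \<Rightarrow> real) set" where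
  "L2_torus \<alpha> = {f. torus_periodic \<alpha> f \<and> f \<in> borel_measurable (torus \<alpha>) \<and>
     integrable (torus \<alpha>) (\<lambda>z. (f z)\<^sup>2) \<and> (LINT z|torus \<alpha>. f z) = 0}"

definition L2_norm :: "real \<Rightarrow> (real \<times> real \<Rightarrow> real) \<Rightarrow> real" where
  "L2_norm \<alpha> f = sqrt (LINT z|torus \<alpha>. (f z)\<^sup>2)"

definition P_zero :: "real \<Rightarrow> (real \<times> real \<Rightarrow> real) \<Rightarrow> real \<times> real \<Rightarrow> real" where
  "P_zero \<alpha> f = (\<lambda>(x, y). \<alpha> / (2 * pi) * (LINT s:{0..<2 * pi / \<alpha>}|lborel. f (s, y)))"

definition P_nonzero :: "real \<Rightarrow> (real \<times> real \<Rightarrow> real) \<Rightarrow> real \<times> real \<Rightarrow> real" where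
  "P_nonzero \<alpha> f = (\<lambda>z. f z - P_zero \<alpha> f z)"

text \<open>
  Test functions are the smooth functions on the torus; \<open>D i j\<close> is the partial derivative of
  order \<open>i\<close> in \<open>x\<close> and \<open>j\<close> in \<open>y\<close>.
\<close>

definition test_functions :: "real \<Rightarrow> (real \<times> real \<Rightarrow> real) set" where
  "test_functions \<alpha> = {\<phi>. torus_periodic \<alpha> \<phi> \<and>
     (\<exists>D :: nat \<Rightarrow> nat \<Rightarrow> real \<times> real \<Rightarrow> real. D 0 0 = \<phi> \<and>
        (\<forall>i j. continuous_on UNIV (D i j) \<and>
           (\<forall>x y. ((\<lambda>s. D i j (s, y)) has_real_derivative D (Suc i) j (x, y)) (at x) \<and>
                  ((\<lambda>s. D i j (x, s)) has_real_derivative D i (Suc j) (x, y)) (at y))))}"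

definition pd_x :: "(real \<times> real \<Rightarrow> real) \<Rightarrow> real \<times> real \<Rightarrow> real" where
  "pd_x \<phi> = (\<lambda>(x, y). deriv (\<lambda>s. \<phi> (s, y)) x)"

definition pd_y :: "(real \<times> real \<Rightarrow> real) \<Rightarrow> real \<times> real \<Rightarrow> real" where
  "pd_y \<phi> = (\<lambda>(x, y). deriv (\<lambda>s. \<phi> (x, s)) y)"

definition laplacian :: "(real \<times> real \<Rightarrow> real) \<Rightarrow> real \<times> real \<Rightarrow> real" where
  "laplacian \<phi> = (\<lambda>z. pd_x (pd_x \<phi>) z + pd_y (pd_y \<phi>) z)"

text \<open>
  The differential operators on \<open>L\<^sub>2\<close> functions are understood in the sense of distributions. Their
  values are unique only up to null sets, so they are rendered as relations: \<open>g\<close> is the weak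
  derivative \<open>\<partial>\<^sub>x f\<close> or \<open>\<partial>\<^sub>y f\<close>, and \<open>\<psi>\<close> is \<open>\<Delta>\<^sup>-\<^sup>1 f\<close>, i.e. the mean-zero solution of
  \<open>\<Delta> \<psi> = f\<close>. A weak derivative of a periodic function has mean zero (take \<open>\<phi> = 1\<close>), so
  requiring \<open>g\<close> to lie in \<open>L2_torus \<alpha>\<close> only asks for square integrability.
\<close>

definition weak_dx :: "real \<Rightarrow> (real \<times> real \<Rightarrow> real) \<Rightarrow> (real \<times> real \<Rightarrow> real) \<Rightarrow> bool" where
  "weak_dx \<alpha> f g \<longleftrightarrow> g \<in> L2_torus \<alpha> \<and>
     (\<forall>\<phi>\<in>test_functions \<alpha>. (LINT z|torus \<alpha>. f z * pd_x \<phi> z) = - (LINT z|torus \<alpha>. g z * \<phi> z))"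

definition weak_dy :: "real \<Rightarrow> (real \<times> real \<Rightarrow> real) \<Rightarrow> (real \<times> real \<Rightarrow> real) \<Rightarrow> bool" where
  "weak_dy \<alpha> f g \<longleftrightarrow> g \<in> L2_torus \<alpha> \<and>
     (\<forall>\<phi>\<in>test_functions \<alpha>. (LINT z|torus \<alpha>. f z * pd_y \<phi> z) = - (LINT z|torus \<alpha>. g z * \<phi> z))"

definition inv_laplacian :: "real \<Rightarrow> (real \<times> real \<Rightarrow> real) \<Rightarrow> (real \<times> real \<Rightarrow> real) \<Rightarrow> bool" where
  "inv_laplacian \<alpha> f \<psi> \<longleftrightarrow> \<psi> \<in> L2_torus \<alpha> \<and>
     (\<forall>\<phi>\<in>test_functions \<alpha>. (LINT z|torus \<alpha>. \<psi> z * laplacian \<phi> z) = (LINT z|torus \<alpha>. f z * \<phi> z))"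

text \<open>
  The solution class is the energy class
  \<open>C([0,\<infinity>); L\<^sub>2) \<inter> L\<^sup>2\<^bsub>loc\<^esub>([0,\<infinity>); H\<^sup>1)\<close>, the standard one for initial data in \<open>L\<^sub>2\<close>.
\<close>

definition energy_class :: "real \<Rightarrow> (real \<Rightarrow> real \<times> real \<Rightarrow> real) \<Rightarrow> bool" where
  "energy_class \<alpha> \<omega> \<longleftrightarrow>
     (\<forall>t\<ge>0. \<omega> t \<in> L2_torus \<alpha>) \<and>
     (\<forall>s\<ge>0. ((\<lambda>t. L2_norm \<alpha> (\<lambda>z. \<omega> t z - \<omega> s z)) \<longlongrightarrow> 0) (at s within {0..})) \<and>
     (\<exists>\<omega>x \<omega>y. (AE t in lborel. t > 0 \<longrightarrow> weak_dx \<alpha> (\<omega> t) (\<omega>x t) \<and> weak_dy \<alpha> (\<omega> t) (\<omega>y t)) \<and>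
        (\<forall>T>0. (\<lambda>t. (L2_norm \<alpha> (\<omega>x t))\<^sup>2 + (L2_norm \<alpha> (\<omega>y t))\<^sup>2) integrable_on {0..T}))"

text \<open>
  The equations hold weakly: \<open>\<partial>\<^sub>t \<omega> = R\<close> means that for every test function \<open>\<phi>\<close> and every
  \<open>t \<ge> 0\<close> the pairing of \<open>\<omega>(t) - \<omega>(0)\<close> with \<open>\<phi>\<close> is the time integral over \<open>[0, t]\<close> of the
  pairing of \<open>R\<close> with \<open>\<phi>\<close>. Only the Laplacian of \<open>\<omega>\<close> is moved onto \<open>\<phi>\<close>; the other terms of the
  right-hand side are integrable functions at almost every time.

  In the linear equation, \<open>h t\<close> is \<open>\<partial>\<^sub>x (1 + \<Delta>\<^sup>-\<^sup>1) \<omega>(t)\<close>.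
\<close>

definition linear_solution :: "real \<Rightarrow> real \<Rightarrow> real \<Rightarrow> (real \<Rightarrow> real \<times> real \<Rightarrow> real) \<Rightarrow> bool" where
  "linear_solution \<alpha> \<nu> a \<omega> \<longleftrightarrow> energy_class \<alpha> \<omega> \<and>
     (\<exists>\<psi> h.
        (AE t in lborel. t > 0 \<longrightarrow>
           inv_laplacian \<alpha> (\<omega> t) (\<psi> t) \<and> weak_dx \<alpha> (\<lambda>z. \<omega> t z + \<psi> t z) (h t)) \<and>
        (\<forall>\<phi>\<in>test_functions \<alpha>. \<forall>t\<ge>0.
           ((\<lambda>s. LINT z|torus \<alpha>. \<nu> * \<omega> s z * laplacian \<phi> z
                  - a * sin (snd z) * h s z * \<phi> z
                  - exp (- \<nu> * s) * sin (snd z) * h s z * \<phi> z)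
            has_integral (LINT z|torus \<alpha>. (\<omega> t z - \<omega> 0 z) * \<phi> z)) {0..t}))"

text \<open>
  In the nonlinear equation, \<open>\<psi> t\<close> is \<open>\<Delta>\<^sup>-\<^sup>1 \<omega>(t)\<close>, and
  \<open>\<psi>x t z * \<omega>y t z - \<psi>y t z * \<omega>x t z\<close> is the Jacobian \<open>J(\<Delta>\<^sup>-\<^sup>1 \<omega>, \<omega>)\<close>.
\<close>

definition nonlinear_solution :: "real \<Rightarrow> real \<Rightarrow> real \<Rightarrow> (real \<Rightarrow> real \<times> real \<Rightarrow> real) \<Rightarrow> bool" where
  "nonlinear_solution \<alpha> \<nu> a \<omega> \<longleftrightarrow> energy_class \<alpha> \<omega> \<and>
     (\<exists>\<psi> \<omega>x \<omega>y \<psi>x \<psi>y.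
        (AE t in lborel. t > 0 \<longrightarrow>
           inv_laplacian \<alpha> (\<omega> t) (\<psi> t) \<and>
           weak_dx \<alpha> (\<omega> t) (\<omega>x t) \<and> weak_dy \<alpha> (\<omega> t) (\<omega>y t) \<and>
           weak_dx \<alpha> (\<psi> t) (\<psi>x t) \<and> weak_dy \<alpha> (\<psi> t) (\<psi>y t)) \<and>
        (\<forall>\<phi>\<in>test_functions \<alpha>. \<forall>t\<ge>0.
           ((\<lambda>s. LINT z|torus \<alpha>. \<nu> * \<omega> s z * laplacian \<phi> z
                  - (\<psi>x s z * \<omega>y s z - \<psi>y s z * \<omega>x s z) * \<phi> z
                  - \<nu> * a * cos (snd z) * \<phi> z)
            has_integral (LINT z|torus \<alpha>. (\<omega> t z - \<omega> 0 z) * \<phi> z)) {0..t}))"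

end

theory Submission
  imports Defs "HOL-Real_Asymp.Real_Asymp"
begin

text \<open>
  In Fourier variables \<open>n = (k, m)\<close> the linear equation couples each row \<open>k\<close> to its neighbours
  \<open>m - 1\<close>, \<open>m + 1\<close> only. For \<open>k \<noteq> 0\<close> the shear is conservative in the energy \<open>\<Sum> lam n \<bar>v n\<bar>\<^sup>2\<close>, where
  \<open>lam n = 1 - 1 / \<bar>n\<bar>\<^sup>2 > 0\<close> because \<open>\<alpha> > 1\<close>, so this energy decreases and its dissipation
  \<open>\<nu> \<Sum> \<bar>n\<bar>\<^sup>2 \<bar>v n\<bar>\<^sup>2\<close> is integrable. A virial (the pairing of neighbouring modes \<open>u (k, m) \<bullet> u (k, m + 1)\<close>,
  \<open>u = lam v\<close>, against an odd cut-off of \<open>m + 1/2\<close>) shows that the time integral of the defects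
  \<open>\<bar>u (k, m - 1) + u (k, m + 1)\<bar>\<^sup>2\<close> with \<open>\<bar>m\<bar> < L\<close> is at most a constant plus an error of order
  \<open>1 / (\<nu> L\<^sup>2)\<close>. If the defects are small, the mass of a low mode is spread evenly along its row and hence
  is a small fraction of the total. So over the time \<open>\<tau> / \<nu>\<close> the low modes contribute \<open>o(1 / \<nu>)\<close> to the
  time integral of the mass, the high modes do so by dissipation, and since the energy is monotone it
  must be small at the final time.

  In the nonlinear problem the Jacobian is a convolution whose symbol is bounded in two ways, which makes
  it a relatively small perturbation of the dissipation as long as the perturbation has size
  \<open>O(\<nu>)\<close>; a continuity argument keeps it that small.
\<close>

section \<open>Products of primitives\<close>

text \<open>Weak solutions give each Fourier coefficient only as the primitive of an integrand that
  is bounded off a null set of times, so energy and virial are differentiated through a product rule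
  for primitives. The energy is an infinite sum, so its balance is made on finite boxes; the flux
  through the boundary of a box is dominated by the dissipation in a thin shell, which vanishes in
  the limit because the total dissipation has a finite time integral. The virial divides row
  \<open>k\<close> by \<open>\<alpha> * k\<close>, the strength of the shear there, so that all rows
  progress at one rate. The axis \<open>k = 0\<close> escapes this argument: \<open>lam\<close>
  vanishes at \<open>(0, 1)\<close> and \<open>(0, -1)\<close>. In the linear problem the axis modes
  stay zero. In the nonlinear one they obey a heat equation forced by pairs of waves only, since two
  axis modes have zero Jacobian. That forcing is quadratic in the waves, and against the viscosity
  it costs a factor of order \<open>1 / \<nu>\<^sup>2\<close> in the squared norm; data of size
  \<open>O(\<nu>)\<close> compensate it exactly, and keep the Jacobian below the
  dissipation.\<close>

lemma constant_of_quadratic_modulus: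
  fixes P :: "real \<Rightarrow> real"
  assumes "\<And>s t. a \<le> s \<Longrightarrow> s \<le> t \<Longrightarrow> t \<le> b \<Longrightarrow> \<bar>P t - P s\<bar> \<le> C * (t - s)\<^sup>2"
    and "a \<le> b"
  shows "P b = P a"
proof -
  have C: "\<bar>P t - P s\<bar> \<le> \<bar>C\<bar> * (t - s)\<^sup>2" if "s \<in> {a..b}" "t \<in> {a..b}" for s t
  proof (cases "s \<le> t")
    case True
    then have "\<bar>P t - P s\<bar> \<le> C * (t - s)\<^sup>2" using assms(1)[of s t] that by auto
    also have "\<dots> \<le> \<bar>C\<bar> * (t - s)\<^sup>2" by (intro mult_right_mono) auto
    finally show ?thesis .
  next
    case False
    then have "\<bar>P s - P t\<bar> \<le> C * (s - t)\<^sup>2" using assms(1)[of t s] that by auto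
    also have "\<dots> \<le> \<bar>C\<bar> * (s - t)\<^sup>2" by (intro mult_right_mono) auto
    finally show ?thesis by (simp add: power2_commute abs_minus_commute)
  qed
  have "(P has_field_derivative 0) (at s within {a..b})" if s: "s \<in> {a..b}" for s
    unfolding has_field_derivative_iff tendsto_iff eventually_at
  proof (intro allI impI)
    fix e :: real assume e: "e > 0"
    show "\<exists>d>0. \<forall>t\<in>{a..b}. t \<noteq> s \<and> dist t s < d \<longrightarrow> dist ((P t - P s) / (t - s)) 0 < e"
    proof (intro exI[of _ "e / (\<bar>C\<bar> + 1)"] conjI ballI impI)
      show "e / (\<bar>C\<bar> + 1) > 0" using e by simp
      fix t assume t: "t \<in> {a..b}" "t \<noteq> s \<and> dist t s < e / (\<bar>C\<bar> + 1)"
      have "\<bar>(P t - P s) / (t - s)\<bar> \<le> \<bar>C\<bar> * \<bar>t - s\<bar>"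
        using C[OF s t(1)] t(2) abs_mult_self_eq[of "t - s"]
        by (simp add: abs_divide pos_divide_le_eq power2_eq_square mult.assoc)
      also have "\<dots> \<le> (\<bar>C\<bar> + 1) * \<bar>t - s\<bar>" by (simp add: mult_right_mono)
      also have "\<dots> < e" using t(2) by (simp add: dist_real_def field_simps)
      finally show "dist ((P t - P s) / (t - s)) 0 < e" by simp
    qed
  qed
  then obtain c where "\<And>x. x \<in> {a..b} \<Longrightarrow> P x = c"
    using has_field_derivative_zero_constant[of "{a..b}" P] by blast
  then show ?thesis using assms(2) by simp
qed

lemma primitive_increment:
  fixes F f :: "real \<Rightarrow> 'a::banach"
  assumes "\<And>t. t \<in> {a..b} \<Longrightarrow> (F has_integral (f t - f a)) {a..t}"
    and "a \<le> s" "s \<le> t" "t \<le> b"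
  shows "(F has_integral (f t - f s)) {s..t}"
proof -
  have t: "(F has_integral (f t - f a)) {a..t}" and s: "(F has_integral (f s - f a)) {a..s}"
    using assms by auto
  have "F integrable_on {s..t}"
    using t assms(2,3) by (auto simp: integrable_on_def intro: integrable_on_subinterval[unfolded integrable_on_def])
  then obtain j where j: "(F has_integral j) {s..t}" by auto
  have "(F has_integral ((f s - f a) + j)) {a..t}"
    using has_integral_combine[OF assms(2,3) s j] .
  then have "j = f t - f s"
    using has_integral_unique[OF t] by (simp add: algebra_simps)
  then show ?thesis using j by simp
qed

text \<open>On a short interval \<open>[s, t]\<close>, freezing \<open>g\<close> at \<open>s\<close>
  and \<open>f\<close> at \<open>t\<close> gives an integrand whose integral is exactly the
  increment of \<open>f * g\<close>. Both functions are Lipschitz with constant \<open>C\<close>, so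
  unfreezing costs \<open>O((t - s)\<^sup>2)\<close>, and \<open>f * g\<close> minus the integral
  has derivative zero everywhere.\<close>

lemma has_integral_mult_primitives:
  fixes f g F G :: "real \<Rightarrow> real"
  assumes F: "\<And>t. t \<in> {a..b} \<Longrightarrow> (F has_integral (f t - f a)) {a..t}"
    and G: "\<And>t. t \<in> {a..b} \<Longrightarrow> (G has_integral (g t - g a)) {a..t}"
    and bF: "\<And>t. t \<in> {a..b} \<Longrightarrow> \<bar>F t\<bar> \<le> C" and bG: "\<And>t. t \<in> {a..b} \<Longrightarrow> \<bar>G t\<bar> \<le> C"
    and ab: "a \<le> b"
  shows "((\<lambda>t. F t * g t + f t * G t) has_integral (f b * g b - f a * g a)) {a..b}"
proof -
  have C: "C \<ge> 0" using bF[of a] ab by force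
  \<comment> \<open>A bounded integrable function is absolutely integrable, and a primitive is
    continuous, hence bounded and measurable; together these make the product integrable.\<close>
  have prod: "(\<lambda>t. F t * g t) integrable_on {a..b}"
    if F: "\<And>t. t \<in> {a..b} \<Longrightarrow> (F has_integral (f t - f a)) {a..t}"
    and G: "\<And>t. t \<in> {a..b} \<Longrightarrow> (G has_integral (g t - g a)) {a..t}"
    and bF: "\<And>t. t \<in> {a..b} \<Longrightarrow> \<bar>F t\<bar> \<le> C" for F f G g :: "real \<Rightarrow> real"
  proof -
    have "F integrable_on {a..b}" using F[of b] ab by auto
    then have abs: "F absolutely_integrable_on {a..b}"
      by (rule absolutely_integrable_integrable_bound[where g = "\<lambda>_. C", rotated])
        (use bF in auto)
    have "continuous_on {a..b} (\<lambda>t. integral {a..t} G)"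
      by (intro indefinite_integral_continuous_1) (use G[of b] ab in auto)
    then have "continuous_on {a..b} (\<lambda>t. integral {a..t} G + g a)"
      by (intro continuous_intros)
    then have g: "continuous_on {a..b} g"
    proof (rule continuous_on_eq)
      show "integral {a..t} G + g a = g t" if "t \<in> {a..b}" for t
        using integral_unique[OF G[OF that]] by simp
    qed
    have "(\<lambda>t. g t * F t) absolutely_integrable_on {a..b}"
      using abs g
      by (intro absolutely_integrable_bounded_measurable_product_real
          continuous_imp_measurable_on_sets_lebesgue compact_imp_bounded compact_continuous_image) auto
    then show ?thesis by (simp add: absolutely_integrable_on_def mult.commute)
  qed
  define K where "K = (\<lambda>t. F t * g t + f t * G t)"
  have Kint: "K integrable_on {a..b}"
    unfolding K_def using prod[OF F G bF] prod[OF G F bG]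
    by (intro integrable_add) (auto simp: mult.commute)
  have lip: "\<bar>f t - f s\<bar> \<le> C * (t - s)"
    if F: "\<And>t. t \<in> {a..b} \<Longrightarrow> (F has_integral (f t - f a)) {a..t}"
    and bF: "\<And>t. t \<in> {a..b} \<Longrightarrow> \<bar>F t\<bar> \<le> C" and st: "a \<le> s" "s \<le> t" "t \<le> b"
    for F f :: "real \<Rightarrow> real" and s t
    using has_integral_bound[OF C primitive_increment[OF F st, unfolded box_real[symmetric]]] bF st
    by (auto simp: box_real)
  define P where "P = (\<lambda>t. f t * g t - integral {a..t} K)"
  have "P b = P a"
  proof (rule constant_of_quadratic_modulus[OF _ ab, where C = "2 * C\<^sup>2"])
    fix s t assume st: "a \<le> s" "s \<le> t" "t \<le> b"
    have K: "(K has_integral (integral {a..t} K - integral {a..s} K)) {s..t}"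
    proof -
      have "integral {a..s} K + integral {s..t} K = integral {a..t} K"
        by (rule Henstock_Kurzweil_Integration.integral_combine)
          (use st Kint in \<open>auto intro: integrable_on_subinterval\<close>)
      moreover have "(K has_integral integral {s..t} K) {s..t}"
        using integrable_integral[OF integrable_on_subinterval[OF Kint, of s t]] st by auto
      ultimately show ?thesis by (metis add_diff_cancel_left')
    qed
    have 1: "((\<lambda>r. F r * g s) has_integral ((f t - f s) * g s)) {s..t}"
      using primitive_increment[OF F st] by (rule has_integral_mult_left)
    have 2: "((\<lambda>r. f t * G r) has_integral (f t * (g t - g s))) {s..t}"
      using primitive_increment[OF G st] by (rule has_integral_mult_right)
    have "((\<lambda>r. F r * g s + f t * G r - K r) has_integral (P t - P s)) {s..t}"
      using has_integral_diff[OF has_integral_add[OF 1 2] K]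
      by (simp add: P_def algebra_simps)
    moreover have "\<bar>F r * g s + f t * G r - K r\<bar> \<le> 2 * C\<^sup>2 * (t - s)" if r: "r \<in> {s..t}" for r
    proof -
      have "F r * g s + f t * G r - K r = F r * (g s - g r) + (f t - f r) * G r"
        by (simp add: K_def algebra_simps)
      also have "\<bar>\<dots>\<bar> \<le> \<bar>F r\<bar> * \<bar>g r - g s\<bar> + \<bar>f t - f r\<bar> * \<bar>G r\<bar>"
        by (metis abs_minus_commute abs_mult abs_triangle_ineq)
      also have "\<dots> \<le> C * (C * (t - s)) + (C * (t - s)) * C"
      proof (intro add_mono mult_mono)
        show "\<bar>g r - g s\<bar> \<le> C * (t - s)"
          using lip[OF G bG, of s r] st r mult_left_mono[of "r - s" "t - s" C] C by auto
        show "\<bar>f t - f r\<bar> \<le> C * (t - s)"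
          using lip[OF F bF, of r t] st r mult_left_mono[of "t - r" "t - s" C] C by auto
      qed (use bF bG st r C in auto)
      finally show ?thesis by (simp add: power2_eq_square)
    qed
    ultimately have "norm (P t - P s) \<le> 2 * C\<^sup>2 * (t - s) * measure lborel (cbox s t)"
      using C st by (intro has_integral_bound[where f = "\<lambda>r. F r * g s + f t * G r - K r"]) (auto simp: box_real)
    then show "\<bar>P t - P s\<bar> \<le> 2 * C\<^sup>2 * (t - s)\<^sup>2"
      using st by (simp add: power2_eq_square mult.assoc)
  qed
  then have "integral {a..b} K = f b * g b - f a * g a" by (simp add: P_def)
  then show ?thesis using Kint integrable_integral by (force simp: K_def)
qed

text \<open>The inner product of complex numbers is the sum of the products of real and of imaginary
  parts. Bounds off \<open>Z\<close> suffice, because the integrands may be set to zero on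
  \<open>Z\<close> without changing any integral.\<close>

lemma has_integral_inner_primitives:
  fixes f g F G :: "real \<Rightarrow> complex"
  assumes F: "\<And>t. t \<in> {a..b} \<Longrightarrow> (F has_integral (f t - f a)) {a..t}"
    and G: "\<And>t. t \<in> {a..b} \<Longrightarrow> (G has_integral (g t - g a)) {a..t}"
    and Z: "negligible Z"
    and bF: "\<And>t. t \<in> {a..b} - Z \<Longrightarrow> norm (F t) \<le> C" and bG: "\<And>t. t \<in> {a..b} - Z \<Longrightarrow> norm (G t) \<le> C"
    and ab: "a \<le> b"
  shows "((\<lambda>t. F t \<bullet> g t + f t \<bullet> G t) has_integral (f b \<bullet> g b - f a \<bullet> g a)) {a..b}"
proof -
  define F' where "F' = (\<lambda>t. if t \<in> Z then 0 else F t)"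
  define G' where "G' = (\<lambda>t. if t \<in> Z then 0 else G t)"
  have F': "(F' has_integral (f t - f a)) {a..t}" if "t \<in> {a..b}" for t
    using has_integral_spike[OF Z _ F[OF that], of F'] by (auto simp: F'_def)
  have G': "(G' has_integral (g t - g a)) {a..t}" if "t \<in> {a..b}" for t
    using has_integral_spike[OF Z _ G[OF that], of G'] by (auto simp: G'_def)
  have bF': "norm (F' t) \<le> \<bar>C\<bar>" and bG': "norm (G' t) \<le> \<bar>C\<bar>" if "t \<in> {a..b}" for t
    using bF[of t] bG[of t] that by (auto simp: F'_def G'_def)
  have comp: "((\<lambda>t. p (F' t)) has_integral (p (f t) - p (f a))) {a..t}"
             "((\<lambda>t. p (G' t)) has_integral (p (g t) - p (g a))) {a..t}"
    if "t \<in> {a..b}" "p = Re \<or> p = Im" for t and p :: "complex \<Rightarrow> real"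
    using has_integral_Re[OF F'[OF that(1)]] has_integral_Im[OF F'[OF that(1)]]
      has_integral_Re[OF G'[OF that(1)]] has_integral_Im[OF G'[OF that(1)]] that(2)
    by auto
  have P: "((\<lambda>t. p (F' t) * p (g t) + p (f t) * p (G' t)) has_integral
      (p (f b) * p (g b) - p (f a) * p (g a))) {a..b}" if p: "p = Re \<or> p = Im" for p
  proof (rule has_integral_mult_primitives[OF _ _ _ _ ab, where C = "\<bar>C\<bar>"])
    show "\<bar>p (F' t)\<bar> \<le> \<bar>C\<bar>" "\<bar>p (G' t)\<bar> \<le> \<bar>C\<bar>" if "t \<in> {a..b}" for t
      using bF'[OF that] bG'[OF that] p abs_Re_le_cmod abs_Im_le_cmod order_trans by blast+
  qed (use comp p in auto)
  have "((\<lambda>t. F' t \<bullet> g t + f t \<bullet> G' t) has_integral (f b \<bullet> g b - f a \<bullet> g a)) {a..b}"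
    using has_integral_add[OF P[of Re] P[of Im]] by (simp add: inner_complex_def algebra_simps)
  then show ?thesis
    by (rule has_integral_spike[OF Z, rotated]) (auto simp: F'_def G'_def)
qed

section \<open>The virial of a row\<close>

text \<open>
  The weight belongs to the pair \<open>(m, m + 1)\<close>, so it is odd about \<open>m = - 1/2\<close>: a tent of slope \<open>1\<close> on
  \<open>\<bar>m + 1/2\<bar> \<le> L + 1/2\<close> that returns to zero with slope \<open>- 1\<close>.
\<close>

definition virial_weight :: "nat \<Rightarrow> int \<Rightarrow> real" where
  "virial_weight L m = (let x = real_of_int m + 1/2; X = real L + 1/2
     in max 0 (min x (2 * X - x)) - max 0 (min (- x) (2 * X + x)))"

lemma virial_weight_nonneg:
  "0 \<le> m \<Longrightarrow> virial_weight L m = max 0 (min (real_of_int m + 1/2) (2 * real L + 1/2 - real_of_int m))"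
  unfolding virial_weight_def Let_def by (simp add: max_def min_def field_simps)

lemma virial_weight_neg:
  "m < 0 \<Longrightarrow> virial_weight L m = - max 0 (min (- real_of_int m - 1/2) (2 * real L + 3/2 + real_of_int m))"
  unfolding virial_weight_def Let_def by (simp add: max_def min_def field_simps)

lemma virial_weight_diff: "\<bar>virial_weight L m - virial_weight L (m - 1)\<bar> \<le> 1"
proof -
  consider "m < 0" | "m = 0" | "m > 0" by linarith
  then show ?thesis
  proof cases
    case 1
    then show ?thesis by (simp add: virial_weight_neg)
  next
    case 2
    then show ?thesis by (simp add: virial_weight_neg virial_weight_nonneg)
  next
    case 3
    then show ?thesis by (simp add: virial_weight_nonneg)
  qed
qed

lemma virial_weight_inside:
  assumes "- int L - 1 \<le> m" "m \<le> int L"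
  shows "virial_weight L m = real_of_int m + 1/2"
proof (cases "m < 0")
  case True
  moreover have "- real L - 1 \<le> real_of_int m" "real_of_int m \<le> -1" using assms True by linarith+
  ultimately show ?thesis by (simp add: virial_weight_neg)
next
  case False
  moreover have "real_of_int m \<le> real L" "real_of_int m \<ge> 0" using assms False by linarith+
  ultimately show ?thesis by (simp add: virial_weight_nonneg)
qed

lemma virial_weight_outside:
  assumes "2 * int L < m \<or> m < - 2 * int L - 1"
  shows "virial_weight L m = 0"
proof (cases "m < 0")
  case True
  moreover have "real_of_int m \<le> - 2 * real L - 2" using assms True by linarith
  ultimately show ?thesis by (simp add: virial_weight_neg)
next
  case False
  moreover have "real_of_int m \<ge> 2 * real L + 1" using assms False by linarith
  ultimately show ?thesis by (simp add: virial_weight_nonneg)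
qed

lemma virial_weight_bound: "\<bar>virial_weight L m\<bar> \<le> real L + 1/2"
proof (cases "m < 0")
  case True
  then show ?thesis by (simp add: virial_weight_neg)
next
  case False
  then show ?thesis by (simp add: virial_weight_nonneg)
qed

lemma sum_int_shift:
  fixes F :: "int \<Rightarrow> 'a::comm_monoid_add"
  assumes "F (- R) = 0" "F (R + 1) = 0"
  shows "(\<Sum>m\<in>{-R..R}. F (m + 1)) = (\<Sum>m\<in>{-R..R}. F m)"
proof -
  have "(\<Sum>m\<in>{-R..R}. F (m + 1)) = (\<Sum>m\<in>{-R+1..R+1}. F m)"
    by (rule sum.reindex_bij_witness[of _ "\<lambda>m. m - 1" "\<lambda>m. m + 1"]) auto
  also have "\<dots> = (\<Sum>m\<in>{-R+1..R}. F m)"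
  proof (rule sum.mono_neutral_right)
    have "{-R+1..R+1} - {-R+1..R} \<subseteq> {R+1}" by auto
    then show "\<forall>i\<in>{-R+1..R+1} - {-R+1..R}. F i = 0" using assms(2) by auto
  qed auto
  also have "\<dots> = (\<Sum>m\<in>{-R..R}. F m)"
  proof (rule sum.mono_neutral_left)
    have "{-R..R} - {-R+1..R} \<subseteq> {-R}" by auto
    then show "\<forall>i\<in>{-R..R} - {-R+1..R}. F i = 0" using assms(1) by auto
  qed auto
  finally show ?thesis .
qed

lemma norm_add_squared_le:
  "(norm (x + y :: 'a::real_inner))\<^sup>2 \<le> 2 * ((norm x)\<^sup>2 + (norm y)\<^sup>2)"
proof -
  have "0 \<le> (norm (x - y))\<^sup>2" by simp
  then show ?thesis
    by (simp add: power2_norm_eq_inner inner_diff_left inner_diff_right inner_add_left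
        inner_add_right inner_commute)
qed

text \<open>The left side is, up to a factor, what the shear does to the sum of
  \<open>h m * (u m \<bullet> u (m + 1))\<close>. Summation by parts collects the products
  \<open>u (m - 1) \<bullet> u (m + 1)\<close> with the coefficient
  \<open>lam m * (h m - h (m - 1))\<close>; completing them to squares of defects leaves only
  diagonal terms. The vanishing of \<open>h\<close> near both ends removes all boundary
  terms.\<close>

lemma virial_identity:
  fixes u :: "int \<Rightarrow> 'a::real_inner" and lam h :: "int \<Rightarrow> real"
  assumes h: "\<And>m. m \<le> - R + 3 \<or> R - 3 \<le> m \<Longrightarrow> h m = 0"
  shows "(\<Sum>m\<in>{-R..R}. h m * (lam m * ((u (m - 1) - u (m + 1)) \<bullet> u (m + 1))
            + lam (m + 1) * (u m \<bullet> (u m - u (m + 2)))))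
       = (\<Sum>m\<in>{-R..R}. lam m * (h m - h (m - 1)) / 2 * (norm (u (m - 1) + u (m + 1)))\<^sup>2
            + (lam (m + 1) * (3 * h m - h (m + 1)) - lam (m - 1) * (3 * h (m - 1) - h (m - 2))) / 2
               * (norm (u m))\<^sup>2)"
proof -
  \<comment> \<open>\<open>B\<close> and \<open>K\<close> are the diagonal and the off-diagonal
    terms that need a shift of the index. \<open>G m\<close> and \<open>W (m + 1)\<close> are the
    squares of \<open>u (m - 1)\<close> and \<open>u (m + 1)\<close> that complete the
    square.\<close>
  define B where "B m = h (m - 1) * lam (m - 1) * (norm (u m))\<^sup>2" for m
  define K where "K m = h (m - 1) * lam m * (u (m - 1) \<bullet> u (m + 1))" for m
  define G where "G m = lam m * (h m - h (m - 1)) * (norm (u (m - 1)))\<^sup>2" for m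
  define W where "W m = lam (m - 1) * (h (m - 1) - h (m - 2)) * (norm (u m))\<^sup>2" for m
  have sh: "(\<Sum>m\<in>{-R..R}. F (m + 1)) = (\<Sum>m\<in>{-R..R}. F m)"
    if "F = B \<or> F = K \<or> F = G \<or> F = W" for F
    using that by (intro sum_int_shift) (auto simp: B_def K_def G_def W_def h)
  have "(\<Sum>m\<in>{-R..R}. h m * (lam m * ((u (m - 1) - u (m + 1)) \<bullet> u (m + 1))
            + lam (m + 1) * (u m \<bullet> (u m - u (m + 2)))))
      = (\<Sum>m\<in>{-R..R}. h m * lam m * (u (m - 1) \<bullet> u (m + 1)) - B (m + 1)
          + h m * lam (m + 1) * (norm (u m))\<^sup>2 - K (m + 1))"
    by (intro sum.cong refl)
      (simp add: B_def K_def power2_norm_eq_inner inner_diff_left inner_diff_right algebra_simps)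
  also have "\<dots> = (\<Sum>m\<in>{-R..R}. h m * lam m * (u (m - 1) \<bullet> u (m + 1)) - B m
          + h m * lam (m + 1) * (norm (u m))\<^sup>2 - K m)"
    using sh by (simp add: sum.distrib sum_subtractf)
  also have "\<dots> = (\<Sum>m\<in>{-R..R}. G (m + 1) / 2 + W m / 2
        + lam m * (h m - h (m - 1)) * (u (m - 1) \<bullet> u (m + 1))
        + (lam (m + 1) * (3 * h m - h (m + 1)) - lam (m - 1) * (3 * h (m - 1) - h (m - 2))) / 2
               * (norm (u m))\<^sup>2)"
    by (intro sum.cong refl) (simp add: B_def K_def G_def W_def field_simps)
  also have "\<dots> = (\<Sum>m\<in>{-R..R}. G m / 2 + W (m + 1) / 2
        + lam m * (h m - h (m - 1)) * (u (m - 1) \<bullet> u (m + 1))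
        + (lam (m + 1) * (3 * h m - h (m + 1)) - lam (m - 1) * (3 * h (m - 1) - h (m - 2))) / 2
               * (norm (u m))\<^sup>2)"
    using sh by (simp add: sum.distrib flip: sum_divide_distrib)
  also have "\<dots> = (\<Sum>m\<in>{-R..R}. lam m * (h m - h (m - 1)) / 2 * (norm (u (m - 1) + u (m + 1)))\<^sup>2
            + (lam (m + 1) * (3 * h m - h (m + 1)) - lam (m - 1) * (3 * h (m - 1) - h (m - 2))) / 2
               * (norm (u m))\<^sup>2)"
    by (intro sum.cong refl)
      (simp add: G_def W_def power2_norm_eq_inner inner_add_left inner_add_right
        inner_commute[of "u (_ + 1)" "u (_ - 1)"] field_simps)
  finally show ?thesis .
qed

text \<open>Where \<open>h m = m + 1/2\<close>, the brackets \<open>3 * h m - h (m + 1)\<close> and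
  \<open>3 * h (m - 1) - h (m - 2)\<close> both equal \<open>2 * m\<close>, so the diagonal term is
  \<open>m * (lam (m + 1) - lam (m - 1))\<close>, nonnegative because \<open>lam\<close> grows with
  \<open>\<bar>m\<bar>\<close>. This is the gain from centring the weight at a half integer. Farther
  out, where the tent bends, the terms have either sign and are only bounded by the nearby
  mass.\<close>

lemma virial_lower_bound:
  fixes u :: "int \<Rightarrow> 'a::real_inner" and lam :: "int \<Rightarrow> real"
  assumes L: "L \<ge> 3" and R: "R = 2 * int L + 5"
    and lam: "\<And>m. c \<le> lam m" "\<And>m. lam m \<le> 1" "0 \<le> c"
    and mono: "\<And>m. 0 \<le> real_of_int m * (lam (m + 1) - lam (m - 1))"
    and far: "\<And>m. int L - 1 \<le> \<bar>m\<bar> \<Longrightarrow> real L * (1 - lam m) \<le> 1"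
  defines "h \<equiv> virial_weight L"
  shows "c / 2 * (\<Sum>m\<in>{m. \<bar>m\<bar> < int L}. (norm (u (m - 1) + u (m + 1)))\<^sup>2)
      - 5 * (\<Sum>m\<in>{m\<in>{-R..R}. int L \<le> \<bar>m\<bar>}. (norm (u (m - 1)))\<^sup>2 + (norm (u m))\<^sup>2 + (norm (u (m + 1)))\<^sup>2)
    \<le> (\<Sum>m\<in>{-R..R}. h m * (lam m * ((u (m - 1) - u (m + 1)) \<bullet> u (m + 1))
            + lam (m + 1) * (u m \<bullet> (u m - u (m + 2)))))" (is "?lhs \<le> ?rhs")
proof -
  define I where "I = {m. \<bar>m\<bar> < int L}"
  define J where "J = {m\<in>{-R..R}. int L \<le> \<bar>m\<bar>}"
  define t where "t m = lam m * (h m - h (m - 1)) / 2 * (norm (u (m - 1) + u (m + 1)))\<^sup>2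
            + (lam (m + 1) * (3 * h m - h (m + 1)) - lam (m - 1) * (3 * h (m - 1) - h (m - 2))) / 2
               * (norm (u m))\<^sup>2" for m
  have I: "finite I" "finite J" "I \<inter> J = {}" "I \<union> J = {-R..R}"
  proof -
    have "I = {- int L<..<int L}" by (auto simp: I_def)
    then show "finite I" by simp
    show "finite J" by (auto simp: J_def intro: finite_subset[of _ "{-R..R}"])
  qed (use R in \<open>auto simp: I_def J_def\<close>)
  have tI: "c / 2 * (norm (u (m - 1) + u (m + 1)))\<^sup>2 \<le> t m" if "m \<in> I" for m
  proof -
    have m: "- int L < m" "m < int L" using that by (auto simp: I_def)
    \<comment> \<open>\<open>\<bar>m\<bar> < L\<close> puts the four indices from
      \<open>m - 2\<close> to \<open>m + 1\<close> into the linear range from \<open>- L - 1\<close>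
      to \<open>L\<close>.\<close>
    have h: "h m = m + 1/2" "h (m - 1) = m - 1/2" "h (m + 1) = m + 3/2" "h (m - 2) = m - 3/2"
      using m virial_weight_inside[of L m] virial_weight_inside[of L "m-1"]
        virial_weight_inside[of L "m+1"] virial_weight_inside[of L "m-2"]
      by (simp_all add: h_def)
    have "t m = lam m / 2 * (norm (u (m - 1) + u (m + 1)))\<^sup>2
        + m * (lam (m + 1) - lam (m - 1)) * (norm (u m))\<^sup>2"
      unfolding t_def h by (simp add: field_simps)
    moreover have "c / 2 * (norm (u (m - 1) + u (m + 1)))\<^sup>2 \<le> lam m / 2 * (norm (u (m - 1) + u (m + 1)))\<^sup>2"
      using lam(1)[of m] by (intro mult_right_mono) auto
    moreover have "0 \<le> m * (lam (m + 1) - lam (m - 1)) * (norm (u m))\<^sup>2"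
      by (intro mult_nonneg_nonneg[OF mono]) auto
    ultimately show ?thesis by linarith
  qed
  have tJ: "- 5 * ((norm (u (m - 1)))\<^sup>2 + (norm (u m))\<^sup>2 + (norm (u (m + 1)))\<^sup>2) \<le> t m" if "m \<in> J" for m
  proof -
    define r1 where "r1 = 3 * h m - h (m + 1)"
    define r2 where "r2 = 3 * h (m - 1) - h (m - 2)"
    have d: "\<bar>h m - h (m - 1)\<bar> \<le> 1" "\<bar>h (m + 1) - h m\<bar> \<le> 1" "\<bar>h (m - 1) - h (m - 2)\<bar> \<le> 1"
      using virial_weight_diff[of L m] virial_weight_diff[of L "m + 1"] virial_weight_diff[of L "m - 1"]
      by (simp_all add: h_def)
    have r: "\<bar>r1 - r2\<bar> \<le> 6" "\<bar>r2\<bar> \<le> 2 * real L + 2"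
      using d virial_weight_bound[of L "m - 1"] unfolding r1_def r2_def h_def by linarith+
    have l01: "0 \<le> lam n" "lam n \<le> 1" for n using lam(1)[of n] lam(2)[of n] lam(3) by auto
    \<comment> \<open>The bracket \<open>r2\<close> grows like \<open>2 * L\<close>, so the
      variation of \<open>lam\<close> must be \<open>O(1 / L)\<close>: two numbers between
      \<open>1 - 1 / L\<close> and 1 differ by at most \<open>1 / L\<close>. The 10 reached below is
      6 from the differences of the weight and 4 from this variation.\<close>
    have dl: "\<bar>lam (m + 1) - lam (m - 1)\<bar> * real L \<le> 1"
    proof -
      have "real L * (1 - lam (m + 1)) \<le> 1" "real L * (1 - lam (m - 1)) \<le> 1"
        using that by (auto intro!: far simp: J_def)
      moreover have "\<bar>lam (m + 1) - lam (m - 1)\<bar> \<le> 1 - lam (m + 1) \<or> \<bar>lam (m + 1) - lam (m - 1)\<bar> \<le> 1 - lam (m - 1)"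
        using l01[of "m+1"] l01[of "m-1"] by linarith
      ultimately show ?thesis
        by (metis mult.commute mult_left_mono of_nat_0_le_iff order_trans)
    qed
    have "\<bar>lam (m + 1) * r1 - lam (m - 1) * r2\<bar> = \<bar>lam (m + 1) * (r1 - r2) + (lam (m + 1) - lam (m - 1)) * r2\<bar>"
      by (simp add: algebra_simps)
    also have "\<dots> \<le> lam (m + 1) * \<bar>r1 - r2\<bar> + \<bar>lam (m + 1) - lam (m - 1)\<bar> * \<bar>r2\<bar>"
      using l01[of "m+1"] by (intro order_trans[OF abs_triangle_ineq]) (simp add: abs_mult)
    also have "\<dots> \<le> 1 * 6 + \<bar>lam (m + 1) - lam (m - 1)\<bar> * (2 * real L + 2)"
      using l01[of "m+1"] r by (intro add_mono mult_mono) auto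
    also have "\<dots> \<le> 6 + \<bar>lam (m + 1) - lam (m - 1)\<bar> * (4 * real L)"
      using L by (intro add_mono mult_left_mono) auto
    also have "\<dots> \<le> 10" using dl by linarith
    finally have "\<bar>lam (m + 1) * r1 - lam (m - 1) * r2\<bar> \<le> 10" .
    then have "- 10 \<le> lam (m + 1) * r1 - lam (m - 1) * r2" by (simp only: abs_le_iff) simp
    then have c1: "- 5 \<le> (lam (m + 1) * r1 - lam (m - 1) * r2) / 2" by simp
    have "\<bar>lam m * (h m - h (m - 1))\<bar> \<le> 1 * 1"
      unfolding abs_mult using l01[of m] d by (intro mult_mono) auto
    then have "- 1 \<le> lam m * (h m - h (m - 1))" by (simp only: abs_le_iff) simp
    then have "- (1/2) * (norm (u (m - 1) + u (m + 1)))\<^sup>2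
        \<le> lam m * (h m - h (m - 1)) / 2 * (norm (u (m - 1) + u (m + 1)))\<^sup>2"
      by (intro mult_right_mono) auto
    moreover have "- 5 * (norm (u m))\<^sup>2 \<le> (lam (m + 1) * r1 - lam (m - 1) * r2) / 2 * (norm (u m))\<^sup>2"
      using c1 by (intro mult_right_mono) auto
    ultimately show ?thesis
      using norm_add_squared_le[of "u (m - 1)" "u (m + 1)"]
        zero_le_power2[of "norm (u (m - 1))"] zero_le_power2[of "norm (u (m + 1))"]
      unfolding t_def r1_def r2_def by (simp only: algebra_simps)
  qed
  have "?rhs = sum t {-R..R}"
    unfolding t_def using R by (intro virial_identity) (auto simp: h_def intro!: virial_weight_outside)
  also have "\<dots> = sum t I + sum t J"
    using sum.union_disjoint[OF I(1,2,3)] I(4) by metis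
  also have "\<dots> \<ge> (\<Sum>m\<in>I. c / 2 * (norm (u (m - 1) + u (m + 1)))\<^sup>2)
      + (\<Sum>m\<in>J. - 5 * ((norm (u (m - 1)))\<^sup>2 + (norm (u m))\<^sup>2 + (norm (u (m + 1)))\<^sup>2))"
    by (intro add_mono sum_mono tI tJ)
  finally show ?thesis
    unfolding I_def[symmetric] J_def[symmetric] sum_distrib_left[symmetric] by linarith
qed

section \<open>Spreading of mass along a row with small defects\<close>

lemma alternating_chain:
  fixes u :: "int \<Rightarrow> 'a::real_inner"
  assumes "\<eta> > 0"
  shows "(norm (u m))\<^sup>2 \<le> (norm (u (m + 2 * int j)))\<^sup>2
     + (\<Sum>i<j. (norm (u (m + 2 * int i) + u (m + 2 * int i + 2)))\<^sup>2 / (2 * \<eta>)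
             + \<eta> * ((norm (u (m + 2 * int i)))\<^sup>2 + (norm (u (m + 2 * int i + 2)))\<^sup>2))"
proof (induction j)
  case 0
  then show ?case by simp
next
  case (Suc j)
  define x y where "x = u (m + 2 * int j)" and "y = u (m + 2 * int j + 2)"
  \<comment> \<open>A small defect means that \<open>y\<close> is nearly \<open>- x\<close>: two
    steps along the row flip the sign but keep the norm. The factorization puts the defect in front,
    and Young's inequality with \<open>\<eta>\<close> separates it.\<close>
  have "(norm x)\<^sup>2 - (norm y)\<^sup>2 = (x + y) \<bullet> (x - y)"
    by (simp add: power2_norm_eq_inner inner_add_left inner_diff_right inner_commute algebra_simps)
  also have "\<dots> \<le> norm (x + y) * norm (x - y)" by (rule norm_cauchy_schwarz)
  also have "\<dots> \<le> (norm (x + y))\<^sup>2 / (2 * \<eta>) + \<eta> / 2 * (norm (x - y))\<^sup>2"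
  proof -
    have "0 \<le> (norm (x + y) - \<eta> * norm (x - y))\<^sup>2 / (2 * \<eta>)" using assms by simp
    also have "\<dots> = (norm (x + y))\<^sup>2 / (2 * \<eta>) + \<eta> / 2 * (norm (x - y))\<^sup>2 - norm (x + y) * norm (x - y)"
      using assms by (simp add: field_simps power2_eq_square)
    finally show ?thesis by simp
  qed
  also have "\<eta> / 2 * (norm (x - y))\<^sup>2 \<le> \<eta> / 2 * (2 * ((norm x)\<^sup>2 + (norm y)\<^sup>2))"
    using norm_add_squared_le[of x "- y"] assms by (intro mult_left_mono) auto
  finally have "(norm x)\<^sup>2 \<le> (norm y)\<^sup>2 + ((norm (x + y))\<^sup>2 / (2 * \<eta>) + \<eta> * ((norm x)\<^sup>2 + (norm y)\<^sup>2))"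
    by (simp add: field_simps)
  then show ?case using Suc unfolding x_def y_def by (simp add: algebra_simps)
qed

text \<open>Walking from \<open>m\<close> in steps of two to the edge of the range changes the
  squared norm only by defects and by \<open>\<eta>\<close> times the mass passed on the way, and at
  the edge a mode is at most \<open>A\<close>. The parameter \<open>\<eta>\<close> trades the weight
  \<open>1 / \<eta>\<close> of the defects against the total mass.\<close>

lemma alternating_spread:
  fixes u :: "int \<Rightarrow> 'a::real_inner"
  assumes \<eta>: "\<eta> > 0" and m: "\<bar>m\<bar> < int L"
    and far: "\<And>j. int L - 1 \<le> \<bar>j\<bar> \<Longrightarrow> (norm (u j))\<^sup>2 \<le> A"
    and B: "\<And>F. finite F \<Longrightarrow> (\<Sum>j\<in>F. (norm (u j))\<^sup>2) \<le> B"
  shows "(norm (u m))\<^sup>2 \<le> A + (\<Sum>j\<in>{j. \<bar>j\<bar> < int L}. (norm (u (j - 1) + u (j + 1)))\<^sup>2) / (2 * \<eta>) + 2 * \<eta> * B"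
proof -
  \<comment> \<open>The walk ends at the last index of the parity of \<open>m\<close> that does not
    exceed \<open>L\<close>, which is \<open>L - 1\<close> or \<open>L\<close>; hence
    \<open>far\<close> starts at \<open>L - 1\<close>.\<close>
  define k where "k = nat ((int L - m) div 2)"
  have k: "int k = (int L - m) div 2" using m by (simp add: k_def)
  have end': "int L - 1 \<le> m + 2 * int k" "m + 2 * int k \<le> int L" unfolding k by presburger+
  have fin: "finite {j. \<bar>j\<bar> < int L}"
    by (rule finite_subset[of _ "{- int L..int L}"]) auto
  have 1: "(\<Sum>i<k. (norm (u (m + 2 * int i) + u (m + 2 * int i + 2)))\<^sup>2)
      = (\<Sum>j\<in>(\<lambda>i. m + 2 * int i + 1) ` {..<k}. (norm (u (j - 1) + u (j + 1)))\<^sup>2)"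
    by (subst sum.reindex) (auto simp: inj_on_def algebra_simps)
  have 2: "\<dots> \<le> (\<Sum>j\<in>{j. \<bar>j\<bar> < int L}. (norm (u (j - 1) + u (j + 1)))\<^sup>2)"
    using m end' by (intro sum_mono2 fin) auto
  have 3: "(\<Sum>i<k. (norm (u (m + 2 * int i)))\<^sup>2) \<le> B"
    using B[of "(\<lambda>i. m + 2 * int i) ` {..<k}"] by (simp add: sum.reindex inj_on_def)
  have 4: "(\<Sum>i<k. (norm (u (m + 2 * int i + 2)))\<^sup>2) \<le> B"
    using B[of "(\<lambda>i. m + 2 * int i + 2) ` {..<k}"] by (simp add: sum.reindex inj_on_def)
  have "(norm (u m))\<^sup>2 \<le> (norm (u (m + 2 * int k)))\<^sup>2
     + ((\<Sum>i<k. (norm (u (m + 2 * int i) + u (m + 2 * int i + 2)))\<^sup>2) / (2 * \<eta>)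
        + \<eta> * ((\<Sum>i<k. (norm (u (m + 2 * int i)))\<^sup>2) + (\<Sum>i<k. (norm (u (m + 2 * int i + 2)))\<^sup>2)))"
    using alternating_chain[OF \<eta>, of u m k]
    by (simp add: sum.distrib sum_divide_distrib sum_distrib_left distrib_left)
  also have "\<dots> \<le> A + ((\<Sum>j\<in>{j. \<bar>j\<bar> < int L}. (norm (u (j - 1) + u (j + 1)))\<^sup>2) / (2 * \<eta>) + \<eta> * (B + B))"
    using 1 2 3 4 \<eta> end' by (intro add_mono far divide_right_mono mult_left_mono) auto
  finally show ?thesis by (simp add: algebra_simps)
qed

section \<open>Energy and virial estimates\<close>

text \<open>The symbol of \<open>- \<Delta>\<close>: the wave \<open>n = (k, m)\<close> has the wave
  vector \<open>(\<alpha> * k, m)\<close>.\<close>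

definition msq :: "real \<Rightarrow> int \<times> int \<Rightarrow> real" where
  "msq \<alpha> n = (\<alpha> * real_of_int (fst n))\<^sup>2 + (real_of_int (snd n))\<^sup>2"

text \<open>The symbol of \<open>1 + \<Delta>\<^sup>-\<^sup>1\<close>, except at \<open>n = 0\<close>, where division by zero gives \<open>1\<close>.\<close>

definition lam :: "real \<Rightarrow> int \<times> int \<Rightarrow> real" where
  "lam \<alpha> n = 1 - 1 / msq \<alpha> n"

definition waves :: "(int \<times> int) set" where
  "waves = {n. fst n \<noteq> 0}"

definition box_waves :: "nat \<Rightarrow> (int \<times> int) set" where
  "box_waves N = ({- int N..int N} - {0}) \<times> {- int N..int N}"

text \<open>When \<open>v\<close> consists of Fourier coefficients, Parseval makes this the squared
  norm of the \<open>P_nonzero\<close> part divided by the area of the torus; \<open>grad\<close> is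
  the same quantity for the gradient.\<close>

definition mass :: "(int \<times> int \<Rightarrow> real \<Rightarrow> complex) \<Rightarrow> real \<Rightarrow> real" where
  "mass v t = (\<Sum>\<^sub>\<infinity>n\<in>waves. (norm (v n t))\<^sup>2)"

definition grad :: "real \<Rightarrow> (int \<times> int \<Rightarrow> real \<Rightarrow> complex) \<Rightarrow> real \<Rightarrow> real" where
  "grad \<alpha> v t = (\<Sum>\<^sub>\<infinity>n\<in>waves. msq \<alpha> n * (norm (v n t))\<^sup>2)"

lemma finite_box_waves [simp]: "finite (box_waves N)"
  by (simp add: box_waves_def)

lemma box_waves_subset: "box_waves N \<subseteq> waves"
  by (auto simp: box_waves_def waves_def)

lemma box_waves_mono: "M \<le> N \<Longrightarrow> box_waves M \<subseteq> box_waves N"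
  by (auto simp: box_waves_def)

lemma msq_nonneg: "0 \<le> msq \<alpha> n"
  by (simp add: msq_def)

lemma waves_msq_ge:
  assumes "\<alpha> > 1" "n \<in> waves"
  shows "\<alpha>\<^sup>2 \<le> msq \<alpha> n" "1 \<le> msq \<alpha> n" "\<alpha> * \<bar>real_of_int (fst n)\<bar> \<le> msq \<alpha> n"
    "1 \<le> \<alpha> * \<bar>real_of_int (fst n)\<bar>"
proof -
  have 1: "1 \<le> \<bar>real_of_int (fst n)\<bar>" using assms(2) by (auto simp: waves_def)
  then have 2: "\<alpha> \<le> \<alpha> * \<bar>real_of_int (fst n)\<bar>" using assms(1) by simp
  then have "\<alpha>\<^sup>2 \<le> (\<alpha> * \<bar>real_of_int (fst n)\<bar>)\<^sup>2" using assms(1) by (intro power_mono) auto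
  then show "\<alpha>\<^sup>2 \<le> msq \<alpha> n" by (simp add: msq_def power_mult_distrib add_increasing2)
  moreover have "1 \<le> \<alpha>\<^sup>2" using assms(1) by simp
  ultimately show "1 \<le> msq \<alpha> n" by linarith
  show "1 \<le> \<alpha> * \<bar>real_of_int (fst n)\<bar>" using 2 assms by linarith
  then have "(\<alpha> * \<bar>real_of_int (fst n)\<bar>) * 1 \<le> (\<alpha> * \<bar>real_of_int (fst n)\<bar>) * (\<alpha> * \<bar>real_of_int (fst n)\<bar>)"
    using assms by (intro mult_left_mono) auto
  also have "\<dots> = (\<alpha> * real_of_int (fst n))\<^sup>2" by (simp add: power2_eq_square)
  finally show "\<alpha> * \<bar>real_of_int (fst n)\<bar> \<le> msq \<alpha> n" by (simp add: msq_def add_increasing2)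
qed

text \<open>The smallest wave number off the axis is \<open>\<alpha>\<close>, attained at
  \<open>(1, 0)\<close>. So \<open>\<alpha> > 1\<close> gives a uniform gap, and the energy weighted
  by \<open>lam\<close> is equivalent to the mass.\<close>

lemma lam_bounds:
  assumes "\<alpha> > 1" "n \<in> waves"
  shows "1 - 1 / \<alpha>\<^sup>2 \<le> lam \<alpha> n" "lam \<alpha> n \<le> 1" "0 < lam \<alpha> n"
proof -
  have "1 / msq \<alpha> n \<le> 1 / \<alpha>\<^sup>2"
    using waves_msq_ge[OF assms] assms(1) by (intro divide_left_mono) auto
  then show 1: "1 - 1 / \<alpha>\<^sup>2 \<le> lam \<alpha> n" by (simp add: lam_def)
  show "lam \<alpha> n \<le> 1" by (simp add: lam_def msq_nonneg)
  have "1 - 1 / \<alpha>\<^sup>2 > 0" using assms(1) by (simp add: power2_eq_square field_simps less_1_mult)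
  then show "0 < lam \<alpha> n" using 1 by linarith
qed

text \<open>Every finite set of waves lies in some box, so the boxes are cofinal in the filter that
  defines infinite sums.\<close>

lemma tendsto_sum_box_waves:
  fixes f :: "int \<times> int \<Rightarrow> real"
  assumes "f summable_on waves"
  shows "(\<lambda>N. \<Sum>n\<in>box_waves N. f n) \<longlonglongrightarrow> (\<Sum>\<^sub>\<infinity>n\<in>waves. f n)"
proof -
  have "filterlim box_waves (finite_subsets_at_top waves) sequentially"
    unfolding filterlim_finite_subsets_at_top
  proof (intro allI impI)
    fix X :: "(int \<times> int) set" assume X: "finite X \<and> X \<subseteq> waves"
    define N0 where "N0 = nat (Max (insert 0 ((\<lambda>n. \<bar>fst n\<bar> + \<bar>snd n\<bar>) ` X)))"
    have N0: "\<bar>fst n\<bar> + \<bar>snd n\<bar> \<le> int N0" if "n \<in> X" for n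
    proof -
      have "\<bar>fst n\<bar> + \<bar>snd n\<bar> \<le> Max (insert 0 ((\<lambda>n. \<bar>fst n\<bar> + \<bar>snd n\<bar>) ` X))"
        using X that by (intro Max_ge) auto
      also have "\<dots> \<le> int N0" unfolding N0_def by simp
      finally show ?thesis .
    qed
    have "X \<subseteq> box_waves N" if "N0 \<le> N" for N
    proof
      fix n assume n: "n \<in> X"
      have "\<bar>fst n\<bar> + \<bar>snd n\<bar> \<le> int N" using N0[OF n] that by linarith
      moreover have "fst n \<noteq> 0" using n X by (auto simp: waves_def)
      ultimately show "n \<in> box_waves N" by (cases n) (auto simp: box_waves_def)
    qed
    then show "\<forall>\<^sub>F N in sequentially. finite (box_waves N) \<and> X \<subseteq> box_waves N \<and> box_waves N \<subseteq> waves"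
      using box_waves_subset by (auto simp: eventually_at_top_linorder)
  qed
  then show ?thesis
    using has_sum_infsum[OF assms] filterlim_compose unfolding has_sum_def by blast
qed

text \<open>
  \<open>N\<close> is a perturbation of relative size \<open>\<theta>\<close>. The bounds that involve derivatives hold off the
  null set \<open>Z\<close> of times, and \<open>Hb\<close> is an integrable majorant of the dissipation.
\<close>

locale shear_modes =
  fixes \<alpha> \<nu> T \<theta> cmin B :: real and c :: "real \<Rightarrow> real"
    and v N :: "int \<times> int \<Rightarrow> real \<Rightarrow> complex" and Hb :: "real \<Rightarrow> real" and Z :: "real set"
  assumes alpha: "\<alpha> > 1" and nu: "\<nu> > 0" and T_pos: "T > 0" and theta: "\<theta> \<ge> 0"
    and c_cont: "continuous_on {0..T} c" and cmin: "cmin > 0"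
    and c_ge: "\<And>t. t \<in> {0..T} \<Longrightarrow> cmin \<le> c t" and c_le: "\<And>t. t \<in> {0..T} \<Longrightarrow> c t \<le> 2"
    and Z: "negligible Z"
    and ode: "\<And>k m t. k \<noteq> 0 \<Longrightarrow> t \<in> {0..T} \<Longrightarrow>
        ((\<lambda>s. - ((\<nu> * msq \<alpha> (k, m)) *\<^sub>R v (k, m) s)
             - (c s * \<alpha> * real_of_int k / 2) *\<^sub>R (lam \<alpha> (k, m - 1) *\<^sub>R v (k, m - 1) s - lam \<alpha> (k, m + 1) *\<^sub>R v (k, m + 1) s)
             - N (k, m) s)
         has_integral (v (k, m) t - v (k, m) 0)) {0..t}"
    and mass_bound: "\<And>t F. t \<in> {0..T} \<Longrightarrow> finite F \<Longrightarrow> F \<subseteq> waves \<Longrightarrow> (\<Sum>n\<in>F. (norm (v n t))\<^sup>2) \<le> B"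
    and Hb_int: "Hb integrable_on {0..T}"
    and Hb: "\<And>t F. t \<in> {0..T} - Z \<Longrightarrow> finite F \<Longrightarrow> F \<subseteq> waves \<Longrightarrow> (\<Sum>n\<in>F. msq \<alpha> n * (norm (v n t))\<^sup>2) \<le> Hb t"
    and N_pointwise: "\<And>t n. t \<in> {0..T} - Z \<Longrightarrow> n \<in> waves \<Longrightarrow> norm (N n t) \<le> \<theta> * sqrt (msq \<alpha> n) * sqrt (mass v t)"
    and N_pairing: "\<And>t F. t \<in> {0..T} - Z \<Longrightarrow> finite F \<Longrightarrow> F \<subseteq> waves \<Longrightarrow>
        (\<Sum>n\<in>F. norm (v n t) * norm (N n t)) \<le> \<theta> * grad \<alpha> v t"
begin

definition c0 :: real where "c0 = 1 - 1 / \<alpha>\<^sup>2"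
definition u :: "int \<times> int \<Rightarrow> real \<Rightarrow> complex" where "u n t = lam \<alpha> n *\<^sub>R v n t"
definition rhs :: "int \<times> int \<Rightarrow> real \<Rightarrow> complex" where
  "rhs n s = - ((\<nu> * msq \<alpha> n) *\<^sub>R v n s)
     - (c s * \<alpha> * real_of_int (fst n) / 2) *\<^sub>R (u (fst n, snd n - 1) s - u (fst n, snd n + 1) s) - N n s"
definition S :: "nat \<Rightarrow> real \<Rightarrow> real" where
  "S M t = (\<Sum>n\<in>box_waves M. msq \<alpha> n * (norm (v n t))\<^sup>2)"
definition E :: "real \<Rightarrow> real" where "E t = (\<Sum>\<^sub>\<infinity>n\<in>waves. lam \<alpha> n * (norm (v n t))\<^sup>2)"

abbreviation "H \<equiv> grad \<alpha> v"

lemma c0: "0 < c0" "c0 < 1"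
  using alpha by (auto simp: c0_def power2_eq_square field_simps less_1_mult)

lemma lam01: "n \<in> waves \<Longrightarrow> c0 \<le> lam \<alpha> n" "n \<in> waves \<Longrightarrow> lam \<alpha> n \<le> 1" "n \<in> waves \<Longrightarrow> 0 < lam \<alpha> n"
  using lam_bounds[OF alpha] by (auto simp: c0_def)

lemma lam_nonneg: "n \<in> waves \<Longrightarrow> 0 \<le> lam \<alpha> n"
  using lam01(3)[of n] by simp

lemma lam_mult_le: "n \<in> waves \<Longrightarrow> 0 \<le> x \<Longrightarrow> lam \<alpha> n * x \<le> x"
  using mult_right_mono[OF lam01(2)[of n], of x] by simp

lemma norm_u_le: "n \<in> waves \<Longrightarrow> norm (u n t) \<le> norm (v n t)"
  using lam01[of n] by (simp add: u_def mult_left_le_one_le)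

lemma norm_u_ge: "n \<in> waves \<Longrightarrow> c0 * norm (v n t) \<le> norm (u n t)"
  using lam01[of n] by (simp add: u_def mult_right_mono)

lemma rhs_integral:
  assumes "n \<in> waves" "t \<in> {0..T}"
  shows "(rhs n has_integral (v n t - v n 0)) {0..t}"
  using ode[of "fst n" t "snd n"] assms
  by (simp add: rhs_def[abs_def] u_def waves_def)

lemma v_continuous: 
  assumes "n \<in> waves"
  shows "continuous_on {0..T} (v n)"
proof -
  have "continuous_on {0..T} (\<lambda>t. integral {0..t} (rhs n))"
    by (intro indefinite_integral_continuous_1) (use rhs_integral[OF assms, of T] T_pos in auto)
  then have "continuous_on {0..T} (\<lambda>t. integral {0..t} (rhs n) + v n 0)"
    by (intro continuous_intros)
  then show ?thesis
  proof (rule continuous_on_eq)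
    show "integral {0..t} (rhs n) + v n 0 = v n t" if "t \<in> {0..T}" for t
      using integral_unique[OF rhs_integral[OF assms that]] by simp
  qed
qed

lemma mass_summable: "t \<in> {0..T} \<Longrightarrow> (\<lambda>n. (norm (v n t))\<^sup>2) summable_on waves"
  by (rule nonneg_bdd_above_summable_on) (auto intro!: bdd_aboveI2[where M = B] mass_bound)

lemma mass_le: "t \<in> {0..T} \<Longrightarrow> mass v t \<le> B"
  unfolding mass_def by (rule infsum_le_finite_sums[OF mass_summable]) (auto intro: mass_bound)

lemma mass_nonneg: "0 \<le> mass v t"
  unfolding mass_def by (rule infsum_nonneg) auto

lemma sum_le_mass: "t \<in> {0..T} \<Longrightarrow> finite F \<Longrightarrow> F \<subseteq> waves \<Longrightarrow> (\<Sum>n\<in>F. (norm (v n t))\<^sup>2) \<le> mass v t"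
  unfolding mass_def by (rule finite_sum_le_infsum[OF mass_summable]) auto

lemma norm_v_le: "t \<in> {0..T} \<Longrightarrow> n \<in> waves \<Longrightarrow> norm (v n t) \<le> sqrt (mass v t)"
  using sum_le_mass[of t "{n}"] by (intro real_le_rsqrt) auto

lemma grad_summable: "t \<in> {0..T} - Z \<Longrightarrow> (\<lambda>n. msq \<alpha> n * (norm (v n t))\<^sup>2) summable_on waves"
  by (rule nonneg_bdd_above_summable_on) (auto intro!: bdd_aboveI2[where M = "Hb t"] Hb simp: msq_nonneg)

lemma sum_le_grad: "t \<in> {0..T} - Z \<Longrightarrow> finite F \<Longrightarrow> F \<subseteq> waves \<Longrightarrow>
    (\<Sum>n\<in>F. msq \<alpha> n * (norm (v n t))\<^sup>2) \<le> H t"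
  unfolding grad_def by (rule finite_sum_le_infsum[OF grad_summable]) (auto simp: msq_nonneg)

lemma grad_nonneg: "0 \<le> H t"
  unfolding grad_def by (rule infsum_nonneg) (auto simp: msq_nonneg)

lemma mass_le_grad:
  assumes "t \<in> {0..T} - Z"
  shows "mass v t \<le> H t"
  unfolding mass_def grad_def
proof (rule infsum_mono[OF mass_summable grad_summable[OF assms]])
  show "(norm (v n t))\<^sup>2 \<le> msq \<alpha> n * (norm (v n t))\<^sup>2" if "n \<in> waves" for n
    using mult_right_mono[OF waves_msq_ge(2)[OF alpha that], of "(norm (v n t))\<^sup>2"] by simp
qed (use assms in auto)

text \<open>For one fixed mode every term is controlled by the mass, with a constant that depends on
  \<open>n\<close>. This is the boundedness that the product rule for primitives requires.\<close>

lemma rhs_bounded: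
  assumes n: "n \<in> waves"
  obtains C where "\<And>t. t \<in> {0..T} - Z \<Longrightarrow> norm (rhs n t) \<le> C"
proof
  fix t assume t: "t \<in> {0..T} - Z"
  have B: "sqrt (mass v t) \<le> sqrt B" using mass_le[of t] t by simp
  have w: "(fst n, snd n - 1) \<in> waves" "(fst n, snd n + 1) \<in> waves" using n by (auto simp: waves_def)
  have v: "norm (v k t) \<le> sqrt B" if "k \<in> waves" for k
    using order_trans[OF norm_v_le[OF _ that, of t] B] t by auto
  have u: "norm (u k t) \<le> sqrt B" if "k \<in> waves" for k
    using norm_u_le[OF that, of t] v[OF that] by simp
  have ct: "0 \<le> c t" "c t \<le> 2" using c_ge[of t] c_le[of t] cmin t by auto
  have "norm (rhs n t) \<le> norm ((\<nu> * msq \<alpha> n) *\<^sub>R v n t)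
     + norm ((c t * \<alpha> * real_of_int (fst n) / 2) *\<^sub>R (u (fst n, snd n - 1) t - u (fst n, snd n + 1) t)) + norm (N n t)"
    unfolding rhs_def by (rule order_trans[OF norm_triangle_ineq4] add_mono order_refl)+ simp_all
  also have "\<dots> \<le> \<nu> * msq \<alpha> n * sqrt B + (\<alpha> * \<bar>real_of_int (fst n)\<bar>) * (sqrt B + sqrt B) + \<theta> * sqrt (msq \<alpha> n) * sqrt B"
  proof (intro add_mono)
    show "norm ((\<nu> * msq \<alpha> n) *\<^sub>R v n t) \<le> \<nu> * msq \<alpha> n * sqrt B"
      using v[OF n] nu by (simp add: abs_mult msq_nonneg mult_left_mono)
    have "norm ((c t * \<alpha> * real_of_int (fst n) / 2) *\<^sub>R (u (fst n, snd n - 1) t - u (fst n, snd n + 1) t))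
      = (c t / 2 * (\<alpha> * \<bar>real_of_int (fst n)\<bar>)) * norm (u (fst n, snd n - 1) t - u (fst n, snd n + 1) t)"
      using ct alpha by (simp add: abs_mult)
    also have "\<dots> \<le> (1 * (\<alpha> * \<bar>real_of_int (fst n)\<bar>)) * (sqrt B + sqrt B)"
      using ct alpha u[OF w(1)] u[OF w(2)]
      by (intro mult_mono order_trans[OF norm_triangle_ineq4] add_mono) auto
    finally show "norm ((c t * \<alpha> * real_of_int (fst n) / 2) *\<^sub>R (u (fst n, snd n - 1) t - u (fst n, snd n + 1) t))
        \<le> (\<alpha> * \<bar>real_of_int (fst n)\<bar>) * (sqrt B + sqrt B)" by simp
    show "norm (N n t) \<le> \<theta> * sqrt (msq \<alpha> n) * sqrt B"
      using order_trans[OF N_pointwise[OF t n]] B theta by (simp add: mult_left_mono msq_nonneg)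
  qed
  finally show "norm (rhs n t) \<le> \<nu> * msq \<alpha> n * sqrt B + (\<alpha> * \<bar>real_of_int (fst n)\<bar>) * (sqrt B + sqrt B) + \<theta> * sqrt (msq \<alpha> n) * sqrt B" .
qed

lemma pair_integral:
  assumes "n \<in> waves" "n' \<in> waves" "0 \<le> a" "a \<le> b" "b \<le> T"
  shows "((\<lambda>t. rhs n t \<bullet> v n' t + v n t \<bullet> rhs n' t) has_integral (v n b \<bullet> v n' b - v n a \<bullet> v n' a)) {a..b}"
proof -
  obtain C1 where C1: "\<And>t. t \<in> {0..T} - Z \<Longrightarrow> norm (rhs n t) \<le> C1" using rhs_bounded[OF assms(1)] by blast
  obtain C2 where C2: "\<And>t. t \<in> {0..T} - Z \<Longrightarrow> norm (rhs n' t) \<le> C2" using rhs_bounded[OF assms(2)] by blast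
  show ?thesis
  proof (rule has_integral_inner_primitives[OF _ _ Z, where C = "max C1 C2"])
    show "(rhs n has_integral (v n t - v n a)) {a..t}" if "t \<in> {a..b}" for t
      by (rule primitive_increment[where a = 0 and b = T]) (use rhs_integral assms that in auto)
    show "(rhs n' has_integral (v n' t - v n' a)) {a..t}" if "t \<in> {a..b}" for t
      by (rule primitive_increment[where a = 0 and b = T]) (use rhs_integral assms that in auto)
  qed (use C1 C2 assms in \<open>auto simp: le_max_iff_disj\<close>)
qed

lemma S_continuous: "continuous_on {0..T} (S M)"
  unfolding S_def using box_waves_subset[of M]
  by (intro continuous_intros v_continuous) auto

text \<open>\<open>H\<close> is, off \<open>Z\<close>, the pointwise limit of the continuous partial
  sums \<open>S M\<close>, which stay below the majorant \<open>Hb\<close>. Dominated convergence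
  gives both its integrability and the limit of the integrals.\<close>

lemma grad_dominated:
  assumes "0 \<le> a" "a \<le> b" "b \<le> T"
  shows "H integrable_on {a..b}" "(\<lambda>M. integral {a..b} (S M)) \<longlonglongrightarrow> integral {a..b} H"
proof -
  define f where "f = (\<lambda>M t. if t \<in> Z then 0 else S M t)"
  define g where "g = (\<lambda>t. if t \<in> Z then 0 else H t)"
  have sub: "{a..b} \<subseteq> {0..T}" using assms by auto
  have Sint: "S M integrable_on {a..b}" for M
    using integrable_continuous_real[OF continuous_on_subset[OF S_continuous sub]] .
  have f: "f M integrable_on {a..b}" for M
    by (rule integrable_spike[OF Sint Z]) (auto simp: f_def)
  have "(\<lambda>t. if t \<in> Z then 0 else Hb t) integrable_on {a..b}"
    by (rule integrable_spike[OF _ Z, of Hb]) (use Hb_int sub in \<open>auto intro: integrable_on_subinterval\<close>)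
  moreover have "norm (f M t) \<le> (if t \<in> Z then 0 else Hb t)" if "t \<in> {a..b}" for M t
    using Hb[of t "box_waves M"] sub that box_waves_subset
    by (auto simp: f_def S_def abs_of_nonneg sum_nonneg msq_nonneg)
  moreover have "(\<lambda>M. f M t) \<longlonglongrightarrow> g t" if "t \<in> {a..b}" for t
    using tendsto_sum_box_waves[OF grad_summable[of t]] that sub
    by (auto simp: f_def g_def S_def grad_def)
  ultimately have dc: "g integrable_on {a..b}" "(\<lambda>M. integral {a..b} (f M)) \<longlonglongrightarrow> integral {a..b} g"
    using dominated_convergence[of f "{a..b}" "\<lambda>t. if t \<in> Z then 0 else Hb t" g] f by auto
  show "H integrable_on {a..b}"
    by (rule integrable_spike[OF dc(1) Z]) (auto simp: g_def)
  have "integral {a..b} (f M) = integral {a..b} (S M)" for M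
    by (rule integral_spike[OF Z]) (auto simp: f_def)
  moreover have "integral {a..b} g = integral {a..b} H"
    by (rule integral_spike[OF Z]) (auto simp: g_def)
  ultimately show "(\<lambda>M. integral {a..b} (S M)) \<longlonglongrightarrow> integral {a..b} H" using dc(2) by simp
qed

text \<open>By symmetry of the inner product, the summand is
  \<open>w m \<bullet> w (m - 1) - w (m + 1) \<bullet> w m\<close>. This is conservation of energy
  by the shear: only the ends of a truncated row exchange energy with the rest.\<close>

lemma telescope:
  fixes w :: "int \<Rightarrow> complex"
  shows "(\<Sum>m\<in>{- int M..int M}. w m \<bullet> (w (m - 1) - w (m + 1)))
     = w (- int M) \<bullet> w (- int M - 1) - w (int M) \<bullet> w (int M + 1)"
proof -
  define a where "a m = w m \<bullet> w (m - 1)" for m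
  have "(\<Sum>m\<in>{- int M..int M}. a m - a (m + 1)) = a (- int M) - a (int M + 1)"
  proof (induction M)
    case (Suc M)
    have e: "{- int (Suc M)..int (Suc M)} = insert (int M + 1) (insert (- int M - 1) {- int M..int M})"
      by auto
    show ?case
      unfolding e using Suc by (simp add: algebra_simps minus_diff_commute)
  qed simp
  then show ?thesis
    by (simp add: a_def inner_diff_right inner_commute[of "w (_ + 1)"])
qed

text \<open>The weight \<open>lam \<alpha> n\<close> turns \<open>v n\<close> into
  \<open>u n\<close> in the shear term, which then telescopes in \<open>m\<close>. What remains at
  the ends of the rows has a coefficient of at most \<open>2 * \<alpha> * \<bar>k\<bar>\<close>, and
  \<open>\<alpha> * \<bar>k\<bar> \<le> msq\<close>, so the dissipation in the shell between two
  boxes dominates it.\<close>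

lemma truncated_rate:
  assumes t: "t \<in> {0..T} - Z" and M: "M \<ge> 1"
  shows "(\<Sum>n\<in>box_waves M. lam \<alpha> n * (2 * (rhs n t \<bullet> v n t)))
    \<le> - 2 * \<nu> * c0 * S M t + (S (M + 1) t - S (M - 1) t) + 2 * \<theta> * H t"
proof -
  have W: "n \<in> waves" if "n \<in> box_waves M" for n using that box_waves_subset by auto
  have ct: "0 \<le> c t" "c t \<le> 2" using c_ge[of t] c_le[of t] cmin t by auto
  define tr where "tr n = c t * \<alpha> * real_of_int (fst n) * (u n t \<bullet> (u (fst n, snd n - 1) t - u (fst n, snd n + 1) t))" for n
  have "lam \<alpha> n * (2 * (rhs n t \<bullet> v n t)) =
      - 2 * \<nu> * (lam \<alpha> n * (msq \<alpha> n * (norm (v n t))\<^sup>2)) - tr n - 2 * lam \<alpha> n * (N n t \<bullet> v n t)" for n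
  proof -
    define d where "d = u (fst n, snd n - 1) t - u (fst n, snd n + 1) t"
    have "rhs n t \<bullet> v n t = - (\<nu> * msq \<alpha> n) * (norm (v n t))\<^sup>2
        - (c t * \<alpha> * real_of_int (fst n) / 2) * (v n t \<bullet> d) - N n t \<bullet> v n t"
      unfolding rhs_def d_def[symmetric] inner_diff_left inner_minus_left inner_scaleR_left
        power2_norm_eq_inner inner_commute[of d] by simp
    moreover have "tr n = c t * \<alpha> * real_of_int (fst n) * (lam \<alpha> n * (v n t \<bullet> d))"
      by (simp add: tr_def d_def u_def[of n])
    ultimately show ?thesis by (simp only:) (simp add: algebra_simps)
  qed
  also have "\<dots> n \<le> - 2 * \<nu> * (c0 * (msq \<alpha> n * (norm (v n t))\<^sup>2)) - tr n + 2 * (norm (v n t) * norm (N n t))"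
    if n: "n \<in> box_waves M" for n
  proof -
    have "c0 * (msq \<alpha> n * (norm (v n t))\<^sup>2) \<le> lam \<alpha> n * (msq \<alpha> n * (norm (v n t))\<^sup>2)"
      using lam01[OF W[OF n]] by (intro mult_right_mono) (auto simp: msq_nonneg)
    moreover have "- (lam \<alpha> n * (N n t \<bullet> v n t)) \<le> lam \<alpha> n * \<bar>N n t \<bullet> v n t\<bar>"
      using lam01[OF W[OF n]] by (metis abs_ge_minus_self less_eq_real_def mult_left_mono mult_minus_right)
    moreover have "lam \<alpha> n * \<bar>N n t \<bullet> v n t\<bar> \<le> 1 * (norm (v n t) * norm (N n t))"
      using lam01[OF W[OF n]] Cauchy_Schwarz_ineq2[of "N n t" "v n t"] by (intro mult_mono) (auto simp: mult.commute)
    moreover have "2 * \<nu> * (c0 * (msq \<alpha> n * (norm (v n t))\<^sup>2)) \<le> 2 * \<nu> * (lam \<alpha> n * (msq \<alpha> n * (norm (v n t))\<^sup>2))"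
      using calculation(1) nu by (intro mult_left_mono) auto
    ultimately show ?thesis by linarith
  qed
  finally have "(\<Sum>n\<in>box_waves M. lam \<alpha> n * (2 * (rhs n t \<bullet> v n t)))
     \<le> (\<Sum>n\<in>box_waves M. - 2 * \<nu> * (c0 * (msq \<alpha> n * (norm (v n t))\<^sup>2)) - tr n + 2 * (norm (v n t) * norm (N n t)))"
    by (intro sum_mono)
  also have "\<dots> = - 2 * \<nu> * c0 * S M t - (\<Sum>n\<in>box_waves M. tr n) + 2 * (\<Sum>n\<in>box_waves M. norm (v n t) * norm (N n t))"
    by (simp add: sum.distrib sum_subtractf S_def sum_distrib_left mult.assoc sum_negf)
  finally have "(\<Sum>n\<in>box_waves M. lam \<alpha> n * (2 * (rhs n t \<bullet> v n t))) \<le> \<dots>" .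
  moreover have "2 * (\<Sum>n\<in>box_waves M. norm (v n t) * norm (N n t)) \<le> 2 * \<theta> * H t"
    using N_pairing[OF t _ box_waves_subset[of M]] by simp
  moreover have "- (\<Sum>n\<in>box_waves M. tr n) \<le> S (M + 1) t - S (M - 1) t"
  proof -
    define K where "K = {- int M..int M} - {0}"
    \<comment> \<open>The last modes of a row and their outer neighbours; for
      \<open>k \<in> K\<close> they lie in the shell between the boxes \<open>M - 1\<close> and
      \<open>M + 1\<close>. Since \<open>M \<ge> 1\<close>, the four indices are distinct and a sum
      over \<open>X\<close> has four terms.\<close>
    define X where "X = {- int M - 1, - int M, int M, int M + 1}"
    define q where "q n = msq \<alpha> n * (norm (v n t))\<^sup>2" for n
    have "(\<Sum>n\<in>box_waves M. tr n) = (\<Sum>k\<in>K. \<Sum>m\<in>{- int M..int M}. tr (k, m))"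
      unfolding box_waves_def K_def by (simp add: sum.cartesian_product)
    also have "\<dots> = (\<Sum>k\<in>K. c t * \<alpha> * real_of_int k * (u (k, - int M) t \<bullet> u (k, - int M - 1) t - u (k, int M) t \<bullet> u (k, int M + 1) t))"
      unfolding tr_def using telescope[of "\<lambda>m. u (_, m) t" M] by (simp flip: sum_distrib_left)
    finally have "- (\<Sum>n\<in>box_waves M. tr n) = (\<Sum>k\<in>K. - (c t * \<alpha> * real_of_int k * (u (k, - int M) t \<bullet> u (k, - int M - 1) t - u (k, int M) t \<bullet> u (k, int M + 1) t)))"
      by (simp add: sum_negf)
    also have "\<dots> \<le> (\<Sum>k\<in>K. \<Sum>m\<in>X. q (k, m))"
    proof (rule sum_mono)
      fix k assume k: "k \<in> K"
      then have k0: "k \<noteq> 0" by (simp add: K_def)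
      then have w: "(k, m) \<in> waves" for m by (simp add: waves_def)
      have ip: "\<bar>u (k, m) t \<bullet> u (k, m') t\<bar> \<le> (norm (v (k, m) t))\<^sup>2 / 2 + (norm (v (k, m') t))\<^sup>2 / 2" for m m'
      proof -
        have "\<bar>u (k, m) t \<bullet> u (k, m') t\<bar> \<le> norm (u (k, m) t) * norm (u (k, m') t)"
          by (rule Cauchy_Schwarz_ineq2)
        also have "\<dots> \<le> norm (v (k, m) t) * norm (v (k, m') t)"
          by (intro mult_mono norm_u_le w) auto
        also have "\<dots> \<le> (norm (v (k, m) t))\<^sup>2 / 2 + (norm (v (k, m') t))\<^sup>2 / 2"
          using sum_squares_bound[of "norm (v (k, m) t)" "norm (v (k, m') t)"] by simp
        finally show ?thesis .
      qed
      have "- (c t * \<alpha> * real_of_int k * (u (k, - int M) t \<bullet> u (k, - int M - 1) t - u (k, int M) t \<bullet> u (k, int M + 1) t))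
         \<le> \<bar>c t * \<alpha> * real_of_int k * (u (k, - int M) t \<bullet> u (k, - int M - 1) t - u (k, int M) t \<bullet> u (k, int M + 1) t)\<bar>"
        by (rule abs_ge_minus_self)
      also have "\<dots> = c t * (\<alpha> * \<bar>real_of_int k\<bar>) * \<bar>u (k, - int M) t \<bullet> u (k, - int M - 1) t - u (k, int M) t \<bullet> u (k, int M + 1) t\<bar>"
        using ct alpha by (simp add: abs_mult)
      also have "\<dots> \<le> 2 * (\<alpha> * \<bar>real_of_int k\<bar>) * (\<Sum>m\<in>X. (norm (v (k, m) t))\<^sup>2 / 2)"
      proof (intro mult_mono)
        have "\<bar>u (k, - int M) t \<bullet> u (k, - int M - 1) t - u (k, int M) t \<bullet> u (k, int M + 1) t\<bar>
          \<le> (norm (v (k, - int M) t))\<^sup>2 / 2 + (norm (v (k, - int M - 1) t))\<^sup>2 / 2 +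
            ((norm (v (k, int M) t))\<^sup>2 / 2 + (norm (v (k, int M + 1) t))\<^sup>2 / 2)"
          using ip[of "- int M" "- int M - 1"] ip[of "int M" "int M + 1"] by linarith
        then show "\<bar>u (k, - int M) t \<bullet> u (k, - int M - 1) t - u (k, int M) t \<bullet> u (k, int M + 1) t\<bar>
          \<le> (\<Sum>m\<in>X. (norm (v (k, m) t))\<^sup>2 / 2)"
          using M by (simp add: X_def)
      qed (use ct alpha in auto)
      also have "\<dots> = (\<Sum>m\<in>X. (\<alpha> * \<bar>real_of_int k\<bar>) * (norm (v (k, m) t))\<^sup>2)"
        by (simp add: sum_distrib_left mult.assoc)
      also have "\<dots> \<le> (\<Sum>m\<in>X. q (k, m))"
        unfolding q_def using waves_msq_ge(3)[OF alpha w] by (intro sum_mono mult_right_mono) auto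
      finally show "- (c t * \<alpha> * real_of_int k * (u (k, - int M) t \<bullet> u (k, - int M - 1) t - u (k, int M) t \<bullet> u (k, int M + 1) t))
        \<le> (\<Sum>m\<in>X. q (k, m))" .
    qed
    also have "\<dots> = sum q (K \<times> X)" by (simp add: sum.cartesian_product)
    also have "\<dots> \<le> sum q (box_waves (M + 1) - box_waves (M - 1))"
    proof (rule sum_mono2)
      show "K \<times> X \<subseteq> box_waves (M + 1) - box_waves (M - 1)"
        using M by (auto simp: K_def X_def box_waves_def)
    qed (auto simp: q_def msq_nonneg)
    also have "\<dots> = S (M + 1) t - S (M - 1) t"
      unfolding S_def q_def[symmetric] by (intro sum_diff box_waves_mono) auto
    finally show ?thesis .
  qed
  ultimately show ?thesis by linarith
qed

lemma E_summable: "t \<in> {0..T} \<Longrightarrow> (\<lambda>n. lam \<alpha> n * (norm (v n t))\<^sup>2) summable_on waves"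
  by (rule summable_on_comparison_test[OF mass_summable])
    (auto intro!: lam_mult_le lam_nonneg mult_nonneg_nonneg)

lemma E_bounds:
  assumes "t \<in> {0..T}"
  shows "c0 * mass v t \<le> E t" "E t \<le> mass v t"
proof -
  show "E t \<le> mass v t" unfolding E_def mass_def
    by (rule infsum_mono[OF E_summable mass_summable])
      (use assms in \<open>auto intro!: lam_mult_le\<close>)
  have "c0 * mass v t = (\<Sum>\<^sub>\<infinity>n\<in>waves. c0 * (norm (v n t))\<^sup>2)"
    unfolding mass_def by (rule infsum_cmult_right'[symmetric])
  also have "\<dots> \<le> E t" unfolding E_def
    by (rule infsum_mono[OF summable_on_cmult_right[OF mass_summable] E_summable])
      (use assms in \<open>simp_all add: lam01 mult_right_mono\<close>)
  finally show "c0 * mass v t \<le> E t" .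
qed

text \<open>The truncated balance is integrated in time before the box grows. The shell term becomes
  \<open>I (M + 1) - I (M - 1)\<close>, a difference of two sequences with the same finite limit, so
  no energy enters from infinity.\<close>

lemma energy_inequality:
  assumes ab: "0 \<le> a" "a \<le> b" "b \<le> T"
  shows "E b - E a \<le> (- 2 * \<nu> * c0 + 2 * \<theta>) * integral {a..b} H"
proof -
  define EN where "EN M t = (\<Sum>n\<in>box_waves M. lam \<alpha> n * (norm (v n t))\<^sup>2)" for M t
  define I where "I M = integral {a..b} (S M)" for M
  have Sint: "(S M has_integral I M) {a..b}" for M
    unfolding I_def by (intro integrable_integral integrable_continuous_real continuous_on_subset[OF S_continuous])
      (use ab in auto)
  have Hint: "(H has_integral integral {a..b} H) {a..b}"
    using grad_dominated(1)[OF ab] by auto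
  have le: "EN M b - EN M a \<le> - 2 * \<nu> * c0 * I M + (I (M + 1) - I (M - 1)) + 2 * \<theta> * integral {a..b} H"
    if M: "M \<ge> 1" for M
  proof -
    have "((\<lambda>t. \<Sum>n\<in>box_waves M. lam \<alpha> n * (2 * (rhs n t \<bullet> v n t))) has_integral
       (\<Sum>n\<in>box_waves M. lam \<alpha> n * (v n b \<bullet> v n b - v n a \<bullet> v n a))) {a..b}"
    proof (intro has_integral_sum has_integral_mult_right)
      fix n assume "n \<in> box_waves M"
      then have "n \<in> waves" using box_waves_subset by auto
      from pair_integral[OF this this ab]
      show "((\<lambda>t. 2 * (rhs n t \<bullet> v n t)) has_integral v n b \<bullet> v n b - v n a \<bullet> v n a) {a..b}"
        by (simp add: inner_commute)
    qed simp
    then have "((\<lambda>t. \<Sum>n\<in>box_waves M. lam \<alpha> n * (2 * (rhs n t \<bullet> v n t))) has_integral (EN M b - EN M a)) {a..b}"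
      by (simp add: EN_def power2_norm_eq_inner right_diff_distrib sum_subtractf)
    then have 1: "((\<lambda>t. if t \<in> Z then 0 else \<Sum>n\<in>box_waves M. lam \<alpha> n * (2 * (rhs n t \<bullet> v n t))) has_integral (EN M b - EN M a)) {a..b}"
      by (rule has_integral_spike[OF Z, rotated]) auto
    have "((\<lambda>t. - 2 * \<nu> * c0 * S M t + (S (M + 1) t - S (M - 1) t) + 2 * \<theta> * H t) has_integral
       (- 2 * \<nu> * c0 * I M + (I (M + 1) - I (M - 1)) + 2 * \<theta> * integral {a..b} H)) {a..b}"
      by (intro has_integral_add has_integral_diff has_integral_mult_right Sint Hint)
    then have 2: "((\<lambda>t. if t \<in> Z then 0 else - 2 * \<nu> * c0 * S M t + (S (M + 1) t - S (M - 1) t) + 2 * \<theta> * H t) has_integral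
       (- 2 * \<nu> * c0 * I M + (I (M + 1) - I (M - 1)) + 2 * \<theta> * integral {a..b} H)) {a..b}"
      by (rule has_integral_spike[OF Z, rotated]) auto
    show ?thesis
      by (rule has_integral_le[OF 1 2]) (use truncated_rate[OF _ M] ab in auto)
  qed
  have I: "I \<longlonglongrightarrow> integral {a..b} H" unfolding I_def using grad_dominated(2)[OF ab] .
  have EN: "(\<lambda>M. EN M t) \<longlonglongrightarrow> E t" if "t \<in> {0..T}" for t
    unfolding EN_def E_def using tendsto_sum_box_waves[OF E_summable[OF that]] .
  have I1: "(\<lambda>M. I (M + 1)) \<longlonglongrightarrow> integral {a..b} H"
    using LIMSEQ_ignore_initial_segment[OF I, of 1] .
  have "(\<lambda>M. I (M + 1 - 1)) \<longlonglongrightarrow> integral {a..b} H" using I by simp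
  then have I2: "(\<lambda>M. I (M - 1)) \<longlonglongrightarrow> integral {a..b} H"
    by (rule LIMSEQ_offset[where k = 1])
  have "E b - E a \<le> - 2 * \<nu> * c0 * integral {a..b} H + (integral {a..b} H - integral {a..b} H) + 2 * \<theta> * integral {a..b} H"
  proof (rule LIMSEQ_le)
    show "(\<lambda>M. EN M b - EN M a) \<longlonglongrightarrow> E b - E a" by (intro tendsto_diff EN) (use ab in auto)
    show "(\<lambda>M. - 2 * \<nu> * c0 * I M + (I (M + 1) - I (M - 1)) + 2 * \<theta> * integral {a..b} H)
      \<longlonglongrightarrow> - 2 * \<nu> * c0 * integral {a..b} H + (integral {a..b} H - integral {a..b} H) + 2 * \<theta> * integral {a..b} H"
      by (intro tendsto_intros I I1 I2)
  qed (use le in blast)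
  then show ?thesis by (simp add: algebra_simps)
qed

end

section \<open>Time integral of the defects and decay of the mass\<close>

context shear_modes
begin

definition rows :: "nat \<Rightarrow> int set" where "rows M = {- int M..int M} - {0}"

definition defect :: "nat \<Rightarrow> nat \<Rightarrow> real \<Rightarrow> real" where
  "defect M L t = (\<Sum>k\<in>rows M. \<Sum>m\<in>{m. \<bar>m\<bar> < int L}. (norm (u (k, m - 1) t + u (k, m + 1) t))\<^sup>2)"

lemma finite_rows [simp]: "finite (rows M)" by (simp add: rows_def)

lemma rows_waves: "k \<in> rows M \<Longrightarrow> (k, m) \<in> waves" by (auto simp: rows_def waves_def)

text \<open>The difference \<open>msq \<alpha> (k, m + 1) - msq \<alpha> (k, m - 1)\<close> is
  \<open>4 * m\<close>, so \<open>lam\<close> increases with \<open>\<bar>m\<bar>\<close>: the sign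
  that makes the diagonal part of the virial favourable.\<close>

lemma lam_mono:
  assumes "k \<noteq> 0"
  shows "0 \<le> real_of_int m * (lam \<alpha> (k, m + 1) - lam \<alpha> (k, m - 1))"
proof -
  have pos: "0 < msq \<alpha> (k, j)" for j
    using waves_msq_ge(2)[OF alpha, of "(k, j)"] assms by (simp add: waves_def)
  have eq: "msq \<alpha> (k, m + 1) - msq \<alpha> (k, m - 1) = 4 * real_of_int m"
    by (simp add: msq_def power2_eq_square algebra_simps)
  show ?thesis
  proof (cases "m \<ge> 0")
    case True
    then have "1 / msq \<alpha> (k, m + 1) \<le> 1 / msq \<alpha> (k, m - 1)"
      using eq pos by (intro divide_left_mono mult_pos_pos) auto
    then show ?thesis using True by (intro mult_nonneg_nonneg) (auto simp: lam_def)
  next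
    case False
    then have "msq \<alpha> (k, m + 1) \<le> msq \<alpha> (k, m - 1)" using eq by simp
    then have "1 / msq \<alpha> (k, m - 1) \<le> 1 / msq \<alpha> (k, m + 1)"
      using pos by (intro divide_left_mono mult_pos_pos) auto
    then show ?thesis using False by (intro mult_nonpos_nonpos) (auto simp: lam_def)
  qed
qed

lemma msq_far:
  assumes "int L - 1 \<le> \<bar>m\<bar>" "L \<ge> 1"
  shows "(real L - 1)\<^sup>2 \<le> msq \<alpha> (k, m)"
proof -
  have "(real L - 1)\<^sup>2 \<le> \<bar>real_of_int m\<bar>\<^sup>2"
    using assms by (intro power_mono) linarith+
  then show ?thesis by (simp add: msq_def add_increasing)
qed

text \<open>\<open>L \<le> 2 * (L - 1) \<le> (L - 1)\<^sup>2\<close>, where the second inequality is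
  the reason for \<open>L \<ge> 3\<close>.\<close>

lemma lam_far:
  assumes "k \<noteq> 0" "L \<ge> 3" "int L - 1 \<le> \<bar>m\<bar>"
  shows "real L * (1 - lam \<alpha> (k, m)) \<le> 1"
proof -
  have L: "real L \<ge> 3" using assms by simp
  have "real L \<le> 2 * (real L - 1)" using L by simp
  also have "\<dots> \<le> (real L - 1) * (real L - 1)" using L by (intro mult_right_mono) auto
  also have "\<dots> \<le> msq \<alpha> (k, m)" using msq_far[of L m k] assms by (simp add: power2_eq_square)
  finally have "real L \<le> msq \<alpha> (k, m)" .
  then show ?thesis using L by (simp add: lam_def)
qed

lemma rows_sum_le_grad:
  assumes t: "t \<in> {0..T} - Z" and A: "finite A"
  shows "(\<Sum>k\<in>rows M. \<Sum>m\<in>A. msq \<alpha> (k, m + j) * (norm (v (k, m + j) t))\<^sup>2) \<le> H t"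
proof -
  define g where "g n = msq \<alpha> n * (norm (v n t))\<^sup>2" for n
  have "(\<Sum>k\<in>rows M. \<Sum>m\<in>A. g (k, m + j)) = (\<Sum>k\<in>rows M. \<Sum>m\<in>(\<lambda>m. m + j) ` A. g (k, m))"
    by (subst sum.reindex) (auto simp: inj_on_def)
  also have "\<dots> = sum g (rows M \<times> (\<lambda>m. m + j) ` A)" by (simp add: sum.cartesian_product)
  also have "\<dots> \<le> H t" unfolding g_def using A
    by (intro sum_le_grad[OF t]) (auto simp: rows_waves)
  finally show ?thesis by (simp add: g_def)
qed

lemma rows_sum_le_mass:
  assumes t: "t \<in> {0..T}" and A: "finite A"
  shows "(\<Sum>k\<in>rows M. \<Sum>m\<in>A. (norm (v (k, m + j) t))\<^sup>2) \<le> mass v t"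
proof -
  define g where "g n = (norm (v n t))\<^sup>2" for n
  have "(\<Sum>k\<in>rows M. \<Sum>m\<in>A. g (k, m + j)) = (\<Sum>k\<in>rows M. \<Sum>m\<in>(\<lambda>m. m + j) ` A. g (k, m))"
    by (subst sum.reindex) (auto simp: inj_on_def)
  also have "\<dots> = sum g (rows M \<times> (\<lambda>m. m + j) ` A)" by (simp add: sum.cartesian_product)
  also have "\<dots> \<le> mass v t" unfolding g_def using A
    by (intro sum_le_mass[OF t]) (auto simp: rows_waves)
  finally show ?thesis by (simp add: g_def)
qed

lemma norm_u_squared_le: "n \<in> waves \<Longrightarrow> (norm (u n t))\<^sup>2 \<le> (norm (v n t))\<^sup>2"
  by (intro power_mono norm_u_le) auto

text \<open>The action of the shear on the virial of row \<open>k\<close>, freed of its factor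
  \<open>- c t / 2\<close>. The range \<open>2 * L + 5\<close> goes far enough past the support of
  the weight for all shifted sums to have no boundary terms.\<close>

definition flux :: "nat \<Rightarrow> int \<Rightarrow> real \<Rightarrow> real" where
  "flux L k t = (\<Sum>m\<in>{-(2 * int L + 5)..2 * int L + 5}. virial_weight L m *
      (lam \<alpha> (k, m) * ((u (k, m - 1) t - u (k, m + 1) t) \<bullet> u (k, m + 1) t)
       + lam \<alpha> (k, m + 1) * (u (k, m) t \<bullet> (u (k, m) t - u (k, m + 2) t))))"

text \<open>The terms without a sign involve only indices \<open>j\<close> with
  \<open>\<bar>j\<bar> \<ge> L - 1\<close>, where \<open>msq\<close> is at least
  \<open>(L - 1)\<^sup>2\<close>, so the dissipation pays for them. The 15 is 5 for each of three
  neighbouring modes.\<close>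

lemma flux_lower_bound:
  assumes t: "t \<in> {0..T} - Z" and L: "L \<ge> 3"
  shows "c0 / 2 * defect M L t - 15 / (real L - 1)\<^sup>2 * H t \<le> (\<Sum>k\<in>rows M. flux L k t)"
proof -
  define R where "R = 2 * int L + 5"
  define J where "J = {m\<in>{-R..R}. int L \<le> \<bar>m\<bar>}"
  have J: "finite J" by (auto simp: J_def intro: finite_subset[of _ "{-R..R}"])
  have L1: "0 < (real L - 1)\<^sup>2" using L by simp
  define Y where "Y j = (\<Sum>k\<in>rows M. \<Sum>m\<in>J. (norm (u (k, m + j) t))\<^sup>2)" for j
  have Y: "Y j \<le> H t / (real L - 1)\<^sup>2" if j: "j \<in> {-1, 0, 1}" for j
  proof -
    have "(real L - 1)\<^sup>2 * Y j \<le> (\<Sum>k\<in>rows M. \<Sum>m\<in>J. msq \<alpha> (k, m + j) * (norm (v (k, m + j) t))\<^sup>2)"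
      unfolding Y_def sum_distrib_left
    proof (intro sum_mono mult_mono norm_u_squared_le rows_waves)
      show "(real L - 1)\<^sup>2 \<le> msq \<alpha> (k, m + j)" if "m \<in> J" for k m
        using that j L by (intro msq_far) (auto simp: J_def)
    qed (auto simp: msq_nonneg)
    also have "\<dots> \<le> H t" by (rule rows_sum_le_grad[OF t J])
    finally show ?thesis using L1 by (simp add: field_simps)
  qed
  have "c0 / 2 * defect M L t - 5 * (Y (-1) + Y 0 + Y 1)
     = (\<Sum>k\<in>rows M. c0 / 2 * (\<Sum>m\<in>{m. \<bar>m\<bar> < int L}. (norm (u (k, m - 1) t + u (k, m + 1) t))\<^sup>2)
         - 5 * (\<Sum>m\<in>J. (norm (u (k, m - 1) t))\<^sup>2 + (norm (u (k, m) t))\<^sup>2 + (norm (u (k, m + 1) t))\<^sup>2))"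
    by (simp add: defect_def Y_def sum_subtractf sum.distrib sum_distrib_left algebra_simps)
  also have "\<dots> \<le> (\<Sum>k\<in>rows M. flux L k t)"
    unfolding flux_def J_def R_def
  proof (intro sum_mono virial_lower_bound[where lam = "\<lambda>m. lam \<alpha> (_, m)" and u = "\<lambda>m. u (_, m) t", OF L refl])
    fix k m assume k: "k \<in> rows M"
    then have "k \<noteq> 0" by (simp add: rows_def)
    then show "0 \<le> real_of_int m * (lam \<alpha> (k, m + 1) - lam \<alpha> (k, m - 1))" by (rule lam_mono)
    show "c0 \<le> lam \<alpha> (k, m)" "lam \<alpha> (k, m) \<le> 1" using lam01[OF rows_waves[OF k]] by auto
    show "real L * (1 - lam \<alpha> (k, m)) \<le> 1" if "int L - 1 \<le> \<bar>m\<bar>"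
      using lam_far[OF \<open>k \<noteq> 0\<close> L that] .
  qed (use c0 in auto)
  finally have "c0 / 2 * defect M L t - 5 * (Y (-1) + Y 0 + Y 1) \<le> (\<Sum>k\<in>rows M. flux L k t)" .
  moreover have "5 * (Y (-1) + Y 0 + Y 1) \<le> 15 / (real L - 1)\<^sup>2 * H t"
    using Y[of "-1"] Y[of 0] Y[of 1] by simp
  ultimately show ?thesis by linarith
qed

text \<open>The shear carries the factor \<open>\<alpha> * k\<close>; dividing by it lets every row
  contribute with the same sign and at the same rate, whichever the sign of \<open>k\<close>. Off
  the axis the divisor is at least 1 in modulus, so it does not spoil any bound.\<close>

definition virial :: "nat \<Rightarrow> nat \<Rightarrow> real \<Rightarrow> real" where
  "virial M L t = (\<Sum>k\<in>rows M. \<Sum>m\<in>{-(2 * int L + 5)..2 * int L + 5}.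
     virial_weight L m / (\<alpha> * real_of_int k) * (u (k, m) t \<bullet> u (k, m + 1) t))"

definition virial_rate :: "nat \<Rightarrow> nat \<Rightarrow> real \<Rightarrow> real" where
  "virial_rate M L t = (\<Sum>k\<in>rows M. \<Sum>m\<in>{-(2 * int L + 5)..2 * int L + 5}.
     virial_weight L m / (\<alpha> * real_of_int k) * (lam \<alpha> (k, m) * lam \<alpha> (k, m + 1) *
       (rhs (k, m) t \<bullet> v (k, m + 1) t + v (k, m) t \<bullet> rhs (k, m + 1) t)))"

lemma virial_integral: "(virial_rate M L has_integral (virial M L T - virial M L 0)) {0..T}"
proof -
  have "(virial_rate M L has_integral (\<Sum>k\<in>rows M. \<Sum>m\<in>{-(2 * int L + 5)..2 * int L + 5}.
     virial_weight L m / (\<alpha> * real_of_int k) * (lam \<alpha> (k, m) * lam \<alpha> (k, m + 1) *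
       (v (k, m) T \<bullet> v (k, m + 1) T - v (k, m) 0 \<bullet> v (k, m + 1) 0)))) {0..T}"
    unfolding virial_rate_def using T_pos
    by (intro has_integral_sum has_integral_mult_right pair_integral rows_waves) auto
  then show ?thesis
    by (simp add: virial_def u_def right_diff_distrib sum_subtractf mult.assoc mult.left_commute)
qed

lemma weight_over_wavenumber:
  assumes "k \<in> rows M"
  shows "\<bar>virial_weight L m / (\<alpha> * real_of_int k)\<bar> \<le> real L + 1/2"
proof -
  have "1 \<le> \<alpha> * \<bar>real_of_int k\<bar>"
    using waves_msq_ge(4)[OF alpha rows_waves[OF assms, of 0]] by simp
  then have "\<bar>virial_weight L m\<bar> / (\<alpha> * \<bar>real_of_int k\<bar>) \<le> \<bar>virial_weight L m\<bar> / 1"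
    by (intro divide_left_mono) auto
  then show ?thesis using virial_weight_bound[of L m] alpha by (simp add: abs_divide abs_mult)
qed

lemma virial_bound:
  assumes t: "t \<in> {0..T}"
  shows "\<bar>virial M L t\<bar> \<le> (real L + 1/2) * mass v t"
proof -
  define I where "I = {-(2 * int L + 5)..2 * int L + 5}"
  have "\<bar>virial M L t\<bar> \<le> (\<Sum>k\<in>rows M. \<Sum>m\<in>I. (real L + 1/2) * ((norm (v (k, m) t))\<^sup>2 / 2 + (norm (v (k, m + 1) t))\<^sup>2 / 2))"
    unfolding virial_def I_def[symmetric]
  proof (intro order_trans[OF sum_abs] sum_mono)
    fix k m assume k: "k \<in> rows M"
    have "\<bar>u (k, m) t \<bullet> u (k, m + 1) t\<bar> \<le> norm (u (k, m) t) * norm (u (k, m + 1) t)"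
      by (rule Cauchy_Schwarz_ineq2)
    also have "\<dots> \<le> norm (v (k, m) t) * norm (v (k, m + 1) t)"
      by (intro mult_mono norm_u_le rows_waves[OF k]) auto
    also have "\<dots> \<le> (norm (v (k, m) t))\<^sup>2 / 2 + (norm (v (k, m + 1) t))\<^sup>2 / 2"
      using sum_squares_bound[of "norm (v (k, m) t)" "norm (v (k, m + 1) t)"] by simp
    finally show "\<bar>virial_weight L m / (\<alpha> * real_of_int k) * (u (k, m) t \<bullet> u (k, m + 1) t)\<bar>
      \<le> (real L + 1/2) * ((norm (v (k, m) t))\<^sup>2 / 2 + (norm (v (k, m + 1) t))\<^sup>2 / 2)"
      unfolding abs_mult by (intro mult_mono weight_over_wavenumber[OF k]) auto
  qed
  also have "\<dots> = (real L + 1/2) * ((\<Sum>k\<in>rows M. \<Sum>m\<in>I. (norm (v (k, m + 0) t))\<^sup>2) / 2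
      + (\<Sum>k\<in>rows M. \<Sum>m\<in>I. (norm (v (k, m + 1) t))\<^sup>2) / 2)"
    by (simp add: sum.distrib sum_divide_distrib flip: sum_distrib_left)
  also have "\<dots> \<le> (real L + 1/2) * (mass v t / 2 + mass v t / 2)"
    by (intro mult_left_mono add_mono divide_right_mono rows_sum_le_mass[OF t]) (auto simp: I_def)
  finally show ?thesis by simp
qed

text \<open>Depends on \<open>\<alpha>\<close> and the cut-offs \<open>M\<close> and
  \<open>L\<close> only. It may be huge, but it enters with the factor \<open>\<theta>\<close>,
  which is at most of order \<open>\<nu>\<close> and becomes small after \<open>M\<close> and
  \<open>L\<close> have been fixed.\<close>

definition noise_const :: "nat \<Rightarrow> nat \<Rightarrow> real" where
  "noise_const M L = (real L + 1/2) * (\<Sum>k\<in>rows M. \<Sum>m\<in>{-(2 * int L + 5)..2 * int L + 5}.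
     sqrt (msq \<alpha> (k, m)) + sqrt (msq \<alpha> (k, m + 1)))"

text \<open>A shift by at most one raises the square of the second component to at most
  \<open>2 * m'\<^sup>2 + 2\<close>, and off the axis the 2 is absorbed by
  \<open>(\<alpha> * k)\<^sup>2 \<ge> 1\<close>.\<close>

lemma msq_neighbour:
  assumes "k \<noteq> 0" "\<bar>m - m'\<bar> \<le> 1"
  shows "msq \<alpha> (k, m) \<le> 4 * msq \<alpha> (k, m')"
proof -
  have "1 \<le> \<alpha> * \<bar>real_of_int k\<bar>"
    using waves_msq_ge(4)[OF alpha, of "(k, 0)"] assms by (simp add: waves_def)
  then have "1\<^sup>2 \<le> (\<alpha> * \<bar>real_of_int k\<bar>)\<^sup>2" by (intro power_mono) auto
  then have 1: "1 \<le> (\<alpha> * real_of_int k)\<^sup>2" by (simp add: power_mult_distrib)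
  have "(real_of_int m - real_of_int m')\<^sup>2 \<le> 1"
    using assms(2) by (simp add: abs_square_le_1 flip: of_int_diff)
  moreover have "(real_of_int m)\<^sup>2 \<le> 2 * (real_of_int m')\<^sup>2 + 2 * (real_of_int m - real_of_int m')\<^sup>2"
    using zero_le_power2[of "real_of_int m - 2 * real_of_int m'"]
    by (simp add: power2_eq_square algebra_simps)
  moreover have "K + a \<le> 4 * K + 4 * b" if "D \<le> 1" "a \<le> 2 * b + 2 * D" "1 \<le> K" "0 \<le> b" for K a b D :: real
    using that by linarith
  ultimately show ?thesis using 1 unfolding msq_def fst_conv snd_conv distrib_left[of 4] by (meson zero_le_power2)
qed

text \<open>The shear part of the product rule is exactly \<open>- (c t / 2)\<close> times the flux.
  The viscous part costs \<open>msq\<close> of two neighbouring modes and goes into \<open>H\<close>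
  with a factor of order \<open>\<nu> * L\<close>. The perturbation is bounded mode by mode, which
  is affordable because finitely many pairs enter.\<close>

lemma virial_rate_bound:
  assumes t: "t \<in> {0..T} - Z"
  shows "virial_rate M L t \<le> - (c t / 2) * (\<Sum>k\<in>rows M. flux L k t)
     + (6 * (real L + 1/2) * \<nu> + \<theta> * noise_const M L) * H t"
proof -
  define I where "I = {-(2 * int L + 5)..2 * int L + 5}"
  define X where "X = real L + 1/2"
  define h where "h = virial_weight L"
  define F where "F k m = h m * (lam \<alpha> (k, m) * ((u (k, m - 1) t - u (k, m + 1) t) \<bullet> u (k, m + 1) t)
       + lam \<alpha> (k, m + 1) * (u (k, m) t \<bullet> (u (k, m) t - u (k, m + 2) t)))" for k m
  define q where "q n = msq \<alpha> n * (norm (v n t))\<^sup>2" for n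
  have "h m / (\<alpha> * real_of_int k) * (lam \<alpha> (k, m) * lam \<alpha> (k, m + 1) *
       (rhs (k, m) t \<bullet> v (k, m + 1) t + v (k, m) t \<bullet> rhs (k, m + 1) t))
     \<le> - (c t / 2) * F k m + (3 * X * \<nu> * (q (k, m + 0) + q (k, m + 1))
         + \<theta> * (X * (sqrt (msq \<alpha> (k, m)) + sqrt (msq \<alpha> (k, m + 1)))) * mass v t)"
    if k: "k \<in> rows M" for k m
  proof -
    define n where "n = (k, m)"
    define n' where "n' = (k, m + 1)"
    have nw: "n \<in> waves" "n' \<in> waves" unfolding n_def n'_def by (rule rows_waves[OF k])+
    have k0: "\<alpha> * real_of_int k \<noteq> 0" using k alpha by (auto simp: rows_def)
    define g where "g = h m / (\<alpha> * real_of_int k)"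
    have gk: "g * (\<alpha> * real_of_int k) = h m" using k0 by (simp add: g_def)
    have g: "\<bar>g\<bar> \<le> X" unfolding g_def h_def X_def by (rule weight_over_wavenumber[OF k])
    define d where "d = u (k, m - 1) t - u (k, m + 1) t"
    define d' where "d' = u (k, m) t - u (k, m + 2) t"
    define y where "y = - \<nu> * (msq \<alpha> n + msq \<alpha> n') * (u n t \<bullet> u n' t)
        - lam \<alpha> n * (N n t \<bullet> u n' t) - lam \<alpha> n' * (u n t \<bullet> N n' t)"
    have r: "rhs n t = - ((\<nu> * msq \<alpha> n) *\<^sub>R v n t) - (c t * \<alpha> * real_of_int k / 2) *\<^sub>R d - N n t"
      by (simp add: rhs_def n_def d_def)
    have r': "rhs n' t = - ((\<nu> * msq \<alpha> n') *\<^sub>R v n' t) - (c t * \<alpha> * real_of_int k / 2) *\<^sub>R d' - N n' t"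
      by (simp add: rhs_def n'_def d'_def add.commute)
    have 1: "lam \<alpha> n * lam \<alpha> n' * (rhs n t \<bullet> v n' t + v n t \<bullet> rhs n' t)
       = - (c t * (\<alpha> * real_of_int k) / 2) * (lam \<alpha> n * (d \<bullet> u n' t) + lam \<alpha> n' * (u n t \<bullet> d')) + y"
      unfolding r r' y_def u_def[of n] u_def[of n']
      by (simp add: inner_diff_left inner_diff_right algebra_simps)
    have 2: "g * (lam \<alpha> n * lam \<alpha> n' * (rhs n t \<bullet> v n' t + v n t \<bullet> rhs n' t)) = - (c t / 2) * F k m + g * y"
    proof -
      have "g * (lam \<alpha> n * lam \<alpha> n' * (rhs n t \<bullet> v n' t + v n t \<bullet> rhs n' t))
        = - (c t / 2) * ((g * (\<alpha> * real_of_int k)) * (lam \<alpha> n * (d \<bullet> u n' t) + lam \<alpha> n' * (u n t \<bullet> d'))) + g * y"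
        unfolding 1 by (simp add: algebra_simps)
      also have "\<dots> = - (c t / 2) * F k m + g * y"
        unfolding gk F_def d_def d'_def n_def n'_def by simp
      finally show ?thesis .
    qed
    have U: "norm (u n t) \<le> norm (v n t)" "norm (u n' t) \<le> norm (v n' t)" using norm_u_le nw by auto
    have m: "norm (v n t) \<le> sqrt (mass v t)" "norm (v n' t) \<le> sqrt (mass v t)"
      using norm_v_le nw t by auto
    have sq: "sqrt (mass v t) * sqrt (mass v t) = mass v t" using mass_nonneg by simp
    have y1: "\<bar>\<nu> * (msq \<alpha> n + msq \<alpha> n') * (u n t \<bullet> u n' t)\<bar> \<le> \<nu> * (3 * (q n + q n'))"
    proof -
      have kk: "k \<noteq> 0" using k by (simp add: rows_def)
      have "\<bar>u n t \<bullet> u n' t\<bar> \<le> norm (v n t) * norm (v n' t)"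
        by (rule order_trans[OF Cauchy_Schwarz_ineq2]) (intro mult_mono U, auto)
      also have "\<dots> \<le> (norm (v n t))\<^sup>2 / 2 + (norm (v n' t))\<^sup>2 / 2"
        using sum_squares_bound[of "norm (v n t)" "norm (v n' t)"] by simp
      finally have "(msq \<alpha> n + msq \<alpha> n') * \<bar>u n t \<bullet> u n' t\<bar> \<le> (msq \<alpha> n + msq \<alpha> n') * ((norm (v n t))\<^sup>2 / 2 + (norm (v n' t))\<^sup>2 / 2)"
        by (intro mult_left_mono) (auto simp: msq_nonneg)
      also have "\<dots> = (msq \<alpha> n + msq \<alpha> n') * (norm (v n t))\<^sup>2 / 2 + (msq \<alpha> n + msq \<alpha> n') * (norm (v n' t))\<^sup>2 / 2"
        by (simp add: algebra_simps)
      \<comment> \<open>Each of the two weights is at most 4 times the other, so their sum is at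
        most 5 times either one. Then 5/2 is rounded up to 3, and two such sums give the 6 of the
        statement.\<close>
      also have "\<dots> \<le> (5 * msq \<alpha> n) * (norm (v n t))\<^sup>2 / 2 + (5 * msq \<alpha> n') * (norm (v n' t))\<^sup>2 / 2"
        using msq_neighbour[OF kk, of m "m + 1"] msq_neighbour[OF kk, of "m + 1" m]
        by (intro add_mono divide_right_mono mult_right_mono) (auto simp: n_def n'_def)
      also have "\<dots> \<le> 3 * (q n + q n')"
      proof -
        have "0 \<le> q n" "0 \<le> q n'" by (simp_all add: q_def msq_nonneg)
        moreover have "(5 * msq \<alpha> n) * (norm (v n t))\<^sup>2 / 2 = 5 / 2 * q n"
          "(5 * msq \<alpha> n') * (norm (v n' t))\<^sup>2 / 2 = 5 / 2 * q n'" by (simp_all add: q_def)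
        moreover have "5 / 2 * x + 5 / 2 * y \<le> 3 * x + 3 * y" if "0 \<le> x" "0 \<le> y" for x y :: real
          using that by linarith
        ultimately show ?thesis unfolding distrib_left[of 3] by metis
      qed
      finally show ?thesis using nu by (simp add: abs_mult msq_nonneg mult.assoc)
    qed
    have y2: "\<bar>lam \<alpha> n * (N n t \<bullet> u n' t)\<bar> \<le> \<theta> * sqrt (msq \<alpha> n) * mass v t"
    proof -
      have "\<bar>lam \<alpha> n * (N n t \<bullet> u n' t)\<bar> \<le> 1 * (norm (N n t) * norm (u n' t))"
        unfolding abs_mult using lam01[OF nw(1)] by (intro mult_mono Cauchy_Schwarz_ineq2) auto
      also have "\<dots> \<le> 1 * ((\<theta> * sqrt (msq \<alpha> n) * sqrt (mass v t)) * sqrt (mass v t))"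
        using N_pointwise[OF t nw(1)] U m theta mass_nonneg msq_nonneg by (intro mult_mono) auto
      finally show ?thesis using sq by (simp add: mult.assoc)
    qed
    have y3: "\<bar>lam \<alpha> n' * (u n t \<bullet> N n' t)\<bar> \<le> \<theta> * sqrt (msq \<alpha> n') * mass v t"
    proof -
      have "\<bar>lam \<alpha> n' * (u n t \<bullet> N n' t)\<bar> \<le> 1 * (norm (N n' t) * norm (u n t))"
        unfolding abs_mult using lam01[OF nw(2)] Cauchy_Schwarz_ineq2[of "u n t" "N n' t"]
        by (intro mult_mono) (auto simp: mult.commute)
      also have "\<dots> \<le> 1 * ((\<theta> * sqrt (msq \<alpha> n') * sqrt (mass v t)) * sqrt (mass v t))"
        using N_pointwise[OF t nw(2)] U m theta mass_nonneg msq_nonneg by (intro mult_mono) auto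
      finally show ?thesis using sq by (simp add: mult.assoc)
    qed
    have "g * y \<le> \<bar>g\<bar> * \<bar>y\<bar>" by (metis abs_ge_self abs_mult)
    also have "\<dots> \<le> X * (\<nu> * (3 * (q n + q n')) + \<theta> * sqrt (msq \<alpha> n) * mass v t + \<theta> * sqrt (msq \<alpha> n') * mass v t)"
    proof (rule mult_mono[OF g])
      show "\<bar>y\<bar> \<le> \<nu> * (3 * (q n + q n')) + \<theta> * sqrt (msq \<alpha> n) * mass v t + \<theta> * sqrt (msq \<alpha> n') * mass v t"
        using y1 y2 y3 unfolding y_def by linarith
    qed (use g in auto)
    also have "\<dots> = 3 * X * \<nu> * (q n + q n') + \<theta> * (X * (sqrt (msq \<alpha> n) + sqrt (msq \<alpha> n'))) * mass v t"
      by (simp add: algebra_simps)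
    finally show ?thesis using 2 unfolding g_def n_def n'_def by simp
  qed
  then have "virial_rate M L t \<le> (\<Sum>k\<in>rows M. \<Sum>m\<in>I. - (c t / 2) * F k m + (3 * X * \<nu> * (q (k, m + 0) + q (k, m + 1))
         + \<theta> * (X * (sqrt (msq \<alpha> (k, m)) + sqrt (msq \<alpha> (k, m + 1)))) * mass v t))"
    unfolding virial_rate_def I_def[symmetric] h_def by (intro sum_mono)
  also have "\<dots> = - (c t / 2) * (\<Sum>k\<in>rows M. \<Sum>m\<in>I. F k m)
      + 3 * X * \<nu> * ((\<Sum>k\<in>rows M. \<Sum>m\<in>I. q (k, m + 0)) + (\<Sum>k\<in>rows M. \<Sum>m\<in>I. q (k, m + 1)))
      + \<theta> * (X * (\<Sum>k\<in>rows M. \<Sum>m\<in>I. sqrt (msq \<alpha> (k, m)) + sqrt (msq \<alpha> (k, m + 1)))) * mass v t"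
    unfolding sum.distrib sum_distrib_left[symmetric] sum_distrib_right[symmetric] by (simp only: add.assoc)
  also have "\<dots> = - (c t / 2) * (\<Sum>k\<in>rows M. flux L k t)
      + 3 * X * \<nu> * ((\<Sum>k\<in>rows M. \<Sum>m\<in>I. q (k, m + 0)) + (\<Sum>k\<in>rows M. \<Sum>m\<in>I. q (k, m + 1)))
      + \<theta> * noise_const M L * mass v t"
    unfolding flux_def F_def noise_const_def I_def h_def X_def ..
  also have "\<dots> \<le> - (c t / 2) * (\<Sum>k\<in>rows M. flux L k t) + 3 * X * \<nu> * (H t + H t) + \<theta> * noise_const M L * H t"
  proof (rule add_mono[OF add_mono[OF order_refl mult_left_mono[OF add_mono]] mult_left_mono])
    show "(\<Sum>k\<in>rows M. \<Sum>m\<in>I. q (k, m + 0)) \<le> H t" "(\<Sum>k\<in>rows M. \<Sum>m\<in>I. q (k, m + 1)) \<le> H t"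
      unfolding q_def by (rule rows_sum_le_grad[OF t]; simp add: I_def)+
    show "mass v t \<le> H t" by (rule mass_le_grad[OF t])
    show "0 \<le> \<theta> * noise_const M L"
      unfolding noise_const_def by (intro mult_nonneg_nonneg theta sum_nonneg add_nonneg_nonneg) (auto simp: msq_nonneg)
    show "0 \<le> 3 * X * \<nu>" using nu by (simp add: X_def)
  qed
  also have "\<dots> = - (c t / 2) * (\<Sum>k\<in>rows M. flux L k t) + (6 * X * \<nu> + \<theta> * noise_const M L) * H t"
    by (simp add: algebra_simps)
  finally show ?thesis unfolding X_def .
qed

lemma defect_continuous: "continuous_on {0..T} (defect M L)"
  unfolding defect_def u_def
  by (intro continuous_intros v_continuous rows_waves)

lemma defect_nonneg: "0 \<le> defect M L t"
  unfolding defect_def by (intro sum_nonneg) auto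

text \<open>With \<open>\<theta> \<le> \<nu> * c0 / 2\<close> the perturbation consumes at most half
  of the dissipation \<open>2 * \<nu> * c0\<close>; the other half bounds the dissipation in space
  and time by the initial energy.\<close>

lemma grad_integral_bound:
  assumes "\<theta> \<le> \<nu> * c0 / 2"
  shows "\<nu> * c0 * integral {0..T} H \<le> mass v 0"
proof -
  have I: "0 \<le> integral {0..T} H"
    using grad_dominated(1)[of 0 T] T_pos by (intro integral_nonneg) (auto simp: grad_nonneg)
  have "E T - E 0 \<le> (- 2 * \<nu> * c0 + 2 * \<theta>) * integral {0..T} H"
    using T_pos by (intro energy_inequality) auto
  also have "\<dots> \<le> (- (\<nu> * c0)) * integral {0..T} H" using assms by (intro mult_right_mono I) simp
  finally have "\<nu> * c0 * integral {0..T} H \<le> E 0 - E T" by simp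
  moreover have "E 0 \<le> mass v 0" using E_bounds T_pos by auto
  moreover have "0 \<le> E T" using E_bounds(1)[of T] T_pos c0 mass_nonneg[of T]
    by (smt (verit) atLeastAtMost_iff mult_nonneg_nonneg)
  ultimately show ?thesis by linarith
qed

lemma E_decreasing:
  assumes "\<theta> \<le> \<nu> * c0 / 2" "0 \<le> a" "a \<le> b" "b \<le> T"
  shows "E b \<le> E a"
proof -
  have "0 \<le> integral {a..b} H"
    using grad_dominated(1)[OF assms(2-4)] by (intro integral_nonneg) (auto simp: grad_nonneg)
  moreover have "0 < \<nu> * c0" using nu c0 by simp
  then have "- 2 * \<nu> * c0 + 2 * \<theta> \<le> 0" using assms(1) by linarith
  ultimately have "(- 2 * \<nu> * c0 + 2 * \<theta>) * integral {a..b} H \<le> 0"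
    by (intro mult_nonpos_nonneg)
  then show ?thesis using energy_inequality[OF assms(2-4)] by linarith
qed

lemma mass_growth:
  assumes "\<theta> \<le> \<nu> * c0 / 2" "t \<in> {0..T}"
  shows "c0 * mass v t \<le> mass v 0"
  using E_bounds(1)[OF assms(2)] E_decreasing[OF assms(1), of 0 t] E_bounds(2)[of 0] assms(2) T_pos
  by auto

text \<open>The virial is of order \<open>L\<close> times the mass at both end times, while its rate
  is at most a negative multiple of the defect plus errors in \<open>H\<close>. Integration leaves a
  boundary term free of \<open>\<nu>\<close>; among the errors, \<open>15 / (L - 1)\<^sup>2\<close>
  multiplies \<open>integral {0..T} H\<close>, which is of order \<open>1 / \<nu>\<close>.\<close>

lemma defect_integral_bound:
  assumes th: "\<theta> \<le> \<nu> * c0 / 2" and L: "L \<ge> 3"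
  shows "cmin * c0 / 4 * integral {0..T} (defect M L)
    \<le> 2 * (real L + 1/2) / c0 * mass v 0
      + (15 / (real L - 1)\<^sup>2 + 6 * (real L + 1/2) * \<nu> + \<theta> * noise_const M L) * integral {0..T} H"
proof -
  define X where "X = real L + 1/2"
  define W where "W = 15 / (real L - 1)\<^sup>2"
  have Hint: "(H has_integral integral {0..T} H) {0..T}"
    using grad_dominated(1)[of 0 T] T_pos by auto
  have Dint: "(defect M L has_integral integral {0..T} (defect M L)) {0..T}"
    by (intro integrable_integral integrable_continuous_real defect_continuous)
  have 1: "((\<lambda>t. if t \<in> Z then 0 else virial_rate M L t) has_integral (virial M L T - virial M L 0)) {0..T}"
    by (rule has_integral_spike[OF Z _ virial_integral]) auto
  have "((\<lambda>t. - (cmin * c0 / 4) * defect M L t + (W + 6 * X * \<nu> + \<theta> * noise_const M L) * H t) has_integral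
     (- (cmin * c0 / 4) * integral {0..T} (defect M L) + (W + 6 * X * \<nu> + \<theta> * noise_const M L) * integral {0..T} H)) {0..T}"
    by (intro has_integral_add has_integral_mult_right Hint Dint)
  then have 2: "((\<lambda>t. if t \<in> Z then 0 else - (cmin * c0 / 4) * defect M L t + (W + 6 * X * \<nu> + \<theta> * noise_const M L) * H t) has_integral
     (- (cmin * c0 / 4) * integral {0..T} (defect M L) + (W + 6 * X * \<nu> + \<theta> * noise_const M L) * integral {0..T} H)) {0..T}"
    by (rule has_integral_spike[OF Z, rotated]) auto
  have "virial_rate M L t \<le> - (cmin * c0 / 4) * defect M L t + (W + 6 * X * \<nu> + \<theta> * noise_const M L) * H t"
    if t: "t \<in> {0..T} - Z" for t
  proof -
    have ct: "cmin \<le> c t" "c t \<le> 2" using c_ge[of t] c_le[of t] t by auto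
    have "c t / 2 * (c0 / 2 * defect M L t - W * H t) \<le> c t / 2 * (\<Sum>k\<in>rows M. flux L k t)"
      using flux_lower_bound[OF t L, of M] ct cmin by (intro mult_left_mono) (auto simp: W_def)
    moreover have "cmin / 2 * (c0 / 2 * defect M L t) \<le> c t / 2 * (c0 / 2 * defect M L t)"
      using ct c0 defect_nonneg[of M L t] by (intro mult_right_mono) auto
    moreover have "c t / 2 * (W * H t) \<le> 1 * (W * H t)"
      using ct grad_nonneg[of t] by (intro mult_right_mono) (auto simp: W_def)
    ultimately show ?thesis
      using virial_rate_bound[OF t, of M L] by (simp add: X_def algebra_simps)
  qed
  then have "virial M L T - virial M L 0 \<le> - (cmin * c0 / 4) * integral {0..T} (defect M L) + (W + 6 * X * \<nu> + \<theta> * noise_const M L) * integral {0..T} H"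
    by (intro has_integral_le[OF 1 2]) auto
  moreover have "\<bar>virial M L T\<bar> \<le> X * mass v T" "\<bar>virial M L 0\<bar> \<le> X * mass v 0"
    using virial_bound[of T M L] virial_bound[of 0 M L] T_pos by (auto simp: X_def)
  moreover have "X * mass v T \<le> X / c0 * mass v 0"
    using mass_growth[OF th, of T] T_pos c0
      mult_left_mono[of "c0 * mass v T" "mass v 0" "X / c0"] by (simp add: X_def)
  moreover have "X * mass v 0 \<le> X / c0 * mass v 0"
  proof (rule mult_right_mono[OF _ mass_nonneg])
    have "X * c0 \<le> X" using c0 by (intro mult_left_le) (auto simp: X_def)
    then show "X \<le> X / c0" using c0 by (simp add: pos_le_divide_eq)
  qed
  moreover have eq: "2 * X / c0 * mass v 0 = 2 * (X / c0 * mass v 0)" by simp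
  ultimately have "cmin * c0 / 4 * integral {0..T} (defect M L) \<le> 2 * X / c0 * mass v 0
      + (W + 6 * X * \<nu> + \<theta> * noise_const M L) * integral {0..T} H"
    unfolding mult_minus_left eq by linarith
  then show ?thesis unfolding X_def W_def .
qed

lemma msq_outside_box:
  assumes "n \<in> waves - box_waves M"
  shows "(real M + 1)\<^sup>2 \<le> msq \<alpha> n"
proof -
  obtain k m where n: "n = (k, m)" by (cases n)
  have "k \<noteq> 0" using assms by (auto simp: n waves_def)
  then consider "int M + 1 \<le> \<bar>k\<bar>" | "int M + 1 \<le> \<bar>m\<bar>"
    using assms by (auto simp: n box_waves_def waves_def)
  then show ?thesis
  proof cases
    case 1
    then have "real M + 1 \<le> \<bar>real_of_int k\<bar>" by linarith
    also have "\<dots> \<le> \<alpha> * \<bar>real_of_int k\<bar>" using alpha by (simp add: mult_le_cancel_right1)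
    finally have "(real M + 1)\<^sup>2 \<le> (\<alpha> * \<bar>real_of_int k\<bar>)\<^sup>2" by (intro power_mono) auto
    then show ?thesis by (simp add: n msq_def power_mult_distrib add_increasing2)
  next
    case 2
    then have "(real M + 1)\<^sup>2 \<le> \<bar>real_of_int m\<bar>\<^sup>2" by (intro power_mono) linarith+
    then show ?thesis by (simp add: n msq_def add_increasing)
  qed
qed

text \<open>Modes outside the box gain \<open>(M + 1)\<^sup>2\<close> from the dissipation. A mode
  inside is compared, along its row, with one at index about \<open>L\<close>; returning from
  \<open>u\<close> to \<open>v\<close> costs \<open>c0\<^sup>2\<close>, and the defect of a row is
  counted once for each of its \<open>2 * M + 1\<close> modes.\<close>

lemma mass_interpolation:
  assumes t: "t \<in> {0..T} - Z" and less: "M < L" and L: "L \<ge> 3" and \<eta>: "\<eta> > 0"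
  shows "mass v t \<le> H t / (real M + 1)\<^sup>2
     + (real (card (box_waves M)) * (1 / (real L - 1)\<^sup>2 + 2 * \<eta>) * H t
        + (2 * real M + 1) / (2 * \<eta>) * defect M L t) / c0\<^sup>2"
proof -
  have L1: "0 < (real L - 1)\<^sup>2" using L by simp
  define D where "D k = (\<Sum>m\<in>{m. \<bar>m\<bar> < int L}. (norm (u (k, m - 1) t + u (k, m + 1) t))\<^sup>2)" for k
  have pt: "(norm (v (k, m) t))\<^sup>2 \<le> (H t / (real L - 1)\<^sup>2 + D k / (2 * \<eta>) + 2 * \<eta> * H t) / c0\<^sup>2"
    if km: "(k, m) \<in> box_waves M" for k m
  proof -
    have w: "(k, j) \<in> waves" for j using km by (auto simp: box_waves_def waves_def)
    have one: "msq \<alpha> (k, j) * (norm (u (k, j) t))\<^sup>2 \<le> H t" for j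
    proof -
      have "msq \<alpha> (k, j) * (norm (u (k, j) t))\<^sup>2 \<le> msq \<alpha> (k, j) * (norm (v (k, j) t))\<^sup>2"
        by (intro mult_left_mono norm_u_squared_le w msq_nonneg)
      also have "\<dots> \<le> H t" using sum_le_grad[OF t, of "{(k, j)}"] w by simp
      finally show ?thesis .
    qed
    have "(norm (u (k, m) t))\<^sup>2 \<le> H t / (real L - 1)\<^sup>2 + D k / (2 * \<eta>) + 2 * \<eta> * H t"
      unfolding D_def
    proof (rule alternating_spread[OF \<eta>, where u = "\<lambda>m. u (k, m) t"])
      show "\<bar>m\<bar> < int L" using km less L by (auto simp: box_waves_def)
      show "(norm (u (k, j) t))\<^sup>2 \<le> H t / (real L - 1)\<^sup>2" if "int L - 1 \<le> \<bar>j\<bar>" for j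
      proof -
        have "(real L - 1)\<^sup>2 * (norm (u (k, j) t))\<^sup>2 \<le> msq \<alpha> (k, j) * (norm (u (k, j) t))\<^sup>2"
          using msq_far[OF that] less L by (intro mult_right_mono) auto
        also have "\<dots> \<le> H t" by (rule one)
        finally show ?thesis using L1 by (simp add: field_simps)
      qed
      show "(\<Sum>j\<in>F. (norm (u (k, j) t))\<^sup>2) \<le> H t" if "finite F" for F
      proof -
        have "(\<Sum>j\<in>F. (norm (u (k, j) t))\<^sup>2) \<le> (\<Sum>j\<in>F. (norm (v (k, j) t))\<^sup>2)"
          by (intro sum_mono norm_u_squared_le w)
        also have "\<dots> = (\<Sum>n\<in>Pair k ` F. (norm (v n t))\<^sup>2)"
          by (subst sum.reindex) (auto simp: inj_on_def)
        also have "\<dots> \<le> mass v t" using t that w by (intro sum_le_mass) auto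
        also have "\<dots> \<le> H t" by (rule mass_le_grad[OF t])
        finally show ?thesis .
      qed
    qed
    moreover have "c0\<^sup>2 * (norm (v (k, m) t))\<^sup>2 \<le> (norm (u (k, m) t))\<^sup>2"
      using power_mono[OF norm_u_ge[OF w, of m t], of 2] c0 by (simp add: power_mult_distrib)
    ultimately show ?thesis using c0 by (simp add: pos_le_divide_eq mult.commute)
  qed
  have box: "(\<Sum>n\<in>box_waves M. (norm (v n t))\<^sup>2)
     \<le> (real (card (box_waves M)) * (1 / (real L - 1)\<^sup>2 + 2 * \<eta>) * H t
        + (2 * real M + 1) / (2 * \<eta>) * defect M L t) / c0\<^sup>2"
  proof -
    have "(\<Sum>n\<in>box_waves M. (norm (v n t))\<^sup>2)
      \<le> (\<Sum>n\<in>box_waves M. (H t / (real L - 1)\<^sup>2 + D (fst n) / (2 * \<eta>) + 2 * \<eta> * H t) / c0\<^sup>2)"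
      using pt by (intro sum_mono) auto
    also have "\<dots> = (real (card (box_waves M)) * (1 / (real L - 1)\<^sup>2 + 2 * \<eta>) * H t
        + (\<Sum>n\<in>box_waves M. D (fst n)) / (2 * \<eta>)) / c0\<^sup>2"
      by (simp add: sum.distrib flip: sum_divide_distrib) (simp add: algebra_simps)
    also have "(\<Sum>n\<in>box_waves M. D (fst n)) = (2 * real M + 1) * defect M L t"
    proof -
      have "(\<Sum>n\<in>box_waves M. D (fst n)) = (\<Sum>k\<in>rows M. \<Sum>m\<in>{- int M..int M}. D k)"
        unfolding box_waves_def rows_def by (subst sum.cartesian_product) (simp add: split_def)
      also have "\<dots> = (2 * real M + 1) * defect M L t"
        by (simp add: defect_def D_def sum_distrib_left)
      finally show ?thesis .
    qed
    finally show ?thesis by simp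
  qed
  show ?thesis unfolding mass_def
  proof (rule infsum_le_finite_sums[OF mass_summable])
    fix F assume F: "finite F" "F \<subseteq> waves"
    have "(\<Sum>n\<in>F. (norm (v n t))\<^sup>2) = (\<Sum>n\<in>F \<inter> box_waves M. (norm (v n t))\<^sup>2) + (\<Sum>n\<in>F - box_waves M. (norm (v n t))\<^sup>2)"
      using F by (simp add: sum.Int_Diff)
    also have "(\<Sum>n\<in>F \<inter> box_waves M. (norm (v n t))\<^sup>2) \<le> (\<Sum>n\<in>box_waves M. (norm (v n t))\<^sup>2)"
      by (intro sum_mono2) auto
    also note box
    also have "(\<Sum>n\<in>F - box_waves M. (norm (v n t))\<^sup>2) \<le> H t / (real M + 1)\<^sup>2"
    proof -
      have "(real M + 1)\<^sup>2 * (\<Sum>n\<in>F - box_waves M. (norm (v n t))\<^sup>2) \<le> (\<Sum>n\<in>F - box_waves M. msq \<alpha> n * (norm (v n t))\<^sup>2)"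
        unfolding sum_distrib_left using F by (intro sum_mono mult_right_mono msq_outside_box) auto
      also have "\<dots> \<le> H t" using F by (intro sum_le_grad[OF t]) auto
      finally show ?thesis by (simp add: pos_le_divide_eq mult.commute)
    qed
    finally show "(\<Sum>n\<in>F. (norm (v n t))\<^sup>2) \<le> H t / (real M + 1)\<^sup>2
     + (real (card (box_waves M)) * (1 / (real L - 1)\<^sup>2 + 2 * \<eta>) * H t
        + (2 * real M + 1) / (2 * \<eta>) * defect M L t) / c0\<^sup>2" by simp
  qed (use t in auto)
qed

text \<open>The energy is nonincreasing, so \<open>c0 * mass v T\<close> is at most the mass at
  every earlier time, hence at most its time average. After multiplication by
  \<open>\<nu> * T\<close> everything on the right is \<open>mass v 0\<close> times a factor that
  the parameters can make small.\<close>

lemma mass_estimate: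
  assumes th: "\<theta> \<le> \<nu> * c0 / 2" and less: "M < L" and L: "L \<ge> 3" and \<eta>: "\<eta> > 0"
  shows "c0 * mass v T * (\<nu> * T) \<le> mass v 0 *
     ((1 / (real M + 1)\<^sup>2 + real (card (box_waves M)) * (1 / (real L - 1)\<^sup>2 + 2 * \<eta>) / c0\<^sup>2) / c0
      + (2 * real M + 1) / (2 * \<eta>) / c0\<^sup>2 * (4 / (cmin * c0)) *
         (2 * (real L + 1/2) / c0 * \<nu>
           + (15 / (real L - 1)\<^sup>2 + 6 * (real L + 1/2) * \<nu> + \<theta> * noise_const M L) / c0))"
proof -
  define A where "A = 1 / (real M + 1)\<^sup>2 + real (card (box_waves M)) * (1 / (real L - 1)\<^sup>2 + 2 * \<eta>) / c0\<^sup>2"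
  define Bc where "Bc = (2 * real M + 1) / (2 * \<eta>) / c0\<^sup>2"
  define P where "P = 2 * (real L + 1/2) / c0"
  define R where "R = 15 / (real L - 1)\<^sup>2 + 6 * (real L + 1/2) * \<nu> + \<theta> * noise_const M L"
  define IH where "IH = integral {0..T} H"
  define ID where "ID = integral {0..T} (defect M L)"
  have nonneg: "0 \<le> A" "0 \<le> Bc" "0 \<le> R"
    using \<eta> nu theta by (auto simp: A_def Bc_def R_def noise_const_def msq_nonneg intro!: add_nonneg_nonneg mult_nonneg_nonneg sum_nonneg)
  have Hint: "(H has_integral IH) {0..T}"
    using grad_dominated(1)[of 0 T] T_pos by (auto simp: IH_def)
  have Dint: "(defect M L has_integral ID) {0..T}"
    unfolding ID_def by (intro integrable_integral integrable_continuous_real defect_continuous)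
  have le: "c0 * mass v T \<le> A * H t + Bc * defect M L t" if t: "t \<in> {0..T} - Z" for t
  proof -
    have "c0 * mass v T \<le> E T" using E_bounds T_pos by auto
    also have "\<dots> \<le> E t" using t by (intro E_decreasing th) auto
    also have "\<dots> \<le> mass v t" using E_bounds t by auto
    also have "\<dots> \<le> A * H t + Bc * defect M L t"
      using mass_interpolation[OF t less L \<eta>] unfolding A_def Bc_def
      by (simp add: add_divide_distrib algebra_simps)
    finally show ?thesis .
  qed
  have "((\<lambda>t. if t \<in> Z then 0 else c0 * mass v T) has_integral (T * (c0 * mass v T))) {0..T}"
    by (rule has_integral_spike[OF Z, of _ _ "\<lambda>_. c0 * mass v T"])
      (use has_integral_const_real[of "c0 * mass v T" 0 T] T_pos in auto)
  moreover have "((\<lambda>t. if t \<in> Z then 0 else A * H t + Bc * defect M L t) has_integral (A * IH + Bc * ID)) {0..T}"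
    by (rule has_integral_spike[OF Z, of _ _ "\<lambda>t. A * H t + Bc * defect M L t"])
      (auto intro!: has_integral_add has_integral_mult_right Hint Dint)
  ultimately have "T * (c0 * mass v T) \<le> A * IH + Bc * ID"
    by (rule has_integral_le) (use le in auto)
  then have 1: "\<nu> * (T * (c0 * mass v T)) \<le> A * (\<nu> * IH) + Bc * (\<nu> * ID)"
  proof -
    assume "T * (c0 * mass v T) \<le> A * IH + Bc * ID"
    then have "\<nu> * (T * (c0 * mass v T)) \<le> \<nu> * (A * IH + Bc * ID)"
      using nu by (intro mult_left_mono) auto
    then show ?thesis by (simp add: algebra_simps)
  qed
  have IH: "\<nu> * IH \<le> mass v 0 / c0"
    using grad_integral_bound[OF th] c0 by (simp add: IH_def field_simps)
  have "cmin * c0 / 4 * ID \<le> P * mass v 0 + R * IH"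
    using defect_integral_bound[OF th L, of M] by (simp add: ID_def IH_def P_def R_def)
  then have "\<nu> * (cmin * c0 / 4 * ID) \<le> \<nu> * (P * mass v 0 + R * IH)"
    using nu by (intro mult_left_mono) auto
  also have "\<dots> = P * \<nu> * mass v 0 + R * (\<nu> * IH)" by (simp add: algebra_simps)
  also have "\<dots> \<le> P * \<nu> * mass v 0 + R * (mass v 0 / c0)"
    using IH nonneg by (intro add_left_mono mult_left_mono) auto
  finally have "cmin * c0 / 4 * (\<nu> * ID) \<le> mass v 0 * (P * \<nu> + R / c0)"
    by (simp add: algebra_simps)
  then have "4 / (cmin * c0) * (cmin * c0 / 4 * (\<nu> * ID)) \<le> 4 / (cmin * c0) * (mass v 0 * (P * \<nu> + R / c0))"
    using cmin c0 by (intro mult_left_mono) auto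
  then have ID: "\<nu> * ID \<le> mass v 0 * (4 / (cmin * c0) * (P * \<nu> + R / c0))"
    using cmin c0 by (simp add: mult.commute mult.left_commute)
  have "\<nu> * (T * (c0 * mass v T)) \<le> A * (mass v 0 / c0) + Bc * (mass v 0 * (4 / (cmin * c0) * (P * \<nu> + R / c0)))"
    using 1 mult_left_mono[OF IH nonneg(1)] mult_left_mono[OF ID nonneg(2)] by linarith
  also have "\<dots> = mass v 0 * (A / c0 + Bc * (4 / (cmin * c0)) * (P * \<nu> + R / c0))"
    by (simp add: algebra_simps)
  finally show ?thesis
    unfolding A_def Bc_def P_def R_def by (simp add: mult_ac)
qed

end

text \<open>
  The parameters are chosen in the order M (high modes), \<eta> and L (spreading along a row), and \<nu> (the
  virial).
\<close>

theorem shear_modes_decay: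
  fixes \<alpha> \<tau> \<delta> cmin :: real
  assumes "\<alpha> > 1" "\<tau> > 0" "\<delta> > 0" "cmin > 0"
  shows "\<exists>\<nu>0>0. \<forall>\<nu> \<theta> B c v N Hb Z. \<nu> \<le> \<nu>0 \<longrightarrow> \<theta> \<le> \<nu> * (1 - 1 / \<alpha>\<^sup>2) / 2 \<longrightarrow>
    shear_modes \<alpha> \<nu> (\<tau> / \<nu>) \<theta> cmin B c v N Hb Z \<longrightarrow> mass v (\<tau> / \<nu>) \<le> \<delta> * mass v 0"
proof -
  define g0 where "g0 = 1 - 1 / \<alpha>\<^sup>2"
  have g0: "0 < g0" "g0 < 1"
    using assms(1) by (auto simp: g0_def power2_eq_square field_simps less_1_mult)
  \<comment> \<open>Since \<open>\<nu> * T = \<tau>\<close>, the factor of \<open>mass v 0\<close>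
    in \<open>mass_estimate\<close> has to be at most \<open>d\<close>. The budget is
    \<open>d / 4\<close> for the high modes, \<open>d / 8\<close> for \<open>\<eta>\<close>,
    \<open>d / 4\<close> for \<open>L\<close> and \<open>d / 4\<close> for
    \<open>\<nu>\<close>.\<close>
  define d where "d = \<delta> * g0 * \<tau>"
  have d: "d > 0" using assms g0 by (simp add: d_def)
  define K where "K M \<eta> = (2 * real M + 1) / (2 * \<eta>) / g0\<^sup>2 * (4 / (cmin * g0))" for M :: nat and \<eta> :: real
  have "(\<lambda>M. 1 / (real M + 1)\<^sup>2 / g0) \<longlonglongrightarrow> 0"
    by (rule tendsto_divide_zero) real_asymp
  then have "eventually (\<lambda>M. 1 / (real M + 1)\<^sup>2 / g0 < d / 4) sequentially"
    by (rule order_tendstoD(2)) (use d in simp)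
  then obtain M :: nat where M: "1 / (real M + 1)\<^sup>2 / g0 < d / 4"
    using eventually_happens[of _ sequentially] by auto
  define w where "w = real (card (box_waves M)) / g0\<^sup>2 / g0"
  have w: "0 \<le> w" using g0 by (simp add: w_def)
  define \<eta> where "\<eta> = d / (16 * (w + 1))"
  have \<eta>: "\<eta> > 0" using d w by (simp add: \<eta>_def)
  have w\<eta>: "w * (2 * \<eta>) \<le> d / 8"
    using w d by (simp add: \<eta>_def field_simps)
  define k where "k = K M \<eta>"
  have k: "0 \<le> k" using \<eta> g0 assms by (simp add: k_def K_def)
  have "(\<lambda>L. (w + k * 15 / g0) * (1 / (real L - 1)\<^sup>2)) \<longlonglongrightarrow> 0"
    by real_asymp
  then have "eventually (\<lambda>L. (w + k * 15 / g0) * (1 / (real L - 1)\<^sup>2) < d / 4) sequentially"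
    by (rule order_tendstoD(2)) (use d in simp)
  moreover have "eventually (\<lambda>L. L \<ge> M + 3) sequentially" by (rule eventually_ge_at_top)
  ultimately have "eventually (\<lambda>L. (w + k * 15 / g0) * (1 / (real L - 1)\<^sup>2) < d / 4 \<and> L \<ge> M + 3) sequentially"
    by (rule eventually_conj)
  then obtain L :: nat where L: "(w + k * 15 / g0) * (1 / (real L - 1)\<^sup>2) < d / 4" "L \<ge> M + 3"
    by (auto simp: eventually_sequentially)
  \<comment> \<open>This is \<open>noise_const\<close>, written out because \<open>\<nu>0\<close> is
    chosen before any instance of the locale is at hand.\<close>
  define nc where "nc = (real L + 1/2) * (\<Sum>k\<in>{- int M..int M} - {0}. \<Sum>m\<in>{-(2 * int L + 5)..2 * int L + 5}.
     sqrt (msq \<alpha> (k, m)) + sqrt (msq \<alpha> (k, m + 1)))"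
  have nc: "0 \<le> nc" unfolding nc_def by (intro mult_nonneg_nonneg sum_nonneg) (auto simp: msq_nonneg)
  define e where "e = k * (2 * (real L + 1/2) / g0 + (6 * (real L + 1/2) + nc) / g0)"
  have e: "0 \<le> e" using k g0 nc by (simp add: e_def)
  define \<nu>0 where "\<nu>0 = d / (4 * (e + 1))"
  have \<nu>0: "\<nu>0 > 0" using d e by (simp add: \<nu>0_def)
  show ?thesis
  proof (intro exI[of _ \<nu>0] conjI \<nu>0 allI impI)
    fix \<nu> \<theta> B :: real and c v N Hb and Z :: "real set"
    assume a: "\<nu> \<le> \<nu>0" "\<theta> \<le> \<nu> * (1 - 1 / \<alpha>\<^sup>2) / 2" "shear_modes \<alpha> \<nu> (\<tau> / \<nu>) \<theta> cmin B c v N Hb Z"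
    interpret shear_modes \<alpha> \<nu> "\<tau> / \<nu>" \<theta> cmin B c v N Hb Z by (rule a(3))
    have g0eq: "shear_modes.c0 \<alpha> = g0" by (simp add: c0_def g0_def)
    have nceq: "shear_modes.noise_const \<alpha> M L = nc" by (simp add: noise_const_def nc_def rows_def)
    define x where "x = 1 / (real L - 1)\<^sup>2"
    have "\<theta> \<le> \<nu> * g0 / 2" using a(2) by (simp add: g0_def)
    also have "\<dots> \<le> \<nu> * 1" using nu g0 by (simp add: mult_le_cancel_left_pos)
    finally have "\<theta> * nc \<le> \<nu> * nc" using nc by (simp add: mult_right_mono)
    then have "k * ((15 * x + 6 * (real L + 1/2) * \<nu> + \<theta> * nc) / g0) \<le> k * ((15 * x + 6 * (real L + 1/2) * \<nu> + \<nu> * nc) / g0)"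
      using k g0 by (intro mult_left_mono divide_right_mono) auto
    moreover have "g0 * mass v (\<tau> / \<nu>) * (\<nu> * (\<tau> / \<nu>)) \<le> mass v 0 *
        ((1 / (real M + 1)\<^sup>2 + real (card (box_waves M)) * (x + 2 * \<eta>) / g0\<^sup>2) / g0
          + k * (2 * (real L + 1/2) / g0 * \<nu> + (15 * x + 6 * (real L + 1/2) * \<nu> + \<theta> * nc) / g0))"
      using mass_estimate[of M L \<eta>] a(2) L(2) \<eta> unfolding g0eq nceq
      by (simp add: k_def K_def x_def g0_def)
    moreover have "(1 / (real M + 1)\<^sup>2 + real (card (box_waves M)) * (x + 2 * \<eta>) / g0\<^sup>2) / g0
        + k * (2 * (real L + 1/2) / g0 * \<nu> + (15 * x + 6 * (real L + 1/2) * \<nu> + \<nu> * nc) / g0)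
      = 1 / (real M + 1)\<^sup>2 / g0 + w * (2 * \<eta>) + (w + k * 15 / g0) * x + \<nu> * e"
      by (simp add: w_def e_def add_divide_distrib algebra_simps)
    moreover have "\<nu> * e \<le> d / 4"
    proof -
      have "\<nu> * e \<le> \<nu>0 * e" using a(1) e by (intro mult_right_mono) auto
      also have "\<dots> \<le> d / 4" using d e by (simp add: \<nu>0_def field_simps)
      finally show ?thesis .
    qed
    moreover have "(w + k * 15 / g0) * x \<le> d / 4" using L(1) by (simp add: x_def)
    ultimately have est: "(1 / (real M + 1)\<^sup>2 + real (card (box_waves M)) * (x + 2 * \<eta>) / g0\<^sup>2) / g0
          + k * (2 * (real L + 1/2) / g0 * \<nu> + (15 * x + 6 * (real L + 1/2) * \<nu> + \<theta> * nc) / g0) \<le> d"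
      and main: "g0 * mass v (\<tau> / \<nu>) * (\<nu> * (\<tau> / \<nu>)) \<le> mass v 0 *
        ((1 / (real M + 1)\<^sup>2 + real (card (box_waves M)) * (x + 2 * \<eta>) / g0\<^sup>2) / g0
          + k * (2 * (real L + 1/2) / g0 * \<nu> + (15 * x + 6 * (real L + 1/2) * \<nu> + \<theta> * nc) / g0))"
      using M w\<eta> d unfolding distrib_left[of k] by linarith+
    have "g0 * \<tau> * mass v (\<tau> / \<nu>) \<le> mass v 0 * d"
      using order_trans[OF main mult_left_mono[OF est mass_nonneg]] nu by (simp add: mult_ac)
    then have "(g0 * \<tau>) * mass v (\<tau> / \<nu>) \<le> (g0 * \<tau>) * (\<delta> * mass v 0)"
      by (simp add: d_def mult_ac)
    then show "mass v (\<tau> / \<nu>) \<le> \<delta> * mass v 0"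
      using g0 assms by (simp add: mult_le_cancel_left_pos)
  qed
qed

section \<open>Fourier series on the torus\<close>

definition mode :: "real \<Rightarrow> int \<times> int \<Rightarrow> real \<times> real \<Rightarrow> complex" where
  "mode \<alpha> n z = cis (\<alpha> * real_of_int (fst n) * fst z + real_of_int (snd n) * snd z)"

definition cell :: "real \<Rightarrow> (real \<times> real) set" where
  "cell \<alpha> = {0..<2 * pi / \<alpha>} \<times> {0..<2 * pi}"

definition area :: "real \<Rightarrow> real" where "area \<alpha> = (2 * pi / \<alpha>) * (2 * pi)"

definition sq_int :: "real \<Rightarrow> (real \<times> real \<Rightarrow> complex) \<Rightarrow> bool" where
  "sq_int \<alpha> F \<longleftrightarrow> F \<in> borel_measurable (torus \<alpha>) \<and> integrable (torus \<alpha>) (\<lambda>z. (norm (F z))\<^sup>2)"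

definition fcoef :: "real \<Rightarrow> (real \<times> real \<Rightarrow> complex) \<Rightarrow> int \<times> int \<Rightarrow> complex" where
  "fcoef \<alpha> F n = (LINT z|torus \<alpha>. F z * cnj (mode \<alpha> n z)) / of_real (area \<alpha>)"

inductive trig_poly :: "real \<Rightarrow> (real \<times> real \<Rightarrow> complex) \<Rightarrow> bool" for \<alpha> where
  mode: "trig_poly \<alpha> (mode \<alpha> n)"
| add: "trig_poly \<alpha> P \<Longrightarrow> trig_poly \<alpha> Q \<Longrightarrow> trig_poly \<alpha> (\<lambda>z. P z + Q z)"
| scale: "trig_poly \<alpha> P \<Longrightarrow> trig_poly \<alpha> (\<lambda>z. c * P z)"

lemma cell_borel [measurable]: "cell \<alpha> \<in> sets borel"
  unfolding cell_def borel_prod[symmetric] by (intro pair_measureI) auto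

lemma torus_eq: "torus \<alpha> = restrict_space lborel (cell \<alpha>)"
  by (simp add: torus_def cell_def)

lemma space_torus [simp]: "space (torus \<alpha>) = cell \<alpha>"
  by (simp add: torus_eq space_restrict_space)

lemma borel_measurable_torus: "f \<in> borel_measurable borel \<Longrightarrow> f \<in> borel_measurable (torus \<alpha>)"
  unfolding torus_eq by (intro measurable_restrict_space1) simp

lemma torus_indicator:
  fixes f :: "real \<times> real \<Rightarrow> 'a::{banach, second_countable_topology}"
  shows "integrable (torus \<alpha>) f \<longleftrightarrow> integrable lborel (\<lambda>z. indicator (cell \<alpha>) z *\<^sub>R f z)"
    "(LINT z|torus \<alpha>. f z) = (LINT z|lborel. indicator (cell \<alpha>) z *\<^sub>R f z)"
  unfolding torus_eq by (auto simp: integrable_restrict_space integral_restrict_space)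

lemma torus_fubini:
  fixes f :: "real \<times> real \<Rightarrow> 'a::{banach, second_countable_topology}"
  assumes "integrable (torus \<alpha>) f"
  shows "(LINT z|torus \<alpha>. f z) = (LINT y|lborel. indicator {0..<2 * pi} y *\<^sub>R
      (LINT x|lborel. indicator {0..<2 * pi / \<alpha>} x *\<^sub>R f (x, y)))"
proof -
  define g where "g z = indicator (cell \<alpha>) z *\<^sub>R f z" for z
  have g: "case_prod (\<lambda>x y. g (x, y)) = g" by auto
  have "integrable (lborel \<Otimes>\<^sub>M lborel) (case_prod (\<lambda>x y. g (x, y)))"
    using assms unfolding g torus_indicator g_def[symmetric] lborel_prod .
  from lborel_pair.integral_snd[OF this]
  have "(LINT z|torus \<alpha>. f z) = (LINT y|lborel. LINT x|lborel. indicator (cell \<alpha>) (x, y) *\<^sub>R f (x, y))"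
    unfolding g lborel_prod torus_indicator(2) g_def[symmetric] by simp
  also have "\<dots> = (LINT y|lborel. indicator {0..<2 * pi} y *\<^sub>R
      (LINT x|lborel. indicator {0..<2 * pi / \<alpha>} x *\<^sub>R f (x, y)))"
  proof (intro Bochner_Integration.integral_cong refl)
    fix y :: real
    show "(LINT x|lborel. indicator (cell \<alpha>) (x, y) *\<^sub>R f (x, y)) = indicator {0..<2 * pi} y *\<^sub>R
      (LINT x|lborel. indicator {0..<2 * pi / \<alpha>} x *\<^sub>R f (x, y))"
    proof (cases "y \<in> {0..<2 * pi}")
      case True
      then have "indicator (cell \<alpha>) (x, y) *\<^sub>R f (x, y) = indicator {0..<2 * pi / \<alpha>} x *\<^sub>R f (x, y)" for x
        by (auto simp: cell_def indicator_def)
      then show ?thesis using True by (simp only: indicator_simps scaleR_one)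
    next
      case False
      then have "indicator (cell \<alpha>) (x, y) *\<^sub>R f (x, y) = 0" for x
        by (auto simp: cell_def indicator_def)
      then show ?thesis using False by (simp only: indicator_simps scaleR_zero_left integral_zero not_False_eq_True)
    qed
  qed
  finally show ?thesis .
qed

locale flat_torus =
  fixes \<alpha> :: real
  assumes alpha_pos: "\<alpha> > 0"
begin

lemma area_pos: "area \<alpha> > 0"
  using alpha_pos by (simp add: area_def)

lemma emeasure_torus: "emeasure (torus \<alpha>) (cell \<alpha>) = ennreal (area \<alpha>)"
proof -
  have "emeasure (torus \<alpha>) (cell \<alpha>) = emeasure (lborel \<Otimes>\<^sub>M lborel) ({0..<2 * pi / \<alpha>} \<times> {0..<2 * pi})"
    unfolding torus_eq using cell_borel[of \<alpha>] by (simp add: emeasure_restrict_space lborel_prod flip: cell_def)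
  also have "\<dots> = emeasure lborel {0..<2 * pi / \<alpha>} * emeasure lborel {0..<2 * pi}"
    by (rule lborel.emeasure_pair_measure_Times) auto
  also have "\<dots> = ennreal (area \<alpha>)"
  proof -
    have "emeasure lborel {0..<2 * pi / \<alpha>} = ennreal (2 * pi / \<alpha>)" "emeasure lborel {0..<2 * pi} = ennreal (2 * pi)"
      using alpha_pos by (auto intro!: emeasure_lborel_Ico[THEN trans])
    moreover have "ennreal (2 * pi / \<alpha>) * ennreal (2 * pi) = ennreal (area \<alpha>)"
      unfolding area_def using alpha_pos by (intro ennreal_mult[symmetric]) auto
    ultimately show ?thesis by simp
  qed
  finally show ?thesis .
qed

sublocale finite_measure "torus \<alpha>"
  by standard (simp add: emeasure_torus)

lemma measure_torus: "measure (torus \<alpha>) (cell \<alpha>) = area \<alpha>"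
  using area_pos by (simp add: measure_def emeasure_torus)

lemma integrable_bounded:
  fixes f :: "real \<times> real \<Rightarrow> 'a::{banach, second_countable_topology}"
  assumes "f \<in> borel_measurable (torus \<alpha>)" "\<And>z. norm (f z) \<le> B"
  shows "integrable (torus \<alpha>) f"
  using integrable_const_bound[OF _ assms(1), of B] assms(2) by auto

lemma continuous_mode: "continuous_on UNIV (mode \<alpha> n)"
  unfolding mode_def[abs_def] cis_conv_exp by (intro continuous_intros)

lemma mode_measurable [measurable]: "mode \<alpha> n \<in> borel_measurable (torus \<alpha>)"
  by (intro borel_measurable_torus borel_measurable_continuous_onI continuous_mode)

lemma norm_mode [simp]: "norm (mode \<alpha> n z) = 1"
  by (simp add: mode_def)

lemma mode_mult: "mode \<alpha> n z * mode \<alpha> m z = mode \<alpha> (n + m) z"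
  by (simp add: mode_def cis_mult algebra_simps)

lemma cnj_mode: "cnj (mode \<alpha> n z) = mode \<alpha> (- n) z"
  by (simp add: mode_def cis_cnj)

lemma mode_0 [simp]: "mode \<alpha> 0 z = 1"
  by (simp add: mode_def)

lemma integral_cis:
  assumes "p > 0" "b \<noteq> 0" "cis (b * p) = 1"
  shows "(LINT x|lborel. indicator {0..<p} x *\<^sub>R cis (b * x)) = 0"
proof -
  have "(LINT x|lborel. indicator {0..<p} x *\<^sub>R cis (b * x)) = (LINT x|lborel. indicator {0..p} x *\<^sub>R cis (b * x))"
  proof (rule integral_cong_AE)
    show "AE x in lborel. indicator {0..<p} x *\<^sub>R cis (b * x) = indicator {0..p} x *\<^sub>R cis (b * x)"
      by (rule AE_mp[OF AE_lborel_singleton[of p]]) (auto simp: indicator_def)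
  qed (simp_all add: cis_conv_exp)
  also have "\<dots> = cis (b * p) / (\<i> * of_real b) - cis (b * 0) / (\<i> * of_real b)"
  proof (rule integral_FTC_Icc)
    show "((\<lambda>x. cis (b * x) / (\<i> * of_real b)) has_vector_derivative cis (b * x)) (at x within {0..p})" for x
    proof -
      have "((\<lambda>z. exp (\<i> * of_real b * z) / (\<i> * of_real b)) has_field_derivative exp (\<i> * of_real b * of_real x)) (at (of_real x))"
        using assms(2) by (auto intro!: derivative_eq_intros)
      from has_vector_derivative_real_field[OF this]
      show ?thesis by (simp add: cis_conv_exp mult.assoc)
    qed
  qed (use assms in \<open>auto simp: cis_conv_exp intro!: continuous_intros\<close>)
  also have "\<dots> = 0" using assms(3) by simp
  finally show ?thesis .
qed

lemma integral_mode: "(LINT z|torus \<alpha>. mode \<alpha> n z) = (if n = 0 then of_real (area \<alpha>) else 0)"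
proof (cases "n = 0")
  case True
  then show ?thesis by (simp add: measure_torus scaleR_conv_of_real)
next
  case False
  obtain k m where n: "n = (k, m)" by (cases n)
  have int: "integrable (torus \<alpha>) (mode \<alpha> n)"
    by (rule integrable_bounded[where B = 1]) auto
  define X where "X = (LINT x|lborel. indicator {0..<2 * pi / \<alpha>} x *\<^sub>R cis (\<alpha> * real_of_int k * x))"
  have "(LINT x|lborel. indicator {0..<2 * pi / \<alpha>} x *\<^sub>R mode \<alpha> n (x, y)) = cis (real_of_int m * y) * X" for y
  proof -
    have "(LINT x|lborel. indicator {0..<2 * pi / \<alpha>} x *\<^sub>R mode \<alpha> n (x, y))
      = (LINT x|lborel. cis (real_of_int m * y) * (indicator {0..<2 * pi / \<alpha>} x *\<^sub>R cis (\<alpha> * real_of_int k * x)))"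
      by (intro Bochner_Integration.integral_cong refl) (simp add: mode_def n cis_mult add.commute mult_scaleR_right)
    then show ?thesis unfolding X_def by (simp only: integral_mult_right_zero)
  qed
  then have "(LINT z|torus \<alpha>. mode \<alpha> n z) = (LINT y|lborel. (indicator {0..<2 * pi} y *\<^sub>R cis (real_of_int m * y)) * X)"
    unfolding torus_fubini[OF int] by (simp only: mult_scaleR_left)
  also have "\<dots> = (LINT y|lborel. indicator {0..<2 * pi} y *\<^sub>R cis (real_of_int m * y)) * X"
    by (rule integral_mult_left_zero)
  also have "\<dots> = 0"
  proof (cases "k = 0")
    case True
    then have "m \<noteq> 0" using False n by (simp add: zero_prod_def)
    then have "(LINT y|lborel. indicator {0..<2 * pi} y *\<^sub>R cis (real_of_int m * y)) = 0"
      using cis_multiple_2pi[of "of_int m"] by (intro integral_cis) (auto simp: mult_ac)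
    then show ?thesis by simp
  next
    case False
    have "cis (\<alpha> * real_of_int k * (2 * pi / \<alpha>)) = 1"
      using alpha_pos cis_multiple_2pi[of "of_int k"] by (simp add: mult_ac)
    then have "X = 0" unfolding X_def
      using False alpha_pos by (intro integral_cis) auto
    then show ?thesis by simp
  qed
  finally show ?thesis using False by simp
qed

lemma sq_int_bounded:
  assumes "f \<in> borel_measurable (torus \<alpha>)" "\<And>z. norm (f z) \<le> B"
  shows "sq_int \<alpha> f"
proof -
  have "integrable (torus \<alpha>) (\<lambda>z. (norm (f z))\<^sup>2)"
  proof (rule integrable_bounded[where B = "B\<^sup>2"])
    show "(\<lambda>z. (norm (f z))\<^sup>2) \<in> borel_measurable (torus \<alpha>)" using assms(1) by measurable
    show "norm ((norm (f z))\<^sup>2) \<le> B\<^sup>2" for z using power_mono[OF assms(2)[of z], of 2] by simp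
  qed
  then show ?thesis using assms by (simp add: sq_int_def)
qed

lemma sq_int_mult:
  assumes "sq_int \<alpha> F" "sq_int \<alpha> G"
  shows "integrable (torus \<alpha>) (\<lambda>z. F z * G z)"
proof (rule Bochner_Integration.integrable_bound)
  show "integrable (torus \<alpha>) (\<lambda>z. (norm (F z))\<^sup>2 + (norm (G z))\<^sup>2)"
    using assms by (auto simp: sq_int_def)
  have [measurable]: "F \<in> borel_measurable (torus \<alpha>)" "G \<in> borel_measurable (torus \<alpha>)"
    using assms by (auto simp: sq_int_def)
  show "(\<lambda>z. F z * G z) \<in> borel_measurable (torus \<alpha>)" by measurable
  show "AE z in torus \<alpha>. norm (F z * G z) \<le> norm ((norm (F z))\<^sup>2 + (norm (G z))\<^sup>2)"
  proof (rule AE_I2)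
    fix z
    have "2 * (norm (F z) * norm (G z)) \<le> (norm (F z))\<^sup>2 + (norm (G z))\<^sup>2"
      using sum_squares_bound[of "norm (F z)" "norm (G z)"] by simp
    moreover have "0 \<le> norm (F z) * norm (G z)" by simp
    ultimately have "norm (F z) * norm (G z) \<le> (norm (F z))\<^sup>2 + (norm (G z))\<^sup>2" by linarith
    then show "norm (F z * G z) \<le> norm ((norm (F z))\<^sup>2 + (norm (G z))\<^sup>2)"
      unfolding norm_mult by simp
  qed
qed

lemma sq_int_add:
  assumes "sq_int \<alpha> F" "sq_int \<alpha> G"
  shows "sq_int \<alpha> (\<lambda>z. F z + G z)"
  unfolding sq_int_def
proof
  have [measurable]: "F \<in> borel_measurable (torus \<alpha>)" "G \<in> borel_measurable (torus \<alpha>)"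
    using assms by (auto simp: sq_int_def)
  show "(\<lambda>z. F z + G z) \<in> borel_measurable (torus \<alpha>)" by measurable
  show "integrable (torus \<alpha>) (\<lambda>z. (norm (F z + G z))\<^sup>2)"
  proof (rule Bochner_Integration.integrable_bound)
    show "integrable (torus \<alpha>) (\<lambda>z. 2 * (norm (F z))\<^sup>2 + 2 * (norm (G z))\<^sup>2)"
      using assms by (auto simp: sq_int_def)
    show "AE z in torus \<alpha>. norm ((norm (F z + G z))\<^sup>2) \<le> norm (2 * (norm (F z))\<^sup>2 + 2 * (norm (G z))\<^sup>2)"
    proof (rule AE_I2)
      fix z
      have "(norm (F z + G z))\<^sup>2 \<le> (norm (F z) + norm (G z))\<^sup>2"
        by (intro power_mono norm_triangle_ineq) auto
      also have "\<dots> \<le> 2 * (norm (F z))\<^sup>2 + 2 * (norm (G z))\<^sup>2"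
        using sum_squares_bound[of "norm (F z)" "norm (G z)"] by (simp add: power2_sum)
      finally show "norm ((norm (F z + G z))\<^sup>2) \<le> norm (2 * (norm (F z))\<^sup>2 + 2 * (norm (G z))\<^sup>2)" by simp
    qed
  qed measurable
qed

lemma sq_int_bounded_mult:
  assumes "sq_int \<alpha> F" "G \<in> borel_measurable (torus \<alpha>)" "\<And>z. norm (G z) \<le> B"
  shows "sq_int \<alpha> (\<lambda>z. G z * F z)"
  unfolding sq_int_def
proof
  have [measurable]: "F \<in> borel_measurable (torus \<alpha>)" "G \<in> borel_measurable (torus \<alpha>)"
    using assms by (auto simp: sq_int_def)
  show "(\<lambda>z. G z * F z) \<in> borel_measurable (torus \<alpha>)" by measurable
  show "integrable (torus \<alpha>) (\<lambda>z. (norm (G z * F z))\<^sup>2)"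
  proof (rule Bochner_Integration.integrable_bound)
    show "integrable (torus \<alpha>) (\<lambda>z. B\<^sup>2 * (norm (F z))\<^sup>2)"
      using assms by (auto simp: sq_int_def)
    show "AE z in torus \<alpha>. norm ((norm (G z * F z))\<^sup>2) \<le> norm (B\<^sup>2 * (norm (F z))\<^sup>2)"
      using assms(3) by (auto simp: norm_mult power_mult_distrib intro!: mult_right_mono power_mono)
  qed measurable
qed

lemma sq_int_scale: "sq_int \<alpha> F \<Longrightarrow> sq_int \<alpha> (\<lambda>z. c * F z)"
  by (rule sq_int_bounded_mult[where B = "norm c"]) auto

lemma sq_int_mode: "sq_int \<alpha> (mode \<alpha> n)"
  by (rule sq_int_bounded[where B = 1]) auto

lemma sq_int_mode_mult: "sq_int \<alpha> F \<Longrightarrow> sq_int \<alpha> (\<lambda>z. mode \<alpha> n z * F z)"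
  by (rule sq_int_bounded_mult[where B = 1]) auto

lemma sq_int_cnj: "sq_int \<alpha> F \<Longrightarrow> sq_int \<alpha> (\<lambda>z. cnj (F z))"
proof -
  assume F: "sq_int \<alpha> F"
  have "cnj \<in> borel_measurable borel" by (intro borel_measurable_continuous_onI continuous_intros)
  then show ?thesis using F measurable_compose[of F "torus \<alpha>" borel cnj borel] by (simp add: sq_int_def)
qed

lemma sq_int_diff: "sq_int \<alpha> F \<Longrightarrow> sq_int \<alpha> G \<Longrightarrow> sq_int \<alpha> (\<lambda>z. F z - G z)"
  using sq_int_add[of F "\<lambda>z. - 1 * G z"] sq_int_scale[of G "-1"] by simp

lemma sq_int_sum: "(\<And>i. i \<in> I \<Longrightarrow> sq_int \<alpha> (F i)) \<Longrightarrow> sq_int \<alpha> (\<lambda>z. \<Sum>i\<in>I. F i z)"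
  by (induction I rule: infinite_finite_induct) (simp_all add: sq_int_add sq_int_bounded[where B = 0])

lemma sq_int_integrable: "sq_int \<alpha> F \<Longrightarrow> integrable (torus \<alpha>) F"
  using sq_int_mult[of F "mode \<alpha> 0"] sq_int_mode[of 0] by simp

lemma trig_poly_sq_int: "trig_poly \<alpha> P \<Longrightarrow> sq_int \<alpha> P"
  by (induction rule: trig_poly.induct) (auto intro: sq_int_mode sq_int_add sq_int_scale)

lemma trig_poly_mult:
  assumes "trig_poly \<alpha> P" "trig_poly \<alpha> Q"
  shows "trig_poly \<alpha> (\<lambda>z. P z * Q z)"
  using assms(1)
proof induction
  case (mode n)
  show ?case using assms(2)
  proof induction
    case (mode m)
    then show ?case using trig_poly.mode[of \<alpha> "n + m"] by (simp add: mode_mult[abs_def])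
  next
    case (add P Q)
    then show ?case using trig_poly.add by (force simp: distrib_left)
  next
    case (scale P c)
    then show ?case using trig_poly.scale[OF scale(2), of c] by (simp add: mult.left_commute)
  qed
next
  case (add P Q)
  then show ?case using trig_poly.add[OF add(3,4)] by (simp add: distrib_right)
next
  case (scale P c)
  then show ?case using trig_poly.scale[OF scale(2), of c] by (simp add: mult.assoc)
qed

lemma trig_poly_const: "trig_poly \<alpha> (\<lambda>z. c)"
  using trig_poly.scale[OF trig_poly.mode[of \<alpha> 0], of c] by simp

lemma trig_poly_zero: "trig_poly \<alpha> (\<lambda>z. 0)" by (rule trig_poly_const)

lemma trig_poly_expansion:
  assumes "trig_poly \<alpha> P"
  shows "\<exists>A c. finite A \<and> P = (\<lambda>z. \<Sum>n\<in>A. c n * mode \<alpha> n z)"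
  using assms
proof induction
  case (mode n)
  show ?case by (rule exI[of _ "{n}"], rule exI[of _ "\<lambda>_. 1"]) auto
next
  case (add P Q)
  then obtain A c B d where P: "finite A" "P = (\<lambda>z. \<Sum>n\<in>A. c n * mode \<alpha> n z)"
    and Q: "finite B" "Q = (\<lambda>z. \<Sum>n\<in>B. d n * mode \<alpha> n z)" by blast
  define c' where "c' n = (if n \<in> A then c n else 0)" for n
  define d' where "d' n = (if n \<in> B then d n else 0)" for n
  have "P z = (\<Sum>n\<in>A \<union> B. c' n * mode \<alpha> n z)" for z
    unfolding P(2) c'_def using P(1) Q(1) by (intro sum.mono_neutral_cong_left) auto
  moreover have "Q z = (\<Sum>n\<in>A \<union> B. d' n * mode \<alpha> n z)" for z
    unfolding Q(2) d'_def using P(1) Q(1) by (intro sum.mono_neutral_cong_left) auto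
  ultimately have "(\<lambda>z. P z + Q z) = (\<lambda>z. \<Sum>n\<in>A \<union> B. (c' n + d' n) * mode \<alpha> n z)"
    by (simp add: distrib_right sum.distrib)
  with P(1) Q(1) show ?case
    by (intro exI[of _ "A \<union> B"] exI[of _ "\<lambda>n. c' n + d' n"]) simp
next
  case (scale P c)
  then obtain A d where P: "finite A" "P = (\<lambda>z. \<Sum>n\<in>A. d n * mode \<alpha> n z)" by blast
  then have "(\<lambda>z. c * P z) = (\<lambda>z. \<Sum>n\<in>A. (c * d n) * mode \<alpha> n z)"
    by (simp add: sum_distrib_left mult.assoc)
  with P(1) show ?case
    by (intro exI[of _ A] exI[of _ "\<lambda>n. c * d n"]) simp
qed

end

section \<open>Density of trigonometric polynomials and Parseval's identity\<close>

context flat_torus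
begin

definition ip :: "(real \<times> real \<Rightarrow> complex) \<Rightarrow> (real \<times> real \<Rightarrow> complex) \<Rightarrow> complex" where
  "ip F G = (LINT z|torus \<alpha>. F z * cnj (G z))"

definition sqn :: "(real \<times> real \<Rightarrow> complex) \<Rightarrow> real" where
  "sqn F = (LINT z|torus \<alpha>. (norm (F z))\<^sup>2)"

lemma sqn_nonneg: "0 \<le> sqn F"
  unfolding sqn_def by simp

lemma ip_self: "ip F F = of_real (sqn F)"
proof -
  have "ip F F = (LINT z|torus \<alpha>. of_real ((norm (F z))\<^sup>2))"
    unfolding ip_def by (intro Bochner_Integration.integral_cong refl) (simp add: complex_norm_square[symmetric])
  then show ?thesis by (simp only: sqn_def integral_complex_of_real)
qed

lemma ip_integrable: "sq_int \<alpha> F \<Longrightarrow> sq_int \<alpha> G \<Longrightarrow> integrable (torus \<alpha>) (\<lambda>z. F z * cnj (G z))"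
  using sq_int_mult[OF _ sq_int_cnj] by blast

lemma ip_add_left: "sq_int \<alpha> F \<Longrightarrow> sq_int \<alpha> G \<Longrightarrow> sq_int \<alpha> K \<Longrightarrow> ip (\<lambda>z. F z + G z) K = ip F K + ip G K"
  unfolding ip_def by (simp add: distrib_right ip_integrable)

lemma ip_scale_left: "ip (\<lambda>z. c * F z) K = c * ip F K"
  unfolding ip_def by (simp add: mult.assoc)

lemma ip_cnj: "ip G F = cnj (ip F G)"
proof -
  have "cnj (ip F G) = (LINT z|torus \<alpha>. cnj (F z * cnj (G z)))"
    unfolding ip_def by (rule Bochner_Integration.integral_cnj[symmetric])
  then show ?thesis by (simp add: ip_def mult.commute)
qed

lemma ip_diff_left: "sq_int \<alpha> F \<Longrightarrow> sq_int \<alpha> G \<Longrightarrow> sq_int \<alpha> K \<Longrightarrow> ip (\<lambda>z. F z - G z) K = ip F K - ip G K"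
  unfolding ip_def by (simp add: left_diff_distrib ip_integrable)

lemma ip_diff_right: "sq_int \<alpha> F \<Longrightarrow> sq_int \<alpha> G \<Longrightarrow> sq_int \<alpha> K \<Longrightarrow> ip K (\<lambda>z. F z - G z) = ip K F - ip K G"
  unfolding ip_def by (simp add: right_diff_distrib ip_integrable)

lemma ip_sum_left: "(\<And>i. i \<in> I \<Longrightarrow> sq_int \<alpha> (F i)) \<Longrightarrow> sq_int \<alpha> K \<Longrightarrow> ip (\<lambda>z. \<Sum>i\<in>I. F i z) K = (\<Sum>i\<in>I. ip (F i) K)"
  unfolding ip_def by (simp add: sum_distrib_right ip_integrable)

lemma ip_mode: "ip F (mode \<alpha> n) = of_real (area \<alpha>) * fcoef \<alpha> F n"
  using area_pos by (simp add: ip_def fcoef_def)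

lemma fcoef_mode: "fcoef \<alpha> (mode \<alpha> n) m = (if n = m then 1 else 0)"
proof -
  have "(LINT z|torus \<alpha>. mode \<alpha> n z * cnj (mode \<alpha> m z)) = (LINT z|torus \<alpha>. mode \<alpha> (n - m) z)"
    by (simp add: cnj_mode mode_mult)
  then show ?thesis using area_pos by (simp add: fcoef_def integral_mode)
qed

text \<open>The square is completed around the coefficients of \<open>F\<close>. With
  \<open>c = fcoef \<alpha> F\<close> this is Bessel's inequality; for an arbitrary approximating
  polynomial it says that passing to the coefficients of \<open>F\<close> only lowers the distance,
  which gives the reverse bound.\<close>

lemma sqn_diff_trig:
  assumes F: "sq_int \<alpha> F" and A: "finite A"
  shows "sqn (\<lambda>z. F z - (\<Sum>n\<in>A. c n * mode \<alpha> n z))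
    = sqn F + area \<alpha> * (\<Sum>n\<in>A. (norm (c n - fcoef \<alpha> F n))\<^sup>2 - (norm (fcoef \<alpha> F n))\<^sup>2)"
proof -
  define P where "P = (\<lambda>z. \<Sum>n\<in>A. c n * mode \<alpha> n z)"
  have s: "sq_int \<alpha> (\<lambda>z. c n * mode \<alpha> n z)" for n by (intro sq_int_scale sq_int_mode)
  have P: "sq_int \<alpha> P" unfolding P_def by (intro sq_int_sum s)
  have PG: "ip P G = (\<Sum>n\<in>A. c n * cnj (of_real (area \<alpha>) * fcoef \<alpha> G n))" if "sq_int \<alpha> G" for G
    unfolding P_def using s that by (subst ip_sum_left) (auto simp: ip_scale_left ip_cnj[of "mode \<alpha> _"] ip_mode)
  have fP: "fcoef \<alpha> P n = c n" if n: "n \<in> A" for n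
  proof -
    have "of_real (area \<alpha>) * fcoef \<alpha> P n = (\<Sum>m\<in>A. c m * cnj (of_real (area \<alpha>) * fcoef \<alpha> (mode \<alpha> n) m))"
      using PG[OF sq_int_mode[of n]] by (simp add: ip_mode)
    also have "\<dots> = (\<Sum>m\<in>A. if m = n then c m * of_real (area \<alpha>) else 0)"
      by (intro sum.cong refl) (auto simp: fcoef_mode)
    also have "\<dots> = of_real (area \<alpha>) * c n" using n A by (simp add: mult.commute)
    finally show ?thesis using area_pos by simp
  qed
  have "complex_of_real (sqn (\<lambda>z. F z - P z)) = (ip F F - ip P F) - (ip F P - ip P P)"
    unfolding ip_self[symmetric] using F P by (simp add: ip_diff_left ip_diff_right sq_int_diff)
  also have "\<dots> = ip F F + (ip P P - ip P F - cnj (ip P F))" by (simp add: ip_cnj[of F P])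
  also have "ip P P - ip P F - cnj (ip P F) = (\<Sum>n\<in>A. of_real (area \<alpha>) *
      (c n * cnj (c n) - c n * cnj (fcoef \<alpha> F n) - cnj (c n) * fcoef \<alpha> F n))"
    unfolding PG[OF P] PG[OF F] cnj_sum sum_subtractf[symmetric]
    by (intro sum.cong refl) (simp add: fP algebra_simps)
  also have "\<dots> = (\<Sum>n\<in>A. of_real (area \<alpha> * ((norm (c n - fcoef \<alpha> F n))\<^sup>2 - (norm (fcoef \<alpha> F n))\<^sup>2)))"
    by (intro sum.cong refl) (simp only: of_real_mult of_real_diff complex_norm_square complex_cnj_diff, simp add: algebra_simps)
  also have "ip F F + \<dots> = of_real (sqn F + area \<alpha> * (\<Sum>n\<in>A. (norm (c n - fcoef \<alpha> F n))\<^sup>2 - (norm (fcoef \<alpha> F n))\<^sup>2))"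
    unfolding ip_self by (simp only: of_real_add of_real_sum sum_distrib_left)
  finally show ?thesis unfolding P_def of_real_eq_iff .
qed

definition approximable :: "(real \<times> real \<Rightarrow> complex) \<Rightarrow> bool" where
  "approximable F \<longleftrightarrow> sq_int \<alpha> F \<and> (\<forall>e>0. \<exists>P. trig_poly \<alpha> P \<and> sqn (\<lambda>z. F z - P z) < e)"

lemma sqn_add_le:
  assumes "sq_int \<alpha> F" "sq_int \<alpha> G"
  shows "sqn (\<lambda>z. F z + G z) \<le> 2 * sqn F + 2 * sqn G"
proof -
  have "sqn (\<lambda>z. F z + G z) \<le> (LINT z|torus \<alpha>. 2 * (norm (F z))\<^sup>2 + 2 * (norm (G z))\<^sup>2)"
    unfolding sqn_def
  proof (rule integral_mono)
    show "integrable (torus \<alpha>) (\<lambda>z. (norm (F z + G z))\<^sup>2)"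
      using sq_int_add[OF assms] by (simp add: sq_int_def)
    show "integrable (torus \<alpha>) (\<lambda>z. 2 * (norm (F z))\<^sup>2 + 2 * (norm (G z))\<^sup>2)"
      using assms by (auto simp: sq_int_def)
    fix z
    have "(norm (F z + G z))\<^sup>2 \<le> (norm (F z) + norm (G z))\<^sup>2"
      by (intro power_mono norm_triangle_ineq) auto
    also have "\<dots> \<le> 2 * (norm (F z))\<^sup>2 + 2 * (norm (G z))\<^sup>2"
      using sum_squares_bound[of "norm (F z)" "norm (G z)"] by (simp add: power2_sum)
    finally show "(norm (F z + G z))\<^sup>2 \<le> 2 * (norm (F z))\<^sup>2 + 2 * (norm (G z))\<^sup>2" .
  qed
  also have "\<dots> = 2 * sqn F + 2 * sqn G" using assms by (simp add: sqn_def sq_int_def)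
  finally show ?thesis .
qed

lemma approximable_limit:
  assumes F: "sq_int \<alpha> F" and lim: "\<And>e. e > 0 \<Longrightarrow> \<exists>G. approximable G \<and> sqn (\<lambda>z. F z - G z) < e"
  shows "approximable F"
  unfolding approximable_def
proof (intro conjI allI impI F)
  fix e :: real assume e: "e > 0"
  obtain G where G: "approximable G" "sqn (\<lambda>z. F z - G z) < e / 4" using lim[of "e / 4"] e by auto
  then obtain P where P: "trig_poly \<alpha> P" "sqn (\<lambda>z. G z - P z) < e / 4"
    using e unfolding approximable_def by (meson divide_pos_pos zero_less_numeral)
  have s: "sq_int \<alpha> (\<lambda>z. F z - G z)" "sq_int \<alpha> (\<lambda>z. G z - P z)"
    using F G(1) P(1) by (auto simp: approximable_def intro: sq_int_diff trig_poly_sq_int)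
  have "sqn (\<lambda>z. F z - P z) = sqn (\<lambda>z. (F z - G z) + (G z - P z))" by simp
  also have "\<dots> \<le> 2 * sqn (\<lambda>z. F z - G z) + 2 * sqn (\<lambda>z. G z - P z)" by (rule sqn_add_le[OF s])
  also have "\<dots> < e" using G(2) P(2) by simp
  finally show "\<exists>P. trig_poly \<alpha> P \<and> sqn (\<lambda>z. F z - P z) < e" using P(1) by blast
qed

lemma approximable_trig_poly: "trig_poly \<alpha> P \<Longrightarrow> approximable P"
  unfolding approximable_def by (auto simp: trig_poly_sq_int sqn_def intro!: exI[of _ P])

lemma approximable_add:
  assumes "approximable F" "approximable G"
  shows "approximable (\<lambda>z. F z + G z)"
  unfolding approximable_def
proof (intro conjI allI impI)
  show "sq_int \<alpha> (\<lambda>z. F z + G z)" using assms by (auto simp: approximable_def intro: sq_int_add)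
  fix e :: real assume e: "e > 0"
  obtain P where P: "trig_poly \<alpha> P" "sqn (\<lambda>z. F z - P z) < e / 4"
    using assms(1) e unfolding approximable_def by (meson divide_pos_pos zero_less_numeral)
  obtain Q where Q: "trig_poly \<alpha> Q" "sqn (\<lambda>z. G z - Q z) < e / 4"
    using assms(2) e unfolding approximable_def by (meson divide_pos_pos zero_less_numeral)
  have s: "sq_int \<alpha> (\<lambda>z. F z - P z)" "sq_int \<alpha> (\<lambda>z. G z - Q z)"
    using assms P(1) Q(1) by (auto simp: approximable_def intro: sq_int_diff trig_poly_sq_int)
  have "sqn (\<lambda>z. F z + G z - (P z + Q z)) = sqn (\<lambda>z. (F z - P z) + (G z - Q z))" by (simp add: algebra_simps)
  also have "\<dots> \<le> 2 * sqn (\<lambda>z. F z - P z) + 2 * sqn (\<lambda>z. G z - Q z)" by (rule sqn_add_le[OF s])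
  also have "\<dots> < e" using P(2) Q(2) by simp
  finally show "\<exists>P. trig_poly \<alpha> P \<and> sqn (\<lambda>z. F z + G z - P z) < e"
    using trig_poly.add[OF P(1) Q(1)] by (intro exI[of _ "\<lambda>z. P z + Q z"]) simp
qed

lemma approximable_scale:
  assumes "approximable F"
  shows "approximable (\<lambda>z. c * F z)"
proof (cases "c = 0")
  case True
  then show ?thesis using approximable_trig_poly[OF trig_poly_zero] by simp
next
  case False
  show ?thesis unfolding approximable_def
  proof (intro conjI allI impI)
    show "sq_int \<alpha> (\<lambda>z. c * F z)" using assms by (auto simp: approximable_def intro: sq_int_scale)
    fix e :: real assume e: "e > 0"
    then have "e / (norm c)\<^sup>2 > 0" using False by simp
    then obtain P where P: "trig_poly \<alpha> P" "sqn (\<lambda>z. F z - P z) < e / (norm c)\<^sup>2"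
      using assms unfolding approximable_def by meson
    have "sqn (\<lambda>z. c * F z - c * P z) = (norm c)\<^sup>2 * sqn (\<lambda>z. F z - P z)"
      by (simp add: sqn_def norm_mult power_mult_distrib flip: right_diff_distrib)
    also have "\<dots> < e" using P(2) False by (simp add: field_simps)
    finally show "\<exists>P. trig_poly \<alpha> P \<and> sqn (\<lambda>z. c * F z - P z) < e"
      using trig_poly.scale[OF P(1), of c] by (intro exI[of _ "\<lambda>z. c * P z"]) simp
  qed
qed

lemma approximable_sum: "finite I \<Longrightarrow> (\<And>i. i \<in> I \<Longrightarrow> approximable (F i)) \<Longrightarrow> approximable (\<lambda>z. \<Sum>i\<in>I. F i z)"
  by (induction I rule: finite_induct) (auto intro: approximable_add approximable_trig_poly trig_poly_zero)

text \<open>Maps the plane onto the product of two unit circles. A continuous function composed with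
  \<open>wrap\<close> is automatically periodic, and lives on a compact set where Stone-Weierstrass
  applies.\<close>

definition wrap :: "real \<times> real \<Rightarrow> complex \<times> complex" where
  "wrap z = (cis (\<alpha> * fst z), cis (snd z))"

lemma continuous_wrap: "continuous_on A wrap"
  unfolding wrap_def[abs_def] cis_conv_exp by (intro continuous_intros)

lemma wrap_in: "wrap z \<in> sphere 0 1 \<times> sphere 0 1"
  by (simp add: wrap_def)

lemma wrap_inj: "inj_on wrap (cell \<alpha>)"
proof (rule inj_onI)
  have *: "s = t" if "cis s = cis t" "s \<in> {0..<2 * pi}" "t \<in> {0..<2 * pi}" for s t
  proof -
    have "sin s = sin t \<and> cos s = cos t" using that(1) by (auto simp: complex_eq_iff)
    then obtain n :: int where n: "s = t + 2 * pi * n" using sin_cos_eq_iff by blast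
    have "2 * pi * n = s - t" using n by simp
    then have "2 * pi * n < 2 * pi * 1" "2 * pi * (-1) < 2 * pi * n"
      using that(2,3) unfolding atLeastLessThan_iff by linarith+
    then have "real_of_int n < 1" "-1 < real_of_int n"
      using mult_less_cancel_left_pos[of "2 * pi"] by (metis pi_gt_zero zero_less_mult_iff zero_less_numeral)+
    then have "n = 0" by linarith
    then show ?thesis using n by simp
  qed
  fix z w assume zw: "z \<in> cell \<alpha>" "w \<in> cell \<alpha>" "wrap z = wrap w"
  have "\<alpha> * fst z = \<alpha> * fst w"
    using zw alpha_pos by (intro *) (auto simp: wrap_def cell_def field_simps)
  moreover have "snd z = snd w"
    using zw by (intro *) (auto simp: wrap_def cell_def)
  ultimately show "z = w" using alpha_pos by (simp add: prod_eq_iff)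
qed

lemma trig_poly_Re_Im:
  "trig_poly \<alpha> (\<lambda>z. of_real (Re (fst (wrap z))))" "trig_poly \<alpha> (\<lambda>z. of_real (Im (fst (wrap z))))"
  "trig_poly \<alpha> (\<lambda>z. of_real (Re (snd (wrap z))))" "trig_poly \<alpha> (\<lambda>z. of_real (Im (snd (wrap z))))"
proof -
  have re: "of_real (cos t) = 1/2 * cis t + 1/2 * cis (- t)" for t
    by (simp add: complex_eq_iff)
  have im: "of_real (sin t) = (- \<i>/2) * cis t + (\<i>/2) * cis (- t)" for t
    by (simp add: complex_eq_iff)
  have m: "mode \<alpha> (1, 0) z = cis (\<alpha> * fst z)" "mode \<alpha> (-1, 0) z = cis (- (\<alpha> * fst z))"
    "mode \<alpha> (0, 1) z = cis (snd z)" "mode \<alpha> (0, -1) z = cis (- snd z)" for z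
    by (simp_all add: mode_def)
  show "trig_poly \<alpha> (\<lambda>z. of_real (Re (fst (wrap z))))" "trig_poly \<alpha> (\<lambda>z. of_real (Im (fst (wrap z))))"
    "trig_poly \<alpha> (\<lambda>z. of_real (Re (snd (wrap z))))" "trig_poly \<alpha> (\<lambda>z. of_real (Im (snd (wrap z))))"
    unfolding wrap_def fst_conv snd_conv cis.simps re im unfolding m[symmetric]
    by (intro trig_poly.add trig_poly.scale trig_poly.mode)+
qed

text \<open>A linear functional of \<open>wrap z\<close> is a combination of its four real
  coordinates, which are cosines and sines; sums and products of trigonometric polynomials are again
  such.\<close>

lemma trig_poly_polynomial:
  assumes "real_polynomial_function p"
  shows "trig_poly \<alpha> (\<lambda>z. of_real (p (wrap z)))"
  using assms
proof induction
  case (linear f)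
  interpret f: bounded_linear f by (rule linear)
  have "f w = f (1, 0) * Re (fst w) + f (\<i>, 0) * Im (fst w) + f (0, 1) * Re (snd w) + f (0, \<i>) * Im (snd w)" for w
  proof -
    have "w = Re (fst w) *\<^sub>R (1, 0) + Im (fst w) *\<^sub>R (\<i>, 0) + Re (snd w) *\<^sub>R (0, 1) + Im (snd w) *\<^sub>R (0, \<i>)"
      by (simp add: prod_eq_iff complex_eq_iff)
    then have "f w = f (Re (fst w) *\<^sub>R (1, 0) + Im (fst w) *\<^sub>R (\<i>, 0) + Re (snd w) *\<^sub>R (0, 1) + Im (snd w) *\<^sub>R (0, \<i>))"
      by (rule arg_cong)
    then show ?thesis by (simp only: f.add f.scaleR) (simp add: mult.commute)
  qed
  then have "(\<lambda>z. complex_of_real (f (wrap z))) = (\<lambda>z. of_real (f (1, 0)) * of_real (Re (fst (wrap z)))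
     + of_real (f (\<i>, 0)) * of_real (Im (fst (wrap z))) + of_real (f (0, 1)) * of_real (Re (snd (wrap z)))
     + of_real (f (0, \<i>)) * of_real (Im (snd (wrap z))))"
    by (metis (no_types) of_real_add of_real_mult)
  then show ?case by (simp only:) (intro trig_poly.add trig_poly.scale trig_poly_Re_Im)
next
  case (const c)
  show ?case by (rule trig_poly_const)
next
  case (add f g)
  then show ?case using trig_poly.add by force
next
  case (mult f g)
  then show ?case using trig_poly_mult by force
qed

lemma approximable_continuous:
  fixes g :: "complex \<times> complex \<Rightarrow> real"
  assumes g: "continuous_on UNIV g"
  shows "approximable (\<lambda>z. of_real (g (wrap z)))"
proof -
  define S :: "(complex \<times> complex) set" where "S = sphere 0 1 \<times> sphere 0 1"
  have S: "compact S" unfolding S_def by (intro compact_Times compact_sphere)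
  have gS: "continuous_on S g" using g continuous_on_subset by blast
  have meas: "(\<lambda>z. complex_of_real (g (wrap z))) \<in> borel_measurable (torus \<alpha>)"
    by (intro borel_measurable_torus borel_measurable_continuous_onI continuous_intros
        continuous_on_compose2[OF g continuous_wrap]) auto
  obtain B where B: "\<And>w. w \<in> S \<Longrightarrow> \<bar>g w\<bar> \<le> B"
    using compact_imp_bounded[OF compact_continuous_image[OF gS S]] by (auto simp: bounded_iff)
  have sq: "sq_int \<alpha> (\<lambda>z. of_real (g (wrap z)))"
    by (rule sq_int_bounded[OF meas, of B]) (use B wrap_in in \<open>auto simp: S_def\<close>)
  show ?thesis
  proof (rule approximable_limit[OF sq])
    fix e :: real assume e: "e > 0"
    \<comment> \<open>A uniform error below \<open>d\<close> gives a squared error of at most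
      \<open>d\<^sup>2 * area \<alpha>\<close>, here \<open>e / 2\<close>.\<close>
    define d where "d = sqrt (e / (2 * area \<alpha>))"
    have d: "d > 0" "d\<^sup>2 * area \<alpha> = e / 2" using e area_pos by (auto simp: d_def)
    obtain p where p: "real_polynomial_function p" "\<And>w. w \<in> S \<Longrightarrow> \<bar>g w - p w\<bar> < d"
      using Stone_Weierstrass_real_polynomial_function[OF S gS d(1)] by blast
    have tp: "trig_poly \<alpha> (\<lambda>z. of_real (p (wrap z)))" by (rule trig_poly_polynomial[OF p(1)])
    have "sqn (\<lambda>z. of_real (g (wrap z)) - of_real (p (wrap z))) \<le> (LINT z|torus \<alpha>. d\<^sup>2)"
      unfolding sqn_def
    proof (rule integral_mono)
      show "integrable (torus \<alpha>) (\<lambda>z. (norm (of_real (g (wrap z)) - complex_of_real (p (wrap z))))\<^sup>2)"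
        using sq_int_diff[OF sq trig_poly_sq_int[OF tp]] by (simp add: sq_int_def)
      show "(norm (of_real (g (wrap z)) - complex_of_real (p (wrap z))))\<^sup>2 \<le> d\<^sup>2" for z
        using p(2)[of "wrap z"] wrap_in[of z] by (intro power_mono) (auto simp: S_def norm_of_real simp flip: of_real_diff)
    qed simp
    also have "\<dots> = e / 2" using d(2) by (simp add: measure_torus mult.commute)
    also have "\<dots> < e" using e by simp
    finally show "\<exists>G. approximable G \<and> sqn (\<lambda>z. of_real (g (wrap z)) - G z) < e"
      using approximable_trig_poly[OF tp] by blast
  qed
qed

lemma sq_int_indicator:
  assumes "D \<in> sets borel"
  shows "sq_int \<alpha> (\<lambda>z. indicator D z)"
proof (rule sq_int_bounded[where B = 1])
  show "(\<lambda>z. indicator D z) \<in> borel_measurable (torus \<alpha>)"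
    using assms by (intro borel_measurable_torus borel_measurable_indicator)
qed (simp add: indicator_def)

text \<open>The indicator is a limit of continuous cut-offs of the distance to the image of
  \<open>K\<close> under \<open>wrap\<close>. Measuring the distance after wrapping makes them
  continuous across the edges of the cell, and injectivity of \<open>wrap\<close> on the half-open
  cell makes them tend to zero off \<open>K\<close>.\<close>

lemma approximable_compact:
  assumes K: "compact K" "K \<subseteq> cell \<alpha>"
  shows "approximable (\<lambda>z. indicator K z)"
proof (cases "K = {}")
  case True
  then show ?thesis using approximable_trig_poly[OF trig_poly_zero] by simp
next
  case False
  define C where "C = wrap ` K"
  have C: "compact C" "C \<noteq> {}"
    unfolding C_def using False K continuous_wrap by (auto intro: compact_continuous_image)
  define g where "g j w = max 0 (1 - real j * infdist w C)" for j :: nat and w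
  have g01: "0 \<le> g j w" "g j w \<le> 1" for j w by (auto simp: g_def infdist_nonneg)
  have gc: "continuous_on UNIV (g j)" for j
    unfolding g_def by (intro continuous_intros)
  have ga: "approximable (\<lambda>z. of_real (g j (wrap z)))" for j by (rule approximable_continuous[OF gc])
  have sq: "sq_int \<alpha> (\<lambda>z. indicator K z)"
    using K(1) by (intro sq_int_indicator) (simp add: compact_imp_closed)
  have lim: "(\<lambda>j. (norm (indicator K z - complex_of_real (g j (wrap z))))\<^sup>2) \<longlonglongrightarrow> 0" if z: "z \<in> cell \<alpha>" for z
  proof (cases "z \<in> K")
    case True
    then have "g j (wrap z) = 1" for j by (simp add: g_def C_def)
    then show ?thesis using True by simp
  next
    case False
    then have "wrap z \<notin> C" using wrap_inj K(2) z by (auto simp: C_def inj_on_def)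
    then have pos: "infdist (wrap z) C > 0"
      using C by (intro infdist_pos_not_in_closed) (auto simp: compact_imp_closed)
    obtain J :: nat where J: "1 < real J * infdist (wrap z) C" using reals_Archimedean3[OF pos] by blast
    have "g j (wrap z) = 0" if "j \<ge> J" for j
    proof -
      have "real J * infdist (wrap z) C \<le> real j * infdist (wrap z) C"
        using that pos by (intro mult_right_mono) auto
      then show ?thesis using J by (simp add: g_def)
    qed
    then have "eventually (\<lambda>j. (norm (indicator K z - complex_of_real (g j (wrap z))))\<^sup>2 = 0) sequentially"
      using False unfolding eventually_sequentially by auto
    then show ?thesis by (rule tendsto_eventually)
  qed
  have "(\<lambda>j. sqn (\<lambda>z. indicator K z - of_real (g j (wrap z)))) \<longlonglongrightarrow> (LINT z|torus \<alpha>. 0)"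
    unfolding sqn_def
  proof (rule integral_dominated_convergence[where w = "\<lambda>_. 1"])
    show "(\<lambda>z. (norm (indicator K z - complex_of_real (g j (wrap z))))\<^sup>2) \<in> borel_measurable (torus \<alpha>)" for j
      using sq_int_diff[OF sq, of "\<lambda>z. of_real (g j (wrap z))"] ga[of j]
      by (auto simp: approximable_def sq_int_def)
    show "AE z in torus \<alpha>. (\<lambda>j. (norm (indicator K z - complex_of_real (g j (wrap z))))\<^sup>2) \<longlonglongrightarrow> 0"
      by (rule AE_I2) (use lim in simp)
    show "AE z in torus \<alpha>. norm ((norm (indicator K z - complex_of_real (g j (wrap z))))\<^sup>2) \<le> 1" for j
    proof (rule AE_I2)
      fix z
      have "indicator K z - complex_of_real (g j (wrap z)) = of_real (indicator K z - g j (wrap z))"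
        by (simp add: indicator_def)
      moreover have "\<bar>indicator K z - g j (wrap z)\<bar> \<le> 1" using g01[of j "wrap z"] by (auto simp: indicator_def)
      ultimately have "norm (indicator K z - complex_of_real (g j (wrap z))) \<le> 1"
        by (metis norm_of_real)
      then show "norm ((norm (indicator K z - complex_of_real (g j (wrap z))))\<^sup>2) \<le> 1"
        by (simp add: power_le_one)
    qed
  qed simp_all
  then have conv: "(\<lambda>j. sqn (\<lambda>z. indicator K z - of_real (g j (wrap z)))) \<longlonglongrightarrow> 0" by simp
  show ?thesis
  proof (rule approximable_limit[OF sq])
    fix e :: real assume "e > 0"
    then have "eventually (\<lambda>j. sqn (\<lambda>z. indicator K z - of_real (g j (wrap z))) < e) sequentially"
      using order_tendstoD(2)[OF conv] by blast
    then obtain j where "sqn (\<lambda>z. indicator K z - of_real (g j (wrap z))) < e"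
      using eventually_happens[of _ sequentially] by auto
    then show "\<exists>G. approximable G \<and> sqn (\<lambda>z. indicator K z - G z) < e" using ga[of j] by blast
  qed
qed

text \<open>Inner regularity of Lebesgue measure reduces a Borel set to closed subsets, and these
  are compact because the cell is bounded.\<close>

lemma approximable_indicator:
  assumes A: "A \<in> sets borel" "A \<subseteq> cell \<alpha>"
  shows "approximable (\<lambda>z. indicator A z)"
proof -
  show ?thesis
  proof (rule approximable_limit[OF sq_int_indicator[OF A(1)]])
    fix e :: real assume e: "e > 0"
    have "A \<in> sets lebesgue" using A(1) by simp
    then obtain K where K: "closed K" "K \<subseteq> A" "A - K \<in> lmeasurable" "emeasure lebesgue (A - K) < ennreal e"
      using sets_lebesgue_inner_closed e by blast
    have "bounded (cell \<alpha>)" unfolding cell_def by (intro bounded_Times) auto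
    then have Kc: "compact K" using K A(2) by (meson bounded_subset compact_eq_bounded_closed order_trans)
    have Kb: "A - K \<in> sets borel" using A(1) K(1) by auto
    have "sqn (\<lambda>z. indicator A z - indicator K z) = (LINT z|torus \<alpha>. indicator (A - K) z)"
      unfolding sqn_def using K(2) by (intro Bochner_Integration.integral_cong) (auto simp: indicator_def)
    also have "\<dots> = (LINT z|lborel. indicator (A - K) z)"
      unfolding torus_indicator(2) using A(2) by (intro Bochner_Integration.integral_cong) (auto simp: indicator_def)
    also have "\<dots> = measure lebesgue (A - K)" using Kb by simp
    also have "\<dots> < e"
      using K(3,4) e by (simp add: emeasure_eq_measure2 ennreal_less_iff)
    finally show "\<exists>G. approximable G \<and> sqn (\<lambda>z. indicator A z - G z) < e"
      using approximable_compact[OF Kc] K(2) A(2) by blast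
  qed
qed

lemma sq_int_cong: "(\<And>z. z \<in> cell \<alpha> \<Longrightarrow> F z = G z) \<Longrightarrow> sq_int \<alpha> F \<longleftrightarrow> sq_int \<alpha> G"
  unfolding sq_int_def
  by (intro arg_cong2[where f = "(\<and>)"] measurable_cong Bochner_Integration.integrable_cong) auto

lemma approximable_cong:
  assumes "\<And>z. z \<in> cell \<alpha> \<Longrightarrow> F z = G z" "approximable G"
  shows "approximable F"
proof -
  have "sqn (\<lambda>z. F z - P z) = sqn (\<lambda>z. G z - P z)" for P
    unfolding sqn_def using assms(1) by (intro Bochner_Integration.integral_cong) auto
  then show ?thesis using assms(2) sq_int_cong[OF assms(1)] by (simp add: approximable_def)
qed

lemma approximable_simple:
  fixes f :: "real \<times> real \<Rightarrow> complex"
  assumes f: "simple_function (torus \<alpha>) f"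
  shows "approximable f"
proof -
  define D where "D y = f -` {y} \<inter> cell \<alpha>" for y
  have D: "D y \<in> sets borel" "D y \<subseteq> cell \<alpha>" for y
  proof -
    have "D y \<in> sets (torus \<alpha>)" unfolding D_def using simple_functionD(2)[OF f] by simp
    then show "D y \<in> sets borel" by (auto simp: torus_eq sets_restrict_space)
  qed (auto simp: D_def)
  have "approximable (\<lambda>z. \<Sum>y\<in>f ` cell \<alpha>. y * indicator (D y) z)"
  proof (rule approximable_sum)
    show "finite (f ` cell \<alpha>)" using simple_functionD(1)[OF f] by simp
    show "approximable (\<lambda>z. y * indicator (D y) z)" for y
      by (rule approximable_scale[OF approximable_indicator[OF D]])
  qed
  moreover have "f z = (\<Sum>y\<in>f ` cell \<alpha>. y * indicator (D y) z)" if "z \<in> cell \<alpha>" for z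
  proof -
    have "indicator (D y) z *\<^sub>R y = y * indicator (D y) z" for y
      by (simp add: indicator_def)
    then show ?thesis
      using simple_function_indicator_representation_banach[OF f, of z] that unfolding space_torus D_def
      by (simp only:)
  qed
  ultimately show ?thesis by (rule approximable_cong[rotated])
qed

text \<open>Simple functions \<open>s i\<close> with
  \<open>norm (s i z) \<le> 2 * norm (F z)\<close> converge to \<open>F\<close>, so
  \<open>9 * (norm (F z))\<^sup>2\<close> dominates the squared errors.\<close>

lemma approximable_sq_int:
  assumes F: "sq_int \<alpha> F"
  shows "approximable F"
proof -
  have [measurable]: "F \<in> borel_measurable (torus \<alpha>)" using F by (simp add: sq_int_def)
  obtain s where s: "\<And>i. simple_function (torus \<alpha>) (s i)"
    and s_lim: "\<And>z. z \<in> cell \<alpha> \<Longrightarrow> (\<lambda>i. s i z) \<longlonglongrightarrow> F z"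
    and s_le: "\<And>i z. z \<in> cell \<alpha> \<Longrightarrow> dist (s i z) 0 \<le> 2 * dist (F z) 0"
  proof -
    obtain s where "(\<forall>i. simple_function (torus \<alpha>) (s i)) \<and> (\<forall>x\<in>cell \<alpha>. (\<lambda>i. s i x) \<longlonglongrightarrow> F x) \<and>
       (\<forall>i. \<forall>x\<in>cell \<alpha>. dist (s i x) 0 \<le> 2 * dist (F x) 0)"
      using borel_measurable_implies_sequence_metric[of F "torus \<alpha>" 0] unfolding space_torus by auto
    then show thesis by (intro that[of s]) blast+
  qed
  have [measurable]: "s i \<in> borel_measurable (torus \<alpha>)" for i
    using borel_measurable_simple_function[OF s] .
  have "(\<lambda>i. sqn (\<lambda>z. F z - s i z)) \<longlonglongrightarrow> (LINT z|torus \<alpha>. 0)"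
    unfolding sqn_def
  proof (rule integral_dominated_convergence[where w = "\<lambda>z. 9 * (norm (F z))\<^sup>2"])
    show "integrable (torus \<alpha>) (\<lambda>z. 9 * (norm (F z))\<^sup>2)" using F by (simp add: sq_int_def)
    show "AE z in torus \<alpha>. (\<lambda>i. (norm (F z - s i z))\<^sup>2) \<longlonglongrightarrow> 0"
    proof (rule AE_I2)
      fix z assume "z \<in> space (torus \<alpha>)"
      then have "(\<lambda>i. (norm (F z - s i z))\<^sup>2) \<longlonglongrightarrow> (norm (F z - F z))\<^sup>2"
        by (intro tendsto_intros s_lim) simp
      then show "(\<lambda>i. (norm (F z - s i z))\<^sup>2) \<longlonglongrightarrow> 0" by simp
    qed
    show "AE z in torus \<alpha>. norm ((norm (F z - s i z))\<^sup>2) \<le> 9 * (norm (F z))\<^sup>2" for i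
    proof (rule AE_I2)
      fix z assume "z \<in> space (torus \<alpha>)"
      then have "norm (F z - s i z) \<le> 3 * norm (F z)"
        using s_le[of z i] norm_triangle_ineq4[of "F z" "s i z"] by simp
      then have "(norm (F z - s i z))\<^sup>2 \<le> (3 * norm (F z))\<^sup>2" by (intro power_mono) auto
      then show "norm ((norm (F z - s i z))\<^sup>2) \<le> 9 * (norm (F z))\<^sup>2" by (simp add: power_mult_distrib)
    qed
  qed measurable
  then have conv: "(\<lambda>i. sqn (\<lambda>z. F z - s i z)) \<longlonglongrightarrow> 0" by simp
  show ?thesis
  proof (rule approximable_limit[OF F])
    fix e :: real assume "e > 0"
    then have "eventually (\<lambda>i. sqn (\<lambda>z. F z - s i z) < e) sequentially"
      using order_tendstoD(2)[OF conv] by blast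
    then obtain i where "sqn (\<lambda>z. F z - s i z) < e"
      using eventually_happens[of _ sequentially] by auto
    then show "\<exists>G. approximable G \<and> sqn (\<lambda>z. F z - G z) < e" using approximable_simple[OF s, of i] by blast
  qed
qed

text \<open>Bessel's inequality bounds all finite sums from above. A trigonometric polynomial close
  to \<open>F\<close> supplies a finite set of modes whose sum is already within \<open>e\<close> of
  the total, and larger sets can only gain.\<close>

theorem parseval:
  assumes F: "sq_int \<alpha> F"
  shows "((\<lambda>n. (norm (fcoef \<alpha> F n))\<^sup>2) has_sum sqn F / area \<alpha>) UNIV"
proof -
  define f where "f n = (norm (fcoef \<alpha> F n))\<^sup>2" for n
  have upper: "sum f A \<le> sqn F / area \<alpha>" if "finite A" for A
  proof -
    have "0 \<le> sqn (\<lambda>z. F z - (\<Sum>n\<in>A. fcoef \<alpha> F n * mode \<alpha> n z))" by (rule sqn_nonneg)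
    then have "area \<alpha> * sum f A \<le> sqn F"
      by (simp add: sqn_diff_trig[OF F that] f_def sum_negf)
    then show ?thesis using area_pos by (simp add: pos_le_divide_eq mult.commute)
  qed
  have "(sum f \<longlongrightarrow> sqn F / area \<alpha>) (finite_subsets_at_top UNIV)"
    unfolding tendsto_iff eventually_finite_subsets_at_top
  proof (intro allI impI)
    fix e :: real assume e: "e > 0"
    then have "e * area \<alpha> > 0" using area_pos by simp
    then obtain P where P: "trig_poly \<alpha> P" "sqn (\<lambda>z. F z - P z) < e * area \<alpha>"
      using approximable_sq_int[OF F] unfolding approximable_def by blast
    obtain A c where A: "finite A" "P = (\<lambda>z. \<Sum>n\<in>A. c n * mode \<alpha> n z)"
      using trig_poly_expansion[OF P(1)] by blast
    have "sqn F + area \<alpha> * (\<Sum>n\<in>A. - f n) \<le> sqn F + area \<alpha> * (\<Sum>n\<in>A. (norm (c n - fcoef \<alpha> F n))\<^sup>2 - (norm (fcoef \<alpha> F n))\<^sup>2)"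
      using area_pos by (intro add_left_mono mult_left_mono sum_mono) (auto simp: f_def)
    also have "\<dots> < e * area \<alpha>" using P(2) unfolding A(2) sqn_diff_trig[OF F A(1)] .
    finally have "sqn F < (e + sum f A) * area \<alpha>" by (simp add: sum_negf algebra_simps)
    then have lower: "sqn F / area \<alpha> < e + sum f A" using area_pos by (simp add: pos_divide_less_eq)
    show "\<exists>X. finite X \<and> X \<subseteq> UNIV \<and> (\<forall>Y. finite Y \<and> X \<subseteq> Y \<and> Y \<subseteq> UNIV \<longrightarrow> dist (sum f Y) (sqn F / area \<alpha>) < e)"
    proof (intro exI[of _ A] conjI allI impI)
      fix Y :: "(int \<times> int) set" assume Y: "finite Y \<and> A \<subseteq> Y \<and> Y \<subseteq> UNIV"
      have "sum f A \<le> sum f Y" using Y by (intro sum_mono2) (auto simp: f_def)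
      then show "dist (sum f Y) (sqn F / area \<alpha>) < e"
        using lower upper[of Y] Y by (simp add: dist_real_def)
    qed (use A in auto)
  qed
  then show ?thesis unfolding has_sum_def f_def .
qed

lemma fcoef_add: "sq_int \<alpha> F \<Longrightarrow> sq_int \<alpha> G \<Longrightarrow> fcoef \<alpha> (\<lambda>z. F z + G z) n = fcoef \<alpha> F n + fcoef \<alpha> G n"
  using ip_add_left[OF _ _ sq_int_mode, of F G n] area_pos by (simp add: ip_mode flip: distrib_left)

lemma fcoef_scale: "fcoef \<alpha> (\<lambda>z. c * F z) n = c * fcoef \<alpha> F n"
  by (simp add: fcoef_def mult.assoc)

lemma fcoef_diff: "sq_int \<alpha> F \<Longrightarrow> sq_int \<alpha> G \<Longrightarrow> fcoef \<alpha> (\<lambda>z. F z - G z) n = fcoef \<alpha> F n - fcoef \<alpha> G n"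
  using ip_diff_left[OF _ _ sq_int_mode, of F G n] area_pos by (simp add: ip_mode flip: right_diff_distrib)

lemma fcoef_mode_mult: "fcoef \<alpha> (\<lambda>z. mode \<alpha> m z * F z) n = fcoef \<alpha> F (n - m)"
proof -
  have "(\<lambda>z. mode \<alpha> m z * F z * cnj (mode \<alpha> n z)) = (\<lambda>z. F z * cnj (mode \<alpha> (n - m) z))"
    by (simp add: cnj_mode mode_mult mult.assoc mult.left_commute[of _ "F _"])
  then show ?thesis unfolding fcoef_def by (simp only:)
qed

lemma fcoef_cnj: "fcoef \<alpha> (\<lambda>z. cnj (F z)) n = cnj (fcoef \<alpha> F (- n))"
proof -
  have "(\<lambda>z. cnj (F z) * cnj (mode \<alpha> n z)) = (\<lambda>z. cnj (F z * cnj (mode \<alpha> (- n) z)))"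
    by (simp add: cnj_mode)
  then have "(LINT z|torus \<alpha>. cnj (F z) * cnj (mode \<alpha> n z)) = cnj (LINT z|torus \<alpha>. F z * cnj (mode \<alpha> (- n) z))"
    by (simp only: Bochner_Integration.integral_cnj)
  then show ?thesis unfolding fcoef_def by simp
qed

lemma sqn_add: 
  assumes "sq_int \<alpha> F" "sq_int \<alpha> G"
  shows "sqn (\<lambda>z. F z + G z) = sqn F + sqn G + 2 * Re (ip F G)"
proof -
  have c: "cnj (ip F F) = ip F F" "cnj (ip G G) = ip G G" by (simp_all add: ip_self)
  have "of_real (sqn (\<lambda>z. F z + G z)) = ip F F + ip G G + (ip F G + cnj (ip F G))"
    unfolding ip_self[symmetric]
    using assms ip_cnj[of F "\<lambda>z. F z + G z"] ip_cnj[of G "\<lambda>z. F z + G z"]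
    by (simp add: ip_add_left sq_int_add ip_cnj[of G F] c)
  also have "\<dots> = of_real (sqn F + sqn G + 2 * Re (ip F G))"
    by (simp add: ip_self complex_add_cnj)
  finally show ?thesis by (simp only: of_real_eq_iff)
qed

text \<open>Polarization: the real part comes from Parseval for the sum of the two functions, the
  imaginary part from the same argument with \<open>- \<i> * F\<close> in place of
  \<open>F\<close>.\<close>

theorem parseval_inner:
  assumes F: "sq_int \<alpha> F" and G: "sq_int \<alpha> G"
  shows "((\<lambda>n. fcoef \<alpha> F n * cnj (fcoef \<alpha> G n)) has_sum ip F G / of_real (area \<alpha>)) UNIV"
proof -
  have re: "((\<lambda>n. Re (fcoef \<alpha> F n * cnj (fcoef \<alpha> G n))) has_sum Re (ip F G) / area \<alpha>) UNIV"
    if F: "sq_int \<alpha> F" and G: "sq_int \<alpha> G" for F G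
  proof -
    have "((\<lambda>n. ((norm (fcoef \<alpha> (\<lambda>z. F z + G z) n))\<^sup>2 + - (norm (fcoef \<alpha> F n))\<^sup>2) + - (norm (fcoef \<alpha> G n))\<^sup>2)
        has_sum ((sqn (\<lambda>z. F z + G z) / area \<alpha> + - (sqn F / area \<alpha>)) + - (sqn G / area \<alpha>))) UNIV"
      by (intro has_sum_add has_sum_uminusI parseval sq_int_add F G)
    then have "((\<lambda>n. 1 / 2 * (((norm (fcoef \<alpha> (\<lambda>z. F z + G z) n))\<^sup>2 + - (norm (fcoef \<alpha> F n))\<^sup>2) + - (norm (fcoef \<alpha> G n))\<^sup>2))
        has_sum (1 / 2 * ((sqn (\<lambda>z. F z + G z) / area \<alpha> + - (sqn F / area \<alpha>)) + - (sqn G / area \<alpha>)))) UNIV"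
      by (rule has_sum_cmult_right)
    moreover have "1 / 2 * (((norm (fcoef \<alpha> (\<lambda>z. F z + G z) n))\<^sup>2 + - (norm (fcoef \<alpha> F n))\<^sup>2) + - (norm (fcoef \<alpha> G n))\<^sup>2)
      = Re (fcoef \<alpha> F n * cnj (fcoef \<alpha> G n))" for n
      unfolding fcoef_add[OF F G] cmod_power2 by (simp add: power2_eq_square algebra_simps)
    moreover have "1 / 2 * ((sqn (\<lambda>z. F z + G z) / area \<alpha> + - (sqn F / area \<alpha>)) + - (sqn G / area \<alpha>)) = Re (ip F G) / area \<alpha>"
      unfolding sqn_add[OF F G] by (simp add: add_divide_distrib)
    ultimately show ?thesis by (simp only:)
  qed
  have im: "((\<lambda>n. Im (fcoef \<alpha> F n * cnj (fcoef \<alpha> G n))) has_sum Im (ip F G) / area \<alpha>) UNIV"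
    using re[OF sq_int_scale[OF F, of "- \<i>"] G] unfolding fcoef_scale ip_scale_left by simp
  have "((\<lambda>n. of_real (Re (fcoef \<alpha> F n * cnj (fcoef \<alpha> G n))) + \<i> * of_real (Im (fcoef \<alpha> F n * cnj (fcoef \<alpha> G n))))
     has_sum (of_real (Re (ip F G) / area \<alpha>) + \<i> * of_real (Im (ip F G) / area \<alpha>))) UNIV"
    by (intro has_sum_add has_sum_cmult_right has_sum_of_real re[OF F G] im)
  moreover have "of_real (Re (ip F G) / area \<alpha>) + \<i> * of_real (Im (ip F G) / area \<alpha>) = ip F G / of_real (area \<alpha>)"
    by (simp add: complex_eq_iff)
  moreover have "of_real (Re (fcoef \<alpha> F n * cnj (fcoef \<alpha> G n))) + \<i> * of_real (Im (fcoef \<alpha> F n * cnj (fcoef \<alpha> G n)))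
     = fcoef \<alpha> F n * cnj (fcoef \<alpha> G n)" for n by (simp add: complex_eq_iff)
  ultimately show ?thesis by (simp only:)
qed

text \<open>The coefficient of a product is the inner product of \<open>F\<close> with
  \<open>mode \<alpha> n z * cnj (G z)\<close>, so the convolution formula is Parseval once more. It
  covers products that are merely integrable, as the Jacobian of two square integrable gradients
  is.\<close>

theorem fcoef_product:
  assumes F: "sq_int \<alpha> F" and G: "sq_int \<alpha> G"
  shows "((\<lambda>p. fcoef \<alpha> F p * fcoef \<alpha> G (n - p)) has_sum fcoef \<alpha> (\<lambda>z. F z * G z) n) UNIV"
proof -
  define K where "K z = mode \<alpha> n z * cnj (G z)" for z
  have K: "sq_int \<alpha> K" unfolding K_def by (intro sq_int_mode_mult sq_int_cnj G)
  have "cnj (fcoef \<alpha> K p) = fcoef \<alpha> G (n - p)" for p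
    unfolding K_def fcoef_mode_mult fcoef_cnj by simp
  moreover have "ip F K / of_real (area \<alpha>) = fcoef \<alpha> (\<lambda>z. F z * G z) n"
    by (simp add: ip_def K_def fcoef_def mult_ac)
  ultimately show ?thesis using parseval_inner[OF F K] by simp
qed

end

section \<open>The Jacobian as a convolution\<close>

lemma infsum_Cauchy_Schwarz:
  fixes f g :: "'a \<Rightarrow> real"
  assumes f: "(\<lambda>x. (f x)\<^sup>2) summable_on A" and g: "(\<lambda>x. (g x)\<^sup>2) summable_on A"
    and nonneg: "\<And>x. x \<in> A \<Longrightarrow> 0 \<le> f x" "\<And>x. x \<in> A \<Longrightarrow> 0 \<le> g x"
  shows "(\<lambda>x. f x * g x) summable_on A"
    and "(\<Sum>\<^sub>\<infinity>x\<in>A. f x * g x) \<le> sqrt (\<Sum>\<^sub>\<infinity>x\<in>A. (f x)\<^sup>2) * sqrt (\<Sum>\<^sub>\<infinity>x\<in>A. (g x)\<^sup>2)"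
proof -
  have fin: "(\<Sum>x\<in>F. f x * g x) \<le> sqrt (\<Sum>\<^sub>\<infinity>x\<in>A. (f x)\<^sup>2) * sqrt (\<Sum>\<^sub>\<infinity>x\<in>A. (g x)\<^sup>2)"
    if F: "finite F" "F \<subseteq> A" for F
  proof -
    have "(\<Sum>x\<in>F. f x * g x)\<^sup>2 \<le> (\<Sum>x\<in>F. (f x)\<^sup>2) * (\<Sum>x\<in>F. (g x)\<^sup>2)"
      by (rule Cauchy_Schwarz_ineq_sum)
    also have "\<dots> \<le> (\<Sum>\<^sub>\<infinity>x\<in>A. (f x)\<^sup>2) * (\<Sum>\<^sub>\<infinity>x\<in>A. (g x)\<^sup>2)"
      by (intro mult_mono finite_sum_le_infsum f g F infsum_nonneg sum_nonneg) auto
    finally show ?thesis by (metis real_le_rsqrt real_sqrt_mult)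
  qed
  show s: "(\<lambda>x. f x * g x) summable_on A"
    by (rule nonneg_bdd_above_summable_on)
      (use fin nonneg in \<open>auto intro!: bdd_aboveI2[where M = "sqrt (\<Sum>\<^sub>\<infinity>x\<in>A. (f x)\<^sup>2) * sqrt (\<Sum>\<^sub>\<infinity>x\<in>A. (g x)\<^sup>2)"] mult_nonneg_nonneg\<close>)
  show "(\<Sum>\<^sub>\<infinity>x\<in>A. f x * g x) \<le> sqrt (\<Sum>\<^sub>\<infinity>x\<in>A. (f x)\<^sup>2) * sqrt (\<Sum>\<^sub>\<infinity>x\<in>A. (g x)\<^sup>2)"
    by (rule infsum_le_finite_sums[OF s fin])
qed

lemma norm_has_sum_le:
  fixes f :: "'a \<Rightarrow> complex"
  assumes "(f has_sum s) A" "g summable_on A" "\<And>x. x \<in> A \<Longrightarrow> norm (f x) \<le> g x"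
  shows "norm s \<le> (\<Sum>\<^sub>\<infinity>x\<in>A. g x)"
proof -
  have g: "0 \<le> g x" if "x \<in> A" for x using assms(3)[OF that] norm_ge_zero order_trans by blast
  have abs: "(\<lambda>x. norm (f x)) summable_on A"
    by (rule summable_on_comparison_test[OF assms(2)]) (use assms(3) in auto)
  have "norm s = norm (\<Sum>\<^sub>\<infinity>x\<in>A. f x)" using assms(1) by (simp add: infsumI)
  also have "\<dots> \<le> (\<Sum>\<^sub>\<infinity>x\<in>A. norm (f x))" by (rule norm_infsum_bound[OF abs])
  also have "\<dots> \<le> (\<Sum>\<^sub>\<infinity>x\<in>A. g x)" by (rule infsum_mono[OF abs assms(2,3)])
  finally show ?thesis .
qed

lemma has_sum_finite_sum:
  fixes f :: "'i \<Rightarrow> 'a \<Rightarrow> real"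
  assumes "\<And>i. i \<in> I \<Longrightarrow> (f i has_sum s i) A"
  shows "((\<lambda>x. \<Sum>i\<in>I. f i x) has_sum (\<Sum>i\<in>I. s i)) A"
  using assms by (induction I rule: infinite_finite_induct) (auto intro: has_sum_add)

text \<open>Young's inequality for a summable and a square summable sequence: Cauchy-Schwarz with
  weight \<open>a\<close>, followed by an exchange of the finite sum over \<open>n\<close> with the
  sum over \<open>p\<close>.\<close>

lemma young_convolution:
  fixes a b :: "'g::ab_group_add \<Rightarrow> real"
  assumes a: "a summable_on UNIV" "\<And>p. 0 \<le> a p"
    and b: "(\<lambda>p. (b p)\<^sup>2) summable_on UNIV" "\<And>p. 0 \<le> b p"
  shows "(\<lambda>p. a p * b (n - p)) summable_on UNIV"
    and "finite F \<Longrightarrow> (\<Sum>n\<in>F. (\<Sum>\<^sub>\<infinity>p. a p * b (n - p))\<^sup>2) \<le> (\<Sum>\<^sub>\<infinity>p. a p)\<^sup>2 * (\<Sum>\<^sub>\<infinity>p. (b p)\<^sup>2)"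
proof -
  define B where "B = (\<Sum>\<^sub>\<infinity>p. (b p)\<^sup>2)"
  have B: "(b p)\<^sup>2 \<le> B" for p
    using finite_sum_le_infsum[OF b(1), of "{p}"] by (simp add: B_def)
  then have b1: "b p \<le> sqrt B" for p using real_le_rsqrt by blast
  have sq: "(\<lambda>p. a p * (b (n - p))\<^sup>2) summable_on UNIV" for n
    by (rule summable_on_comparison_test[OF summable_on_cmult_left[OF a(1), of B]])
      (use a B in \<open>auto intro!: mult_left_mono mult_nonneg_nonneg\<close>)
  show s: "(\<lambda>p. a p * b (n - p)) summable_on UNIV" for n
    by (rule summable_on_comparison_test[OF summable_on_cmult_left[OF a(1), of "sqrt B"]])
      (use a b b1 in \<open>auto intro!: mult_left_mono mult_nonneg_nonneg\<close>)
  have pt: "(\<Sum>\<^sub>\<infinity>p. a p * b (n - p))\<^sup>2 \<le> (\<Sum>\<^sub>\<infinity>p. a p) * (\<Sum>\<^sub>\<infinity>p. a p * (b (n - p))\<^sup>2)" for n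
  proof -
    have e: "(\<Sum>\<^sub>\<infinity>p. (sqrt (a p))\<^sup>2) = (\<Sum>\<^sub>\<infinity>p. a p)" "(\<Sum>\<^sub>\<infinity>p. (sqrt (a p) * b (n - p))\<^sup>2) = (\<Sum>\<^sub>\<infinity>p. a p * (b (n - p))\<^sup>2)"
      "(\<Sum>\<^sub>\<infinity>p. sqrt (a p) * (sqrt (a p) * b (n - p))) = (\<Sum>\<^sub>\<infinity>p. a p * b (n - p))"
      using a(2) by (auto simp: power_mult_distrib mult.assoc[symmetric] intro!: infsum_cong)
    have "(\<Sum>\<^sub>\<infinity>p. sqrt (a p) * (sqrt (a p) * b (n - p)))
       \<le> sqrt (\<Sum>\<^sub>\<infinity>p. (sqrt (a p))\<^sup>2) * sqrt (\<Sum>\<^sub>\<infinity>p. (sqrt (a p) * b (n - p))\<^sup>2)"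
      by (rule infsum_Cauchy_Schwarz) (use a b sq in \<open>auto simp: power_mult_distrib\<close>)
    then have "(\<Sum>\<^sub>\<infinity>p. a p * b (n - p)) \<le> sqrt ((\<Sum>\<^sub>\<infinity>p. a p) * (\<Sum>\<^sub>\<infinity>p. a p * (b (n - p))\<^sup>2))"
      unfolding e real_sqrt_mult .
    moreover have "0 \<le> (\<Sum>\<^sub>\<infinity>p. a p * b (n - p))"
      by (intro infsum_nonneg mult_nonneg_nonneg a b)
    moreover have "0 \<le> (\<Sum>\<^sub>\<infinity>p. a p) * (\<Sum>\<^sub>\<infinity>p. a p * (b (n - p))\<^sup>2)"
      by (intro mult_nonneg_nonneg infsum_nonneg a) auto
    ultimately show ?thesis by (metis power_mono real_sqrt_pow2)
  qed
  show "(\<Sum>n\<in>F. (\<Sum>\<^sub>\<infinity>p. a p * b (n - p))\<^sup>2) \<le> (\<Sum>\<^sub>\<infinity>p. a p)\<^sup>2 * (\<Sum>\<^sub>\<infinity>p. (b p)\<^sup>2)" if F: "finite F"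
  proof -
    have A: "0 \<le> (\<Sum>\<^sub>\<infinity>p. a p)" by (intro infsum_nonneg a)
    have hs: "((\<lambda>p. \<Sum>n\<in>F. a p * (b (n - p))\<^sup>2) has_sum (\<Sum>n\<in>F. \<Sum>\<^sub>\<infinity>p. a p * (b (n - p))\<^sup>2)) UNIV"
      by (rule has_sum_finite_sum) (rule has_sum_infsum[OF sq])
    have "(\<Sum>n\<in>F. (\<Sum>\<^sub>\<infinity>p. a p * b (n - p))\<^sup>2) \<le> (\<Sum>n\<in>F. (\<Sum>\<^sub>\<infinity>p. a p) * (\<Sum>\<^sub>\<infinity>p. a p * (b (n - p))\<^sup>2))"
      by (intro sum_mono pt)
    also have "\<dots> = (\<Sum>\<^sub>\<infinity>p. a p) * (\<Sum>n\<in>F. \<Sum>\<^sub>\<infinity>p. a p * (b (n - p))\<^sup>2)"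
      by (simp add: sum_distrib_left)
    also have "(\<Sum>n\<in>F. \<Sum>\<^sub>\<infinity>p. a p * (b (n - p))\<^sup>2) = (\<Sum>\<^sub>\<infinity>p. \<Sum>n\<in>F. a p * (b (n - p))\<^sup>2)"
      by (rule infsumI[OF hs, symmetric])
    also have "\<dots> \<le> (\<Sum>\<^sub>\<infinity>p. a p * B)"
    proof (rule infsum_mono)
      show "(\<lambda>p. \<Sum>n\<in>F. a p * (b (n - p))\<^sup>2) summable_on UNIV" 
        by (rule has_sum_imp_summable[OF hs])
      show "(\<lambda>p. a p * B) summable_on UNIV" using a by (intro summable_on_cmult_left)
      fix p
      have "(\<Sum>n\<in>F. (b (n - p))\<^sup>2) = (\<Sum>n\<in>(\<lambda>n. n - p) ` F. (b n)\<^sup>2)"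
        by (subst sum.reindex) (auto simp: inj_on_def)
      also have "\<dots> \<le> B" unfolding B_def using F by (intro finite_sum_le_infsum b) auto
      finally show "(\<Sum>n\<in>F. a p * (b (n - p))\<^sup>2) \<le> a p * B"
        using a(2) by (simp add: mult_left_mono flip: sum_distrib_left)
    qed
    also have "\<dots> = (\<Sum>\<^sub>\<infinity>p. a p) * B" by (rule infsum_cmult_left')
    finally show ?thesis using A by (simp add: B_def power2_eq_square mult.assoc mult_left_mono)
  qed
qed

text \<open>Symmetric partial sums are compared with a telescoping sum. The pair
  \<open>N + 1\<close> and \<open>- N - 1\<close> adds
  \<open>2 / (1 + x\<^sup>2) \<le> 4 / x - 4 / (x + 1)\<close> with \<open>x = N + 1\<close>, and
  the bound \<open>5 - 4 / (N + 1)\<close> is exact at \<open>N = 0\<close>.\<close>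

lemma summable_inverse_square_int: "(\<lambda>k::int. 1 / (1 + (real_of_int k)\<^sup>2)) summable_on UNIV"
proof (rule nonneg_bdd_above_summable_on)
  have box: "(\<Sum>k\<in>{- int N..int N}. 1 / (1 + (real_of_int k)\<^sup>2)) \<le> 5 - 4 / (real N + 1)" for N
  proof (induction N)
    case (Suc N)
    define x where "x = real N + 1"
    have x: "x \<ge> 1" by (simp add: x_def)
    have e: "{- int (Suc N)..int (Suc N)} = insert (int N + 1) (insert (- int N - 1) {- int N..int N})" by auto
    have "(- real N - 1)\<^sup>2 = x\<^sup>2" by (simp add: x_def power2_eq_square algebra_simps)
    then have "(\<Sum>k\<in>{- int (Suc N)..int (Suc N)}. 1 / (1 + (real_of_int k)\<^sup>2))
       = 2 / (1 + x\<^sup>2) + (\<Sum>k\<in>{- int N..int N}. 1 / (1 + (real_of_int k)\<^sup>2))"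
      unfolding e by (simp add: x_def)
    also have "\<dots> \<le> (4 / x - 4 / (x + 1)) + (5 - 4 / x)"
    proof (rule add_mono)
      have "2 * (x * (x + 1)) \<le> 4 * (1 + x\<^sup>2)"
      proof -
        have "0 \<le> (x - 1) * (x - 1)" "0 \<le> x * x" by simp_all
        moreover have "(x - 1) * (x - 1) = x * x - 2 * x + 1" "2 * (x * (x + 1)) = 2 * (x * x) + 2 * x"
          "4 * (1 + x\<^sup>2) = 4 + 4 * (x * x)"
          by (simp_all add: power2_eq_square algebra_simps)
        ultimately show ?thesis by linarith
      qed
      then have "2 / (1 + x\<^sup>2) \<le> 4 / (x * (x + 1))"
      proof -
        have p: "0 < 1 + x\<^sup>2" "0 < x * (x + 1)" using x by (auto intro: add_pos_nonneg)
        assume le: "2 * (x * (x + 1)) \<le> 4 * (1 + x\<^sup>2)"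
        have "2 \<le> 4 * (1 + x\<^sup>2) / (x * (x + 1))" by (rule mult_imp_le_div_pos[OF p(2) le])
        then show ?thesis by (intro mult_imp_div_pos_le[OF p(1)]) (simp add: mult.commute)
      qed
      also have "\<dots> = 4 / x - 4 / (x + 1)" using x by (simp add: field_simps)
      finally show "2 / (1 + x\<^sup>2) \<le> 4 / x - 4 / (x + 1)" .
    qed (use Suc in \<open>simp add: x_def\<close>)
    finally show ?case by (simp add: x_def add.commute)
  qed simp
  show "bdd_above (sum (\<lambda>k::int. 1 / (1 + (real_of_int k)\<^sup>2)) ` {F. F \<subseteq> UNIV \<and> finite F})"
  proof (rule bdd_aboveI2)
    fix F :: "int set" assume "F \<in> {F. F \<subseteq> UNIV \<and> finite F}"
    then have F: "finite F" by simp
    define N where "N = nat (Max (insert 0 (abs ` F)))"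
    have "F \<subseteq> {- int N..int N}"
    proof
      fix k assume "k \<in> F"
      then have "\<bar>k\<bar> \<le> Max (insert 0 (abs ` F))" using F by (intro Max_ge) auto
      also have "\<dots> \<le> int N" unfolding N_def by simp
      finally show "k \<in> {- int N..int N}" by auto
    qed
    then have "(\<Sum>k\<in>F. 1 / (1 + (real_of_int k)\<^sup>2)) \<le> (\<Sum>k\<in>{- int N..int N}. 1 / (1 + (real_of_int k)\<^sup>2))"
      by (intro sum_mono2) auto
    also have "\<dots> \<le> 5 - 4 / (real N + 1)" by (rule box)
    also have "\<dots> \<le> 5" by simp
    finally show "(\<Sum>k\<in>F. 1 / (1 + (real_of_int k)\<^sup>2)) \<le> 5" .
  qed
qed simp

text \<open>The inverse fourth power of the length is summable in two dimensions, by comparison with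
  a product of two one-dimensional series. At \<open>n = 0\<close> the summand is 0, because
  division by zero gives 0.\<close>

lemma summable_msq_inverse_square:
  assumes "\<alpha> > 1"
  shows "(\<lambda>n. 1 / (msq \<alpha> n)\<^sup>2) summable_on UNIV"
proof (rule nonneg_bdd_above_summable_on)
  define f where "f k = 1 / (1 + (real_of_int k)\<^sup>2)" for k :: int
  define S where "S = (\<Sum>\<^sub>\<infinity>k. f k)"
  have S: "0 \<le> S" unfolding S_def by (intro infsum_nonneg) (simp add: f_def)
  have fF: "sum f F \<le> S" if "finite F" for F
    unfolding S_def using summable_inverse_square_int by (intro finite_sum_le_infsum that) (auto simp: f_def[abs_def])
  have pt: "1 / (msq \<alpha> (k, m))\<^sup>2 \<le> 3 * (f k * f m)" for k m
  proof (cases "k = 0 \<and> m = 0")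
    case True
    then show ?thesis by (simp add: msq_def f_def)
  next
    case False
    define x y where "x = (real_of_int k)\<^sup>2" and "y = (real_of_int m)\<^sup>2"
    have xy: "0 \<le> x" "0 \<le> y" by (auto simp: x_def y_def)
    have "1 \<le> \<bar>k\<bar> \<or> 1 \<le> \<bar>m\<bar>" using False by auto
    then have "1 \<le> \<bar>real_of_int k\<bar> \<or> 1 \<le> \<bar>real_of_int m\<bar>" by linarith
    then have "1 \<le> x \<or> 1 \<le> y"
      using power_mono[of 1 "\<bar>real_of_int k\<bar>" 2] power_mono[of 1 "\<bar>real_of_int m\<bar>" 2]
      by (auto simp: x_def y_def)
    then have s: "1 \<le> x + y" using xy by linarith
    have "1 * x \<le> \<alpha>\<^sup>2 * x" using assms xy by (intro mult_right_mono) auto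
    then have ms: "x + y \<le> msq \<alpha> (k, m)" by (simp add: msq_def x_def y_def power_mult_distrib)
    have "(1 + x) * (1 + y) \<le> 3 * (x + y)\<^sup>2"
    proof -
      define s q where "s = x + y" and "q = s * s"
      have "s * 1 \<le> q" using s unfolding s_def q_def by (intro mult_left_mono) auto
      moreover have "x * y \<le> q" using xy unfolding s_def q_def by (intro mult_mono) auto
      moreover have "(1 + x) * (1 + y) = 1 + s + x * y" by (simp add: s_def algebra_simps)
      moreover have "3 * (x + y)\<^sup>2 = 3 * q" by (simp add: q_def s_def power2_eq_square)
      moreover have "1 \<le> s" using s by (simp add: s_def)
      ultimately show ?thesis by linarith
    qed
    also have "\<dots> \<le> 3 * (msq \<alpha> (k, m))\<^sup>2"
      using ms s by (intro mult_left_mono power_mono) auto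
    finally have le: "(1 + x) * (1 + y) \<le> 3 * (msq \<alpha> (k, m))\<^sup>2" .
    have "3 / (3 * (msq \<alpha> (k, m))\<^sup>2) \<le> 3 / ((1 + x) * (1 + y))"
      using le xy ms s by (intro divide_left_mono mult_pos_pos) auto
    then show ?thesis by (simp add: f_def x_def y_def)
  qed
  show "bdd_above (sum (\<lambda>n. 1 / (msq \<alpha> n)\<^sup>2) ` {F. F \<subseteq> UNIV \<and> finite F})"
  proof (rule bdd_aboveI2)
    fix F :: "(int \<times> int) set" assume "F \<in> {F. F \<subseteq> UNIV \<and> finite F}"
    then have F: "finite F" by simp
    have "(\<Sum>n\<in>F. 1 / (msq \<alpha> n)\<^sup>2) \<le> (\<Sum>n\<in>F. 3 * (f (fst n) * f (snd n)))"
      by (intro sum_mono) (use pt in auto)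
    also have "\<dots> \<le> (\<Sum>n\<in>fst ` F \<times> snd ` F. 3 * (f (fst n) * f (snd n)))"
      using F by (intro sum_mono2) (auto simp: f_def image_iff rev_image_eqI, force+)
    also have "\<dots> = 3 * (sum f (fst ` F) * sum f (snd ` F))"
    proof -
      have "sum f (fst ` F) * sum f (snd ` F) = (\<Sum>n\<in>fst ` F \<times> snd ` F. f (fst n) * f (snd n))"
        unfolding sum_product by (subst sum.cartesian_product) (simp add: split_def)
      then show ?thesis by (simp add: sum_distrib_left)
    qed
    also have "\<dots> \<le> 3 * (S * S)"
      using F S by (intro mult_left_mono mult_mono fF sum_nonneg) (auto simp: f_def)
    finally show "(\<Sum>n\<in>F. 1 / (msq \<alpha> n)\<^sup>2) \<le> 3 * (S * S)" .
  qed
qed simp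

text \<open>On the axis the lattice is one-dimensional, so the inverse square of the length is
  already summable; over the whole lattice that sum would diverge logarithmically. Thus the velocity
  of the axis modes is summable by their mass alone, while that of the waves costs a
  gradient.\<close>

lemma summable_msq_inverse_axis: "(\<lambda>n. 1 / msq \<alpha> n) summable_on - waves"
proof (rule nonneg_bdd_above_summable_on)
  define f where "f k = 1 / (1 + (real_of_int k)\<^sup>2)" for k :: int
  show "bdd_above (sum (\<lambda>n. 1 / msq \<alpha> n) ` {F. F \<subseteq> - waves \<and> finite F})"
  proof (rule bdd_aboveI2)
    fix F assume "F \<in> {F. F \<subseteq> - waves \<and> finite F}"
    then have F: "finite F" "F \<subseteq> - waves" by auto
    have "(\<Sum>n\<in>F. 1 / msq \<alpha> n) \<le> (\<Sum>n\<in>F. 2 * f (snd n))"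
    proof (rule sum_mono)
      fix n assume "n \<in> F"
      then have n: "fst n = 0" using F by (auto simp: waves_def)
      show "1 / msq \<alpha> n \<le> 2 * f (snd n)"
      proof (cases "snd n = 0")
        case False
        then have "1 \<le> \<bar>real_of_int (snd n)\<bar>" by linarith
        then have "1 \<le> (real_of_int (snd n))\<^sup>2" using power_mono[of 1 "\<bar>real_of_int (snd n)\<bar>" 2] by simp
        moreover have "1 / t \<le> 2 / (1 + t)" if "1 \<le> t" for t :: real
          using that by (simp add: field_simps)
        ultimately show ?thesis using n by (simp add: msq_def f_def)
      qed (simp add: n msq_def f_def)
    qed
    also have "\<dots> = (\<Sum>k\<in>snd ` F. 2 * f k)"
    proof (subst sum.reindex)
      have "fst n = 0" if "n \<in> F" for n using F(2) that by (auto simp: waves_def)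
      then show "inj_on snd F" by (intro inj_onI) (simp add: prod_eq_iff)
    qed simp
    also have "\<dots> \<le> 2 * (\<Sum>\<^sub>\<infinity>k. f k)"
      unfolding sum_distrib_left[symmetric] using F
      by (intro mult_left_mono finite_sum_le_infsum) (auto simp: f_def summable_inverse_square_int)
    finally show "(\<Sum>n\<in>F. 1 / msq \<alpha> n) \<le> 2 * (\<Sum>\<^sub>\<infinity>k. f k)" .
  qed
qed (simp add: msq_nonneg)

text \<open>The determinant of the two wave vectors. The Jacobian of two waves has the symbol
  \<open>- cross \<alpha> p q\<close> and \<open>\<Delta>\<^sup>-\<^sup>1\<close> has
  \<open>- 1 / msq \<alpha> p\<close>, so
  \<open>J(\<Delta>\<^sup>-\<^sup>1 \<omega>, \<omega>)\<close> has
  \<open>cross \<alpha> p q / msq \<alpha> p\<close>.\<close>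

definition cross :: "real \<Rightarrow> int \<times> int \<Rightarrow> int \<times> int \<Rightarrow> real" where
  "cross \<alpha> p q = \<alpha> * (real_of_int (fst p) * real_of_int (snd q) - real_of_int (snd p) * real_of_int (fst q))"

text \<open>Lagrange's identity: the square of the determinant and the square of the scalar product
  add up to the product of the squared lengths.\<close>

lemma cross_le: "\<bar>cross \<alpha> p q\<bar> \<le> sqrt (msq \<alpha> p) * sqrt (msq \<alpha> q)"
proof -
  define a b c d where "a = \<alpha> * real_of_int (fst p)" and "b = real_of_int (snd p)"
    and "c = \<alpha> * real_of_int (fst q)" and "d = real_of_int (snd q)"
  have "cross \<alpha> p q = a * d - b * c" by (simp add: cross_def a_def b_def c_def d_def algebra_simps)
  moreover have "(a * d - b * c)\<^sup>2 \<le> (a\<^sup>2 + b\<^sup>2) * (c\<^sup>2 + d\<^sup>2)"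
    using zero_le_power2[of "a * c + b * d"] by (simp add: power2_eq_square algebra_simps)
  ultimately have "(cross \<alpha> p q)\<^sup>2 \<le> msq \<alpha> p * msq \<alpha> q"
    by (simp add: msq_def a_def b_def c_def d_def)
  then show ?thesis by (metis real_sqrt_abs real_sqrt_le_iff real_sqrt_mult)
qed

lemma cross_diff: "cross \<alpha> p (n - p) = cross \<alpha> p n"
  by (simp add: cross_def algebra_simps)

lemma cross_axis: "p \<notin> waves \<Longrightarrow> q \<notin> waves \<Longrightarrow> cross \<alpha> p q = 0"
  by (simp add: cross_def waves_def)

lemma msq_ge_1:
  assumes "\<alpha> > 1" "n \<noteq> 0"
  shows "1 \<le> msq \<alpha> n"
proof (cases "n \<in> waves")
  case False
  then have "snd n \<noteq> 0" using assms(2) by (auto simp: waves_def prod_eq_iff)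
  then have "1 \<le> \<bar>real_of_int (snd n)\<bar>" by linarith
  then show ?thesis using power_mono[of 1 "\<bar>real_of_int (snd n)\<bar>" 2] by (simp add: msq_def add_increasing)
qed (use assms waves_msq_ge in auto)

text \<open>
  The two bounds on the symbol of the Jacobian: \<open>p \<times> (n - p) = p \<times> n\<close>, so the derivative can be put either on
  the second factor or on the product.
\<close>

lemma symbol_le:
  assumes "\<alpha> > 1"
  shows "\<bar>cross \<alpha> p q / msq \<alpha> p\<bar> \<le> sqrt (msq \<alpha> q) / sqrt (msq \<alpha> p)"
    and "\<bar>cross \<alpha> p (n - p) / msq \<alpha> p\<bar> \<le> sqrt (msq \<alpha> n) / sqrt (msq \<alpha> p)"
    and "\<bar>cross \<alpha> p (n - p) / msq \<alpha> p\<bar> \<le> sqrt (msq \<alpha> n)"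
proof -
  show 1: "\<bar>cross \<alpha> p q / msq \<alpha> p\<bar> \<le> sqrt (msq \<alpha> q) / sqrt (msq \<alpha> p)" for q
  proof (cases "p = 0")
    case False
    define s where "s = sqrt (msq \<alpha> p)"
    have s: "0 < s" "msq \<alpha> p = s * s" using False msq_ge_1[OF assms, of p] by (simp_all add: s_def)
    have "\<bar>cross \<alpha> p q\<bar> / (s * s) \<le> s * sqrt (msq \<alpha> q) / (s * s)"
      using cross_le[of \<alpha> p q] by (intro divide_right_mono) (auto simp: s_def)
    then show ?thesis using s by (simp add: abs_divide flip: s_def)
  qed (simp add: msq_def)
  show 2: "\<bar>cross \<alpha> p (n - p) / msq \<alpha> p\<bar> \<le> sqrt (msq \<alpha> n) / sqrt (msq \<alpha> p)"
    using 1[of n] by (simp add: cross_diff)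
  show "\<bar>cross \<alpha> p (n - p) / msq \<alpha> p\<bar> \<le> sqrt (msq \<alpha> n)"
  proof (cases "p = 0")
    case False
    then have "1 \<le> sqrt (msq \<alpha> p)" using msq_ge_1[OF assms, of p] by simp
    then have "sqrt (msq \<alpha> n) / sqrt (msq \<alpha> p) \<le> sqrt (msq \<alpha> n) / 1"
      by (intro divide_left_mono) (auto simp: msq_nonneg)
    then show ?thesis using 2 by simp
  qed (simp add: msq_def)
qed

text \<open>The Jacobian at one instant. Below, \<open>Y\<close> is the full mass, \<open>V\<close>
  the mass of the waves and \<open>G\<close> their dissipation. The decisive bounds contain one
  factor \<open>sqrt Y\<close>, the smallness, times quantities of the waves alone.\<close>

locale jacobian_convolution =
  fixes \<alpha> :: real and w N :: "int \<times> int \<Rightarrow> complex"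
  assumes alpha1: "\<alpha> > 1"
    and w2: "(\<lambda>n. (norm (w n))\<^sup>2) summable_on UNIV"
    and wH: "(\<lambda>n. msq \<alpha> n * (norm (w n))\<^sup>2) summable_on waves"
    and N: "\<And>n. ((\<lambda>p. of_real (cross \<alpha> p (n - p) / msq \<alpha> p) * (w p * w (n - p))) has_sum N n) UNIV"
begin

definition "Y = (\<Sum>\<^sub>\<infinity>n. (norm (w n))\<^sup>2)"
definition "V = (\<Sum>\<^sub>\<infinity>n\<in>waves. (norm (w n))\<^sup>2)"
definition "G = (\<Sum>\<^sub>\<infinity>n\<in>waves. msq \<alpha> n * (norm (w n))\<^sup>2)"
definition "K1 = (\<Sum>\<^sub>\<infinity>n. 1 / (msq \<alpha> n)\<^sup>2)"
definition "K2 = (\<Sum>\<^sub>\<infinity>n\<in>-waves. 1 / msq \<alpha> n)"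

definition "y n = (if n \<in> waves then norm (w n) else 0)"
definition "z n = (if n \<in> waves then 0 else norm (w n))"

lemma yz_nonneg: "0 \<le> y n" "0 \<le> z n" "y n \<le> norm (w n)" "z n \<le> norm (w n)"
  by (auto simp: y_def z_def)

lemma consts_nonneg: "0 \<le> Y" "0 \<le> V" "0 \<le> G" "0 \<le> K1" "0 \<le> K2"
  unfolding Y_def V_def G_def K1_def K2_def by (auto intro!: infsum_nonneg simp: msq_nonneg)

lemma y2: "(\<lambda>n. (y n)\<^sup>2) summable_on UNIV" "(\<Sum>\<^sub>\<infinity>n. (y n)\<^sup>2) = V"
proof -
  show "(\<lambda>n. (y n)\<^sup>2) summable_on UNIV"
    by (rule summable_on_comparison_test[OF w2]) (auto simp: y_def)
  show "(\<Sum>\<^sub>\<infinity>n. (y n)\<^sup>2) = V"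
    unfolding V_def by (rule infsum_cong_neutral) (auto simp: y_def)
qed

lemma z2: "(\<lambda>n. (z n)\<^sup>2) summable_on UNIV" "(\<Sum>\<^sub>\<infinity>n. (z n)\<^sup>2) \<le> Y"
proof -
  show s: "(\<lambda>n. (z n)\<^sup>2) summable_on UNIV"
    by (rule summable_on_comparison_test[OF w2]) (auto simp: z_def)
  show "(\<Sum>\<^sub>\<infinity>n. (z n)\<^sup>2) \<le> Y"
    unfolding Y_def by (rule infsum_mono[OF s w2]) (auto simp: z_def)
qed

text \<open>The velocity of a mode is its vorticity divided by its wave number: \<open>A\<close> is
  the velocity of the waves and \<open>Za\<close> that of the axis modes. The gradient of the wave
  part is \<open>g\<close>.\<close>

definition "A p = y p / sqrt (msq \<alpha> p)"
definition "Za p = z p / sqrt (msq \<alpha> p)"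
definition "g p = sqrt (msq \<alpha> p) * y p"

lemma g2: "(\<lambda>p. (g p)\<^sup>2) summable_on UNIV" "(\<Sum>\<^sub>\<infinity>p. (g p)\<^sup>2) = G"
proof -
  have e: "(g p)\<^sup>2 = (if p \<in> waves then msq \<alpha> p * (norm (w p))\<^sup>2 else 0)" for p
    by (simp add: g_def y_def power_mult_distrib msq_nonneg)
  show "(\<lambda>p. (g p)\<^sup>2) summable_on UNIV"
    using wH by (subst summable_on_cong_neutral[where T = waves and g = "\<lambda>n. msq \<alpha> n * (norm (w n))\<^sup>2"]) (auto simp: e)
  show "(\<Sum>\<^sub>\<infinity>p. (g p)\<^sup>2) = G"
    unfolding G_def by (rule infsum_cong_neutral) (auto simp: e)
qed

lemma A_nonneg: "0 \<le> A p" "0 \<le> Za p" "0 \<le> g p"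
  by (simp_all add: A_def Za_def g_def yz_nonneg msq_nonneg)

text \<open>Writing \<open>A p\<close> as \<open>(1 / msq \<alpha> p) * g p\<close>, Cauchy-Schwarz
  makes the velocity of the waves summable at the price of one gradient.\<close>

lemma A1: "A summable_on UNIV" "(\<Sum>\<^sub>\<infinity>p. A p) \<le> sqrt K1 * sqrt G"
proof -
  have e: "A p = (1 / msq \<alpha> p) * g p" for p
  proof (cases "p = 0")
    case False
    then have "0 < msq \<alpha> p" using msq_ge_1[OF alpha1, of p] by simp
    then show ?thesis by (simp add: A_def g_def real_div_sqrt field_simps)
  qed (simp add: A_def g_def msq_def)
  have s: "(\<lambda>p. (1 / msq \<alpha> p)\<^sup>2) summable_on UNIV"
    using summable_msq_inverse_square[OF alpha1] by (simp add: power_one_over)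
  show "A summable_on UNIV"
    unfolding e[abs_def] using infsum_Cauchy_Schwarz(1)[OF s g2(1)] A_nonneg msq_nonneg by simp
  show "(\<Sum>\<^sub>\<infinity>p. A p) \<le> sqrt K1 * sqrt G"
    unfolding e[abs_def] using infsum_Cauchy_Schwarz(2)[OF s g2(1)] A_nonneg msq_nonneg
    by (simp add: g2 K1_def power_one_over)
qed

lemma Za1: "Za summable_on UNIV" "(\<Sum>\<^sub>\<infinity>p. Za p) \<le> sqrt K2 * sqrt Y"
proof -
  define j where "j p = (if p \<in> waves then 0 else 1 / sqrt (msq \<alpha> p))" for p
  have e: "Za p = j p * z p" for p by (simp add: Za_def j_def z_def)
  have j2: "(j p)\<^sup>2 = (if p \<in> waves then 0 else 1 / msq \<alpha> p)" for p
    by (simp add: j_def power_divide msq_nonneg)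
  have s: "(\<lambda>p. (j p)\<^sup>2) summable_on UNIV"
    using summable_msq_inverse_axis[of \<alpha>]
    by (subst summable_on_cong_neutral[where T = "-waves" and g = "\<lambda>n. 1 / msq \<alpha> n"]) (auto simp: j2)
  have K: "(\<Sum>\<^sub>\<infinity>p. (j p)\<^sup>2) = K2"
    unfolding K2_def by (rule infsum_cong_neutral) (auto simp: j2)
  have nn: "0 \<le> j p" for p by (simp add: j_def msq_nonneg)
  show "Za summable_on UNIV"
    unfolding e[abs_def] using infsum_Cauchy_Schwarz(1)[OF s z2(1)] nn yz_nonneg by simp
  have "(\<Sum>\<^sub>\<infinity>p. Za p) \<le> sqrt (\<Sum>\<^sub>\<infinity>p. (j p)\<^sup>2) * sqrt (\<Sum>\<^sub>\<infinity>p. (z p)\<^sup>2)"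
    unfolding e[abs_def] using infsum_Cauchy_Schwarz(2)[OF s z2(1)] nn yz_nonneg by simp
  also have "\<dots> \<le> sqrt K2 * sqrt Y" unfolding K using z2(2) by (intro mult_left_mono) (auto simp: consts_nonneg)
  finally show "(\<Sum>\<^sub>\<infinity>p. Za p) \<le> sqrt K2 * sqrt Y" .
qed

lemma reflected:
  fixes f :: "int \<times> int \<Rightarrow> real"
  assumes "(\<lambda>p. (f p)\<^sup>2) summable_on UNIV"
  shows "(\<lambda>p. (f (n - p))\<^sup>2) summable_on UNIV" "(\<Sum>\<^sub>\<infinity>p. (f (n - p))\<^sup>2) = (\<Sum>\<^sub>\<infinity>p. (f p)\<^sup>2)"
proof -
  have b: "bij_betw (\<lambda>p. n - p) UNIV UNIV"
    by (rule bij_betwI[where g = "\<lambda>p. n - p"]) auto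
  show "(\<lambda>p. (f (n - p))\<^sup>2) summable_on UNIV"
    using summable_on_reindex_bij_betw[OF b, of "\<lambda>p. (f p)\<^sup>2"] assms by simp
  show "(\<Sum>\<^sub>\<infinity>p. (f (n - p))\<^sup>2) = (\<Sum>\<^sub>\<infinity>p. (f p)\<^sup>2)"
    using infsum_reindex_bij_betw[OF b, of "\<lambda>p. (f p)\<^sup>2"] by simp
qed

lemma norm_N_le_Y: "norm (N n) \<le> sqrt (msq \<alpha> n) * Y"
proof -
  note cs = infsum_Cauchy_Schwarz[OF w2 reflected(1)[OF w2, of n]]
  have s: "(\<lambda>p. sqrt (msq \<alpha> n) * (norm (w p) * norm (w (n - p)))) summable_on UNIV"
    by (intro summable_on_cmult_right cs(1)) auto
  have "norm (N n) \<le> (\<Sum>\<^sub>\<infinity>p. sqrt (msq \<alpha> n) * (norm (w p) * norm (w (n - p))))"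
  proof (rule norm_has_sum_le[OF N s])
    fix p
    have "norm (of_real (cross \<alpha> p (n - p) / msq \<alpha> p) * (w p * w (n - p))) = \<bar>cross \<alpha> p (n - p) / msq \<alpha> p\<bar> * (norm (w p) * norm (w (n - p)))"
      by (simp only: norm_mult norm_of_real)
    also have "\<dots> \<le> sqrt (msq \<alpha> n) * (norm (w p) * norm (w (n - p)))"
      by (intro mult_right_mono symbol_le(3)[OF alpha1]) auto
    finally show "norm (of_real (cross \<alpha> p (n - p) / msq \<alpha> p) * (w p * w (n - p))) \<le> sqrt (msq \<alpha> n) * (norm (w p) * norm (w (n - p)))" .
  qed
  also have "\<dots> = sqrt (msq \<alpha> n) * (\<Sum>\<^sub>\<infinity>p. norm (w p) * norm (w (n - p)))"
    by (rule infsum_cmult_right')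
  also have "\<dots> \<le> sqrt (msq \<alpha> n) * Y"
  proof (rule mult_left_mono)
    have "(\<Sum>\<^sub>\<infinity>p. norm (w p) * norm (w (n - p))) \<le> sqrt Y * sqrt Y"
      using cs(2) unfolding reflected(2)[OF w2] Y_def[symmetric] by simp
    then show "(\<Sum>\<^sub>\<infinity>p. norm (w p) * norm (w (n - p))) \<le> Y" by (simp add: consts_nonneg)
  qed (simp add: msq_nonneg)
  finally show ?thesis .
qed

text \<open>If \<open>n\<close> is a wave, then \<open>p\<close> or \<open>n - p\<close> is one. So
  every term of the convolution contains a wave factor, and the bound is linear in
  \<open>sqrt V\<close>, as a perturbation of relative size requires.\<close>

lemma norm_N_waves_le:
  assumes n: "n \<in> waves"
  shows "norm (N n) \<le> 2 * sqrt Y * sqrt (msq \<alpha> n) * sqrt V"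
proof -
  note c1 = infsum_Cauchy_Schwarz[OF y2(1) reflected(1)[OF w2, of n]]
  note c2 = infsum_Cauchy_Schwarz[OF z2(1) reflected(1)[OF y2(1), of n]]
  have s1: "(\<lambda>p. y p * norm (w (n - p))) summable_on UNIV" by (rule c1) (auto simp: yz_nonneg)
  have s2: "(\<lambda>p. z p * y (n - p)) summable_on UNIV" by (rule c2) (auto simp: yz_nonneg)
  have s: "(\<lambda>p. sqrt (msq \<alpha> n) * (y p * norm (w (n - p)) + z p * y (n - p))) summable_on UNIV"
    by (intro summable_on_cmult_right summable_on_add s1 s2)
  have split: "norm (w p) * norm (w (n - p)) \<le> y p * norm (w (n - p)) + z p * y (n - p)" for p
    using n by (auto simp: y_def z_def waves_def)
  have "norm (N n) \<le> (\<Sum>\<^sub>\<infinity>p. sqrt (msq \<alpha> n) * (y p * norm (w (n - p)) + z p * y (n - p)))"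
  proof (rule norm_has_sum_le[OF N s])
    fix p
    have "norm (of_real (cross \<alpha> p (n - p) / msq \<alpha> p) * (w p * w (n - p))) = \<bar>cross \<alpha> p (n - p) / msq \<alpha> p\<bar> * (norm (w p) * norm (w (n - p)))"
      by (simp only: norm_mult norm_of_real)
    also have "\<dots> \<le> sqrt (msq \<alpha> n) * (y p * norm (w (n - p)) + z p * y (n - p))"
      by (intro mult_mono symbol_le(3)[OF alpha1] split) (auto simp: msq_nonneg)
    finally show "norm (of_real (cross \<alpha> p (n - p) / msq \<alpha> p) * (w p * w (n - p))) \<le> sqrt (msq \<alpha> n) * (y p * norm (w (n - p)) + z p * y (n - p))" .
  qed
  also have "\<dots> = sqrt (msq \<alpha> n) * ((\<Sum>\<^sub>\<infinity>p. y p * norm (w (n - p))) + (\<Sum>\<^sub>\<infinity>p. z p * y (n - p)))"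
    using infsum_add[OF s1 s2] by (simp add: infsum_cmult_right')
  also have "\<dots> \<le> sqrt (msq \<alpha> n) * (sqrt V * sqrt Y + sqrt Y * sqrt V)"
  proof (intro mult_left_mono add_mono)
    show "(\<Sum>\<^sub>\<infinity>p. y p * norm (w (n - p))) \<le> sqrt V * sqrt Y"
      using c1(2) yz_nonneg unfolding reflected(2)[OF w2] y2 Y_def by simp
    have "(\<Sum>\<^sub>\<infinity>p. z p * y (n - p)) \<le> sqrt (\<Sum>\<^sub>\<infinity>p. (z p)\<^sup>2) * sqrt V"
      using c2(2) yz_nonneg unfolding reflected(2)[OF y2(1)] y2 by simp
    also have "\<dots> \<le> sqrt Y * sqrt V" using z2(2) by (intro mult_right_mono) (auto simp: consts_nonneg)
    finally show "(\<Sum>\<^sub>\<infinity>p. z p * y (n - p)) \<le> sqrt Y * sqrt V" .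
  qed (simp add: msq_nonneg)
  also have "\<dots> = 2 * sqrt Y * sqrt (msq \<alpha> n) * sqrt V" by (simp add: algebra_simps)
  finally show ?thesis .
qed

text \<open>For a wave \<open>p\<close> the derivative is put on \<open>n\<close>, and the velocity
  \<open>A\<close> is summable with one gradient. For an axis mode \<open>p\<close> the factor
  \<open>n - p\<close> is a wave and takes the derivative, and \<open>Za\<close> is summable by the
  mass. In both cases Young's inequality leaves two gradients of waves and one factor
  \<open>sqrt Y\<close>.\<close>

lemma pairing_le:
  assumes F: "finite F" "F \<subseteq> waves"
  shows "(\<Sum>n\<in>F. norm (w n) * norm (N n)) \<le> (sqrt K1 + sqrt K2) * sqrt Y * G"
proof -
  define P where "P n = (\<Sum>\<^sub>\<infinity>p. A p * norm (w (n - p)))" for n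
  define Q where "Q n = (\<Sum>\<^sub>\<infinity>p. Za p * g (n - p))" for n
  note yP = young_convolution[of A "\<lambda>p. norm (w p)", OF A1(1) A_nonneg(1) w2 norm_ge_zero]
  note yQ = young_convolution[of Za g, OF Za1(1) A_nonneg(2) g2(1) A_nonneg(3)]
  have PQ: "0 \<le> P n" "0 \<le> Q n" for n
    unfolding P_def Q_def by (auto intro!: infsum_nonneg mult_nonneg_nonneg A_nonneg)
  have Nn: "norm (N n) \<le> sqrt (msq \<alpha> n) * P n + Q n" if n: "n \<in> waves" for n
  proof -
    have s: "(\<lambda>p. sqrt (msq \<alpha> n) * (A p * norm (w (n - p))) + Za p * g (n - p)) summable_on UNIV"
      by (intro summable_on_add summable_on_cmult_right yP(1) yQ(1))
    have "norm (N n) \<le> (\<Sum>\<^sub>\<infinity>p. sqrt (msq \<alpha> n) * (A p * norm (w (n - p))) + Za p * g (n - p))"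
    proof (rule norm_has_sum_le[OF N s])
      fix p
      have e: "norm (of_real (cross \<alpha> p (n - p) / msq \<alpha> p) * (w p * w (n - p))) = \<bar>cross \<alpha> p (n - p) / msq \<alpha> p\<bar> * (norm (w p) * norm (w (n - p)))"
        by (simp only: norm_mult norm_of_real)
      show "norm (of_real (cross \<alpha> p (n - p) / msq \<alpha> p) * (w p * w (n - p))) \<le> sqrt (msq \<alpha> n) * (A p * norm (w (n - p))) + Za p * g (n - p)"
      proof (cases "p \<in> waves")
        case True
        have "\<bar>cross \<alpha> p (n - p) / msq \<alpha> p\<bar> * (norm (w p) * norm (w (n - p))) \<le> sqrt (msq \<alpha> n) / sqrt (msq \<alpha> p) * (norm (w p) * norm (w (n - p)))"
          by (intro mult_right_mono symbol_le(2)[OF alpha1]) auto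
        then show ?thesis using True unfolding e by (simp add: A_def Za_def y_def z_def mult_ac)
      next
        case False
        then have np: "n - p \<in> waves" using n by (auto simp: waves_def)
        have "\<bar>cross \<alpha> p (n - p) / msq \<alpha> p\<bar> * (norm (w p) * norm (w (n - p))) \<le> sqrt (msq \<alpha> (n - p)) / sqrt (msq \<alpha> p) * (norm (w p) * norm (w (n - p)))"
          by (intro mult_right_mono symbol_le(1)[OF alpha1]) auto
        then show ?thesis using False np unfolding e by (simp add: A_def Za_def g_def y_def z_def mult_ac)
      qed
    qed
    also have "\<dots> = sqrt (msq \<alpha> n) * P n + Q n"
      unfolding P_def Q_def infsum_cmult_right'[symmetric]
      by (intro infsum_add summable_on_cmult_right yP(1) yQ(1))
    finally show ?thesis .
  qed
  have "(\<Sum>n\<in>F. norm (w n) * norm (N n)) \<le> (\<Sum>n\<in>F. g n * P n + y n * Q n)"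
  proof (rule sum_mono)
    fix n assume "n \<in> F"
    then have n: "n \<in> waves" using F by auto
    have "norm (w n) * norm (N n) \<le> norm (w n) * (sqrt (msq \<alpha> n) * P n + Q n)"
      by (intro mult_left_mono Nn n) auto
    then show "norm (w n) * norm (N n) \<le> g n * P n + y n * Q n"
      using n by (simp add: g_def y_def algebra_simps)
  qed
  also have "\<dots> = (\<Sum>n\<in>F. g n * P n) + (\<Sum>n\<in>F. y n * Q n)" by (rule sum.distrib)
  also have "\<dots> \<le> sqrt G * (sqrt K1 * sqrt G * sqrt Y) + sqrt V * (sqrt K2 * sqrt Y * sqrt G)"
  proof (rule add_mono)
    have cs: "(\<Sum>n\<in>F. a n * b n) \<le> sqrt X * (k * sqrt B)"
      if "(\<Sum>n\<in>F. (a n)\<^sup>2) \<le> X" "(\<Sum>n\<in>F. (b n)\<^sup>2) \<le> k\<^sup>2 * B" "0 \<le> k" "0 \<le> X" "0 \<le> B" for a b :: "_ \<Rightarrow> real" and X k B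
    proof -
      have "(\<Sum>n\<in>F. a n * b n)\<^sup>2 \<le> (\<Sum>n\<in>F. (a n)\<^sup>2) * (\<Sum>n\<in>F. (b n)\<^sup>2)" by (rule Cauchy_Schwarz_ineq_sum)
      also have "\<dots> \<le> X * (k\<^sup>2 * B)" using that by (intro mult_mono sum_nonneg) auto
      finally have "(\<Sum>n\<in>F. a n * b n) \<le> sqrt (X * (k\<^sup>2 * B))" by (rule real_le_rsqrt)
      then show ?thesis using that by (simp add: real_sqrt_mult)
    qed
    have "(\<Sum>n\<in>F. (P n)\<^sup>2) \<le> (\<Sum>\<^sub>\<infinity>p. A p)\<^sup>2 * Y"
      unfolding P_def Y_def by (rule yP(2)[OF F(1)])
    also have "\<dots> \<le> (sqrt K1 * sqrt G)\<^sup>2 * Y"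
      by (intro mult_right_mono power_mono A1 infsum_nonneg A_nonneg consts_nonneg)
    finally show "(\<Sum>n\<in>F. g n * P n) \<le> sqrt G * (sqrt K1 * sqrt G * sqrt Y)"
      using finite_sum_le_infsum[OF g2(1) F(1)] by (intro cs) (auto simp: g2 consts_nonneg)
    have "(\<Sum>n\<in>F. (Q n)\<^sup>2) \<le> (\<Sum>\<^sub>\<infinity>p. Za p)\<^sup>2 * G"
      unfolding Q_def g2(2)[symmetric] by (rule yQ(2)[OF F(1)])
    also have "\<dots> \<le> (sqrt K2 * sqrt Y)\<^sup>2 * G"
      by (intro mult_right_mono power_mono Za1 infsum_nonneg A_nonneg consts_nonneg)
    finally show "(\<Sum>n\<in>F. y n * Q n) \<le> sqrt V * (sqrt K2 * sqrt Y * sqrt G)"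
      using finite_sum_le_infsum[OF y2(1) F(1)] by (intro cs) (auto simp: y2 consts_nonneg)
  qed
  also have "\<dots> \<le> sqrt G * (sqrt K1 * sqrt G * sqrt Y) + sqrt G * (sqrt K2 * sqrt Y * sqrt G)"
  proof -
    have "V \<le> G" unfolding V_def G_def
    proof (rule infsum_mono)
      show "(\<lambda>n. (norm (w n))\<^sup>2) summable_on waves" using w2 summable_on_subset_banach by blast
      show "(norm (w n))\<^sup>2 \<le> msq \<alpha> n * (norm (w n))\<^sup>2" if "n \<in> waves" for n
        using mult_right_mono[OF waves_msq_ge(2)[OF alpha1 that], of "(norm (w n))\<^sup>2"] by simp
    qed (rule wH)
    then show ?thesis by (intro add_left_mono mult_right_mono) (auto simp: consts_nonneg)
  qed
  also have "\<dots> = (sqrt K1 + sqrt K2) * sqrt Y * (sqrt G * sqrt G)" by (simp add: algebra_simps)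
  also have "sqrt G * sqrt G = G" by (simp add: consts_nonneg)
  finally show ?thesis .
qed

text \<open>For \<open>n\<close> on the axis, \<open>p\<close> and \<open>n - p\<close> are both
  waves or both on the axis, and in the latter case the determinant is zero. So the forcing of the
  axis is quadratic in the waves; the derivative on \<open>n\<close> is removed by dividing by
  \<open>msq \<alpha> n\<close>, which the viscosity of the axis modes will supply.\<close>

lemma axis_le:
  assumes F: "finite F" "F \<inter> waves = {}"
  shows "(\<Sum>n\<in>F. (norm (N n))\<^sup>2 / msq \<alpha> n) \<le> K1 * G * V"
proof -
  define P where "P n = (\<Sum>\<^sub>\<infinity>p. A p * y (n - p))" for n
  note yP = young_convolution[of A y, OF A1(1) A_nonneg(1) y2(1) yz_nonneg(1)]
  have "(\<Sum>n\<in>F. (norm (N n))\<^sup>2 / msq \<alpha> n) \<le> (\<Sum>n\<in>F. (P n)\<^sup>2)"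
  proof (rule sum_mono)
    fix n assume "n \<in> F"
    then have n: "n \<notin> waves" using F by auto
    have s: "(\<lambda>p. sqrt (msq \<alpha> n) * (A p * y (n - p))) summable_on UNIV"
      by (intro summable_on_cmult_right yP(1))
    have "norm (N n) \<le> (\<Sum>\<^sub>\<infinity>p. sqrt (msq \<alpha> n) * (A p * y (n - p)))"
    proof (rule norm_has_sum_le[OF N s])
      fix p
      have e: "norm (of_real (cross \<alpha> p (n - p) / msq \<alpha> p) * (w p * w (n - p))) = \<bar>cross \<alpha> p (n - p) / msq \<alpha> p\<bar> * (norm (w p) * norm (w (n - p)))"
        by (simp only: norm_mult norm_of_real)
      show "norm (of_real (cross \<alpha> p (n - p) / msq \<alpha> p) * (w p * w (n - p))) \<le> sqrt (msq \<alpha> n) * (A p * y (n - p))"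
      proof (cases "p \<in> waves")
        case True
        then have np: "n - p \<in> waves" using n by (auto simp: waves_def)
        have "\<bar>cross \<alpha> p (n - p) / msq \<alpha> p\<bar> * (norm (w p) * norm (w (n - p))) \<le> sqrt (msq \<alpha> n) / sqrt (msq \<alpha> p) * (norm (w p) * norm (w (n - p)))"
          by (intro mult_right_mono symbol_le(2)[OF alpha1]) auto
        then show ?thesis using True np unfolding e by (simp add: A_def y_def mult_ac)
      next
        case False
        then have "cross \<alpha> p (n - p) = 0" using n by (intro cross_axis) (auto simp: waves_def)
        then show ?thesis by (simp add: msq_nonneg A_nonneg yz_nonneg)
      qed
    qed
    also have "\<dots> = sqrt (msq \<alpha> n) * P n" unfolding P_def by (rule infsum_cmult_right')
    finally have "(norm (N n))\<^sup>2 \<le> (sqrt (msq \<alpha> n) * P n)\<^sup>2" by (intro power_mono) auto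
    also have "\<dots> = msq \<alpha> n * (P n)\<^sup>2" by (simp add: power_mult_distrib msq_nonneg)
    finally show "(norm (N n))\<^sup>2 / msq \<alpha> n \<le> (P n)\<^sup>2"
      using msq_nonneg[of \<alpha> n] by (cases "msq \<alpha> n = 0") (auto simp: field_simps)
  qed
  also have "\<dots> \<le> (\<Sum>\<^sub>\<infinity>p. A p)\<^sup>2 * V"
    unfolding P_def y2(2)[symmetric] by (rule yP(2)[OF F(1)])
  also have "\<dots> \<le> (sqrt K1 * sqrt G)\<^sup>2 * V"
    by (intro mult_right_mono power_mono A1 infsum_nonneg A_nonneg consts_nonneg)
  also have "\<dots> = K1 * G * V" by (simp add: power_mult_distrib consts_nonneg)
  finally show ?thesis .
qed

end

section \<open>Continuity argument for the perturbed flow\<close>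

lemma continuous_bootstrap:
  fixes y :: "real \<Rightarrow> real"
  assumes cont: "continuous_on {0..T} y" and y0: "y 0 < R"
    and step: "\<And>t. t \<in> {0<..T} \<Longrightarrow> (\<And>s. s \<in> {0..t} \<Longrightarrow> y s \<le> R) \<Longrightarrow> y t < R"
    and t: "t \<in> {0..T}"
  shows "y t \<le> R"
proof (rule ccontr)
  assume "\<not> y t \<le> R"
  define S where "S = {s \<in> {0..t}. R \<le> y s}"
  have S: "t \<in> S" "bdd_below S" using \<open>\<not> y t \<le> R\<close> t by (auto simp: S_def)
  have "continuous_on {0..t} y" using cont by (rule continuous_on_subset) (use t in auto)
  then have "closed ({0..t} \<inter> y -` {R..})" by (rule continuous_closed_preimage) auto
  moreover have "S = {0..t} \<inter> y -` {R..}" by (auto simp: S_def)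
  ultimately have "closed S" by simp
  \<comment> \<open>The first time at which \<open>R\<close> is reached. It is positive by
    \<open>y0\<close>, and \<open>y\<close> is at most \<open>R\<close> up to and including it, so
    the strict conclusion of \<open>step\<close> contradicts \<open>R \<le> y s\<close>.\<close>
  define s where "s = Inf S"
  have s: "s \<in> S" unfolding s_def using S \<open>closed S\<close> by (intro closed_contains_Inf) auto
  have lt: "y r < R" if "r \<in> {0..<s}" for r
  proof (rule ccontr)
    assume "\<not> y r < R"
    then have "r \<in> S" using that s by (auto simp: S_def)
    then have "s \<le> r" unfolding s_def using S by (intro cInf_lower) auto
    then show False using that by simp
  qed
  have "s \<noteq> 0" using s y0 by (auto simp: S_def)
  then have s_pos: "s \<in> {0<..T}" using s t by (auto simp: S_def)
  have ys: "y s \<le> R"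
  proof (rule tendsto_upperbound)
    show "(y \<longlongrightarrow> y s) (at s within {0..<s})"
    proof (rule tendsto_within_subset)
      show "(y \<longlongrightarrow> y s) (at s within {0..T})" using cont s_pos by (auto simp: continuous_on)
    qed (use s_pos in auto)
    show "eventually (\<lambda>r. y r \<le> R) (at s within {0..<s})"
      using lt by (auto simp: eventually_at_filter intro!: always_eventually less_imp_le)
    have "s islimpt {0<..<s}" using s_pos by (intro islimpt_greaterThanLessThan2) auto
    then have "s islimpt {0..<s}" by (rule islimpt_subset) auto
    then show "at s within {0..<s} \<noteq> bot" by (simp add: trivial_limit_within)
  qed
  have "y s < R"
  proof (rule step[OF s_pos])
    show "y r \<le> R" if "r \<in> {0..s}" for r using that lt[of r] ys by (cases "r = s") auto
  qed
  then show False using s by (simp add: S_def)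
qed

text \<open>The 2 serves the pointwise bound on \<open>N\<close>, the two roots serve the pairing.
  \<open>K1\<close> and \<open>K2\<close> depend on \<open>\<alpha>\<close> alone, so one constant
  works at all times and for all solutions.\<close>

definition jacobian_const :: "real \<Rightarrow> real" where
  "jacobian_const \<alpha> = 2 + sqrt (jacobian_convolution.K1 \<alpha>) + sqrt (jacobian_convolution.K2 \<alpha>)"

text \<open>All modes are included, and on the axis the shear term disappears with the factor
  \<open>k\<close>. In contrast to \<open>shear_modes\<close>, \<open>N\<close> is tied to
  \<open>w\<close> as its Jacobian, so the relative smallness of \<open>N\<close> has to be derived
  from the smallness of \<open>w\<close>.\<close>

locale perturbed_flow =
  fixes \<alpha> \<nu> T cmin :: real and c :: "real \<Rightarrow> real"
    and w N :: "int \<times> int \<Rightarrow> real \<Rightarrow> complex" and Hb :: "real \<Rightarrow> real" and Z :: "real set"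
  assumes alpha: "\<alpha> > 1" and nu: "\<nu> > 0" and T_pos: "T > 0"
    and c_cont: "continuous_on {0..T} c" and cmin: "cmin > 0"
    and c_ge: "\<And>t. t \<in> {0..T} \<Longrightarrow> cmin \<le> c t" and c_le: "\<And>t. t \<in> {0..T} \<Longrightarrow> c t \<le> 2"
    and Z: "negligible Z"
    and ode: "\<And>k m t. t \<in> {0..T} \<Longrightarrow>
        ((\<lambda>s. - ((\<nu> * msq \<alpha> (k, m)) *\<^sub>R w (k, m) s)
             - (c s * \<alpha> * real_of_int k / 2) *\<^sub>R (lam \<alpha> (k, m - 1) *\<^sub>R w (k, m - 1) s - lam \<alpha> (k, m + 1) *\<^sub>R w (k, m + 1) s)
             - N (k, m) s)
         has_integral (w (k, m) t - w (k, m) 0)) {0..t}"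
    and w2: "\<And>t. t \<in> {0..T} \<Longrightarrow> (\<lambda>n. (norm (w n t))\<^sup>2) summable_on UNIV"
    and y_cont: "continuous_on {0..T} (\<lambda>t. \<Sum>\<^sub>\<infinity>n. (norm (w n t))\<^sup>2)"
    and Hb_int: "Hb integrable_on {0..T}"
    and Hb: "\<And>t F. t \<in> {0..T} - Z \<Longrightarrow> finite F \<Longrightarrow> (\<Sum>n\<in>F. msq \<alpha> n * (norm (w n t))\<^sup>2) \<le> Hb t"
    and N: "\<And>t n. t \<in> {0..T} - Z \<Longrightarrow>
        ((\<lambda>p. of_real (cross \<alpha> p (n - p) / msq \<alpha> p) * (w p t * w (n - p) t)) has_sum N n t) UNIV"
begin

definition y :: "real \<Rightarrow> real" where "y t = (\<Sum>\<^sub>\<infinity>n. (norm (w n t))\<^sup>2)"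

abbreviation "K4 \<equiv> jacobian_convolution.K1 \<alpha>"
abbreviation "Kc \<equiv> jacobian_const \<alpha>"

lemma y_nonneg: "0 \<le> y t" unfolding y_def by (rule infsum_nonneg) auto

lemma sum_le_y: "t \<in> {0..T} \<Longrightarrow> finite F \<Longrightarrow> (\<Sum>n\<in>F. (norm (w n t))\<^sup>2) \<le> y t"
  unfolding y_def by (rule finite_sum_le_infsum[OF w2]) auto

lemma mass_le_y: "t \<in> {0..T} \<Longrightarrow> mass w t \<le> y t"
  unfolding mass_def y_def
  by (rule infsum_mono_neutral[OF summable_on_subset_banach[OF w2] w2]) auto

lemma convolution:
  assumes "t \<in> {0..T} - Z"
  shows "jacobian_convolution \<alpha> (\<lambda>n. w n t) (\<lambda>n. N n t)"
proof
  show "(\<lambda>n. msq \<alpha> n * (norm (w n t))\<^sup>2) summable_on waves"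
    by (rule nonneg_bdd_above_summable_on)
      (use assms in \<open>auto intro!: bdd_aboveI2[where M = "Hb t"] Hb simp: msq_nonneg\<close>)
qed (use assms alpha w2 N in auto)

lemma conv_consts: 
  assumes "t \<in> {0..T} - Z"
  shows "jacobian_convolution.Y (\<lambda>n. w n t) = y t" "jacobian_convolution.V (\<lambda>n. w n t) = mass w t"
    "jacobian_convolution.G \<alpha> (\<lambda>n. w n t) = grad \<alpha> w t"
proof -
  interpret J: jacobian_convolution \<alpha> "\<lambda>n. w n t" "\<lambda>n. N n t" by (rule convolution[OF assms])
  show "jacobian_convolution.Y (\<lambda>n. w n t) = y t" "jacobian_convolution.V (\<lambda>n. w n t) = mass w t"
    "jacobian_convolution.G \<alpha> (\<lambda>n. w n t) = grad \<alpha> w t"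
    unfolding J.Y_def J.V_def J.G_def y_def mass_def grad_def by (rule refl)+
qed

text \<open>The signs of the constants are read off from an instance of the Jacobian locale, hence
  from some time outside \<open>Z\<close>. Such a time exists because a nondegenerate interval is
  not negligible.\<close>

lemma K_nonneg: "0 \<le> K4" "2 \<le> Kc"
proof -
  have "\<exists>t. t \<in> {0..T} - Z"
  proof (rule ccontr)
    assume "\<not> (\<exists>t. t \<in> {0..T} - Z)"
    then have "{0..T} \<subseteq> Z" by auto
    then have "negligible {0..T}" using Z negligible_subset by blast
    then show False using T_pos negligible_interval(1)[of 0 T] by (simp add: box_real)
  qed
  then obtain t where "t \<in> {0..T} - Z" by blast
  then interpret J: jacobian_convolution \<alpha> "\<lambda>n. w n t" "\<lambda>n. N n t" by (rule convolution)
  show "0 \<le> K4" "2 \<le> Kc" using J.consts_nonneg by (auto simp: jacobian_const_def)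
qed

text \<open>As long as the full mass is at most \<open>R\<^sup>2\<close>, the Jacobian acts on the
  waves as a perturbation of relative size \<open>\<theta> = Kc * R\<close>, so the theory of the
  waves applies up to that time.\<close>

lemma shear_modes_until:
  assumes t1: "t1 \<in> {0<..T}" and R: "0 \<le> R" and le: "\<And>s. s \<in> {0..t1} \<Longrightarrow> y s \<le> R\<^sup>2"
  shows "shear_modes \<alpha> \<nu> t1 (Kc * R) cmin (R\<^sup>2) c w N Hb Z"
proof
  show "continuous_on {0..t1} c" using c_cont by (rule continuous_on_subset) (use t1 in auto)
  show "Hb integrable_on {0..t1}" using Hb_int by (rule integrable_on_subinterval) (use t1 in auto)
  show "0 \<le> Kc * R" using K_nonneg R by simp
  show "(\<Sum>n\<in>F. (norm (w n t))\<^sup>2) \<le> R\<^sup>2" if "t \<in> {0..t1}" "finite F" for t F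
    using sum_le_y[of t F] le[of t] that t1 by auto
  fix t assume t: "t \<in> {0..t1} - Z"
  then have tT: "t \<in> {0..T} - Z" using t1 by auto
  interpret J: jacobian_convolution \<alpha> "\<lambda>n. w n t" "\<lambda>n. N n t" by (rule convolution[OF tT])
  have yR: "sqrt (y t) \<le> R" using le[of t] t R by (auto intro: real_le_lsqrt)
  show "norm (N n t) \<le> Kc * R * sqrt (msq \<alpha> n) * sqrt (mass w t)" if "n \<in> waves" for n
  proof -
    have "norm (N n t) \<le> 2 * sqrt (y t) * sqrt (msq \<alpha> n) * sqrt (mass w t)"
      using J.norm_N_waves_le[OF that] by (simp add: conv_consts[OF tT])
    also have "\<dots> \<le> Kc * R * sqrt (msq \<alpha> n) * sqrt (mass w t)"
      using yR K_nonneg J.consts_nonneg by (intro mult_right_mono mult_mono) (auto simp: msq_nonneg conv_consts[OF tT] R)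
    finally show ?thesis .
  qed
  show "(\<Sum>n\<in>F. norm (w n t) * norm (N n t)) \<le> Kc * R * grad \<alpha> w t" if "finite F" "F \<subseteq> waves" for F
  proof -
    have "(\<Sum>n\<in>F. norm (w n t) * norm (N n t)) \<le> (sqrt J.K1 + sqrt J.K2) * sqrt (y t) * grad \<alpha> w t"
      using J.pairing_le[OF that] by (simp add: conv_consts[OF tT])
    also have "\<dots> \<le> Kc * R * grad \<alpha> w t"
      using yR J.consts_nonneg by (intro mult_right_mono mult_mono) (auto simp: jacobian_const_def conv_consts[OF tT] R)
    finally show ?thesis .
  qed
qed (use t1 alpha nu c_ge c_le cmin Z ode Hb in auto)

text \<open>The axis modes solve a heat equation with the forcing \<open>- N\<close>. Young's
  inequality absorbs the factor \<open>w\<close> in the viscosity and leaves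
  \<open>(norm N)\<^sup>2 / (2 * \<nu> * msq)\<close>, which \<open>axis_le\<close> bounds by
  \<open>K4 / (2 * \<nu>)\<close> times dissipation times mass of the waves. The mass stays below a
  multiple of its initial value and the dissipation integrates to order \<open>1 / \<nu>\<close>;
  hence \<open>\<nu>\<^sup>2\<close> in the denominator.\<close>

lemma axis_growth:
  assumes t1: "t1 \<in> {0<..T}" and R: "0 \<le> R" and le: "\<And>s. s \<in> {0..t1} \<Longrightarrow> y s \<le> R\<^sup>2"
    and small: "Kc * R \<le> \<nu> * (1 - 1 / \<alpha>\<^sup>2) / 2"
    and F: "finite F" "F \<inter> waves = {}"
  shows "(\<Sum>n\<in>F. (norm (w n t1))\<^sup>2) \<le> (\<Sum>n\<in>F. (norm (w n 0))\<^sup>2)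
    + K4 * (mass w 0)\<^sup>2 / (2 * \<nu>\<^sup>2 * (1 - 1 / \<alpha>\<^sup>2)\<^sup>2)"
proof -
  interpret S: shear_modes \<alpha> \<nu> t1 "Kc * R" cmin "R\<^sup>2" c w N Hb Z
    by (rule shear_modes_until[OF t1 R le])
  have c0: "S.c0 = 1 - 1 / \<alpha>\<^sup>2" by (rule S.c0_def)
  define f where "f n s = - ((\<nu> * msq \<alpha> n) *\<^sub>R w n s) - N n s" for n s
  have f: "(f n has_integral (w n t - w n 0)) {0..t}" if "n \<in> F" "t \<in> {0..t1}" for n t
  proof -
    have "fst n = 0" using F that(1) by (auto simp: waves_def)
    then show ?thesis using ode[of t 0 "snd n"] that(2) t1 by (cases n) (simp add: f_def[abs_def])
  qed
  have int: "((\<lambda>s. \<Sum>n\<in>F. f n s \<bullet> w n s + w n s \<bullet> f n s) has_integral (\<Sum>n\<in>F. w n t1 \<bullet> w n t1 - w n 0 \<bullet> w n 0)) {0..t1}"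
  proof (intro has_integral_sum F)
    fix n assume n: "n \<in> F"
    have b: "norm (f n t) \<le> \<nu> * msq \<alpha> n * R + sqrt (msq \<alpha> n) * R\<^sup>2" if t: "t \<in> {0..t1} - Z" for t
    proof -
      have tT: "t \<in> {0..T} - Z" using t t1 by auto
      interpret J: jacobian_convolution \<alpha> "\<lambda>n. w n t" "\<lambda>n. N n t" by (rule convolution[OF tT])
      have "(norm (w n t))\<^sup>2 \<le> R\<^sup>2" using sum_le_y[of t "{n}"] le[of t] t tT by auto
      then have "norm (w n t) \<le> R" using R by (rule power2_le_imp_le)
      moreover have "norm (N n t) \<le> sqrt (msq \<alpha> n) * y t"
        using J.norm_N_le_Y by (simp add: conv_consts[OF tT])
      moreover have "sqrt (msq \<alpha> n) * y t \<le> sqrt (msq \<alpha> n) * R\<^sup>2"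
        using le[of t] t by (intro mult_left_mono) (auto simp: msq_nonneg)
      moreover have "norm (f n t) \<le> norm ((\<nu> * msq \<alpha> n) *\<^sub>R w n t) + norm (N n t)"
        unfolding f_def using norm_triangle_ineq4[of "- ((\<nu> * msq \<alpha> n) *\<^sub>R w n t)" "N n t"] by simp
      moreover have "norm ((\<nu> * msq \<alpha> n) *\<^sub>R w n t) \<le> \<nu> * msq \<alpha> n * R"
        using \<open>norm (w n t) \<le> R\<close> nu by (simp add: abs_mult msq_nonneg mult_left_mono)
      ultimately show ?thesis by linarith
    qed
    show "((\<lambda>s. f n s \<bullet> w n s + w n s \<bullet> f n s) has_integral (w n t1 \<bullet> w n t1 - w n 0 \<bullet> w n 0)) {0..t1}"
      by (rule has_integral_inner_primitives[OF f[OF n] f[OF n] Z b b]) (use t1 in auto)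
  qed
  define M where "M = K4 / (2 * \<nu>) * (mass w 0 / S.c0)"
  have M: "0 \<le> M" using K_nonneg nu S.c0 S.mass_nonneg by (simp add: M_def)
  have "((\<lambda>s. M * grad \<alpha> w s) has_integral (M * integral {0..t1} (grad \<alpha> w))) {0..t1}"
    using S.grad_dominated(1)[of 0 t1] t1 by (intro has_integral_mult_right integrable_integral) auto
  then have int2: "((\<lambda>s. if s \<in> Z then 0 else M * grad \<alpha> w s) has_integral (M * integral {0..t1} (grad \<alpha> w))) {0..t1}"
    by (rule has_integral_spike[OF Z, rotated]) auto
  have int1: "((\<lambda>s. if s \<in> Z then 0 else \<Sum>n\<in>F. f n s \<bullet> w n s + w n s \<bullet> f n s) has_integral (\<Sum>n\<in>F. w n t1 \<bullet> w n t1 - w n 0 \<bullet> w n 0)) {0..t1}"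
    by (rule has_integral_spike[OF Z _ int]) auto
  have "(\<Sum>n\<in>F. f n s \<bullet> w n s + w n s \<bullet> f n s) \<le> M * grad \<alpha> w s" if s: "s \<in> {0..t1} - Z" for s
  proof -
    have sT: "s \<in> {0..T} - Z" using s t1 by auto
    interpret J: jacobian_convolution \<alpha> "\<lambda>n. w n s" "\<lambda>n. N n s" by (rule convolution[OF sT])
    have "(\<Sum>n\<in>F. f n s \<bullet> w n s + w n s \<bullet> f n s) \<le> (\<Sum>n\<in>F. 1 / (2 * \<nu>) * ((norm (N n s))\<^sup>2 / msq \<alpha> n))"
    proof (rule sum_mono)
      fix n assume n: "n \<in> F"
      have e: "f n s \<bullet> w n s + w n s \<bullet> f n s = - 2 * (\<nu> * msq \<alpha> n * (norm (w n s))\<^sup>2) - 2 * (N n s \<bullet> w n s)"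
      proof -
        have "f n s \<bullet> w n s = - (\<nu> * msq \<alpha> n * (norm (w n s))\<^sup>2) - N n s \<bullet> w n s"
          unfolding f_def inner_diff_left inner_minus_left inner_scaleR_left power2_norm_eq_inner ..
        then show ?thesis by (subst inner_commute[of "w n s" "f n s"]) simp
      qed
      show "f n s \<bullet> w n s + w n s \<bullet> f n s \<le> 1 / (2 * \<nu>) * ((norm (N n s))\<^sup>2 / msq \<alpha> n)"
      proof (cases "msq \<alpha> n = 0")
        case True
        \<comment> \<open>This is the mean mode \<open>n = 0\<close>, which has no viscosity; the
          forcing vanishes there as well, because its bound contains
          \<open>sqrt (msq \<alpha> n)\<close>.\<close>
        then have "N n s = 0" using J.norm_N_le_Y[of n] by simp
        then show ?thesis using True unfolding e by simp
      next
        case False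
        then have m: "0 < msq \<alpha> n" using msq_nonneg[of \<alpha> n] by linarith
        define k where "k = 2 * \<nu> * msq \<alpha> n"
        have k: "k > 0" using m nu by (simp add: k_def)
        define a b where "a = norm (w n s)" and "b = norm (N n s)"
        have "- (N n s \<bullet> w n s) \<le> b * a"
          using Cauchy_Schwarz_ineq2[of "N n s" "w n s"] unfolding a_def b_def by linarith
        moreover have "0 \<le> (k * a - b)\<^sup>2 / k" using k by simp
        moreover have "(k * a - b)\<^sup>2 / k = k * a\<^sup>2 - 2 * (b * a) + b\<^sup>2 / k"
          
        proof -
          have "(k * a - b)\<^sup>2 = k * (k * a\<^sup>2) - k * (2 * (b * a)) + b\<^sup>2"
            by (simp add: power2_eq_square algebra_simps)
          then show ?thesis using k by (simp add: add_divide_distrib diff_divide_distrib)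
        qed
        moreover have "b\<^sup>2 / k = 1 / (2 * \<nu>) * (b\<^sup>2 / msq \<alpha> n)" by (simp add: k_def)
        moreover have "k * a\<^sup>2 = 2 * (\<nu> * msq \<alpha> n * a\<^sup>2)" by (simp add: k_def)
        ultimately have "- 2 * (\<nu> * msq \<alpha> n * a\<^sup>2) - 2 * (N n s \<bullet> w n s) \<le> 1 / (2 * \<nu>) * (b\<^sup>2 / msq \<alpha> n)"
          by linarith
        then show ?thesis unfolding e a_def b_def .
      qed
    qed
    also have "\<dots> = 1 / (2 * \<nu>) * (\<Sum>n\<in>F. (norm (N n s))\<^sup>2 / msq \<alpha> n)" by (rule sum_distrib_left[symmetric])
    also have "\<dots> \<le> 1 / (2 * \<nu>) * (K4 * grad \<alpha> w s * mass w s)"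
      using J.axis_le[OF F] nu by (intro mult_left_mono) (auto simp: conv_consts[OF sT])
    also have "\<dots> \<le> 1 / (2 * \<nu>) * (K4 * grad \<alpha> w s * (mass w 0 / S.c0))"
    proof (intro mult_left_mono)
      have "S.c0 * mass w s \<le> mass w 0" using small s by (intro S.mass_growth) (auto simp: c0)
      then show "mass w s \<le> mass w 0 / S.c0" using S.c0 by (simp add: field_simps)
    qed (use nu K_nonneg S.grad_nonneg in auto)
    finally show ?thesis by (simp add: M_def mult_ac)
  qed
  then have "(\<Sum>n\<in>F. w n t1 \<bullet> w n t1 - w n 0 \<bullet> w n 0) \<le> M * integral {0..t1} (grad \<alpha> w)"
    by (intro has_integral_le[OF int1 int2]) auto
  also have "\<dots> \<le> M * (mass w 0 / (\<nu> * S.c0))"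
  proof (rule mult_left_mono[OF _ M])
    have "\<nu> * S.c0 * integral {0..t1} (grad \<alpha> w) \<le> mass w 0"
      using small by (intro S.grad_integral_bound) (simp add: c0)
    then show "integral {0..t1} (grad \<alpha> w) \<le> mass w 0 / (\<nu> * S.c0)"
      using nu S.c0 by (simp add: pos_le_divide_eq mult.commute)
  qed
  also have "\<dots> = K4 * (mass w 0)\<^sup>2 / (2 * \<nu>\<^sup>2 * S.c0\<^sup>2)"
    by (simp add: M_def power2_eq_square mult_ac)
  finally show ?thesis by (simp add: power2_norm_eq_inner sum_subtractf c0)
qed

text \<open>The waves are bounded by their energy and the axis modes by the heat equation. The right
  side depends on \<open>y 0\<close> and not on \<open>R\<close>, so small data improve the assumed
  bound \<open>R\<^sup>2\<close>; this is what closes the bootstrap.\<close>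

lemma y_growth:
  assumes t1: "t1 \<in> {0<..T}" and R: "0 \<le> R" and le: "\<And>s. s \<in> {0..t1} \<Longrightarrow> y s \<le> R\<^sup>2"
    and small: "Kc * R \<le> \<nu> * (1 - 1 / \<alpha>\<^sup>2) / 2"
  shows "y t1 \<le> y 0 / (1 - 1 / \<alpha>\<^sup>2) + y 0 + K4 * (y 0)\<^sup>2 / (2 * \<nu>\<^sup>2 * (1 - 1 / \<alpha>\<^sup>2)\<^sup>2)"
proof -
  interpret S: shear_modes \<alpha> \<nu> t1 "Kc * R" cmin "R\<^sup>2" c w N Hb Z
    by (rule shear_modes_until[OF t1 R le])
  have c0: "S.c0 = 1 - 1 / \<alpha>\<^sup>2" by (rule S.c0_def)
  have T0: "0 \<in> {0..T}" "t1 \<in> {0..T}" using t1 T_pos by auto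
  have "S.c0 * mass w t1 \<le> mass w 0" using small t1 by (intro S.mass_growth) (auto simp: c0)
  also have "\<dots> \<le> y 0" by (rule mass_le_y[OF T0(1)])
  finally have m: "mass w t1 \<le> y 0 / S.c0" using S.c0 by (simp add: field_simps)
  show ?thesis unfolding y_def[of t1]
  proof (rule infsum_le_finite_sums[OF w2[OF T0(2)]])
    fix F :: "(int \<times> int) set" assume F: "finite F"
    have "(\<Sum>n\<in>F. (norm (w n t1))\<^sup>2) = (\<Sum>n\<in>F \<inter> waves. (norm (w n t1))\<^sup>2) + (\<Sum>n\<in>F - waves. (norm (w n t1))\<^sup>2)"
      using F by (simp add: sum.Int_Diff)
    moreover have "(\<Sum>n\<in>F \<inter> waves. (norm (w n t1))\<^sup>2) \<le> mass w t1"
      using F t1 by (intro S.sum_le_mass) auto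
    moreover have "(\<Sum>n\<in>F - waves. (norm (w n t1))\<^sup>2) \<le> (\<Sum>n\<in>F - waves. (norm (w n 0))\<^sup>2)
        + K4 * (mass w 0)\<^sup>2 / (2 * \<nu>\<^sup>2 * (1 - 1 / \<alpha>\<^sup>2)\<^sup>2)"
      using F by (intro axis_growth[OF t1 R le small]) auto
    moreover have "(\<Sum>n\<in>F - waves. (norm (w n 0))\<^sup>2) \<le> y 0" using F T0 by (intro sum_le_y) auto
    moreover have "K4 * (mass w 0)\<^sup>2 / (2 * \<nu>\<^sup>2 * (1 - 1 / \<alpha>\<^sup>2)\<^sup>2) \<le> K4 * (y 0)\<^sup>2 / (2 * \<nu>\<^sup>2 * (1 - 1 / \<alpha>\<^sup>2)\<^sup>2)"
      using mass_le_y[OF T0(1)] S.mass_nonneg K_nonneg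
      by (intro divide_right_mono mult_left_mono power_mono) auto
    ultimately show "(\<Sum>n\<in>F. (norm (w n t1))\<^sup>2) \<le> y 0 / (1 - 1 / \<alpha>\<^sup>2) + y 0 + K4 * (y 0)\<^sup>2 / (2 * \<nu>\<^sup>2 * (1 - 1 / \<alpha>\<^sup>2)\<^sup>2)"
      using m unfolding c0 by linarith
  qed
qed

end

text \<open>The radius \<open>R = \<nu> * r\<close> is the largest one for which the relative size
  \<open>Kc * R\<close> stays within half of the dissipation. For data of size
  \<open>\<nu> * d0\<close> the growth bound is \<open>\<nu>\<^sup>2 * (d0\<^sup>2 * M)\<close>, all
  other powers of \<open>\<nu>\<close> cancelling, so \<open>d0\<close> can be chosen from
  \<open>\<alpha>\<close> alone.\<close>

theorem perturbed_flow_decay: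
  fixes \<alpha> \<tau> \<delta> cmin :: real
  assumes "\<alpha> > 1" "\<tau> > 0" "\<delta> > 0" "cmin > 0"
  shows "\<exists>\<nu>0>0. \<exists>d0>0. \<forall>\<nu> c w N Hb Z. \<nu> \<le> \<nu>0 \<longrightarrow> perturbed_flow \<alpha> \<nu> (\<tau> / \<nu>) cmin c w N Hb Z \<longrightarrow>
    (\<Sum>\<^sub>\<infinity>n. (norm (w n 0))\<^sup>2) \<le> (\<nu> * d0)\<^sup>2 \<longrightarrow> mass w (\<tau> / \<nu>) \<le> \<delta> * mass w 0"
proof -
  define g0 where "g0 = 1 - 1 / \<alpha>\<^sup>2"
  have g0: "0 < g0" "g0 < 1"
    using assms(1) by (auto simp: g0_def power2_eq_square field_simps less_1_mult)
  obtain \<nu>0 where \<nu>0: "\<nu>0 > 0" and core: "\<And>\<nu> \<theta> B c v N Hb Z. \<nu> \<le> \<nu>0 \<Longrightarrow> \<theta> \<le> \<nu> * g0 / 2 \<Longrightarrow>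
    shear_modes \<alpha> \<nu> (\<tau> / \<nu>) \<theta> cmin B c v N Hb Z \<Longrightarrow> mass v (\<tau> / \<nu>) \<le> \<delta> * mass v 0"
    using shear_modes_decay[OF assms] unfolding g0_def by blast
  define r where "r = g0 / (2 * jacobian_const \<alpha>)"
  define K where "K = jacobian_convolution.K1 \<alpha>"
  define M where "M = 1 / g0 + 1 + K / (2 * g0\<^sup>2)"
  \<comment> \<open>The signs of the constants are known only inside the locale, so the definition
    falls back on 1 otherwise and is positive in any case. The \<open>+ 1\<close> makes the
    bootstrap strict, through \<open>M < (M + 1)\<^sup>2\<close>.\<close>
  define d0 where "d0 = (if 2 \<le> jacobian_const \<alpha> \<and> 0 \<le> K then r / (M + 1) else 1)"
  show ?thesis
  proof (rule exI[of _ \<nu>0], intro conjI \<nu>0, rule exI[of _ d0], intro conjI allI impI)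
    show "0 < d0"
    proof (cases "2 \<le> jacobian_const \<alpha> \<and> 0 \<le> K")
      case True
      then have "0 < r" "0 < M" using g0 by (auto simp: r_def M_def intro!: add_pos_nonneg)
      then show ?thesis using True by (simp add: d0_def)
    qed (auto simp: d0_def)
    fix \<nu> c w N Hb and Z :: "real set"
    assume \<nu>: "\<nu> \<le> \<nu>0" and pf: "perturbed_flow \<alpha> \<nu> (\<tau> / \<nu>) cmin c w N Hb Z"
      and init: "(\<Sum>\<^sub>\<infinity>n. (norm (w n 0))\<^sup>2) \<le> (\<nu> * d0)\<^sup>2"
    interpret perturbed_flow \<alpha> \<nu> "\<tau> / \<nu>" cmin c w N Hb Z by (rule pf)
    have K: "0 \<le> K" "2 \<le> jacobian_const \<alpha>" using K_nonneg by (auto simp: K_def)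
    have r: "0 < r" "r \<le> 1" using g0 K by (auto simp: r_def)
    have M: "1 \<le> M" using g0 K by (auto simp: M_def intro!: add_nonneg_nonneg)
    have d0: "d0 = r / (M + 1)" using K by (simp add: d0_def)
    have d01: "0 < d0" "d0 \<le> 1" using r M by (auto simp: d0)
    define R where "R = \<nu> * r"
    have R: "0 \<le> R" using nu r by (simp add: R_def)
    have small: "jacobian_const \<alpha> * R \<le> \<nu> * (1 - 1 / \<alpha>\<^sup>2) / 2"
      using K by (simp add: R_def r_def g0_def)
    have y0: "y 0 \<le> (\<nu> * d0)\<^sup>2" using init by (simp add: y_def)
    have dM: "d0\<^sup>2 * M < r\<^sup>2"
    proof -
      have "M < (M + 1)\<^sup>2" using M by (simp add: power2_eq_square algebra_simps add_pos_nonneg)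
      then have "r\<^sup>2 * M < r\<^sup>2 * (M + 1)\<^sup>2" using r by simp
      then show ?thesis using M by (simp add: d0 power_divide field_simps)
    qed
    have bound: "y 0 / (1 - 1 / \<alpha>\<^sup>2) + y 0 + K * (y 0)\<^sup>2 / (2 * \<nu>\<^sup>2 * (1 - 1 / \<alpha>\<^sup>2)\<^sup>2) < R\<^sup>2"
    proof -
      have "(y 0)\<^sup>2 \<le> ((\<nu> * d0)\<^sup>2)\<^sup>2" using y0 y_nonneg by (intro power_mono) auto
      also have "\<dots> = \<nu>\<^sup>2 * (\<nu>\<^sup>2 * d0\<^sup>2) * d0\<^sup>2" by (simp add: power2_eq_square)
      also have "\<dots> \<le> \<nu>\<^sup>2 * (\<nu>\<^sup>2 * d0\<^sup>2) * 1" using d01 by (intro mult_left_mono) (auto simp: power_le_one)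
      finally have y2: "(y 0)\<^sup>2 \<le> \<nu>\<^sup>2 * (\<nu>\<^sup>2 * d0\<^sup>2)" by simp
      have "y 0 / g0 + y 0 + K * (y 0)\<^sup>2 / (2 * \<nu>\<^sup>2 * g0\<^sup>2)
        \<le> (\<nu>\<^sup>2 * d0\<^sup>2) / g0 + \<nu>\<^sup>2 * d0\<^sup>2 + K * (\<nu>\<^sup>2 * (\<nu>\<^sup>2 * d0\<^sup>2)) / (2 * \<nu>\<^sup>2 * g0\<^sup>2)"
        using y0 y2 g0 K by (intro add_mono divide_right_mono mult_left_mono) (auto simp: power_mult_distrib)
      also have "\<dots> = \<nu>\<^sup>2 * (d0\<^sup>2 * M)"
        using nu g0 by (simp add: M_def field_simps)
      also have "\<dots> < \<nu>\<^sup>2 * r\<^sup>2" using dM nu by simp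
      finally show ?thesis by (simp add: R_def power_mult_distrib g0_def)
    qed
    have yR: "y t \<le> R\<^sup>2" if "t \<in> {0..\<tau> / \<nu>}" for t
    proof (rule continuous_bootstrap[OF _ _ _ that])
      show "continuous_on {0..\<tau> / \<nu>} y" using y_cont by (simp add: y_def[abs_def])
      have "0 \<le> y 0 / (1 - 1 / \<alpha>\<^sup>2)" using g0 y_nonneg by (simp add: g0_def)
      moreover have "0 \<le> K * (y 0)\<^sup>2 / (2 * \<nu>\<^sup>2 * (1 - 1 / \<alpha>\<^sup>2)\<^sup>2)" using K by simp
      ultimately show "y 0 < R\<^sup>2" using bound by linarith
      show "y t < R\<^sup>2" if "t \<in> {0<..\<tau> / \<nu>}" "\<And>s. s \<in> {0..t} \<Longrightarrow> y s \<le> R\<^sup>2" for t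
        using y_growth[OF that(1) R that(2) small] bound by (simp add: K_def)
    qed
    have "shear_modes \<alpha> \<nu> (\<tau> / \<nu>) (jacobian_const \<alpha> * R) cmin (R\<^sup>2) c w N Hb Z"
      using T_pos by (intro shear_modes_until R yR) auto
    then show "mass w (\<tau> / \<nu>) \<le> \<delta> * mass w 0"
      using \<nu> small by (intro core) (auto simp: g0_def)
  qed
qed

section \<open>Fourier coefficients of weak solutions\<close>

text \<open>A cosine with a phase treats sine and cosine at once: every derivative shifts the phase
  by \<open>pi / 2\<close>, so one formula gives the partial derivatives of all orders.\<close>

definition plane_wave :: "real \<Rightarrow> real \<Rightarrow> real \<Rightarrow> real \<times> real \<Rightarrow> real" where
  "plane_wave a b s z = cos (a * fst z + b * snd z + s)"

lemma plane_wave_shift: "- sin (a * x + b * y + s) = plane_wave a b (s + pi / 2) (x, y)"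
  by (simp add: plane_wave_def minus_sin_cos_eq add.assoc)

lemma plane_wave_dx: "((\<lambda>t. plane_wave a b s (t, y)) has_real_derivative a * plane_wave a b (s + pi / 2) (x, y)) (at x)"
proof -
  have "((\<lambda>t. cos (a * t + b * y + s)) has_real_derivative - sin (a * x + b * y + s) * a) (at x)"
    by (auto intro!: derivative_eq_intros)
  then show ?thesis unfolding plane_wave_shift by (simp add: plane_wave_def mult.commute)
qed

lemma plane_wave_dy: "((\<lambda>t. plane_wave a b s (x, t)) has_real_derivative b * plane_wave a b (s + pi / 2) (x, y)) (at y)"
proof -
  have "((\<lambda>t. cos (a * x + b * t + s)) has_real_derivative - sin (a * x + b * y + s) * b) (at y)"
    by (auto intro!: derivative_eq_intros)
  then show ?thesis unfolding plane_wave_shift by (simp add: plane_wave_def mult.commute)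
qed

lemma pd_x_plane_wave: "pd_x (\<lambda>z. c * plane_wave a b s z) = (\<lambda>z. (c * a) * plane_wave a b (s + pi / 2) z)"
  unfolding pd_x_def using DERIV_imp_deriv[OF DERIV_cmult[OF plane_wave_dx]] by (auto simp: fun_eq_iff)

lemma pd_y_plane_wave: "pd_y (\<lambda>z. c * plane_wave a b s z) = (\<lambda>z. (c * b) * plane_wave a b (s + pi / 2) z)"
  unfolding pd_y_def using DERIV_imp_deriv[OF DERIV_cmult[OF plane_wave_dy]] by (auto simp: fun_eq_iff)

lemma plane_wave_pi: "plane_wave a b (s + pi / 2 + pi / 2) z = - plane_wave a b s z"
proof -
  have "a * fst z + b * snd z + (s + pi / 2 + pi / 2) = (a * fst z + b * snd z + s) + pi" by simp
  then show ?thesis unfolding plane_wave_def by (simp only: cos_periodic_pi)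
qed

lemma plane_wave_test_function:
  assumes "\<alpha> > 0"
  shows "plane_wave (\<alpha> * real_of_int k) (real_of_int m) s \<in> test_functions \<alpha>"
proof -
  define D where "D i j z = (\<alpha> * real_of_int k) ^ i * real_of_int m ^ j *
      plane_wave (\<alpha> * real_of_int k) (real_of_int m) (s + real (i + j) * (pi / 2)) z" for i j z
  have per: "cos (t + 2 * pi * real_of_int l) = cos t" for t l
    using sin_cos_eq_iff[of "t + 2 * pi * real_of_int l" t] by blast
  have "torus_periodic \<alpha> (plane_wave (\<alpha> * real_of_int k) (real_of_int m) s)"
    unfolding torus_periodic_def plane_wave_def
  proof (intro allI conjI)
    fix x y
    have "\<alpha> * real_of_int k * (x + 2 * pi / \<alpha>) + real_of_int m * y + s
       = (\<alpha> * real_of_int k * x + real_of_int m * y + s) + 2 * pi * real_of_int k"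
      using assms by (simp add: field_simps)
    then show "cos (\<alpha> * real_of_int k * fst (x + 2 * pi / \<alpha>, y) + real_of_int m * snd (x + 2 * pi / \<alpha>, y) + s)
      = cos (\<alpha> * real_of_int k * fst (x, y) + real_of_int m * snd (x, y) + s)"
      unfolding fst_conv snd_conv by (simp only: per)
    have "\<alpha> * real_of_int k * x + real_of_int m * (y + 2 * pi) + s
       = (\<alpha> * real_of_int k * x + real_of_int m * y + s) + 2 * pi * real_of_int m"
      by (simp add: algebra_simps)
    then show "cos (\<alpha> * real_of_int k * fst (x, y + 2 * pi) + real_of_int m * snd (x, y + 2 * pi) + s)
      = cos (\<alpha> * real_of_int k * fst (x, y) + real_of_int m * snd (x, y) + s)"
      unfolding fst_conv snd_conv by (simp only: per)
  qed
  moreover have "D 0 0 = plane_wave (\<alpha> * real_of_int k) (real_of_int m) s"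
    by (simp add: D_def[abs_def])
  moreover have "continuous_on UNIV (D i j)" for i j
    unfolding D_def plane_wave_def by (intro continuous_intros)
  moreover have "((\<lambda>t. D i j (t, y)) has_real_derivative D (Suc i) j (x, y)) (at x)" for i j x y
    using DERIV_cmult[OF plane_wave_dx, of "(\<alpha> * real_of_int k) ^ i * real_of_int m ^ j"
        "\<alpha> * real_of_int k" "real_of_int m" "s + real (i + j) * (pi / 2)" y x]
    by (simp add: D_def algebra_simps add_divide_distrib)
  moreover have "((\<lambda>t. D i j (x, t)) has_real_derivative D i (Suc j) (x, y)) (at y)" for i j x y
    using DERIV_cmult[OF plane_wave_dy, of "(\<alpha> * real_of_int k) ^ i * real_of_int m ^ j"
        "\<alpha> * real_of_int k" "real_of_int m" "s + real (i + j) * (pi / 2)" x y]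
    by (simp add: D_def algebra_simps add_divide_distrib)
  ultimately show ?thesis unfolding test_functions_def by blast
qed

context flat_torus
begin

text \<open>Test functions are real, so a mode enters the weak formulation through its real part
  \<open>cw\<close> and its imaginary part \<open>sw\<close>.\<close>

definition cw :: "int \<times> int \<Rightarrow> real \<times> real \<Rightarrow> real" where
  "cw n = plane_wave (\<alpha> * real_of_int (fst n)) (real_of_int (snd n)) 0"

definition sw :: "int \<times> int \<Rightarrow> real \<times> real \<Rightarrow> real" where
  "sw n = plane_wave (\<alpha> * real_of_int (fst n)) (real_of_int (snd n)) (- (pi / 2))"

lemma cw_sw_test: "cw n \<in> test_functions \<alpha>" "sw n \<in> test_functions \<alpha>"
  unfolding cw_def sw_def by (rule plane_wave_test_function[OF alpha_pos])+

lemma cw_sw_derivs: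
  "pd_x (cw n) = (\<lambda>z. - (\<alpha> * real_of_int (fst n)) * sw n z)" "pd_x (sw n) = (\<lambda>z. \<alpha> * real_of_int (fst n) * cw n z)"
  "pd_y (cw n) = (\<lambda>z. - real_of_int (snd n) * sw n z)" "pd_y (sw n) = (\<lambda>z. real_of_int (snd n) * cw n z)"
  "laplacian (cw n) = (\<lambda>z. - msq \<alpha> n * cw n z)" "laplacian (sw n) = (\<lambda>z. - msq \<alpha> n * sw n z)"
proof -
  have sh: "plane_wave a b (pi / 2) z = - plane_wave a b (- (pi / 2)) z" for a b z
    using plane_wave_pi[of a b "- (pi / 2)" z] by simp
  note px = pd_x_plane_wave[where c = 1, simplified] and py = pd_y_plane_wave[where c = 1, simplified]
  show "pd_x (cw n) = (\<lambda>z. - (\<alpha> * real_of_int (fst n)) * sw n z)"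
    unfolding cw_def sw_def px[where s = 0, simplified] sh by (simp add: fun_eq_iff)
  show "pd_y (cw n) = (\<lambda>z. - real_of_int (snd n) * sw n z)"
    unfolding cw_def sw_def py[where s = 0, simplified] sh by (simp add: fun_eq_iff)
  show "pd_x (sw n) = (\<lambda>z. \<alpha> * real_of_int (fst n) * cw n z)"
    unfolding cw_def sw_def px by simp
  show "pd_y (sw n) = (\<lambda>z. real_of_int (snd n) * cw n z)"
    unfolding cw_def sw_def py by simp
  have lap: "laplacian (plane_wave a b s) = (\<lambda>z. - (a\<^sup>2 + b\<^sup>2) * plane_wave a b s z)" for a b s
    unfolding laplacian_def px py pd_x_plane_wave pd_y_plane_wave plane_wave_pi
    by (simp add: fun_eq_iff power2_eq_square algebra_simps)
  show "laplacian (cw n) = (\<lambda>z. - msq \<alpha> n * cw n z)" "laplacian (sw n) = (\<lambda>z. - msq \<alpha> n * sw n z)"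
    unfolding cw_def sw_def lap msq_def by auto
qed

lemma cnj_mode_cw_sw: "cnj (mode \<alpha> n z) = of_real (cw n z) - \<i> * of_real (sw n z)"
proof -
  have "cos (t - pi / 2) = sin t" for t by (simp add: cos_diff)
  then show ?thesis by (simp add: mode_def cw_def sw_def plane_wave_def complex_eq_iff)
qed

lemma cw_sw_bounded: "\<bar>cw n z\<bar> \<le> 1" "\<bar>sw n z\<bar> \<le> 1"
  by (simp_all add: cw_def sw_def plane_wave_def)

lemma cw_sw_measurable [measurable]: "cw n \<in> borel_measurable (torus \<alpha>)" "sw n \<in> borel_measurable (torus \<alpha>)"
  unfolding cw_def sw_def plane_wave_def
  by (intro borel_measurable_torus borel_measurable_continuous_onI continuous_intros)+

lemma integrable_mult_wave:
  fixes f :: "real \<times> real \<Rightarrow> real"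
  assumes f: "integrable (torus \<alpha>) f" and p: "p = cw n \<or> p = sw n"
  shows "integrable (torus \<alpha>) (\<lambda>z. f z * p z)"
proof (rule Bochner_Integration.integrable_bound[OF f])
  have [measurable]: "f \<in> borel_measurable (torus \<alpha>)" "p \<in> borel_measurable (torus \<alpha>)" using f p by auto
  show "(\<lambda>z. f z * p z) \<in> borel_measurable (torus \<alpha>)" by measurable
  show "AE z in torus \<alpha>. norm (f z * p z) \<le> norm (f z)"
    using p cw_sw_bounded[of n] by (auto simp: abs_mult intro!: mult_left_le)
qed

definition rfc :: "(real \<times> real \<Rightarrow> real) \<Rightarrow> int \<times> int \<Rightarrow> complex" where
  "rfc f n = fcoef \<alpha> (\<lambda>z. of_real (f z)) n"

lemma rfc_real:
  assumes f: "integrable (torus \<alpha>) f"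
  shows "rfc f n = (of_real (LINT z|torus \<alpha>. f z * cw n z) - \<i> * of_real (LINT z|torus \<alpha>. f z * sw n z)) / of_real (area \<alpha>)"
proof -
  have "integrable (torus \<alpha>) (\<lambda>z. f z * cw n z)" "integrable (torus \<alpha>) (\<lambda>z. f z * sw n z)"
    using integrable_mult_wave[OF f] by blast+
  then have i: "integrable (torus \<alpha>) (\<lambda>z. complex_of_real (f z * cw n z))" "integrable (torus \<alpha>) (\<lambda>z. \<i> * complex_of_real (f z * sw n z))"
    by (simp_all only: integrable_mult_right integrable_of_real)
  have "(LINT z|torus \<alpha>. of_real (f z) * cnj (mode \<alpha> n z))
    = (LINT z|torus \<alpha>. complex_of_real (f z * cw n z) - \<i> * complex_of_real (f z * sw n z))"
    by (simp add: cnj_mode_cw_sw right_diff_distrib mult.left_commute)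
  also have "\<dots> = (LINT z|torus \<alpha>. complex_of_real (f z * cw n z)) - (LINT z|torus \<alpha>. \<i> * complex_of_real (f z * sw n z))"
    by (rule Bochner_Integration.integral_diff[OF i])
  also have "\<dots> = of_real (LINT z|torus \<alpha>. f z * cw n z) - \<i> * of_real (LINT z|torus \<alpha>. f z * sw n z)"
    by (simp only: integral_complex_of_real integral_mult_right_zero)
  finally show ?thesis by (simp add: rfc_def fcoef_def)
qed

definition sq_real :: "(real \<times> real \<Rightarrow> real) \<Rightarrow> bool" where
  "sq_real f \<longleftrightarrow> sq_int \<alpha> (\<lambda>z. of_real (f z))"

lemma sq_real_iff: "sq_real f \<longleftrightarrow> f \<in> borel_measurable (torus \<alpha>) \<and> integrable (torus \<alpha>) (\<lambda>z. (f z)\<^sup>2)"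
  unfolding sq_real_def sq_int_def by (simp add: borel_measurable_complex_iff)

lemma L2_sq_real: "f \<in> L2_torus \<alpha> \<Longrightarrow> sq_real f"
  by (simp add: sq_real_iff L2_torus_def)

lemma sq_real_integrable: "sq_real f \<Longrightarrow> integrable (torus \<alpha>) f"
  using integrable_Re[OF sq_int_integrable[of "\<lambda>z. of_real (f z)"]] by (simp add: sq_real_def)

lemma sq_real_mult: "sq_real f \<Longrightarrow> sq_real g \<Longrightarrow> integrable (torus \<alpha>) (\<lambda>z. f z * g z)"
  using integrable_Re[OF sq_int_mult[of "\<lambda>z. of_real (f z)" "\<lambda>z. of_real (g z)"]] by (simp add: sq_real_def)

lemma sq_real_add: "sq_real f \<Longrightarrow> sq_real g \<Longrightarrow> sq_real (\<lambda>z. f z + g z)"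
  unfolding sq_real_def by (drule (1) sq_int_add) simp

lemma sq_real_diff: "sq_real f \<Longrightarrow> sq_real g \<Longrightarrow> sq_real (\<lambda>z. f z - g z)"
  unfolding sq_real_def by (drule (1) sq_int_diff) simp

lemma sq_real_scale: "sq_real f \<Longrightarrow> sq_real (\<lambda>z. c * f z)"
  unfolding sq_real_def by (drule sq_int_scale[where c = "of_real c"]) simp

lemma rfc_add: "integrable (torus \<alpha>) f \<Longrightarrow> integrable (torus \<alpha>) g \<Longrightarrow> rfc (\<lambda>z. f z + g z) n = rfc f n + rfc g n"
proof -
  assume f: "integrable (torus \<alpha>) f" and g: "integrable (torus \<alpha>) g"
  have "(LINT z|torus \<alpha>. (f z + g z) * p z) = (LINT z|torus \<alpha>. f z * p z) + (LINT z|torus \<alpha>. g z * p z)"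
    if "p = cw n \<or> p = sw n" for p
    unfolding distrib_right using integrable_mult_wave[OF f that] integrable_mult_wave[OF g that]
    by (rule Bochner_Integration.integral_add)
  then show ?thesis
    unfolding rfc_real[OF f] rfc_real[OF g] rfc_real[OF Bochner_Integration.integrable_add[OF f g]]
    by (simp add: diff_divide_distrib add_divide_distrib distrib_left)
qed

lemma rfc_scale: "rfc (\<lambda>z. c * f z) n = of_real c * rfc f n"
  unfolding rfc_def using fcoef_scale[of "of_real c" "\<lambda>z. of_real (f z)" n] by simp

lemma rfc_diff: "integrable (torus \<alpha>) f \<Longrightarrow> integrable (torus \<alpha>) g \<Longrightarrow> rfc (\<lambda>z. f z - g z) n = rfc f n - rfc g n"
  using rfc_add[of f "\<lambda>z. -1 * g z" n] rfc_scale[of "-1" g n] by simp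

lemma rfc_L2_zero: "f \<in> L2_torus \<alpha> \<Longrightarrow> rfc f 0 = 0"
  by (simp add: rfc_def fcoef_def L2_torus_def)

lemma rfc_weak_dx:
  assumes f: "sq_real f" and "weak_dx \<alpha> f g"
  shows "rfc g n = \<i> * of_real (\<alpha> * real_of_int (fst n)) * rfc f n"
proof -
  have g: "integrable (torus \<alpha>) g" using assms(2) by (auto simp: weak_dx_def intro: sq_real_integrable L2_sq_real)
  define a where "a = \<alpha> * real_of_int (fst n)"
  have "(LINT z|torus \<alpha>. f z * pd_x (cw n) z) = - (LINT z|torus \<alpha>. g z * cw n z)"
    "(LINT z|torus \<alpha>. f z * pd_x (sw n) z) = - (LINT z|torus \<alpha>. g z * sw n z)"
    using assms(2) cw_sw_test[of n] by (auto simp: weak_dx_def)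
  moreover have "(LINT z|torus \<alpha>. f z * pd_x (cw n) z) = - a * (LINT z|torus \<alpha>. f z * sw n z)"
    "(LINT z|torus \<alpha>. f z * pd_x (sw n) z) = a * (LINT z|torus \<alpha>. f z * cw n z)"
    unfolding cw_sw_derivs a_def by (simp_all add: mult.left_commute flip: integral_mult_right_zero)
  ultimately have "(LINT z|torus \<alpha>. g z * cw n z) = a * (LINT z|torus \<alpha>. f z * sw n z)"
    "(LINT z|torus \<alpha>. g z * sw n z) = - a * (LINT z|torus \<alpha>. f z * cw n z)" by linarith+
  then show ?thesis
    unfolding rfc_real[OF g] rfc_real[OF sq_real_integrable[OF f]] a_def[symmetric]
    by (simp add: algebra_simps)
qed

lemma rfc_weak_dy:
  assumes f: "sq_real f" and "weak_dy \<alpha> f g"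
  shows "rfc g n = \<i> * of_real (real_of_int (snd n)) * rfc f n"
proof -
  have g: "integrable (torus \<alpha>) g" using assms(2) by (auto simp: weak_dy_def intro: sq_real_integrable L2_sq_real)
  define a where "a = real_of_int (snd n)"
  have "(LINT z|torus \<alpha>. f z * pd_y (cw n) z) = - (LINT z|torus \<alpha>. g z * cw n z)"
    "(LINT z|torus \<alpha>. f z * pd_y (sw n) z) = - (LINT z|torus \<alpha>. g z * sw n z)"
    using assms(2) cw_sw_test[of n] by (auto simp: weak_dy_def)
  moreover have "(LINT z|torus \<alpha>. f z * pd_y (cw n) z) = - a * (LINT z|torus \<alpha>. f z * sw n z)"
    "(LINT z|torus \<alpha>. f z * pd_y (sw n) z) = a * (LINT z|torus \<alpha>. f z * cw n z)"
    unfolding cw_sw_derivs a_def by (simp_all add: mult.left_commute flip: integral_mult_right_zero)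
  ultimately have "(LINT z|torus \<alpha>. g z * cw n z) = a * (LINT z|torus \<alpha>. f z * sw n z)"
    "(LINT z|torus \<alpha>. g z * sw n z) = - a * (LINT z|torus \<alpha>. f z * cw n z)" by linarith+
  then show ?thesis
    unfolding rfc_real[OF g] rfc_real[OF sq_real_integrable[OF f]] a_def[symmetric]
    by (simp add: algebra_simps)
qed

text \<open>For \<open>n \<noteq> 0\<close> by testing with the real waves, which are eigenfunctions
  of the Laplacian. At \<open>n = 0\<close> both sides vanish: \<open>\<psi>\<close> has mean zero,
  and division by zero gives 0.\<close>

lemma rfc_inv_laplacian:
  assumes f: "sq_real f" and "inv_laplacian \<alpha> f \<psi>"
  shows "rfc \<psi> n = - (rfc f n / of_real (msq \<alpha> n))"
proof (cases "n = 0")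
  case True
  then show ?thesis using assms(2) by (simp add: inv_laplacian_def rfc_L2_zero msq_def)
next
  case False
  have p: "integrable (torus \<alpha>) \<psi>" using assms(2) by (auto simp: inv_laplacian_def intro: sq_real_integrable L2_sq_real)
  have m: "msq \<alpha> n \<noteq> 0"
    using False alpha_pos by (auto simp: msq_def prod_eq_iff sum_power2_eq_zero_iff)
  have "(LINT z|torus \<alpha>. \<psi> z * laplacian (cw n) z) = (LINT z|torus \<alpha>. f z * cw n z)"
    "(LINT z|torus \<alpha>. \<psi> z * laplacian (sw n) z) = (LINT z|torus \<alpha>. f z * sw n z)"
    using assms(2) cw_sw_test[of n] by (auto simp: inv_laplacian_def)
  moreover have "(LINT z|torus \<alpha>. \<psi> z * laplacian (cw n) z) = - msq \<alpha> n * (LINT z|torus \<alpha>. \<psi> z * cw n z)"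
    "(LINT z|torus \<alpha>. \<psi> z * laplacian (sw n) z) = - msq \<alpha> n * (LINT z|torus \<alpha>. \<psi> z * sw n z)"
    unfolding cw_sw_derivs by (simp_all add: mult.left_commute flip: integral_mult_right_zero)
  ultimately have c: "(LINT z|torus \<alpha>. f z * cw n z) = - msq \<alpha> n * (LINT z|torus \<alpha>. \<psi> z * cw n z)"
    "(LINT z|torus \<alpha>. f z * sw n z) = - msq \<alpha> n * (LINT z|torus \<alpha>. \<psi> z * sw n z)" by simp_all
  have "rfc f n = - of_real (msq \<alpha> n) * rfc \<psi> n"
    unfolding rfc_real[OF p] rfc_real[OF sq_real_integrable[OF f]] c by (simp add: algebra_simps)
  then show ?thesis using m by simp
qed

lemma sin_cos_y:
  "complex_of_real (sin (snd z)) = (mode \<alpha> (0, 1) z - mode \<alpha> (0, -1) z) / (2 * \<i>)"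
  "complex_of_real (cos (snd z)) = (mode \<alpha> (0, 1) z + mode \<alpha> (0, -1) z) / 2"
  by (simp_all add: mode_def complex_eq_iff)

text \<open>The sine consists of the modes \<open>(0, 1)\<close> and \<open>(0, -1)\<close>, so
  multiplying by it couples a mode to its two neighbours in the same row.\<close>

lemma rfc_sin_mult:
  assumes h: "sq_real h"
  shows "rfc (\<lambda>z. sin (snd z) * h z) n = (rfc h (n - (0, 1)) - rfc h (n + (0, 1))) / (2 * \<i>)"
proof -
  define hc where "hc z = complex_of_real (h z)" for z
  have hc: "sq_int \<alpha> hc" using h by (simp add: sq_real_def hc_def[abs_def])
  have "(\<lambda>z. complex_of_real (sin (snd z) * h z)) = (\<lambda>z. 1 / (2 * \<i>) * (mode \<alpha> (0, 1) z * hc z - mode \<alpha> (0, -1) z * hc z))"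
    by (simp add: sin_cos_y hc_def fun_eq_iff field_simps)
  then have "rfc (\<lambda>z. sin (snd z) * h z) n = 1 / (2 * \<i>) * (fcoef \<alpha> hc (n - (0, 1)) - fcoef \<alpha> hc (n - (0, -1)))"
    unfolding rfc_def by (simp only: fcoef_scale fcoef_diff[OF sq_int_mode_mult[OF hc] sq_int_mode_mult[OF hc]] fcoef_mode_mult)
  moreover have "n - (0, -1) = n + (0, 1)" by (simp add: prod_eq_iff)
  ultimately show ?thesis by (simp add: rfc_def hc_def[abs_def])
qed

lemma sq_real_sin_cos: "sq_real (\<lambda>z. sin (snd z))" "sq_real (\<lambda>z. cos (snd z))"
  unfolding sq_real_def
  by (intro sq_int_bounded[where B = 1] borel_measurable_torus borel_measurable_continuous_onI continuous_intros; simp)+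

lemma rfc_sin_cos:
  "rfc (\<lambda>z. cos (snd z)) n = (if n = (0, 1) \<or> n = (0, -1) then 1 / 2 else 0)"
  "rfc (\<lambda>z. sin (snd z)) n = - (\<i> * of_int (snd n) * rfc (\<lambda>z. cos (snd z)) n)"
proof -
  have c: "(\<lambda>z. complex_of_real (cos (snd z))) = (\<lambda>z. 1 / 2 * (mode \<alpha> (0, 1) z + mode \<alpha> (0, -1) z))"
    by (simp add: sin_cos_y fun_eq_iff)
  have s: "(\<lambda>z. complex_of_real (sin (snd z))) = (\<lambda>z. 1 / (2 * \<i>) * (mode \<alpha> (0, 1) z - mode \<alpha> (0, -1) z))"
    by (simp add: sin_cos_y fun_eq_iff)
  show 1: "rfc (\<lambda>z. cos (snd z)) n = (if n = (0, 1) \<or> n = (0, -1) then 1 / 2 else 0)"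
    unfolding rfc_def c fcoef_scale fcoef_add[OF sq_int_mode sq_int_mode] fcoef_mode by auto
  show "rfc (\<lambda>z. sin (snd z)) n = - (\<i> * of_int (snd n) * rfc (\<lambda>z. cos (snd z)) n)"
    unfolding 1 unfolding rfc_def s fcoef_scale fcoef_diff[OF sq_int_mode sq_int_mode] fcoef_mode
    by (auto simp: field_simps)
qed

lemma rfc_product:
  assumes "sq_real f" "sq_real g"
  shows "((\<lambda>p. rfc f p * rfc g (n - p)) has_sum rfc (\<lambda>z. f z * g z) n) UNIV"
  using fcoef_product[of "\<lambda>z. of_real (f z)" "\<lambda>z. of_real (g z)" n] assms
  by (simp add: rfc_def sq_real_def)

lemma L2_norm_sqn: "L2_norm \<alpha> f = sqrt (sqn (\<lambda>z. of_real (f z)))"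
  by (simp add: L2_norm_def sqn_def)

lemma rfc_parseval:
  assumes "sq_real f"
  shows "((\<lambda>n. (norm (rfc f n))\<^sup>2) has_sum (L2_norm \<alpha> f)\<^sup>2 / area \<alpha>) UNIV"
  using parseval[of "\<lambda>z. of_real (f z)"] assms by (simp add: rfc_def sq_real_def L2_norm_sqn sqn_nonneg)

lemma L2_norm_nonneg: "0 \<le> L2_norm \<alpha> f" by (simp add: L2_norm_sqn sqn_nonneg)

text \<open>The Cauchy-Schwarz inequality behind it is transferred from the Fourier coefficients by
  the two Parseval identities.\<close>

lemma L2_norm_triangle:
  assumes f: "sq_real f" and g: "sq_real g"
  shows "L2_norm \<alpha> (\<lambda>z. f z + g z) \<le> L2_norm \<alpha> f + L2_norm \<alpha> g"
proof -
  define F G where "F z = complex_of_real (f z)" and "G z = complex_of_real (g z)" for z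
  have FG: "sq_int \<alpha> F" "sq_int \<alpha> G" using f g by (auto simp: sq_real_def F_def[abs_def] G_def[abs_def])
  note pF = parseval[OF FG(1)] and pG = parseval[OF FG(2)]
  note cs = infsum_Cauchy_Schwarz[OF has_sum_imp_summable[OF pF] has_sum_imp_summable[OF pG] norm_ge_zero norm_ge_zero]
  have "norm (ip F G / of_real (area \<alpha>)) \<le> (\<Sum>\<^sub>\<infinity>n. norm (fcoef \<alpha> F n) * norm (fcoef \<alpha> G n))"
    by (rule norm_has_sum_le[OF parseval_inner[OF FG] cs(1)]) (simp add: norm_mult)
  also have "\<dots> \<le> sqrt (sqn F / area \<alpha>) * sqrt (sqn G / area \<alpha>)"
    using cs(2) unfolding infsumI[OF pF] infsumI[OF pG] .
  also have "\<dots> = sqrt (sqn F) * sqrt (sqn G) / area \<alpha>"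
    using area_pos by (simp add: real_sqrt_divide)
  finally have "norm (ip F G) \<le> sqrt (sqn F) * sqrt (sqn G)"
    using area_pos by (simp add: norm_divide divide_le_cancel)
  then have "Re (ip F G) \<le> sqrt (sqn F) * sqrt (sqn G)" using complex_Re_le_cmod order_trans by blast
  then have "sqn (\<lambda>z. F z + G z) \<le> (sqrt (sqn F) + sqrt (sqn G))\<^sup>2"
    unfolding sqn_add[OF FG] by (simp add: power2_sum sqn_nonneg)
  then have "sqrt (sqn (\<lambda>z. F z + G z)) \<le> sqrt ((sqrt (sqn F) + sqrt (sqn G))\<^sup>2)"
    by (rule real_sqrt_le_mono)
  then have "sqrt (sqn (\<lambda>z. F z + G z)) \<le> sqrt (sqn F) + sqrt (sqn G)"
    by (simp add: sqn_nonneg)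
  then show ?thesis by (simp add: L2_norm_sqn F_def[abs_def] G_def[abs_def])
qed

text \<open>Testing with the real and imaginary parts of a mode turns the weak equation into an
  integral equation for one Fourier coefficient. Splitting the spatial integral needs
  \<open>g s\<close> integrable, which holds off \<open>Z\<close>, and the time integral does not
  see \<open>Z\<close>.\<close>

lemma rfc_ode:
  fixes \<omega> g :: "real \<Rightarrow> real \<times> real \<Rightarrow> real"
  assumes Z: "negligible Z"
    and \<omega>: "\<And>s. 0 \<le> s \<Longrightarrow> sq_real (\<omega> s)"
    and g: "\<And>s. 0 \<le> s \<Longrightarrow> s \<notin> Z \<Longrightarrow> integrable (torus \<alpha>) (g s)"
    and eq: "\<And>\<phi> t. \<phi> \<in> test_functions \<alpha> \<Longrightarrow> t \<ge> 0 \<Longrightarrow>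
       ((\<lambda>s. LINT z|torus \<alpha>. \<nu> * \<omega> s z * laplacian \<phi> z - g s z * \<phi> z)
         has_integral (LINT z|torus \<alpha>. (\<omega> t z - \<omega> 0 z) * \<phi> z)) {0..t}"
    and t: "t \<ge> 0"
  shows "((\<lambda>s. - ((\<nu> * msq \<alpha> n) *\<^sub>R rfc (\<omega> s) n) - rfc (g s) n) has_integral (rfc (\<omega> t) n - rfc (\<omega> 0) n)) {0..t}"
proof -
  define I where "I p s = (LINT z|torus \<alpha>. \<nu> * \<omega> s z * laplacian p z - g s z * p z)" for p :: "real \<times> real \<Rightarrow> real" and s
  have \<omega>i: "integrable (torus \<alpha>) (\<omega> t)" "integrable (torus \<alpha>) (\<omega> 0)"
    using \<omega>[of t] \<omega>[of 0] t by (auto intro: sq_real_integrable)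
  have "((\<lambda>s. (of_real (I (cw n) s) - \<i> * of_real (I (sw n) s)) / complex_of_real (area \<alpha>)) has_integral
     (of_real (LINT z|torus \<alpha>. (\<omega> t z - \<omega> 0 z) * cw n z) - \<i> * of_real (LINT z|torus \<alpha>. (\<omega> t z - \<omega> 0 z) * sw n z)) / complex_of_real (area \<alpha>)) {0..t}"
    unfolding I_def
    by (intro has_integral_divide has_integral_diff has_integral_mult_right has_integral_of_real eq cw_sw_test t)
  also have "(of_real (LINT z|torus \<alpha>. (\<omega> t z - \<omega> 0 z) * cw n z) - \<i> * of_real (LINT z|torus \<alpha>. (\<omega> t z - \<omega> 0 z) * sw n z)) / complex_of_real (area \<alpha>)
     = rfc (\<lambda>z. \<omega> t z - \<omega> 0 z) n"
    by (rule rfc_real[symmetric]) (rule Bochner_Integration.integrable_diff[OF \<omega>i])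
  also have "\<dots> = rfc (\<omega> t) n - rfc (\<omega> 0) n"
    by (rule rfc_diff[OF \<omega>i])
  finally have main: "((\<lambda>s. (of_real (I (cw n) s) - \<i> * of_real (I (sw n) s)) / complex_of_real (area \<alpha>)) has_integral
     (rfc (\<omega> t) n - rfc (\<omega> 0) n)) {0..t}" .
  show ?thesis
  proof (rule has_integral_spike[OF Z _ main])
    fix s assume s: "s \<in> {0..t} - Z"
    then have w: "integrable (torus \<alpha>) (\<omega> s)" and gs: "integrable (torus \<alpha>) (g s)"
      using \<omega> g by (auto intro: sq_real_integrable)
    have I: "I p s = - (\<nu> * msq \<alpha> n) * (LINT z|torus \<alpha>. \<omega> s z * p z) - (LINT z|torus \<alpha>. g s z * p z)"
      if p: "p = cw n \<or> p = sw n" for p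
    proof -
      have "laplacian p = (\<lambda>z. - msq \<alpha> n * p z)" using p cw_sw_derivs(5,6)[of n] by auto
      then have "I p s = (LINT z|torus \<alpha>. - (\<nu> * msq \<alpha> n) * (\<omega> s z * p z) - g s z * p z)"
        unfolding I_def by (simp add: mult_ac)
      also have "\<dots> = (LINT z|torus \<alpha>. - (\<nu> * msq \<alpha> n) * (\<omega> s z * p z)) - (LINT z|torus \<alpha>. g s z * p z)"
        using p w gs by (intro Bochner_Integration.integral_diff integrable_mult_right integrable_mult_wave) auto
      finally show ?thesis by (simp only: integral_mult_right_zero)
    qed
    have Ics: "I (cw n) s = - (\<nu> * msq \<alpha> n) * (LINT z|torus \<alpha>. \<omega> s z * cw n z) - (LINT z|torus \<alpha>. g s z * cw n z)"
      "I (sw n) s = - (\<nu> * msq \<alpha> n) * (LINT z|torus \<alpha>. \<omega> s z * sw n z) - (LINT z|torus \<alpha>. g s z * sw n z)"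
      using I by auto
    show "- ((\<nu> * msq \<alpha> n) *\<^sub>R rfc (\<omega> s) n) - rfc (g s) n = (of_real (I (cw n) s) - \<i> * of_real (I (sw n) s)) / complex_of_real (area \<alpha>)"
      unfolding rfc_real[OF w] rfc_real[OF gs] Ics
      by (simp add: scaleR_conv_of_real algebra_simps diff_divide_distrib add_divide_distrib)
  qed
qed

end

section \<open>The mean in \<open>x\<close> and consequences of the energy class\<close>

context flat_torus
begin

lemma rfc_cong_AE:
  assumes "AE z in torus \<alpha>. f z = g z" "f \<in> borel_measurable (torus \<alpha>)" "g \<in> borel_measurable (torus \<alpha>)"
  shows "rfc f n = rfc g n"
  unfolding rfc_def fcoef_def
proof (intro arg_cong2[where f = "(/)"] refl integral_cong_AE)
  show "AE z in torus \<alpha>. of_real (f z) * cnj (mode \<alpha> n z) = of_real (g z) * cnj (mode \<alpha> n z)"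
    using assms(1) by eventually_elim simp
  have m: "(\<lambda>z. cnj (mode \<alpha> n z)) \<in> borel_measurable (torus \<alpha>)" by (simp add: cnj_mode)
  show "(\<lambda>z. of_real (f z) * cnj (mode \<alpha> n z)) \<in> borel_measurable (torus \<alpha>)"
    "(\<lambda>z. of_real (g z) * cnj (mode \<alpha> n z)) \<in> borel_measurable (torus \<alpha>)"
    using assms m by auto
qed

lemma integrable_torus_snd:
  fixes r :: "real \<Rightarrow> real"
  assumes r: "r \<in> borel_measurable borel" "integrable lborel (\<lambda>y. indicator {0..<2 * pi} y * r y)"
  shows "integrable (torus \<alpha>) (\<lambda>z. r (snd z))"
proof -
  have "integrable (lborel \<Otimes>\<^sub>M lborel) (\<lambda>(x, y). indicator {0..<2 * pi / \<alpha>} x * (indicator {0..<2 * pi} y * r y))"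
  proof (rule lborel_pair.Fubini_integrable)
    show "(\<lambda>(x, y). indicator {0..<2 * pi / \<alpha>} x * (indicator {0..<2 * pi} y * r y)) \<in> borel_measurable (lborel \<Otimes>\<^sub>M lborel)"
      using r(1) by measurable
    have "(\<lambda>x. LINT y|lborel. norm (case (x, y) of (x, y) \<Rightarrow> indicator {0..<2 * pi / \<alpha>} x * (indicator {0..<2 * pi} y * r y)))
      = (\<lambda>x. indicator {0..<2 * pi / \<alpha>} x * (LINT y|lborel. norm (indicator {0..<2 * pi} y * r y)))"
      by (simp add: abs_mult)
    moreover have "integrable lborel (indicator {0..<2 * pi / \<alpha>} :: real \<Rightarrow> real)"
      by (rule integrable_real_indicator) (use alpha_pos in auto)
    ultimately show "integrable lborel (\<lambda>x. LINT y|lborel. norm (case (x, y) of (x, y) \<Rightarrow> indicator {0..<2 * pi / \<alpha>} x * (indicator {0..<2 * pi} y * r y)))"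
      by (simp only: integrable_mult_left)
    show "AE x in lborel. integrable lborel (\<lambda>y. case (x, y) of (x, y) \<Rightarrow> indicator {0..<2 * pi / \<alpha>} x * (indicator {0..<2 * pi} y * r y))"
      using r(2) by simp
  qed
  moreover have "(\<lambda>(x, y). indicator {0..<2 * pi / \<alpha>} x * (indicator {0..<2 * pi} y * r y)) = (\<lambda>z. indicator (cell \<alpha>) z *\<^sub>R r (snd z))"
    by (auto simp: fun_eq_iff cell_def indicator_def)
  ultimately show ?thesis unfolding torus_indicator(1) lborel_prod by simp
qed

context
  fixes f :: "real \<times> real \<Rightarrow> real"
  assumes f: "sq_real f"
begin

text \<open>A Borel measurable form of \<open>P_zero\<close>: measurability of \<open>f\<close> is
  known on the cell, so \<open>f\<close> is cut off there before it is integrated.\<close>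

definition x_mean :: "real \<Rightarrow> real" where
  "x_mean y = \<alpha> / (2 * pi) * (LINT x|lborel. indicator (cell \<alpha>) (x, y) * f (x, y))"

lemma P_zero_eq:
  assumes "z \<in> cell \<alpha>"
  shows "P_zero \<alpha> f z = x_mean (snd z)"
proof -
  have "(\<lambda>s. indicator {0..<2 * pi / \<alpha>} s *\<^sub>R f (s, snd z)) = (\<lambda>s. indicator (cell \<alpha>) (s, snd z) * f (s, snd z))"
    using assms by (auto simp: cell_def indicator_def fun_eq_iff)
  then show ?thesis unfolding P_zero_def x_mean_def set_lebesgue_integral_def split_def by (simp only:)
qed

lemma cut_measurable: "(\<lambda>z. indicator (cell \<alpha>) z * f z) \<in> borel_measurable borel"
proof -
  have "f \<in> borel_measurable (restrict_space lborel (cell \<alpha>))" using f by (simp add: sq_real_iff torus_eq)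
  then have "(\<lambda>z. indicator (cell \<alpha>) z *\<^sub>R f z) \<in> borel_measurable lborel"
    by (subst (asm) borel_measurable_restrict_space_iff) auto
  then show ?thesis by simp
qed

lemma x_mean_measurable: "x_mean \<in> borel_measurable borel"
proof -
  have [measurable]: "(\<lambda>z. indicator (cell \<alpha>) z * f z) \<in> borel_measurable (borel \<Otimes>\<^sub>M borel)"
    unfolding borel_prod by (rule cut_measurable)
  have "(\<lambda>p::real \<times> real. (snd p, fst p)) \<in> measurable (borel \<Otimes>\<^sub>M borel) (borel \<Otimes>\<^sub>M borel)" by measurable
  from measurable_compose[OF this, of "\<lambda>z. indicator (cell \<alpha>) z * f z" borel]
  have "(\<lambda>p. indicator (cell \<alpha>) (snd p, fst p) * f (snd p, fst p)) \<in> borel_measurable (borel \<Otimes>\<^sub>M borel)"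
    using \<open>(\<lambda>z. indicator (cell \<alpha>) z * f z) \<in> borel_measurable (borel \<Otimes>\<^sub>M borel)\<close> by simp
  then have "(\<lambda>(y, x). indicator (cell \<alpha>) (x, y) * f (x, y)) \<in> borel_measurable (borel \<Otimes>\<^sub>M lborel)"
    by (simp add: split_def measurable_cong_sets[OF sets_pair_measure_cong[OF refl sets_lborel] refl])
  then have "(\<lambda>y. LINT x|lborel. indicator (cell \<alpha>) (x, y) * f (x, y)) \<in> borel_measurable borel"
    by (rule lborel.borel_measurable_lebesgue_integral)
  then show ?thesis unfolding x_mean_def[abs_def] by simp
qed

text \<open>Jensen's inequality, obtained from the fact that the integral of
  \<open>(g - m * I)\<^sup>2\<close> along a line is nonnegative, where \<open>m\<close> is the mean
  on that line and \<open>I\<close> the indicator of one period.\<close>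

lemma x_mean_square_integrable: "integrable lborel (\<lambda>y. indicator {0..<2 * pi} y * (x_mean y)\<^sup>2)"
proof -
  define p where "p = 2 * pi / \<alpha>"
  have p: "p > 0" using alpha_pos by (simp add: p_def)
  define g where "g z = indicator (cell \<alpha>) z * f z" for z
  have g: "case_prod (\<lambda>x y. g (x, y)) = g" "case_prod (\<lambda>x y. (g (x, y))\<^sup>2) = (\<lambda>z. (g z)\<^sup>2)" by auto
  have "integrable lborel g"
    using sq_real_integrable[OF f] unfolding torus_indicator(1) g_def[abs_def] by simp
  then have i1: "integrable (lborel \<Otimes>\<^sub>M lborel) (case_prod (\<lambda>x y. g (x, y)))"
    unfolding g(1) lborel_prod .
  have "integrable lborel (\<lambda>z. indicator (cell \<alpha>) z *\<^sub>R (f z)\<^sup>2)"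
    using f unfolding sq_real_iff torus_indicator(1) by simp
  moreover have "indicator (cell \<alpha>) z *\<^sub>R (f z)\<^sup>2 = (g z)\<^sup>2" for z by (auto simp: g_def indicator_def)
  ultimately have i2: "integrable (lborel \<Otimes>\<^sub>M lborel) (case_prod (\<lambda>x y. (g (x, y))\<^sup>2))"
    unfolding g(2) lborel_prod by simp
  show ?thesis
  proof (rule Bochner_Integration.integrable_bound)
    show "integrable lborel (\<lambda>y. 1 / p * (LINT x|lborel. (g (x, y))\<^sup>2))"
      using lborel_pair.integrable_snd[OF i2] by simp
    show "(\<lambda>y. indicator {0..<2 * pi} y * (x_mean y)\<^sup>2) \<in> borel_measurable lborel"
      using x_mean_measurable by simp
    show "AE y in lborel. norm (indicator {0..<2 * pi} y * (x_mean y)\<^sup>2) \<le> norm (1 / p * (LINT x|lborel. (g (x, y))\<^sup>2))"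
      using lborel_pair.AE_integrable_snd[OF i1] lborel_pair.AE_integrable_snd[OF i2]
    proof eventually_elim
      fix y assume y1: "integrable lborel (\<lambda>x. g (x, y))" and y2: "integrable lborel (\<lambda>x. (g (x, y))\<^sup>2)"
      define m where "m = (LINT x|lborel. g (x, y)) / p"
      define I where "I = (indicator {0..<p} :: real \<Rightarrow> real)"
      have I: "integrable lborel I" "(LINT x|lborel. I x) = p"
        using p by (auto simp: I_def intro!: integrable_real_indicator)
      have gI: "g (x, y) * I x = g (x, y)" for x by (auto simp: g_def I_def p_def cell_def indicator_def)
      have II: "(I x)\<^sup>2 = I x" for x by (simp add: I_def indicator_def)
      have "(g (x, y) - m * I x)\<^sup>2 = (g (x, y))\<^sup>2 - 2 * m * g (x, y) + m\<^sup>2 * I x" for x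
        using gI[of x] II[of x] by (simp add: power2_diff power_mult_distrib mult_ac)
      then have "(LINT x|lborel. (g (x, y) - m * I x)\<^sup>2) = (LINT x|lborel. (g (x, y))\<^sup>2 - 2 * m * g (x, y) + m\<^sup>2 * I x)" by simp
      also have "\<dots> = (LINT x|lborel. (g (x, y))\<^sup>2) - 2 * m * (LINT x|lborel. g (x, y)) + m\<^sup>2 * p"
        using y1 y2 I by simp
      also have "\<dots> = (LINT x|lborel. (g (x, y))\<^sup>2) - m\<^sup>2 * p"
        using p by (simp add: m_def power2_eq_square field_simps)
      finally have "m\<^sup>2 * p \<le> (LINT x|lborel. (g (x, y))\<^sup>2)"
        using integral_nonneg_AE[of "\<lambda>x. (g (x, y) - m * I x)\<^sup>2" lborel] by simp
      then have "m\<^sup>2 \<le> 1 / p * (LINT x|lborel. (g (x, y))\<^sup>2)" using p by (simp add: field_simps)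
      moreover have "x_mean y = m" using alpha_pos by (simp add: x_mean_def m_def g_def p_def)
      moreover have "0 \<le> 1 / p * (LINT x|lborel. (g (x, y))\<^sup>2)" using p by simp
      ultimately show "norm (indicator {0..<2 * pi} y * (x_mean y)\<^sup>2) \<le> norm (1 / p * (LINT x|lborel. (g (x, y))\<^sup>2))"
        using p by (simp add: indicator_def)
    qed
  qed
qed

lemma sq_real_x_mean: "sq_real (\<lambda>z. x_mean (snd z))"
  unfolding sq_real_iff
proof
  show "(\<lambda>z. x_mean (snd z)) \<in> borel_measurable (torus \<alpha>)"
    by (intro borel_measurable_torus measurable_compose[OF _ x_mean_measurable] borel_measurable_continuous_onI continuous_intros)
  show "integrable (torus \<alpha>) (\<lambda>z. (x_mean (snd z))\<^sup>2)"
    using x_mean_measurable x_mean_square_integrable by (intro integrable_torus_snd) auto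
qed

text \<open>By Fubini the \<open>x\<close> integral \<open>X\<close> of the wave factors out. It
  vanishes for \<open>k \<noteq> 0\<close>; for \<open>k = 0\<close> it is the period, which undoes
  the averaging.\<close>

lemma rfc_x_mean: "rfc (\<lambda>z. x_mean (snd z)) n = (if fst n = 0 then rfc f n else 0)"
proof -
  define p where "p = 2 * pi / \<alpha>"
  have p: "p > 0" using alpha_pos by (simp add: p_def)
  define k m where "k = fst n" and "m = snd n"
  define e where "e y = cis (- (real_of_int m * y))" for y
  define X where "X = (LINT x|lborel. indicator {0..<p} x *\<^sub>R cis (- (\<alpha> * real_of_int k) * x))"
  have mode: "cnj (mode \<alpha> n (x, y)) = cis (- (\<alpha> * real_of_int k) * x) * e y" for x y
    by (simp add: mode_def cis_cnj e_def k_def m_def cis_mult)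
  have int: "integrable (torus \<alpha>) (\<lambda>z. of_real (h z) * cnj (mode \<alpha> n z))" if "sq_real h" for h
    using sq_int_mult[of "\<lambda>z. of_real (h z)" "mode \<alpha> (- n)"] that sq_int_mode by (simp add: sq_real_def cnj_mode)
  have 1: "(LINT z|torus \<alpha>. of_real (x_mean (snd z)) * cnj (mode \<alpha> n z))
    = (LINT y|lborel. indicator {0..<2 * pi} y *\<^sub>R (of_real (x_mean y) * e y * X))"
    unfolding torus_fubini[OF int[OF sq_real_x_mean]]
  proof (intro Bochner_Integration.integral_cong refl arg_cong2[where f = scaleR])
    fix y
    have "(LINT x|lborel. indicator {0..<2 * pi / \<alpha>} x *\<^sub>R (of_real (x_mean (snd (x, y))) * cnj (mode \<alpha> n (x, y))))
      = (LINT x|lborel. (of_real (x_mean y) * e y) * (indicator {0..<p} x *\<^sub>R cis (- (\<alpha> * real_of_int k) * x)))"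
      unfolding mode p_def by (intro Bochner_Integration.integral_cong refl) (simp add: mult_ac mult_scaleR_right)
    then show "(LINT x|lborel. indicator {0..<2 * pi / \<alpha>} x *\<^sub>R (of_real (x_mean (snd (x, y))) * cnj (mode \<alpha> n (x, y)))) = of_real (x_mean y) * e y * X"
      unfolding X_def by (simp only: integral_mult_right_zero)
  qed
  show ?thesis
  proof (cases "k = 0")
    case False
    have "cis (- (\<alpha> * real_of_int k) * p) = 1"
      using alpha_pos cis_multiple_2pi[of "- of_int k"] by (simp add: p_def mult_ac)
    then have "X = 0" unfolding X_def using False p alpha_pos by (intro integral_cis) auto
    then show ?thesis using False 1 by (simp add: rfc_def fcoef_def k_def)
  next
    case True
    have X: "X = of_real p"
      using p True by (simp add: X_def scaleR_conv_of_real)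
    have "(LINT z|torus \<alpha>. of_real (f z) * cnj (mode \<alpha> n z))
      = (LINT y|lborel. indicator {0..<2 * pi} y *\<^sub>R (of_real (x_mean y) * e y * X))"
      unfolding torus_fubini[OF int[OF f]]
    proof (intro Bochner_Integration.integral_cong refl)
      fix y
      show "indicator {0..<2 * pi} y *\<^sub>R (LINT x|lborel. indicator {0..<2 * pi / \<alpha>} x *\<^sub>R (of_real (f (x, y)) * cnj (mode \<alpha> n (x, y))))
        = indicator {0..<2 * pi} y *\<^sub>R (of_real (x_mean y) * e y * X)"
      proof (cases "y \<in> {0..<2 * pi}")
        case yB: True
        have "(LINT x|lborel. indicator {0..<2 * pi / \<alpha>} x *\<^sub>R (of_real (f (x, y)) * cnj (mode \<alpha> n (x, y))))
          = (LINT x|lborel. e y * of_real (indicator (cell \<alpha>) (x, y) * f (x, y)))"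
          unfolding mode using yB True
          by (intro Bochner_Integration.integral_cong refl) (auto simp: cell_def indicator_def)
        also have "\<dots> = e y * of_real (LINT x|lborel. indicator (cell \<alpha>) (x, y) * f (x, y))"
          by (simp only: integral_mult_right_zero integral_complex_of_real)
        also have "(LINT x|lborel. indicator (cell \<alpha>) (x, y) * f (x, y)) = x_mean y * p"
          using alpha_pos by (simp add: x_mean_def p_def)
        finally show ?thesis by (simp add: X mult_ac)
      next
        case False
        then show ?thesis by (simp only: indicator_simps not_False_eq_True scaleR_zero_left)
      qed
    qed
    then show ?thesis using True 1 by (simp add: rfc_def fcoef_def k_def)
  qed
qed

lemma sq_real_P_zero: "sq_real (P_zero \<alpha> f)"
  using sq_real_x_mean sq_int_cong[of "\<lambda>z. of_real (P_zero \<alpha> f z)" "\<lambda>z. of_real (x_mean (snd z))"] P_zero_eq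
  by (simp add: sq_real_def)

lemma rfc_P_zero: "rfc (P_zero \<alpha> f) n = (if fst n = 0 then rfc f n else 0)"
proof -
  have "rfc (P_zero \<alpha> f) n = rfc (\<lambda>z. x_mean (snd z)) n"
    using sq_real_P_zero sq_real_x_mean P_zero_eq by (intro rfc_cong_AE) (auto simp: sq_real_iff)
  then show ?thesis by (simp add: rfc_x_mean)
qed

lemma sq_real_P_nonzero: "sq_real (P_nonzero \<alpha> f)"
  unfolding P_nonzero_def by (intro sq_real_diff f sq_real_P_zero)

lemma rfc_P_nonzero: "rfc (P_nonzero \<alpha> f) n = (if fst n = 0 then 0 else rfc f n)"
  unfolding P_nonzero_def
  using rfc_diff[OF sq_real_integrable[OF f] sq_real_integrable[OF sq_real_P_zero], of n] by (simp add: rfc_P_zero)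

lemma L2_norm_P_nonzero:
  "(L2_norm \<alpha> (P_nonzero \<alpha> f))\<^sup>2 / area \<alpha> = (\<Sum>\<^sub>\<infinity>n\<in>waves. (norm (rfc f n))\<^sup>2)"
proof -
  have "(L2_norm \<alpha> (P_nonzero \<alpha> f))\<^sup>2 / area \<alpha> = (\<Sum>\<^sub>\<infinity>n. (norm (rfc (P_nonzero \<alpha> f) n))\<^sup>2)"
    using infsumI[OF rfc_parseval[OF sq_real_P_nonzero]] by simp
  also have "\<dots> = (\<Sum>\<^sub>\<infinity>n\<in>waves. (norm (rfc f n))\<^sup>2)"
    by (rule infsum_cong_neutral) (auto simp: rfc_P_nonzero waves_def)
  finally show ?thesis .
qed

end

text \<open>The time \<open>0\<close>, about which the assumption says nothing, is put into the null
  set.\<close>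

lemma AE_nonneg_times:
  assumes "AE t in lborel. t > (0::real) \<longrightarrow> P t"
  obtains Z where "negligible Z" "\<And>t. 0 \<le> t \<Longrightarrow> t \<notin> Z \<Longrightarrow> P t"
proof -
  obtain M where M: "\<And>t. t \<notin> M \<Longrightarrow> t > 0 \<longrightarrow> P t" "M \<in> null_sets lborel"
    using AE_E3[OF assms] by auto
  have "negligible M" using null_sets_completionI[OF M(2)] by (simp add: negligible_iff_null_sets)
  then have "negligible (insert 0 M)" by simp
  moreover have "P t" if "0 \<le> t" "t \<notin> insert 0 M" for t using M(1)[of t] that by auto
  ultimately show thesis by (rule that)
qed

text \<open>Parseval for the two weak derivatives, as \<open>msq \<alpha> n\<close> is the sum of
  the squares of the components of the wave vector. \<open>Hb\<close> becomes the integrable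
  majorant of the dissipation.\<close>

lemma energy_class_grad:
  assumes "energy_class \<alpha> \<omega>"
  obtains Z Hb where "negligible Z" "\<And>T. T > 0 \<Longrightarrow> Hb integrable_on {0..T}"
    "\<And>t F. 0 \<le> t \<Longrightarrow> t \<notin> Z \<Longrightarrow> finite F \<Longrightarrow> (\<Sum>n\<in>F. msq \<alpha> n * (norm (rfc (\<omega> t) n))\<^sup>2) \<le> Hb t"
proof -
  obtain \<omega>x \<omega>y where ae: "AE t in lborel. t > 0 \<longrightarrow> weak_dx \<alpha> (\<omega> t) (\<omega>x t) \<and> weak_dy \<alpha> (\<omega> t) (\<omega>y t)"
    and int: "\<And>T. T > 0 \<Longrightarrow> (\<lambda>t. (L2_norm \<alpha> (\<omega>x t))\<^sup>2 + (L2_norm \<alpha> (\<omega>y t))\<^sup>2) integrable_on {0..T}"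
    using assms unfolding energy_class_def by blast
  obtain Z where Z: "negligible Z" "\<And>t. 0 \<le> t \<Longrightarrow> t \<notin> Z \<Longrightarrow> weak_dx \<alpha> (\<omega> t) (\<omega>x t) \<and> weak_dy \<alpha> (\<omega> t) (\<omega>y t)"
    using AE_nonneg_times[OF ae] by blast
  define Hb where "Hb t = (1 / area \<alpha>) * ((L2_norm \<alpha> (\<omega>x t))\<^sup>2 + (L2_norm \<alpha> (\<omega>y t))\<^sup>2)" for t
  show thesis
  proof (rule that[OF Z(1), of Hb])
    show "Hb integrable_on {0..T}" if "T > 0" for T
      unfolding Hb_def using int[OF that] by (intro integrable_on_mult_right)
    fix t and F :: "(int \<times> int) set" assume t: "0 \<le> t" "t \<notin> Z" and F: "finite F"
    have sq: "sq_real (\<omega> t)" using assms t by (auto simp: energy_class_def intro: L2_sq_real)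
    have w: "weak_dx \<alpha> (\<omega> t) (\<omega>x t)" "weak_dy \<alpha> (\<omega> t) (\<omega>y t)" using Z(2)[OF t] by auto
    have sx: "sq_real (\<omega>x t)" "sq_real (\<omega>y t)" using w by (auto simp: weak_dx_def weak_dy_def intro: L2_sq_real)
    have e: "msq \<alpha> n * (norm (rfc (\<omega> t) n))\<^sup>2 = (norm (rfc (\<omega>x t) n))\<^sup>2 + (norm (rfc (\<omega>y t) n))\<^sup>2" for n
      unfolding rfc_weak_dx[OF sq w(1)] rfc_weak_dy[OF sq w(2)]
      by (simp add: norm_mult msq_def power_mult_distrib algebra_simps)
    have "(\<Sum>n\<in>F. msq \<alpha> n * (norm (rfc (\<omega> t) n))\<^sup>2) = (\<Sum>n\<in>F. (norm (rfc (\<omega>x t) n))\<^sup>2) + (\<Sum>n\<in>F. (norm (rfc (\<omega>y t) n))\<^sup>2)"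
      unfolding e by (rule sum.distrib)
    also have "\<dots> \<le> (L2_norm \<alpha> (\<omega>x t))\<^sup>2 / area \<alpha> + (L2_norm \<alpha> (\<omega>y t))\<^sup>2 / area \<alpha>"
      by (intro add_mono finite_sum_le_has_sum[OF rfc_parseval] sx F) auto
    also have "\<dots> = Hb t" by (simp add: Hb_def add_divide_distrib)
    finally show "(\<Sum>n\<in>F. msq \<alpha> n * (norm (rfc (\<omega> t) n))\<^sup>2) \<le> Hb t" .
  qed
qed

text \<open>The added profile covers the perturbation \<open>\<omega>'\<close>, and
  \<open>c = 0\<close> covers \<open>\<omega>\<close> itself. Continuity follows from the reverse
  triangle inequality.\<close>

lemma energy_class_norm_continuous:
  assumes E: "energy_class \<alpha> \<omega>" and c: "continuous_on {0..T} c"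
  shows "continuous_on {0..T} (\<lambda>t. L2_norm \<alpha> (\<lambda>z. \<omega> t z + c t * cos (snd z)))"
  unfolding continuous_on
proof
  fix s assume s: "s \<in> {0..T}"
  define h where "h t z = \<omega> t z + c t * cos (snd z)" for t z
  have w: "sq_real (\<omega> t)" if "t \<in> {0..T}" for t using E that by (auto simp: energy_class_def intro: L2_sq_real)
  have cs: "sq_real (\<lambda>z. a * cos (snd z))" for a by (intro sq_real_scale sq_real_sin_cos)
  have h: "sq_real (h t)" if "t \<in> {0..T}" for t unfolding h_def by (intro sq_real_add w cs that)
  have nc: "L2_norm \<alpha> (\<lambda>z. a * cos (snd z)) = \<bar>a\<bar> * L2_norm \<alpha> (\<lambda>z. cos (snd z))" for a
    by (simp add: L2_norm_def power_mult_distrib real_sqrt_mult)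
  have nm: "L2_norm \<alpha> (\<lambda>z. p z - q z) = L2_norm \<alpha> (\<lambda>z. q z - p z)" for p q
    by (simp add: L2_norm_def power2_commute)
  define b where "b t = L2_norm \<alpha> (\<lambda>z. \<omega> t z - \<omega> s z) + \<bar>c t - c s\<bar> * L2_norm \<alpha> (\<lambda>z. cos (snd z))" for t
  have diff: "L2_norm \<alpha> (\<lambda>z. h t z - h s z) \<le> b t" if "t \<in> {0..T}" for t
  proof -
    have "L2_norm \<alpha> (\<lambda>z. h t z - h s z) = L2_norm \<alpha> (\<lambda>z. (\<omega> t z - \<omega> s z) + (c t - c s) * cos (snd z))"
      by (simp add: h_def algebra_simps)
    also have "\<dots> \<le> b t"
      unfolding b_def nc[symmetric] by (intro L2_norm_triangle sq_real_diff w cs that s)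
    finally show ?thesis .
  qed
  have bound: "\<bar>L2_norm \<alpha> (h t) - L2_norm \<alpha> (h s)\<bar> \<le> b t" if t: "t \<in> {0..T}" for t
  proof -
    have "L2_norm \<alpha> (\<lambda>z. h s z + (h t z - h s z)) \<le> L2_norm \<alpha> (h s) + L2_norm \<alpha> (\<lambda>z. h t z - h s z)"
      by (intro L2_norm_triangle sq_real_diff h t s)
    moreover have "L2_norm \<alpha> (\<lambda>z. h t z + (h s z - h t z)) \<le> L2_norm \<alpha> (h t) + L2_norm \<alpha> (\<lambda>z. h s z - h t z)"
      by (intro L2_norm_triangle sq_real_diff h t s)
    ultimately show ?thesis using diff[OF t] nm[of "h s" "h t"] by simp
  qed
  have "((\<lambda>t. L2_norm \<alpha> (\<lambda>z. \<omega> t z - \<omega> s z)) \<longlongrightarrow> 0) (at s within {0..})"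
    using E s by (auto simp: energy_class_def)
  then have "((\<lambda>t. L2_norm \<alpha> (\<lambda>z. \<omega> t z - \<omega> s z)) \<longlongrightarrow> 0) (at s within {0..T})"
    by (rule tendsto_within_subset) auto
  moreover have "(c \<longlongrightarrow> c s) (at s within {0..T})" using c s by (simp add: continuous_on)
  ultimately have "(b \<longlongrightarrow> 0 + \<bar>c s - c s\<bar> * L2_norm \<alpha> (\<lambda>z. cos (snd z))) (at s within {0..T})"
    unfolding b_def by (intro tendsto_intros)
  then have b0: "(b \<longlongrightarrow> 0) (at s within {0..T})" by simp
  have "((\<lambda>t. L2_norm \<alpha> (h t) - L2_norm \<alpha> (h s)) \<longlongrightarrow> 0) (at s within {0..T})"
    by (rule tendsto_0_le[OF b0, of _ 1]) (auto simp: eventually_at_filter intro!: always_eventually order_trans[OF bound])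
  then have "((\<lambda>t. L2_norm \<alpha> (h t)) \<longlongrightarrow> L2_norm \<alpha> (h s)) (at s within {0..T})"
    by (simp add: LIM_zero_iff)
  then show "((\<lambda>t. L2_norm \<alpha> (\<lambda>z. \<omega> t z + c t * cos (snd z))) \<longlongrightarrow> L2_norm \<alpha> (\<lambda>z. \<omega> s z + c s * cos (snd z))) (at s within {0..T})"
    unfolding h_def .
qed

end

section \<open>Decay of solutions\<close>

lemma linear_decay_stays_zero:
  fixes z :: "real \<Rightarrow> complex"
  assumes \<mu>: "0 \<le> \<mu>" and T: "0 \<le> T"
    and ode: "\<And>t. t \<in> {0..T} \<Longrightarrow> ((\<lambda>s. - (\<mu> *\<^sub>R z s)) has_integral (z t - z 0)) {0..t}"
    and C: "\<And>t. t \<in> {0..T} \<Longrightarrow> norm (z t) \<le> C" and z0: "z 0 = 0"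
  shows "z T = 0"
proof -
  have b: "norm (- (\<mu> *\<^sub>R z t)) \<le> \<mu> * C" if "t \<in> {0..T} - {}" for t
    using C[of t] that \<mu> by (simp add: mult_left_mono)
  have "((\<lambda>t. - (\<mu> *\<^sub>R z t) \<bullet> z t + z t \<bullet> - (\<mu> *\<^sub>R z t)) has_integral (z T \<bullet> z T - z 0 \<bullet> z 0)) {0..T}"
    by (rule has_integral_inner_primitives[OF ode ode negligible_empty b b T])
  then have "z T \<bullet> z T - z 0 \<bullet> z 0 \<le> 0"
    by (rule has_integral_le[OF _ has_integral_0]) (simp add: \<mu>)
  then show ?thesis using z0 inner_ge_zero[of "z T"] by (simp add: order_antisym)
qed

text \<open>Up to the time \<open>\<tau> / \<nu>\<close> the transient part of the shear has decayed
  at most to \<open>exp (- \<tau>)\<close>. So even for \<open>a = 0\<close> the shear has a lower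
  bound that does not depend on \<open>\<nu>\<close>.\<close>

lemma profile_bounds:
  fixes a \<nu> t \<tau> :: real
  assumes "a \<in> {0, 1}" "0 < \<nu>" "0 \<le> t" "t \<le> \<tau> / \<nu>"
  shows "exp (- \<tau>) \<le> a + exp (- \<nu> * t)" "a + exp (- \<nu> * t) \<le> 2"
proof -
  have "\<nu> * t \<le> \<tau>" using assms by (simp add: field_simps)
  then have "exp (- \<tau>) \<le> exp (- \<nu> * t)" "exp (- \<nu> * t) \<le> 1" using assms by auto
  moreover have "0 \<le> a" "a \<le> 1" using assms(1) by auto
  ultimately show "exp (- \<tau>) \<le> a + exp (- \<nu> * t)" "a + exp (- \<nu> * t) \<le> 2" by linarith+
qed

section \<open>Solutions of the two equations as systems of modes\<close>

context flat_torus
begin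

text \<open>The assumption on \<open>h\<close> says that it is
  \<open>\<partial>\<^sub>x (1 + \<Delta>\<^sup>-\<^sup>1)\<close> of a function with coefficients
  \<open>w\<close>. The \<open>\<i>\<close> of the derivative cancels that of the sine, so the
  coupling is real.\<close>

lemma rfc_shear_term:
  assumes h: "sq_real h" and e: "\<And>p. rfc h p = \<i> * of_real (\<alpha> * real_of_int (fst p)) * (lam \<alpha> p *\<^sub>R w p)"
  shows "rfc (\<lambda>z. b * (sin (snd z) * h z)) (k, m)
    = (b * \<alpha> * real_of_int k / 2) *\<^sub>R (lam \<alpha> (k, m - 1) *\<^sub>R w (k, m - 1) - lam \<alpha> (k, m + 1) *\<^sub>R w (k, m + 1))"
  unfolding rfc_scale rfc_sin_mult[OF h] e by (simp add: scaleR_conv_of_real field_simps)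

lemma energy_class_sq_real: "energy_class \<alpha> \<omega> \<Longrightarrow> 0 \<le> t \<Longrightarrow> sq_real (\<omega> t)"
  by (auto simp: energy_class_def intro: L2_sq_real)

lemma energy_class_bounded:
  assumes E: "energy_class \<alpha> \<omega>"
  obtains B where "\<And>t F. t \<in> {0..T} \<Longrightarrow> finite F \<Longrightarrow> (\<Sum>n\<in>F. (norm (rfc (\<omega> t) n))\<^sup>2) \<le> B"
proof -
  have "continuous_on {0..T} (\<lambda>t. L2_norm \<alpha> (\<omega> t))"
    using energy_class_norm_continuous[OF E, of T "\<lambda>_. 0"] by simp
  then have "bounded ((\<lambda>t. L2_norm \<alpha> (\<omega> t)) ` {0..T})"
    by (intro compact_imp_bounded compact_continuous_image compact_Icc)
  then obtain C where "\<forall>t\<in>{0..T}. norm (L2_norm \<alpha> (\<omega> t)) \<le> C"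
    unfolding bounded_iff by blast
  then have C: "\<bar>L2_norm \<alpha> (\<omega> t)\<bar> \<le> C" if "t \<in> {0..T}" for t using that by simp
  show thesis
  proof (rule that)
    fix t and F :: "(int \<times> int) set" assume t: "t \<in> {0..T}" and F: "finite F"
    have "(\<Sum>n\<in>F. (norm (rfc (\<omega> t) n))\<^sup>2) \<le> (L2_norm \<alpha> (\<omega> t))\<^sup>2 / area \<alpha>"
      using t by (intro finite_sum_le_has_sum[OF rfc_parseval] energy_class_sq_real[OF E] F) auto
    also have "\<dots> \<le> C\<^sup>2 / area \<alpha>"
      using C[OF t] area_pos by (intro divide_right_mono abs_le_square_iff[THEN iffD1]) auto
    finally show "(\<Sum>n\<in>F. (norm (rfc (\<omega> t) n))\<^sup>2) \<le> C\<^sup>2 / area \<alpha>" .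
  qed
qed

lemma linear_solution_ode:
  assumes sol: "linear_solution \<alpha> \<nu> a \<omega>" and t: "0 \<le> t"
  shows "((\<lambda>s. - ((\<nu> * msq \<alpha> (k, m)) *\<^sub>R rfc (\<omega> s) (k, m))
             - ((a + exp (- \<nu> * s)) * \<alpha> * real_of_int k / 2) *\<^sub>R
               (lam \<alpha> (k, m - 1) *\<^sub>R rfc (\<omega> s) (k, m - 1) - lam \<alpha> (k, m + 1) *\<^sub>R rfc (\<omega> s) (k, m + 1)))
         has_integral (rfc (\<omega> t) (k, m) - rfc (\<omega> 0) (k, m))) {0..t}"
proof -
  have E: "energy_class \<alpha> \<omega>" using sol by (simp add: linear_solution_def)
  obtain \<psi> h where ae: "AE t in lborel. t > 0 \<longrightarrow>
           inv_laplacian \<alpha> (\<omega> t) (\<psi> t) \<and> weak_dx \<alpha> (\<lambda>z. \<omega> t z + \<psi> t z) (h t)"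
    and eq: "\<And>\<phi> t. \<phi> \<in> test_functions \<alpha> \<Longrightarrow> t \<ge> 0 \<Longrightarrow>
           ((\<lambda>s. LINT z|torus \<alpha>. \<nu> * \<omega> s z * laplacian \<phi> z
                  - a * sin (snd z) * h s z * \<phi> z
                  - exp (- \<nu> * s) * sin (snd z) * h s z * \<phi> z)
            has_integral (LINT z|torus \<alpha>. (\<omega> t z - \<omega> 0 z) * \<phi> z)) {0..t}"
    using sol unfolding linear_solution_def by blast
  obtain Z1 where Z1: "negligible Z1" "\<And>t. 0 \<le> t \<Longrightarrow> t \<notin> Z1 \<Longrightarrow>
      inv_laplacian \<alpha> (\<omega> t) (\<psi> t) \<and> weak_dx \<alpha> (\<lambda>z. \<omega> t z + \<psi> t z) (h t)"
    using AE_nonneg_times[OF ae] by blast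
  note \<omega> = energy_class_sq_real[OF E]
  define c where "c s = a + exp (- \<nu> * s)" for s
  define g where "g s z = c s * (sin (snd z) * h s z)" for s z
  have h: "sq_real (h s)" "rfc (h s) p = \<i> * of_real (\<alpha> * real_of_int (fst p)) * (lam \<alpha> p *\<^sub>R rfc (\<omega> s) p)"
    if s: "0 \<le> s" "s \<notin> Z1" for s p
  proof -
    have il: "inv_laplacian \<alpha> (\<omega> s) (\<psi> s)" and wd: "weak_dx \<alpha> (\<lambda>z. \<omega> s z + \<psi> s z) (h s)" using Z1(2)[OF s] by auto
    have \<psi>: "sq_real (\<psi> s)" using il by (auto simp: inv_laplacian_def intro: L2_sq_real)
    show "sq_real (h s)" using wd by (auto simp: weak_dx_def intro: L2_sq_real)
    have "rfc (\<lambda>z. \<omega> s z + \<psi> s z) p = lam \<alpha> p *\<^sub>R rfc (\<omega> s) p"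
      unfolding rfc_add[OF sq_real_integrable[OF \<omega>[OF s(1)]] sq_real_integrable[OF \<psi>]] rfc_inv_laplacian[OF \<omega>[OF s(1)] il]
      by (simp add: lam_def scaleR_conv_of_real algebra_simps)
    then show "rfc (h s) p = \<i> * of_real (\<alpha> * real_of_int (fst p)) * (lam \<alpha> p *\<^sub>R rfc (\<omega> s) p)"
      using rfc_weak_dx[OF sq_real_add[OF \<omega>[OF s(1)] \<psi>] wd, of p] by simp
  qed
  have gi: "integrable (torus \<alpha>) (g s)" if "0 \<le> s" "s \<notin> Z1" for s
    unfolding g_def[abs_def] using sq_real_mult[OF sq_real_sin_cos(1) h(1)[OF that]] by simp
  have eq': "((\<lambda>s. LINT z|torus \<alpha>. \<nu> * \<omega> s z * laplacian \<phi> z - g s z * \<phi> z)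
         has_integral (LINT z|torus \<alpha>. (\<omega> t z - \<omega> 0 z) * \<phi> z)) {0..t}"
    if "\<phi> \<in> test_functions \<alpha>" "t \<ge> 0" for \<phi> t
  proof -
    have "(\<lambda>s. LINT z|torus \<alpha>. \<nu> * \<omega> s z * laplacian \<phi> z - g s z * \<phi> z)
      = (\<lambda>s. LINT z|torus \<alpha>. \<nu> * \<omega> s z * laplacian \<phi> z - a * sin (snd z) * h s z * \<phi> z
                  - exp (- \<nu> * s) * sin (snd z) * h s z * \<phi> z)"
      unfolding g_def c_def by (intro ext Bochner_Integration.integral_cong refl) (simp add: algebra_simps)
    then show ?thesis using eq[OF that] by (simp only:)
  qed
  show ?thesis
  proof (rule has_integral_spike[OF Z1(1) _ rfc_ode[OF Z1(1) \<omega> gi eq' t]])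
    fix s assume "s \<in> {0..t} - Z1"
    then have s: "0 \<le> s" "s \<notin> Z1" by auto
    show "- ((\<nu> * msq \<alpha> (k, m)) *\<^sub>R rfc (\<omega> s) (k, m))
           - ((a + exp (- \<nu> * s)) * \<alpha> * real_of_int k / 2) *\<^sub>R
             (lam \<alpha> (k, m - 1) *\<^sub>R rfc (\<omega> s) (k, m - 1) - lam \<alpha> (k, m + 1) *\<^sub>R rfc (\<omega> s) (k, m + 1))
       = - ((\<nu> * msq \<alpha> (k, m)) *\<^sub>R rfc (\<omega> s) (k, m)) - rfc (g s) (k, m)"
      using rfc_shear_term[OF h[OF s], of "c s" k m] by (simp only: g_def[abs_def] c_def)
  qed
qed

text \<open>The shear carries the factor \<open>k\<close>, so the axis modes obey a pure heat
  equation and stay zero. Hence \<open>mass\<close> accounts for the full norm of a linear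
  solution.\<close>

lemma linear_solution_zero_modes:
  assumes sol: "linear_solution \<alpha> \<nu> a \<omega>" and \<nu>: "0 < \<nu>" and T: "0 \<le> T"
    and init: "AE z in torus \<alpha>. P_nonzero \<alpha> (\<omega> 0) z = \<omega> 0 z" and k: "fst n = 0"
  shows "rfc (\<omega> 0) n = 0" "rfc (\<omega> T) n = 0"
proof -
  have E: "energy_class \<alpha> \<omega>" using sol by (simp add: linear_solution_def)
  note \<omega> = energy_class_sq_real[OF E]
  have "rfc (P_nonzero \<alpha> (\<omega> 0)) n = rfc (\<omega> 0) n"
    using sq_real_P_nonzero[OF \<omega>[of 0]] \<omega>[of 0] by (intro rfc_cong_AE init) (auto simp: sq_real_iff)
  then show 0: "rfc (\<omega> 0) n = 0" using rfc_P_nonzero[OF \<omega>[of 0], of n] k by simp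
  obtain B where B: "\<And>t F. t \<in> {0..T} \<Longrightarrow> finite F \<Longrightarrow> (\<Sum>n\<in>F. (norm (rfc (\<omega> t) n))\<^sup>2) \<le> B"
    using energy_class_bounded[OF E] by blast
  have ode: "((\<lambda>s. - ((\<nu> * msq \<alpha> n) *\<^sub>R rfc (\<omega> s) n)) has_integral (rfc (\<omega> t) n - rfc (\<omega> 0) n)) {0..t}" if "t \<in> {0..T}" for t
  proof -
    obtain m where n: "n = (0, m)" using k by (cases n) auto
    show ?thesis using linear_solution_ode[OF sol, of t 0 m] that unfolding n by simp
  qed
  show "rfc (\<omega> T) n = 0"
  proof (rule linear_decay_stays_zero[OF _ T ode _ 0])
    show "0 \<le> \<nu> * msq \<alpha> n" using \<nu> by (simp add: msq_def)
    show "norm (rfc (\<omega> t) n) \<le> sqrt B" if "t \<in> {0..T}" for t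
      using B[OF that, of "{n}"] by (simp add: real_le_rsqrt)
  qed
qed

text \<open>The case \<open>\<theta> = 0\<close> of the decay of the waves, with
  \<open>exp (- \<tau>)\<close> as lower bound of the shear and with \<open>\<delta>\<^sup>2\<close>
  because masses are squared norms.\<close>

theorem linear_decay:
  assumes alpha: "\<alpha> > 1" and "\<tau> > 0" "\<delta> > 0" and a: "a \<in> {0, 1}"
  shows "\<exists>\<nu>0>0. \<forall>\<nu>. 0 < \<nu> \<and> \<nu> \<le> \<nu>0 \<longrightarrow>
        (\<forall>\<omega>. linear_solution \<alpha> \<nu> a \<omega> \<and> \<omega> 0 \<in> L2_torus \<alpha> \<and>
             (AE z in torus \<alpha>. P_nonzero \<alpha> (\<omega> 0) z = \<omega> 0 z) \<longrightarrow>
             L2_norm \<alpha> (\<omega> (\<tau> / \<nu>)) \<le> \<delta> * L2_norm \<alpha> (\<omega> 0))"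
proof -
  obtain \<nu>0 where \<nu>0: "\<nu>0 > 0" and core: "\<forall>\<nu> \<theta> B c v N Hb Z. \<nu> \<le> \<nu>0 \<longrightarrow> \<theta> \<le> \<nu> * (1 - 1 / \<alpha>\<^sup>2) / 2 \<longrightarrow>
      shear_modes \<alpha> \<nu> (\<tau> / \<nu>) \<theta> (exp (- \<tau>)) B c v N Hb Z \<longrightarrow> mass v (\<tau> / \<nu>) \<le> \<delta>\<^sup>2 * mass v 0"
    using shear_modes_decay[OF alpha \<open>\<tau> > 0\<close> zero_less_power[OF \<open>\<delta> > 0\<close>, of 2] exp_gt_zero[of "- \<tau>"]]
    by (elim exE conjE) (rule that)
  show ?thesis
  proof (intro exI[of _ \<nu>0] conjI \<nu>0 allI impI; elim conjE)
    fix \<nu> \<omega>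
    assume \<nu>: "0 < \<nu>" "\<nu> \<le> \<nu>0" and sol: "linear_solution \<alpha> \<nu> a \<omega>"
      and init: "AE z in torus \<alpha>. P_nonzero \<alpha> (\<omega> 0) z = \<omega> 0 z"
    define T where "T = \<tau> / \<nu>"
    have T: "T > 0" using \<nu> \<open>\<tau> > 0\<close> by (simp add: T_def)
    have E: "energy_class \<alpha> \<omega>" using sol by (simp add: linear_solution_def)
    note \<omega> = energy_class_sq_real[OF E]
    obtain B where B: "\<And>t F. t \<in> {0..T} \<Longrightarrow> finite F \<Longrightarrow> (\<Sum>n\<in>F. (norm (rfc (\<omega> t) n))\<^sup>2) \<le> B"
      using energy_class_bounded[OF E] by blast
    obtain Z Hb where Z: "negligible Z" and Hb: "\<And>T. T > 0 \<Longrightarrow> Hb integrable_on {0..T}"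
      "\<And>t F. 0 \<le> t \<Longrightarrow> t \<notin> Z \<Longrightarrow> finite F \<Longrightarrow> (\<Sum>n\<in>F. msq \<alpha> n * (norm (rfc (\<omega> t) n))\<^sup>2) \<le> Hb t"
      using energy_class_grad[OF E] by blast
    define v where "v n t = rfc (\<omega> t) n" for n t
    have mv: "mass v t = (L2_norm \<alpha> (\<omega> t))\<^sup>2 / area \<alpha>" if "0 \<le> t" "\<And>n. fst n = 0 \<Longrightarrow> rfc (\<omega> t) n = 0" for t
    proof -
      have "mass v t = (\<Sum>\<^sub>\<infinity>n. (norm (rfc (\<omega> t) n))\<^sup>2)"
        unfolding mass_def v_def by (rule infsum_cong_neutral) (use that(2) in \<open>auto simp: waves_def\<close>)
      then show ?thesis using infsumI[OF rfc_parseval[OF \<omega>[OF that(1)]]] by simp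
    qed
    have "shear_modes \<alpha> \<nu> T 0 (exp (- \<tau>)) B (\<lambda>t. a + exp (- \<nu> * t)) v (\<lambda>_ _. 0) Hb Z"
    proof
      show "((\<lambda>s. - ((\<nu> * msq \<alpha> (k, m)) *\<^sub>R v (k, m) s)
             - ((a + exp (- \<nu> * s)) * \<alpha> * real_of_int k / 2) *\<^sub>R (lam \<alpha> (k, m - 1) *\<^sub>R v (k, m - 1) s - lam \<alpha> (k, m + 1) *\<^sub>R v (k, m + 1) s)
             - 0) has_integral (v (k, m) t - v (k, m) 0)) {0..t}" if "t \<in> {0..T}" for k m t
        using linear_solution_ode[OF sol, of t k m] that by (simp add: v_def)
      show "exp (- \<tau>) \<le> a + exp (- \<nu> * t)" "a + exp (- \<nu> * t) \<le> 2" if "t \<in> {0..T}" for t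
        using profile_bounds[OF a \<nu>(1)] that by (auto simp: T_def)
    qed (use alpha \<nu> T Z Hb B in \<open>auto simp: v_def grad_def msq_def intro!: continuous_intros infsum_nonneg mult_nonneg_nonneg\<close>)
    then have "mass v T \<le> \<delta>\<^sup>2 * mass v 0"
      unfolding T_def by (rule core[rule_format, OF \<nu>(2), rotated]) (use alpha \<nu> in \<open>simp add: one_le_power\<close>)
    moreover have "mass v T = (L2_norm \<alpha> (\<omega> T))\<^sup>2 / area \<alpha>" "mass v 0 = (L2_norm \<alpha> (\<omega> 0))\<^sup>2 / area \<alpha>"
      using T by (auto intro!: mv linear_solution_zero_modes[OF sol \<nu>(1) _ init])
    ultimately have "(L2_norm \<alpha> (\<omega> T))\<^sup>2 \<le> (\<delta> * L2_norm \<alpha> (\<omega> 0))\<^sup>2"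
      using area_pos by (simp add: power_mult_distrib divide_le_cancel)
    then show "L2_norm \<alpha> (\<omega> (\<tau> / \<nu>)) \<le> \<delta> * L2_norm \<alpha> (\<omega> 0)"
      unfolding T_def[symmetric] by (rule power2_le_imp_le) (use \<open>\<delta> > 0\<close> L2_norm_nonneg in simp)
  qed
qed

text \<open>Insert \<open>\<omega> = \<omega>' - c * cos y\<close>. The profile has no Jacobian with
  itself, its Jacobian with \<open>\<omega>'\<close> is the shear term, and the rest is the Jacobian
  of \<open>\<omega>'\<close>, given by the convolution. Because
  \<open>\<Delta>\<^sup>-\<^sup>1 cos y = - cos y\<close>, the two mixed terms combine to
  \<open>1 + \<Delta>\<^sup>-\<^sup>1\<close>.\<close>

lemma rfc_jacobian:
  assumes \<omega>: "sq_real \<omega>" and il: "inv_laplacian \<alpha> \<omega> \<psi>"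
    and d\<omega>: "weak_dx \<alpha> \<omega> \<omega>x" "weak_dy \<alpha> \<omega> \<omega>y" and d\<psi>: "weak_dx \<alpha> \<psi> \<psi>x" "weak_dy \<alpha> \<psi> \<psi>y"
    and w: "\<And>n. w n = rfc \<omega> n + of_real c * rfc (\<lambda>z. cos (snd z)) n"
  shows "integrable (torus \<alpha>) (\<lambda>z. \<psi>x z * \<omega>y z - \<psi>y z * \<omega>x z)"
    and "((\<lambda>p. of_real (cross \<alpha> p ((k, m) - p) / msq \<alpha> p) * (w p * w ((k, m) - p))) has_sum
      (rfc (\<lambda>z. \<psi>x z * \<omega>y z - \<psi>y z * \<omega>x z) (k, m)
        - (c * \<alpha> * real_of_int k / 2) *\<^sub>R (lam \<alpha> (k, m - 1) *\<^sub>R w (k, m - 1) - lam \<alpha> (k, m + 1) *\<^sub>R w (k, m + 1)))) UNIV"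
proof -
  have sq: "sq_real \<psi>" "sq_real \<omega>x" "sq_real \<omega>y" "sq_real \<psi>x" "sq_real \<psi>y"
    using il d\<omega> d\<psi> by (auto simp: inv_laplacian_def weak_dx_def weak_dy_def intro: L2_sq_real)
  show "integrable (torus \<alpha>) (\<lambda>z. \<psi>x z * \<omega>y z - \<psi>y z * \<omega>x z)"
    by (intro Bochner_Integration.integrable_diff sq_real_mult sq)
  note \<psi>c = rfc_inv_laplacian[OF \<omega> il] and \<omega>xc = rfc_weak_dx[OF \<omega> d\<omega>(1)] and \<omega>yc = rfc_weak_dy[OF \<omega> d\<omega>(2)]
    and \<psi>xc = rfc_weak_dx[OF sq(1) d\<psi>(1)] and \<psi>yc = rfc_weak_dy[OF sq(1) d\<psi>(2)]
  define C where "C n = rfc (\<lambda>z. cos (snd z)) n" for n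
  \<comment> \<open>The profile lives at \<open>(0, 1)\<close> and \<open>(0, -1)\<close>: it has no
    \<open>x\<close> derivative, and \<open>msq\<close> is 1 there.\<close>
  have C0: "of_int (fst n) * C n = 0" and Cm: "C n / of_real (msq \<alpha> n) = C n" for n
    by (auto simp: C_def rfc_sin_cos msq_def)
  have w': "rfc \<omega> n = w n - of_real c * C n" for n by (simp add: w C_def)
  \<comment> \<open>\<open>wy\<close> and \<open>py\<close> are the \<open>y\<close> derivatives of
    \<open>\<omega>'\<close> and of its stream function, whose \<open>x\<close> derivatives are
    those of \<open>\<omega>\<close> and \<open>\<psi>\<close>; \<open>q\<close> is
    \<open>\<partial>\<^sub>x (1 + \<Delta>\<^sup>-\<^sup>1) \<omega>'\<close>.\<close>
  define wy where "wy z = \<omega>y z - c * sin (snd z)" for z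
  define py where "py z = \<psi>y z + c * sin (snd z)" for z
  define q where "q z = \<psi>x z + \<omega>x z" for z
  have sqs: "sq_real wy" "sq_real py" "sq_real q"
    unfolding wy_def py_def q_def by (intro sq_real_add sq_real_diff sq_real_scale sq_real_sin_cos sq)+
  have sinC: "rfc (\<lambda>z. c * sin (snd z)) n = - (of_real c * \<i> * of_int (snd n) * C n)" for n
    by (simp add: rfc_scale rfc_sin_cos(2) C_def)
  have csi: "integrable (torus \<alpha>) (\<lambda>z. c * sin (snd z))"
    by (intro sq_real_integrable sq_real_scale sq_real_sin_cos)
  have wyc: "rfc wy n = \<i> * of_int (snd n) * w n" for n
    unfolding wy_def rfc_diff[OF sq_real_integrable[OF sq(3)] csi] \<omega>yc w' sinC by (simp add: algebra_simps)
  have pyc: "rfc py n = - (\<i> * of_int (snd n) * (w n / of_real (msq \<alpha> n)))" for n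
  proof -
    have "rfc py n = - (\<i> * of_int (snd n) * ((w n - of_real c * C n) / of_real (msq \<alpha> n) + of_real c * C n))"
      unfolding py_def rfc_add[OF sq_real_integrable[OF sq(5)] csi] \<psi>yc \<psi>c w' sinC by (simp add: algebra_simps)
    also have "(w n - of_real c * C n) / of_real (msq \<alpha> n) = w n / of_real (msq \<alpha> n) - of_real c * C n"
      unfolding diff_divide_distrib times_divide_eq_right[symmetric] Cm ..
    finally show ?thesis by simp
  qed
  have k\<omega>: "of_int (fst n) * rfc \<omega> n = of_int (fst n) * w n" for n
    using C0[of n] unfolding w' by (simp add: right_diff_distrib mult.left_commute)
  have \<omega>xc': "rfc \<omega>x n = \<i> * of_real \<alpha> * (of_int (fst n) * w n)" for n
    unfolding \<omega>xc k\<omega>[symmetric] by (simp add: mult_ac)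
  have \<psi>xc': "rfc \<psi>x n = - (\<i> * of_real \<alpha> * (of_int (fst n) * w n) / of_real (msq \<alpha> n))" for n
    unfolding \<psi>xc \<psi>c k\<omega>[symmetric] by (simp add: mult_ac)
  have qc: "rfc q n = \<i> * of_real (\<alpha> * real_of_int (fst n)) * (lam \<alpha> n *\<^sub>R w n)" for n
    unfolding q_def rfc_add[OF sq_real_integrable[OF sq(4)] sq_real_integrable[OF sq(2)]] \<omega>xc' \<psi>xc'
    by (simp add: lam_def scaleR_conv_of_real algebra_simps)
  have J: "(\<lambda>z. \<psi>x z * \<omega>y z - \<psi>y z * \<omega>x z) = (\<lambda>z. (\<psi>x z * wy z - py z * \<omega>x z) + c * (sin (snd z) * q z))"
    by (simp add: wy_def py_def q_def algebra_simps fun_eq_iff)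
  have i: "integrable (torus \<alpha>) (\<lambda>z. \<psi>x z * wy z)" "integrable (torus \<alpha>) (\<lambda>z. py z * \<omega>x z)"
    "integrable (torus \<alpha>) (\<lambda>z. c * (sin (snd z) * q z))"
    by (intro sq_real_mult sq sqs integrable_mult_right sq_real_sin_cos)+
  have "rfc (\<lambda>z. \<psi>x z * \<omega>y z - \<psi>y z * \<omega>x z) (k, m)
      - (c * \<alpha> * real_of_int k / 2) *\<^sub>R (lam \<alpha> (k, m - 1) *\<^sub>R w (k, m - 1) - lam \<alpha> (k, m + 1) *\<^sub>R w (k, m + 1))
    = rfc (\<lambda>z. \<psi>x z * wy z) (k, m) - rfc (\<lambda>z. py z * \<omega>x z) (k, m)"
    unfolding J rfc_add[OF Bochner_Integration.integrable_diff[OF i(1,2)] i(3)] rfc_diff[OF i(1,2)]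
      rfc_shear_term[OF sqs(3) qc] by simp
  moreover have "((\<lambda>p. rfc \<psi>x p * rfc wy ((k, m) - p) - rfc py p * rfc \<omega>x ((k, m) - p)) has_sum
      (rfc (\<lambda>z. \<psi>x z * wy z) (k, m) - rfc (\<lambda>z. py z * \<omega>x z) (k, m))) UNIV"
    using has_sum_add[OF rfc_product[OF sq(4) sqs(1)] has_sum_uminusI[OF rfc_product[OF sqs(2) sq(2)]], of "(k, m)" "(k, m)"]
    by simp
  moreover have "rfc \<psi>x p * rfc wy r - rfc py p * rfc \<omega>x r = of_real (cross \<alpha> p r / msq \<alpha> p) * (w p * w r)" for p r
    unfolding \<psi>xc' wyc pyc \<omega>xc' by (simp add: cross_def diff_divide_distrib algebra_simps)
  ultimately show "((\<lambda>p. of_real (cross \<alpha> p ((k, m) - p) / msq \<alpha> p) * (w p * w ((k, m) - p))) has_sum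
      (rfc (\<lambda>z. \<psi>x z * \<omega>y z - \<psi>y z * \<omega>x z) (k, m)
        - (c * \<alpha> * real_of_int k / 2) *\<^sub>R (lam \<alpha> (k, m - 1) *\<^sub>R w (k, m - 1) - lam \<alpha> (k, m + 1) *\<^sub>R w (k, m + 1)))) UNIV"
    by simp
qed

text \<open>The profile solves the equation exactly: its time derivative, its viscous term and the
  force cancel. What remains for \<open>\<omega>'\<close> is viscosity, shear and its own
  Jacobian.\<close>

lemma nonlinear_solution_perturbed_flow:
  assumes alpha: "\<alpha> > 1" and a: "a \<in> {0, 1}" and \<nu>: "0 < \<nu>" and \<tau>: "0 < \<tau>"
    and sol: "nonlinear_solution \<alpha> \<nu> a \<omega>"
    and pert: "\<And>t. 0 \<le> t \<Longrightarrow> \<omega>' t = (\<lambda>z. \<omega> t z + (a + exp (- \<nu> * t)) * cos (snd z))"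
  shows "\<exists>N Hb Z. perturbed_flow \<alpha> \<nu> (\<tau> / \<nu>) (exp (- \<tau>)) (\<lambda>t. a + exp (- \<nu> * t)) (\<lambda>n t. rfc (\<omega>' t) n) N Hb Z"
proof -
  define T where "T = \<tau> / \<nu>"
  have T: "T > 0" using \<nu> \<tau> by (simp add: T_def)
  have E: "energy_class \<alpha> \<omega>" using sol by (simp add: nonlinear_solution_def)
  note \<omega> = energy_class_sq_real[OF E]
  obtain \<psi> \<omega>x \<omega>y \<psi>x \<psi>y where ae: "AE t in lborel. t > 0 \<longrightarrow>
           inv_laplacian \<alpha> (\<omega> t) (\<psi> t) \<and>
           weak_dx \<alpha> (\<omega> t) (\<omega>x t) \<and> weak_dy \<alpha> (\<omega> t) (\<omega>y t) \<and>
           weak_dx \<alpha> (\<psi> t) (\<psi>x t) \<and> weak_dy \<alpha> (\<psi> t) (\<psi>y t)"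
    and eq: "\<forall>\<phi>\<in>test_functions \<alpha>. \<forall>t\<ge>0.
           ((\<lambda>s. LINT z|torus \<alpha>. \<nu> * \<omega> s z * laplacian \<phi> z
                  - (\<psi>x s z * \<omega>y s z - \<psi>y s z * \<omega>x s z) * \<phi> z
                  - \<nu> * a * cos (snd z) * \<phi> z)
            has_integral (LINT z|torus \<alpha>. (\<omega> t z - \<omega> 0 z) * \<phi> z)) {0..t}"
    using sol unfolding nonlinear_solution_def by (elim conjE exE) (rule that)
  obtain Z1 where Z1: "negligible Z1" and Z1': "\<And>t. 0 \<le> t \<Longrightarrow> t \<notin> Z1 \<Longrightarrow>
           inv_laplacian \<alpha> (\<omega> t) (\<psi> t) \<and>
           weak_dx \<alpha> (\<omega> t) (\<omega>x t) \<and> weak_dy \<alpha> (\<omega> t) (\<omega>y t) \<and>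
           weak_dx \<alpha> (\<psi> t) (\<psi>x t) \<and> weak_dy \<alpha> (\<psi> t) (\<psi>y t)"
    using AE_nonneg_times[OF ae] by blast
  obtain Z2 Hb where Z2: "negligible Z2" and Hb: "\<And>T. T > 0 \<Longrightarrow> Hb integrable_on {0..T}"
    "\<And>t F. 0 \<le> t \<Longrightarrow> t \<notin> Z2 \<Longrightarrow> finite F \<Longrightarrow> (\<Sum>n\<in>F. msq \<alpha> n * (norm (rfc (\<omega> t) n))\<^sup>2) \<le> Hb t"
    using energy_class_grad[OF E] by blast
  define c where "c s = a + exp (- \<nu> * s)" for s
  define C where "C n = rfc (\<lambda>z. cos (snd z)) n" for n
  define w where "w n t = rfc (\<omega>' t) n" for n t
  define J where "J s z = \<psi>x s z * \<omega>y s z - \<psi>y s z * \<omega>x s z" for s z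
  \<comment> \<open>What is left of the Jacobian of \<open>\<omega>\<close> once the shear term is
    removed; \<open>rfc_jacobian\<close> identifies it with the convolution of
    \<open>w\<close>.\<close>
  define N where "N n s = rfc (J s) n - (c s * \<alpha> * real_of_int (fst n) / 2) *\<^sub>R
    (lam \<alpha> (fst n, snd n - 1) *\<^sub>R w (fst n, snd n - 1) s - lam \<alpha> (fst n, snd n + 1) *\<^sub>R w (fst n, snd n + 1) s)" for n s
  have cosb: "sq_real (\<lambda>z. b * cos (snd z))" for b by (intro sq_real_scale sq_real_sin_cos)
  have w: "w n t = rfc (\<omega> t) n + of_real (c t) * C n" if "0 \<le> t" for n t
    unfolding w_def pert[OF that] rfc_add[OF sq_real_integrable[OF \<omega>[OF that]] sq_real_integrable[OF cosb]]
    by (simp add: rfc_scale C_def c_def)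
  have sq': "sq_real (\<omega>' t)" if "0 \<le> t" for t
    unfolding pert[OF that] by (intro sq_real_add \<omega> that cosb)
  have Ji: "integrable (torus \<alpha>) (J s)"
    and Nsum: "((\<lambda>p. of_real (cross \<alpha> p (n - p) / msq \<alpha> p) * (w p s * w (n - p) s)) has_sum N n s) UNIV"
    if s: "0 \<le> s" "s \<notin> Z1" for s n
  proof -
    have il: "inv_laplacian \<alpha> (\<omega> s) (\<psi> s)" and d: "weak_dx \<alpha> (\<omega> s) (\<omega>x s)" "weak_dy \<alpha> (\<omega> s) (\<omega>y s)"
      "weak_dx \<alpha> (\<psi> s) (\<psi>x s)" "weak_dy \<alpha> (\<psi> s) (\<psi>y s)" using Z1'[OF s] by auto
    note j = rfc_jacobian[OF \<omega>[OF s(1)] il d w[OF s(1), unfolded C_def]]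
    show "integrable (torus \<alpha>) (J s)" using j(1) unfolding J_def .
    show "((\<lambda>p. of_real (cross \<alpha> p (n - p) / msq \<alpha> p) * (w p s * w (n - p) s)) has_sum N n s) UNIV"
      using j(2)[where k = "fst n" and m = "snd n"] unfolding N_def J_def prod.collapse .
  qed
  define g where "g s z = J s z + (\<nu> * a) * cos (snd z)" for s z
  have gi: "integrable (torus \<alpha>) (g s)" if "0 \<le> s" "s \<notin> Z1" for s
    unfolding g_def[abs_def] using Ji[OF that] sq_real_integrable[OF cosb] by simp
  have eq': "((\<lambda>s. LINT z|torus \<alpha>. \<nu> * \<omega> s z * laplacian \<phi> z - g s z * \<phi> z)
         has_integral (LINT z|torus \<alpha>. (\<omega> t z - \<omega> 0 z) * \<phi> z)) {0..t}"
    if "\<phi> \<in> test_functions \<alpha>" "t \<ge> 0" for \<phi> t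
  proof -
    have "(\<lambda>s. LINT z|torus \<alpha>. \<nu> * \<omega> s z * laplacian \<phi> z - g s z * \<phi> z)
      = (\<lambda>s. LINT z|torus \<alpha>. \<nu> * \<omega> s z * laplacian \<phi> z
                  - (\<psi>x s z * \<omega>y s z - \<psi>y s z * \<omega>x s z) * \<phi> z
                  - \<nu> * a * cos (snd z) * \<phi> z)"
      unfolding g_def J_def by (intro ext Bochner_Integration.integral_cong refl) (simp add: algebra_simps)
    then show ?thesis using eq[rule_format, OF that] by (simp only:)
  qed
  have ode: "((\<lambda>s. - ((\<nu> * msq \<alpha> n) *\<^sub>R w n s) - rfc (J s) n) has_integral (w n t - w n 0)) {0..t}" if t: "0 \<le> t" for n t
  proof -
    have "((\<lambda>s. (- \<nu> * exp (- \<nu> * s)) *\<^sub>R C n) has_integral (c t *\<^sub>R C n - c 0 *\<^sub>R C n)) {0..t}"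
      unfolding c_def by (rule fundamental_theorem_of_calculus[OF t]) (auto intro!: derivative_eq_intros)
    from has_integral_add[OF rfc_ode[OF Z1 \<omega> gi eq' t, where n = n] this]
    have "((\<lambda>s. - ((\<nu> * msq \<alpha> n) *\<^sub>R rfc (\<omega> s) n) - rfc (g s) n + (- \<nu> * exp (- \<nu> * s)) *\<^sub>R C n) has_integral (w n t - w n 0)) {0..t}"
      using t by (simp add: w scaleR_conv_of_real algebra_simps)
    then show ?thesis
    proof (rule has_integral_spike[OF Z1, rotated])
      fix s assume "s \<in> {0..t} - Z1"
      then have s: "0 \<le> s" "s \<notin> Z1" by auto
      have "rfc (g s) n = rfc (J s) n + of_real (\<nu> * a) * C n"
        unfolding g_def rfc_add[OF Ji[OF s] sq_real_integrable[OF cosb]] by (simp add: rfc_scale C_def)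
      moreover have "C n = 0 \<or> msq \<alpha> n = 1" by (auto simp: C_def rfc_sin_cos msq_def)
      then have "(\<nu> * msq \<alpha> n) *\<^sub>R w n s = (\<nu> * msq \<alpha> n) *\<^sub>R rfc (\<omega> s) n + of_real (\<nu> * c s) * C n"
        using s by (auto simp: w scaleR_conv_of_real algebra_simps)
      ultimately show "- ((\<nu> * msq \<alpha> n) *\<^sub>R w n s) - rfc (J s) n
         = - ((\<nu> * msq \<alpha> n) *\<^sub>R rfc (\<omega> s) n) - rfc (g s) n + (- \<nu> * exp (- \<nu> * s)) *\<^sub>R C n"
        by (simp add: c_def scaleR_conv_of_real algebra_simps)
    qed
  qed
  define K where "K = (L2_norm \<alpha> (\<lambda>z. cos (snd z)))\<^sup>2 / area \<alpha>"
  have c_bounds: "exp (- \<tau>) \<le> c t" "c t \<le> 2" if "t \<in> {0..T}" for t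
    unfolding c_def using profile_bounds[OF a \<nu>] that by (auto simp: T_def)
  \<comment> \<open>The 8 is the 2 from the square of a sum times the square of the bound
    \<open>c t \<le> 2\<close>; on the support of the profile \<open>msq\<close> is 1.\<close>
  have Hb': "(\<Sum>n\<in>F. msq \<alpha> n * (norm (w n t))\<^sup>2) \<le> 2 * Hb t + 8 * K"
    if t: "t \<in> {0..T}" "t \<notin> Z2" and F: "finite F" for t F
  proof -
    have "0 \<le> c t" using c_bounds(1)[OF t(1)] exp_ge_zero[of "- \<tau>"] by linarith
    have le: "msq \<alpha> n * (norm (w n t))\<^sup>2 \<le> 2 * (msq \<alpha> n * (norm (rfc (\<omega> t) n))\<^sup>2) + 8 * (norm (C n))\<^sup>2" for n
    proof -
      have "norm (of_real (c t) * C n) \<le> 2 * norm (C n)"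
        using c_bounds(2)[OF t(1)] \<open>0 \<le> c t\<close> by (simp add: norm_mult mult_right_mono)
      then have "(norm (of_real (c t) * C n))\<^sup>2 \<le> (2 * norm (C n))\<^sup>2" by (rule power_mono) simp
      moreover have "(norm (w n t))\<^sup>2 \<le> 2 * (norm (rfc (\<omega> t) n))\<^sup>2 + 2 * (norm (of_real (c t) * C n))\<^sup>2"
        using t(1) norm_add_squared_le[of "rfc (\<omega> t) n" "of_real (c t) * C n"] by (simp add: w)
      ultimately have "(norm (w n t))\<^sup>2 \<le> 2 * (norm (rfc (\<omega> t) n))\<^sup>2 + 8 * (norm (C n))\<^sup>2"
        by (simp add: power_mult_distrib)
      moreover have "0 \<le> msq \<alpha> n" by (simp add: msq_def)
      ultimately have "msq \<alpha> n * (norm (w n t))\<^sup>2 \<le> msq \<alpha> n * (2 * (norm (rfc (\<omega> t) n))\<^sup>2 + 8 * (norm (C n))\<^sup>2)"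
        by (rule mult_left_mono)
      moreover have "C n = 0 \<or> msq \<alpha> n = 1" by (auto simp: C_def rfc_sin_cos msq_def)
      ultimately show ?thesis by (elim disjE) (simp_all add: algebra_simps)
    qed
    have "(\<Sum>n\<in>F. (norm (C n))\<^sup>2) \<le> K"
      unfolding C_def K_def by (rule finite_sum_le_has_sum[OF rfc_parseval[OF sq_real_sin_cos(2)]]) (use F in auto)
    moreover have "(\<Sum>n\<in>F. msq \<alpha> n * (norm (rfc (\<omega> t) n))\<^sup>2) \<le> Hb t" using Hb(2)[of t F] t F by auto
    moreover have "(\<Sum>n\<in>F. msq \<alpha> n * (norm (w n t))\<^sup>2)
      \<le> 2 * (\<Sum>n\<in>F. msq \<alpha> n * (norm (rfc (\<omega> t) n))\<^sup>2) + 8 * (\<Sum>n\<in>F. (norm (C n))\<^sup>2)"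
      unfolding sum_distrib_left sum.distrib[symmetric] by (rule sum_mono[OF le])
    ultimately show ?thesis by linarith
  qed
  have c_cont: "continuous_on {0..T} c" unfolding c_def by (intro continuous_intros)
  have "perturbed_flow \<alpha> \<nu> T (exp (- \<tau>)) c w N (\<lambda>t. 2 * Hb t + 8 * K) (Z1 \<union> Z2)"
  proof
    show "negligible (Z1 \<union> Z2)" using Z1 Z2 by (rule negligible_Un)
    show "((\<lambda>s. - ((\<nu> * msq \<alpha> (k, m)) *\<^sub>R w (k, m) s)
             - (c s * \<alpha> * real_of_int k / 2) *\<^sub>R (lam \<alpha> (k, m - 1) *\<^sub>R w (k, m - 1) s - lam \<alpha> (k, m + 1) *\<^sub>R w (k, m + 1) s)
             - N (k, m) s) has_integral (w (k, m) t - w (k, m) 0)) {0..t}" if "t \<in> {0..T}" for k m t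
      using ode[of t "(k, m)"] that by (simp add: N_def)
    show "(\<lambda>n. (norm (w n t))\<^sup>2) summable_on UNIV" if "t \<in> {0..T}" for t
      unfolding w_def using rfc_parseval[OF sq'] that has_sum_imp_summable by auto
    show "continuous_on {0..T} (\<lambda>t. \<Sum>\<^sub>\<infinity>n. (norm (w n t))\<^sup>2)"
    proof (rule continuous_on_eq)
      show "continuous_on {0..T} (\<lambda>t. (L2_norm \<alpha> (\<lambda>z. \<omega> t z + c t * cos (snd z)))\<^sup>2 / area \<alpha>)"
        using area_pos by (intro continuous_intros energy_class_norm_continuous[OF E c_cont]) auto
      fix t assume "t \<in> {0..T}"
      then have t: "0 \<le> t" by simp
      show "(L2_norm \<alpha> (\<lambda>z. \<omega> t z + c t * cos (snd z)))\<^sup>2 / area \<alpha> = (\<Sum>\<^sub>\<infinity>n. (norm (w n t))\<^sup>2)"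
        using infsumI[OF rfc_parseval[OF sq'[OF t]]] by (simp add: w_def pert[OF t] c_def)
    qed
    show "(\<lambda>t. 2 * Hb t + 8 * K) integrable_on {0..T}"
      by (intro integrable_add integrable_on_mult_right Hb(1) T integrable_const_ivl)
    show "((\<lambda>p. of_real (cross \<alpha> p (n - p) / msq \<alpha> p) * (w p t * w (n - p) t)) has_sum N n t) UNIV"
      if "t \<in> {0..T} - (Z1 \<union> Z2)" for t n
      using Nsum that by simp
  qed (use alpha \<nu> T c_cont c_bounds Hb' in simp_all)
  then show ?thesis unfolding c_def w_def T_def by blast
qed

text \<open>The threshold for \<open>d\<close> carries the factor
  \<open>sqrt (area \<alpha>)\<close> because Parseval equates the sum over the modes with the
  squared norm divided by the area. The waves of \<open>w\<close> are the coefficients of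
  \<open>P_nonzero\<close> of the perturbation, so \<open>mass\<close> measures exactly the norm in
  the claim.\<close>

theorem nonlinear_decay:
  assumes alpha: "\<alpha> > 1" and "\<tau> > 0" "\<delta> > 0" and a: "a \<in> {0, 1}"
  shows "\<exists>\<nu>0>0. \<exists>d0>0. \<forall>\<nu> d. 0 < \<nu> \<and> \<nu> \<le> \<nu>0 \<and> 0 < d \<and> d \<le> d0 \<longrightarrow>
        (\<forall>\<omega> \<omega>'. nonlinear_solution \<alpha> \<nu> a \<omega> \<and>
             (\<forall>t\<ge>0. \<forall>z. \<omega> t z = - a * cos (snd z) - exp (- \<nu> * t) * cos (snd z) + \<omega>' t z) \<and>
             \<omega>' 0 \<in> L2_torus \<alpha> \<and> L2_norm \<alpha> (\<omega>' 0) \<le> \<nu> * d \<longrightarrow>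
             L2_norm \<alpha> (P_nonzero \<alpha> (\<omega>' (\<tau> / \<nu>))) \<le> \<delta> * L2_norm \<alpha> (P_nonzero \<alpha> (\<omega>' 0)))"
proof -
  obtain \<nu>0 d0 where \<nu>0: "\<nu>0 > 0" and d0: "d0 > 0" and core: "\<forall>\<nu> c w N Hb Z. \<nu> \<le> \<nu>0 \<longrightarrow>
      perturbed_flow \<alpha> \<nu> (\<tau> / \<nu>) (exp (- \<tau>)) c w N Hb Z \<longrightarrow>
      (\<Sum>\<^sub>\<infinity>n. (norm (w n 0))\<^sup>2) \<le> (\<nu> * d0)\<^sup>2 \<longrightarrow> mass w (\<tau> / \<nu>) \<le> \<delta>\<^sup>2 * mass w 0"
    using perturbed_flow_decay[OF alpha \<open>\<tau> > 0\<close> zero_less_power[OF \<open>\<delta> > 0\<close>, of 2] exp_gt_zero[of "- \<tau>"]]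
    by (elim exE conjE) (rule that)
  show ?thesis
  proof (rule exI[of _ \<nu>0], intro conjI \<nu>0, rule exI[of _ "d0 * sqrt (area \<alpha>)"], intro conjI allI impI; (elim conjE)?)
    show "0 < d0 * sqrt (area \<alpha>)" using d0 area_pos by simp
  next
    fix \<nu> d \<omega> \<omega>'
    assume \<nu>: "0 < \<nu>" "\<nu> \<le> \<nu>0" and d: "0 < d" "d \<le> d0 * sqrt (area \<alpha>)" and sol: "nonlinear_solution \<alpha> \<nu> a \<omega>"
      and pert: "\<forall>t\<ge>0. \<forall>z. \<omega> t z = - a * cos (snd z) - exp (- \<nu> * t) * cos (snd z) + \<omega>' t z"
      and small: "L2_norm \<alpha> (\<omega>' 0) \<le> \<nu> * d"
    have p: "\<omega>' t = (\<lambda>z. \<omega> t z + (a + exp (- \<nu> * t)) * cos (snd z))" if "0 \<le> t" for t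
    proof
      fix z
      have "\<omega> t z = - a * cos (snd z) - exp (- \<nu> * t) * cos (snd z) + \<omega>' t z" using pert that by blast
      then show "\<omega>' t z = \<omega> t z + (a + exp (- \<nu> * t)) * cos (snd z)" by (simp add: distrib_right)
    qed
    have E: "energy_class \<alpha> \<omega>" using sol by (simp add: nonlinear_solution_def)
    have sq: "sq_real (\<omega>' t)" if "0 \<le> t" for t
      unfolding p[OF that] by (intro sq_real_add energy_class_sq_real[OF E] that sq_real_scale sq_real_sin_cos)
    define T where "T = \<tau> / \<nu>"
    have T: "0 \<le> T" using \<nu> \<open>\<tau> > 0\<close> by (simp add: T_def)
    define w where "w n t = rfc (\<omega>' t) n" for n t
    have mw: "mass w t = (L2_norm \<alpha> (P_nonzero \<alpha> (\<omega>' t)))\<^sup>2 / area \<alpha>" if "0 \<le> t" for t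
      by (simp add: mass_def w_def L2_norm_P_nonzero[OF sq[OF that]])
    obtain N Hb Z where flow: "perturbed_flow \<alpha> \<nu> (\<tau> / \<nu>) (exp (- \<tau>)) (\<lambda>t. a + exp (- \<nu> * t)) w N Hb Z"
      using nonlinear_solution_perturbed_flow[OF alpha a \<nu>(1) \<open>\<tau> > 0\<close> sol p] unfolding w_def by blast
    have "L2_norm \<alpha> (\<omega>' 0) \<le> \<nu> * (d0 * sqrt (area \<alpha>))"
      using small mult_left_mono[OF d(2), of \<nu>] \<nu>(1) by linarith
    then have "(L2_norm \<alpha> (\<omega>' 0))\<^sup>2 \<le> (\<nu> * (d0 * sqrt (area \<alpha>)))\<^sup>2"
      by (intro power_mono L2_norm_nonneg)
    then have "(L2_norm \<alpha> (\<omega>' 0))\<^sup>2 / area \<alpha> \<le> (\<nu> * d0)\<^sup>2"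
      using area_pos by (simp add: power_mult_distrib pos_divide_le_eq)
    then have "(\<Sum>\<^sub>\<infinity>n. (norm (w n 0))\<^sup>2) \<le> (\<nu> * d0)\<^sup>2"
      using infsumI[OF rfc_parseval[OF sq[of 0]]] by (simp add: w_def)
    with core[rule_format, OF \<nu>(2) flow] have "mass w T \<le> \<delta>\<^sup>2 * mass w 0" by (simp add: T_def)
    then have "(L2_norm \<alpha> (P_nonzero \<alpha> (\<omega>' T)))\<^sup>2 \<le> (\<delta> * L2_norm \<alpha> (P_nonzero \<alpha> (\<omega>' 0)))\<^sup>2"
      using area_pos T by (simp add: mw power_mult_distrib divide_le_cancel)
    then show "L2_norm \<alpha> (P_nonzero \<alpha> (\<omega>' (\<tau> / \<nu>))) \<le> \<delta> * L2_norm \<alpha> (P_nonzero \<alpha> (\<omega>' 0))"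
      unfolding T_def[symmetric] by (rule power2_le_imp_le) (use \<open>\<delta> > 0\<close> L2_norm_nonneg in simp)
  qed
qed

end

theorem theorem1p1:
  fixes \<alpha> \<tau> \<delta> a :: real
  assumes "\<alpha> > 1" and "\<tau> > 0" and "\<delta> > 0" and "a \<in> {0, 1}"
  shows
    "(\<exists>\<nu>0>0. \<forall>\<nu>. 0 < \<nu> \<and> \<nu> \<le> \<nu>0 \<longrightarrow>
        (\<forall>\<omega>. linear_solution \<alpha> \<nu> a \<omega> \<and> \<omega> 0 \<in> L2_torus \<alpha> \<and>
             (AE z in torus \<alpha>. P_nonzero \<alpha> (\<omega> 0) z = \<omega> 0 z) \<longrightarrow>
             L2_norm \<alpha> (\<omega> (\<tau> / \<nu>)) \<le> \<delta> * L2_norm \<alpha> (\<omega> 0)))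
     \<and>
     (\<exists>\<nu>0>0. \<exists>d0>0. \<forall>\<nu> d. 0 < \<nu> \<and> \<nu> \<le> \<nu>0 \<and> 0 < d \<and> d \<le> d0 \<longrightarrow>
        (\<forall>\<omega> \<omega>'. nonlinear_solution \<alpha> \<nu> a \<omega> \<and>
             (\<forall>t\<ge>0. \<forall>z. \<omega> t z = - a * cos (snd z) - exp (- \<nu> * t) * cos (snd z) + \<omega>' t z) \<and>
             \<omega>' 0 \<in> L2_torus \<alpha> \<and> L2_norm \<alpha> (\<omega>' 0) \<le> \<nu> * d \<longrightarrow>
             L2_norm \<alpha> (P_nonzero \<alpha> (\<omega>' (\<tau> / \<nu>))) \<le> \<delta> * L2_norm \<alpha> (P_nonzero \<alpha> (\<omega>' 0))))"
proof -
  interpret flat_torus \<alpha> by unfold_locales (use assms(1) in simp)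
  show ?thesis using linear_decay[OF assms] nonlinear_decay[OF assms] by (rule conjI)
qed

end
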